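(* Let $\Omega$ be a smooth domain in the plane, $\Sigma$ a piece (relatively open smooth arc) of its boundary, and $L$ a smooth locally integrable complex vector field defined near each point of $\Sigma$, such that $\Sigma$ is noncharacteristic for $L$. Let $f$ be a continuous solution of $Lf=0$ in $\Omega$ (where $L$ is defined). Assume that for some defining function $\rho$ of $\Omega$ there exists an integer $N$ such that $$\int_{\rho=t}|f|\,d\sigma_t=O(t^{-N})\quad\text{as } t\to0^+,$$ and that the trace $bf$ of $f$ on $\Sigma$ belongs to $L^1(\Sigma)$. Suppose that (after contracting $\Sigma$ around one of its points) $Z$ is a smooth first integral of $L$ near $\Sigma$ such that the restriction of $\operatorname{Re}Z$ to $\Sigma$ has a nonzero differential. For $p\in\Sigma$ let $S^+(p)$ be the part lying in $\Omega$ of the curve $S(p)=\{w:\operatorname{Re}Z(w)=\operatorname{Re}Z(p)\}$ near $p$. Then for almost all $p\in\Sigma$, $$\lim_{S^+(p)\ni q\to p}f(q)=bf(p).$$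
   Context: A nowhere vanishing smooth planar vector field $L$ is locally integrable in an open set if each point of the set has a neighborhood admitting a smooth complex function $Z$ with $LZ=0$ and $dZ\ne0$; such a $Z$ is called a first integral. $\Sigma$ noncharacteristic for $L$ means that $L$ is transversal to $\Sigma$, i.e. $L\rho\neq 0$ on $\Sigma$. The defining function $\rho$ is smooth, positive in $\Omega$, zero on $\partial\Omega$, with $d\rho\neq0$ on $\partial\Omega$; $\sigma_t$ denotes arc length on the curve $\{\rho=t\}$. "Almost all" is with respect to arc length on $\Sigma$. The curve $S(p)$ is, near $p$, a smooth curve transversal to $\Sigma$. Trace: near any point of $\Sigma$ choose coordinates $(x,t)$ with $t=\rho$, so that $\Sigma=\{t=0\}$, $\Omega=\{t>0\}$ and $L$ is a nonvanishing multiple of $\partial_t+a(x,t)\partial_x$. Under the growth assumption, $f(\cdot,t)$ converges in the sense of distributions in $x$ as $t\to0^+$; the limit is the trace (boundary value) $bf$ of $f$ on $\Sigma$. *)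

theory Defs
  imports "HOL-Analysis.Analysis"
begin

type_synonym plane = "real \<times> real"


subsection \<open>Smooth functions\<close>

text \<open>
  \<open>Ck_on n f S\<close> is meant for open \<open>S\<close>: \<open>f\<close> has continuous (iterated directional) derivatives
  up to order \<open>n\<close> on \<open>S\<close>.
\<close>

primrec Ck_on :: "nat \<Rightarrow> ('a::real_normed_vector \<Rightarrow> 'b::real_normed_vector) \<Rightarrow> 'a set \<Rightarrow> bool" where
  "Ck_on 0 f S \<longleftrightarrow> continuous_on S f"
| "Ck_on (Suc n) f S \<longleftrightarrow>
     (\<forall>x\<in>S. f differentiable (at x)) \<and> (\<forall>v. Ck_on n (\<lambda>x. frechet_derivative f (at x) v) S)"

definition smooth_on :: "'a set \<Rightarrow> ('a::real_normed_vector \<Rightarrow> 'b::real_normed_vector) \<Rightarrow> bool" where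
  "smooth_on S f \<longleftrightarrow> (\<forall>n. Ck_on n f S)"

definition nonzero_differential :: "('a::real_normed_vector \<Rightarrow> 'b::real_normed_vector) \<Rightarrow> 'a \<Rightarrow> bool" where
  "nonzero_differential f p \<longleftrightarrow> frechet_derivative f (at p) \<noteq> (\<lambda>v. 0)"

text \<open>Elements of \<open>C\<^sub>c\<^sup>\<infinity>(W)\<close>, extended by \<open>0\<close> to the whole space.\<close>

definition test_function :: "'a::real_normed_vector set \<Rightarrow> ('a \<Rightarrow> complex) \<Rightarrow> bool" where
  "test_function W \<phi> \<longleftrightarrow>
     smooth_on UNIV \<phi> \<and> (\<exists>K. compact K \<and> K \<subseteq> W \<and> (\<forall>x. x \<notin> K \<longrightarrow> \<phi> x = 0))"


subsection \<open>Arcs and arc length\<close>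

definition regular_arc :: "real \<Rightarrow> real \<Rightarrow> (real \<Rightarrow> plane) \<Rightarrow> bool" where
  "regular_arc a b \<gamma> \<longleftrightarrow>
     a < b \<and> smooth_on {a<..<b} \<gamma> \<and> inj_on \<gamma> {a<..<b} \<and>
     (\<forall>s\<in>{a<..<b}. vector_derivative \<gamma> (at s) \<noteq> 0)"

definition regular_arc_in :: "plane set \<Rightarrow> real \<Rightarrow> real \<Rightarrow> (real \<Rightarrow> plane) \<Rightarrow> bool" where
  "regular_arc_in C a b \<gamma> \<longleftrightarrow> regular_arc a b \<gamma> \<and> \<gamma> ` {a<..<b} \<subseteq> C"

definition smooth_open_arc :: "plane set \<Rightarrow> bool" where
  "smooth_open_arc C \<longleftrightarrow> (\<exists>a b \<gamma>. regular_arc a b \<gamma> \<and> C = \<gamma> ` {a<..<b})"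

text \<open>
  The integral of a nonnegative function with respect to arc length on a (not necessarily
  connected) smooth curve \<open>C\<close>: the supremum of the sums of the integrals
  \<open>\<integral> g(\<gamma>(s)) |\<gamma>'(s)| ds\<close> over finite systems of pairwise disjoint regular arcs in \<open>C\<close>.
  Since every component of a smooth curve is, up to at most one point, a regular open arc, this is
  the usual integral.
\<close>

definition disjoint_arcs_in :: "plane set \<Rightarrow> (real \<times> real \<times> (real \<Rightarrow> plane)) set \<Rightarrow> bool" where
  "disjoint_arcs_in C G \<longleftrightarrow>
     finite G \<and> (\<forall>(a, b, \<gamma>)\<in>G. regular_arc_in C a b \<gamma>) \<and>
     disjoint_family_on (\<lambda>(a, b, \<gamma>). \<gamma> ` {a<..<b}) G"

definition arc_integral :: "plane set \<Rightarrow> (plane \<Rightarrow> ennreal) \<Rightarrow> ennreal" where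
  "arc_integral C g =
     (SUP G \<in> {G. disjoint_arcs_in C G}.
        \<Sum>(a, b, \<gamma>)\<in>G.
          \<integral>\<^sup>+ s\<in>{a<..<b}. g (\<gamma> s) * ennreal (norm (vector_derivative \<gamma> (at s))) \<partial>lebesgue)"

definition arc_L1 :: "plane set \<Rightarrow> (plane \<Rightarrow> complex) \<Rightarrow> bool" where
  "arc_L1 C g \<longleftrightarrow>
     (\<forall>a b \<gamma>. regular_arc_in C a b \<gamma> \<longrightarrow> (\<lambda>s. g (\<gamma> s)) \<in> borel_measurable (lebesgue_on {a<..<b})) \<and>
     arc_integral C (\<lambda>q. ennreal (norm (g q))) < \<infinity>"

definition arc_AE :: "plane set \<Rightarrow> (plane \<Rightarrow> bool) \<Rightarrow> bool" where
  "arc_AE C P \<longleftrightarrow>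
     (\<forall>a b \<gamma>. regular_arc_in C a b \<gamma> \<longrightarrow> (AE s in lebesgue. s \<in> {a<..<b} \<longrightarrow> P (\<gamma> s)))"


subsection \<open>Smooth domains\<close>

definition defining_function :: "plane set \<Rightarrow> (plane \<Rightarrow> real) \<Rightarrow> bool" where
  "defining_function \<Omega> \<rho> \<longleftrightarrow>
     (\<exists>D. open D \<and> closure \<Omega> \<subseteq> D \<and> smooth_on D \<rho>) \<and>
     (\<forall>q\<in>\<Omega>. \<rho> q > 0) \<and>
     (\<forall>q\<in>frontier \<Omega>. \<rho> q = 0 \<and> nonzero_differential \<rho> q)"

definition smooth_domain :: "plane set \<Rightarrow> bool" where
  "smooth_domain \<Omega> \<longleftrightarrow> open \<Omega> \<and> connected \<Omega> \<and> (\<exists>\<rho>. defining_function \<Omega> \<rho>)"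

definition boundary_piece :: "plane set \<Rightarrow> plane set \<Rightarrow> bool" where
  "boundary_piece \<Omega> \<Sigma> \<longleftrightarrow> openin (top_of_set (frontier \<Omega>)) \<Sigma> \<and> smooth_open_arc \<Sigma>"


subsection \<open>Complex vector fields\<close>

text \<open>
  The vector field \<open>A \<partial>\<^sub>x + B \<partial>\<^sub>y\<close> is represented by the function \<open>L = (\<lambda>q. (A q, B q))\<close>.
\<close>

type_synonym cvfield = "plane \<Rightarrow> complex \<times> complex"

definition partial_x :: "(plane \<Rightarrow> complex) \<Rightarrow> plane \<Rightarrow> complex" where
  "partial_x g q = frechet_derivative g (at q) (1, 0)"

definition partial_y :: "(plane \<Rightarrow> complex) \<Rightarrow> plane \<Rightarrow> complex" where
  "partial_y g q = frechet_derivative g (at q) (0, 1)"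

definition vf_apply :: "cvfield \<Rightarrow> (plane \<Rightarrow> complex) \<Rightarrow> plane \<Rightarrow> complex" where
  "vf_apply L g q = fst (L q) * partial_x g q + snd (L q) * partial_y g q"

definition vf_transpose :: "cvfield \<Rightarrow> (plane \<Rightarrow> complex) \<Rightarrow> plane \<Rightarrow> complex" where
  "vf_transpose L \<phi> q =
     - (partial_x (\<lambda>z. fst (L z) * \<phi> z) q + partial_y (\<lambda>z. snd (L z) * \<phi> z) q)"

text \<open>Continuous functions \<open>f\<close> on \<open>W\<close> with \<open>L f = 0\<close> in the sense of distributions.\<close>

definition continuous_solution :: "cvfield \<Rightarrow> plane set \<Rightarrow> (plane \<Rightarrow> complex) \<Rightarrow> bool" where
  "continuous_solution L W f \<longleftrightarrow>
     continuous_on W f \<and>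
     (\<forall>\<phi>. test_function W \<phi> \<longrightarrow> (LINT q|lebesgue. f q * vf_transpose L \<phi> q) = 0)"

definition first_integral :: "cvfield \<Rightarrow> plane set \<Rightarrow> (plane \<Rightarrow> complex) \<Rightarrow> bool" where
  "first_integral L V Z \<longleftrightarrow>
     smooth_on V Z \<and> (\<forall>q\<in>V. vf_apply L Z q = 0 \<and> nonzero_differential Z q)"

definition locally_integrable_vf :: "cvfield \<Rightarrow> plane set \<Rightarrow> bool" where
  "locally_integrable_vf L U \<longleftrightarrow>
     smooth_on U L \<and> (\<forall>q\<in>U. L q \<noteq> 0) \<and>
     (\<forall>q\<in>U. \<exists>V Z. open V \<and> q \<in> V \<and> V \<subseteq> U \<and> first_integral L V Z)"

definition noncharacteristic :: "cvfield \<Rightarrow> (plane \<Rightarrow> real) \<Rightarrow> plane set \<Rightarrow> bool" where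
  "noncharacteristic L \<rho> \<Sigma> \<longleftrightarrow> (\<forall>p\<in>\<Sigma>. vf_apply L (\<lambda>q. complex_of_real (\<rho> q)) p \<noteq> 0)"

definition nonzero_differential_along :: "plane set \<Rightarrow> (plane \<Rightarrow> real) \<Rightarrow> bool" where
  "nonzero_differential_along C u \<longleftrightarrow>
     (\<forall>a b \<gamma>. regular_arc_in C a b \<gamma> \<longrightarrow>
        (\<forall>s\<in>{a<..<b}. vector_derivative (\<lambda>r. u (\<gamma> r)) (at s) \<noteq> 0))"


subsection \<open>Traces\<close>

text \<open>
  A system of coordinates \<open>(x, t)\<close> with \<open>t = \<rho>\<close> near \<open>p \<in> \<Sigma>\<close>, given by the inverse chart \<open>\<Phi>\<close>. If
  \<open>\<Sigma>\<close> is noncharacteristic for \<open>L\<close>, then the coefficient \<open>L \<rho>\<close> of \<open>\<partial>\<^sub>t\<close> in \<open>L\<close> does not vanish near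
  \<open>t = 0\<close>, so that \<open>L\<close> is there a nonvanishing multiple of some \<open>\<partial>\<^sub>t + a \<partial>\<^sub>x\<close>.
\<close>

definition boundary_chart ::
  "plane set \<Rightarrow> plane set \<Rightarrow> (plane \<Rightarrow> real) \<Rightarrow> plane set \<Rightarrow> plane \<Rightarrow> real \<Rightarrow> (real \<times> real \<Rightarrow> plane) \<Rightarrow> bool"
  where
  "boundary_chart \<Omega> \<Sigma> \<rho> U p \<delta> \<Phi> \<longleftrightarrow>
     \<delta> > 0 \<and> \<Phi> (0, 0) = p \<and>
     smooth_on ({-\<delta><..<\<delta>} \<times> {-\<delta><..<\<delta>}) \<Phi> \<and>
     inj_on \<Phi> ({-\<delta><..<\<delta>} \<times> {-\<delta><..<\<delta>}) \<and>
     (\<forall>z\<in>{-\<delta><..<\<delta>} \<times> {-\<delta><..<\<delta>}. bij (frechet_derivative \<Phi> (at z))) \<and>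
     (\<forall>x\<in>{-\<delta><..<\<delta>}. \<forall>t\<in>{-\<delta><..<\<delta>}.
        \<Phi> (x, t) \<in> U \<and> \<rho> (\<Phi> (x, t)) = t \<and>
        (\<Phi> (x, t) \<in> \<Sigma> \<longleftrightarrow> t = 0) \<and> (\<Phi> (x, t) \<in> \<Omega> \<longleftrightarrow> t > 0))"

text \<open>
  Convergence of \<open>f(\<cdot>, t)\<close> to the function \<open>bf\<close> in the sense of distributions in \<open>x\<close> as
  \<open>t \<rightarrow> 0+\<close>, near each point of \<open>\<Sigma>\<close>. This is to be used together with the local integrability of
  \<open>bf\<close> on \<open>\<Sigma>\<close> (see \<open>arc_L1\<close>), without which the integral on the right is meaningless.
\<close>

definition is_trace ::
  "plane set \<Rightarrow> plane set \<Rightarrow> (plane \<Rightarrow> real) \<Rightarrow> plane set \<Rightarrow> (plane \<Rightarrow> complex) \<Rightarrow> (plane \<Rightarrow> complex) \<Rightarrow> bool"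
  where
  "is_trace \<Omega> \<Sigma> \<rho> U f bf \<longleftrightarrow>
     (\<forall>p\<in>\<Sigma>. \<exists>\<delta> \<Phi>. boundary_chart \<Omega> \<Sigma> \<rho> U p \<delta> \<Phi> \<and>
        (\<forall>\<phi>. test_function {-\<delta><..<\<delta>} \<phi> \<longrightarrow>
           ((\<lambda>t. LINT x|lebesgue. f (\<Phi> (x, t)) * \<phi> x) \<longlongrightarrow>
            (LINT x|lebesgue. bf (\<Phi> (x, 0)) * \<phi> x)) (at_right 0)))"

definition level_curve_plus :: "plane set \<Rightarrow> plane set \<Rightarrow> (plane \<Rightarrow> complex) \<Rightarrow> plane \<Rightarrow> plane set" where
  "level_curve_plus \<Omega> V Z p = {w \<in> V. Re (Z w) = Re (Z p)} \<inter> \<Omega>"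

end

theory Submission
  imports Defs "HOL-Complex_Analysis.Complex_Analysis" "HOL-Real_Asymp.Real_Asymp"
begin

text \<open>
  In coordinates \<open>(x, t)\<close> with \<open>t = \<rho>\<close> write \<open>F\<close> for \<open>f\<close> and \<open>\<zeta>\<close> for \<open>Z\<close>. As \<open>L f = 0\<close>, the form
  \<open>F d\<zeta>\<close> is closed, so there are iterated primitives \<open>G\<^sub>j\<close> with \<open>G\<^sub>0 = F\<close> and \<open>dG\<^bsub>j+1\<^esub> = G\<^sub>j d\<zeta>\<close>.
  Each of them gains a power of \<open>t\<close>, hence \<open>w = G\<^sub>k\<close> extends continuously to \<open>t = 0\<close> for large \<open>k\<close>,
  and there \<open>w\<close> is a uniform limit of entire functions of \<open>\<zeta>\<close> (Baouendi-Treves). On \<open>t = 0\<close> the trace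
  is the \<open>k\<close>-th weak derivative of \<open>w\<close> with respect to \<open>\<zeta>\<close>, so that almost everywhere \<open>w\<close> has a Peano
  expansion of order \<open>k\<close> in \<open>\<zeta>\<close> with leading coefficient \<open>bf / k!\<close>.

  Now take \<open>X = Re \<zeta>\<close> and \<open>t\<close> as coordinates: \<open>\<zeta> = X + i \<phi>(X, t)\<close>, and the curves \<open>S(p)\<close> are the lines
  \<open>X = const\<close>. If \<open>\<phi>(X\<^sub>0, t) > \<phi>(X\<^sub>0, 0)\<close> for some \<open>t\<close>, then \<open>\<zeta>\<close> covers a region above the graph of
  \<open>\<phi>(\<cdot>, 0)\<close> near \<open>X\<^sub>0\<close>, on which \<open>w = H(\<zeta>)\<close> and \<open>F = H\<^bsup>(k)\<^esup>(\<zeta>)\<close> with \<open>H\<close> holomorphic, and the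
  maximum principle turns the Peano expansion into convergence of \<open>H\<^bsup>(k)\<^esup>\<close> along the vertical line.
  The region below the graph is treated by conjugation. Finally, if \<open>\<phi>(X\<^sub>0, t) = \<phi>(X\<^sub>0, 0)\<close>, then for
  all but countably many such \<open>X\<^sub>0\<close> the same happens at points \<open>X \<rightarrow> X\<^sub>0\<close>, where
  \<open>w(X, t) = w(X, 0)\<close>; comparing the Peano expansions gives \<open>F(X\<^sub>0, t) = bf\<close> there.
\<close>

section \<open>Calculus of smooth functions\<close>

text \<open>The obstacle is that \<zeta> need not be injective and \<open>F\<close> may be unbounded
  near \<open>t = 0\<close>, so that \<open>F\<close> itself cannot be treated as a function of
  \<zeta> up to the boundary. Only after enough integrations is there a function \<open>w\<close> on
  the closed strip, and for such a \<open>w\<close> the approximation shows that points with the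
  same \<zeta> give the same value. To return to \<open>F\<close> one has to differentiate
  \<open>k\<close> times in \<zeta>, which needs either a planar region of values (hence the cases
  above and below the graph) or coincidences accumulating at the point (hence limit points and
  countable exceptional sets). Peano expansions carry the almost everywhere information on the
  trace: they are pointwise statements on the slice \<open>t = 0\<close> alone, and the maximum
  principle transports them to the scale of the distance from the boundary point. This works because
  the graph is Lipschitz, so that discs of comparable radius fit above it. A fibre may cross its
  starting height infinitely often; therefore the estimates are stated in terms of the height and
  not of \<open>t\<close>, and the crossings are treated separately.\<close>

lemma Ck_on_cong:
  assumes "open S" "\<And>x. x \<in> S \<Longrightarrow> f x = g x"
  shows "Ck_on n f S \<longleftrightarrow> Ck_on n g S"
proof -
  have imp: "Ck_on n f S \<Longrightarrow> Ck_on n g S"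
    if "\<And>x. x \<in> S \<Longrightarrow> f x = g x" for f g :: "'a \<Rightarrow> 'b"
    using that
  proof (induction n arbitrary: f g)
    case 0
    then show ?case by (metis Ck_on.simps(1) continuous_on_cong)
  next
    case (Suc n)
    have d: "f differentiable at x" if "x \<in> S" for x
      using Suc.prems that by simp
    have fd: "frechet_derivative f (at x) = frechet_derivative g (at x)" if "x \<in> S" for x
      using frechet_derivative_transform_within_open[OF d[OF that] \<open>open S\<close> that] Suc.prems(2) by simp
    have "g differentiable at x" if "x \<in> S" for x
      using d[OF that] Suc.prems(2) \<open>open S\<close> that
      by (meson differentiable_def has_derivative_transform_within_open)
    moreover have "Ck_on n (\<lambda>x. frechet_derivative g (at x) v) S" for v
      by (rule Suc.IH[of "\<lambda>x. frechet_derivative f (at x) v"]) (use Suc.prems fd in auto)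
    ultimately show ?case by simp
  qed
  show ?thesis using imp[of f g] imp[of g f] assms(2) by metis
qed

lemma Ck_on_subset: "Ck_on n f S \<Longrightarrow> T \<subseteq> S \<Longrightarrow> Ck_on n f T"
  by (induction n arbitrary: f) (auto intro: continuous_on_subset)

lemma Ck_on_Suc_imp: "Ck_on (Suc n) f S \<Longrightarrow> Ck_on n f S"
proof (induction n arbitrary: f)
  case 0
  then show ?case
    by (auto intro!: continuous_at_imp_continuous_on differentiable_imp_continuous_within)
next
  case (Suc n)
  then show ?case by simp
qed

lemma Ck_on_const: "Ck_on n (\<lambda>x. c) S"
  by (induction n arbitrary: c) (auto simp: frechet_derivative_const)

lemma Ck_on_linear:
  assumes "bounded_linear h"
  shows "Ck_on n h S"
proof (cases n)
  case 0
  then show ?thesis by (simp add: assms linear_continuous_on)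
next
  case (Suc m)
  have "frechet_derivative h (at x) = h" for x
    by (metis assms bounded_linear_imp_has_derivative frechet_derivative_at)
  then show ?thesis
    using assms by (auto simp: Suc Ck_on_const bounded_linear_imp_differentiable)
qed

lemma Ck_on_add:
  assumes "open S" "Ck_on n f S" "Ck_on n g S"
  shows "Ck_on n (\<lambda>x. f x + g x) S"
  using assms(2,3)
proof (induction n arbitrary: f g)
  case 0
  then show ?case by (simp add: continuous_on_add)
next
  case (Suc n)
  have "frechet_derivative (\<lambda>x. f x + g x) (at x) v
      = frechet_derivative f (at x) v + frechet_derivative g (at x) v" if "x \<in> S" for x v
  proof -
    have "((\<lambda>x. f x + g x) has_derivative
        (\<lambda>v. frechet_derivative f (at x) v + frechet_derivative g (at x) v)) (at x)"
      by (intro has_derivative_add) (use Suc.prems that in \<open>auto simp: frechet_derivative_works\<close>)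
    from frechet_derivative_at[OF this] show ?thesis by metis
  qed
  then have "Ck_on n (\<lambda>x. frechet_derivative (\<lambda>x. f x + g x) (at x) v) S" for v
    using Suc.IH[of "\<lambda>x. frechet_derivative f (at x) v" "\<lambda>x. frechet_derivative g (at x) v"] Suc.prems
    by (subst Ck_on_cong[OF \<open>open S\<close>]) auto
  then show ?case using Suc.prems by auto
qed

lemma Ck_on_bilinear:
  assumes "bounded_bilinear h" "open S" "Ck_on n f S" "Ck_on n g S"
  shows "Ck_on n (\<lambda>x. h (f x) (g x)) S"
  using assms(3,4)
proof (induction n arbitrary: f g)
  case 0
  then show ?case by (simp add: bounded_bilinear.continuous_on[OF assms(1)])
next
  case (Suc n)
  let ?D = "\<lambda>x v. h (f x) (frechet_derivative g (at x) v) + h (frechet_derivative f (at x) v) (g x)"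
  have der: "((\<lambda>x. h (f x) (g x)) has_derivative ?D x) (at x)" if "x \<in> S" for x
    by (intro bounded_bilinear.FDERIV[OF assms(1)])
      (use Suc.prems that in \<open>auto simp: frechet_derivative_works\<close>)
  have "frechet_derivative (\<lambda>x. h (f x) (g x)) (at x) v = ?D x v" if "x \<in> S" for x v
    using frechet_derivative_at[OF der[OF that]] by metis
  moreover have "Ck_on n (\<lambda>x. ?D x v) S" for v
    by (intro Ck_on_add Suc.IH assms(2)) (use Suc.prems Ck_on_Suc_imp in auto)
  ultimately have "Ck_on n (\<lambda>x. frechet_derivative (\<lambda>x. h (f x) (g x)) (at x) v) S" for v
    by (subst Ck_on_cong[OF \<open>open S\<close>]) auto
  then show ?case using der by (auto simp: differentiable_def)
qed

lemma Ck_on_linear_compose: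
  assumes "bounded_linear h" "open S" "Ck_on n f S"
  shows "Ck_on n (\<lambda>x. h (f x)) S"
  using assms(3)
proof (induction n arbitrary: f)
  case 0
  then show ?case by (simp add: bounded_linear.continuous_on[OF assms(1)])
next
  case (Suc n)
  have der: "((\<lambda>x. h (f x)) has_derivative (\<lambda>v. h (frechet_derivative f (at x) v))) (at x)"
    if "x \<in> S" for x
    by (intro bounded_linear.has_derivative[OF assms(1)])
      (use Suc.prems that in \<open>auto simp: frechet_derivative_works\<close>)
  have "frechet_derivative (\<lambda>x. h (f x)) (at x) v = h (frechet_derivative f (at x) v)"
    if "x \<in> S" for x v
    using frechet_derivative_at[OF der[OF that]] by metis
  moreover have "Ck_on n (\<lambda>x. h (frechet_derivative f (at x) v)) S" for v
    by (intro Suc.IH) (use Suc.prems in auto)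
  ultimately have "Ck_on n (\<lambda>x. frechet_derivative (\<lambda>x. h (f x)) (at x) v) S" for v
    by (subst Ck_on_cong[OF \<open>open S\<close>]) auto
  then show ?case using der by (auto simp: differentiable_def)
qed

lemma Ck_on_sum:
  assumes "open S" "\<And>i. i \<in> I \<Longrightarrow> Ck_on n (f i) S"
  shows "Ck_on n (\<lambda>x. \<Sum>i\<in>I. f i x) S"
  using assms(2)
proof (induction I rule: infinite_finite_induct)
  case (insert i I)
  have "Ck_on n (\<lambda>x. f i x + (\<Sum>i\<in>I. f i x)) S"
    by (rule Ck_on_add) (use insert assms in auto)
  then show ?case using insert.hyps by simp
qed (simp_all add: Ck_on_const)

text \<open>In the chain rule the derivative of \<open>g\<close> is applied to a vector that moves
  with \<open>x\<close>, whereas \<open>Ck_on\<close> only speaks of fixed directions. Expanding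
  that vector in the basis separates the two dependences, and the induction hypothesis applies to
  the finitely many functions \<open>frechet_derivative g (at _) b\<close>; this is why the middle
  space is Euclidean.\<close>

lemma Ck_on_compose:
  fixes f :: "'a::real_normed_vector \<Rightarrow> 'b::euclidean_space"
    and g :: "'b \<Rightarrow> 'c::real_normed_vector"
  assumes "open S" "open T" "f ` S \<subseteq> T" "Ck_on n f S" "Ck_on n g T"
  shows "Ck_on n (\<lambda>x. g (f x)) S"
  using assms(4,5)
proof (induction n arbitrary: g)
  case 0
  then show ?case using assms(3) by (auto intro: continuous_on_compose2)
next
  case (Suc n)
  have Df: "(f has_derivative frechet_derivative f (at x)) (at x)" if "x \<in> S" for x
    using Suc.prems that by (auto simp: frechet_derivative_works)
  have Dg: "(g has_derivative frechet_derivative g (at (f x))) (at (f x))" if "x \<in> S" for x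
    using Suc.prems that assms(3) by (auto simp: frechet_derivative_works)
  have der: "((\<lambda>x. g (f x)) has_derivative
      (\<lambda>v. frechet_derivative g (at (f x)) (frechet_derivative f (at x) v))) (at x)"
    if "x \<in> S" for x
    using has_derivative_compose[OF Df[OF that] Dg[OF that]] .
  have "frechet_derivative (\<lambda>x. g (f x)) (at x) v =
      (\<Sum>b\<in>Basis. (frechet_derivative f (at x) v \<bullet> b) *\<^sub>R frechet_derivative g (at (f x)) b)"
    if "x \<in> S" for x v
  proof -
    have lin: "linear (frechet_derivative g (at (f x)))"
      using Dg[OF that] has_derivative_linear by blast
    have "frechet_derivative (\<lambda>x. g (f x)) (at x) v
        = frechet_derivative g (at (f x)) (frechet_derivative f (at x) v)"
      using frechet_derivative_at[OF der[OF that]] by metis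
    also have "\<dots> = frechet_derivative g (at (f x))
        (\<Sum>b\<in>Basis. (frechet_derivative f (at x) v \<bullet> b) *\<^sub>R b)"
      by (simp add: euclidean_representation)
    finally show ?thesis
      by (simp add: linear_sum[OF lin] linear_cmul[OF lin] o_def)
  qed
  moreover have "Ck_on n (\<lambda>x. \<Sum>b\<in>Basis. (frechet_derivative f (at x) v \<bullet> b) *\<^sub>R
      frechet_derivative g (at (f x)) b) S" for v
  proof (intro Ck_on_sum assms(1) Ck_on_bilinear[OF bounded_bilinear_scaleR])
    fix b :: 'b assume "b \<in> Basis"
    show "Ck_on n (\<lambda>x. frechet_derivative f (at x) v \<bullet> b) S"
      by (rule Ck_on_linear_compose[OF bounded_linear_inner_left assms(1)]) (use Suc.prems in auto)
    show "Ck_on n (\<lambda>x. frechet_derivative g (at (f x)) b) S"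
      by (rule Suc.IH) (use Suc.prems Ck_on_Suc_imp in auto)
  qed
  ultimately have "Ck_on n (\<lambda>x. frechet_derivative (\<lambda>x. g (f x)) (at x) v) S" for v
    by (subst Ck_on_cong[OF \<open>open S\<close>]) auto
  then show ?case using der by (auto simp: differentiable_def)
qed

lemma Ck_on_inverse:
  fixes f :: "'a::real_normed_vector \<Rightarrow> 'b::real_normed_field"
  assumes "open S" "Ck_on n f S" "\<And>x. x \<in> S \<Longrightarrow> f x \<noteq> 0"
  shows "Ck_on n (\<lambda>x. inverse (f x)) S"
  using assms(2)
proof (induction n)
  case 0
  then show ?case using assms(3) by (auto intro: continuous_on_inverse)
next
  case (Suc n)
  let ?D = "\<lambda>x v. - (inverse (f x) * frechet_derivative f (at x) v * inverse (f x))"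
  have der: "((\<lambda>x. inverse (f x)) has_derivative ?D x) (at x)" if "x \<in> S" for x
    by (intro Deriv.has_derivative_inverse)
      (use Suc.prems that assms(3) in \<open>auto simp: frechet_derivative_works\<close>)
  have "frechet_derivative (\<lambda>x. inverse (f x)) (at x) v = ?D x v" if "x \<in> S" for x v
    using frechet_derivative_at[OF der[OF that]] by metis
  moreover have "Ck_on n (\<lambda>x. ?D x v) S" for v
    by (intro Ck_on_linear_compose[OF bounded_linear_minus[OF bounded_linear_ident]]
        Ck_on_bilinear[OF bounded_bilinear_mult] assms(1) Suc.IH)
      (use Suc.prems Ck_on_Suc_imp in auto)
  ultimately have "Ck_on n (\<lambda>x. frechet_derivative (\<lambda>x. inverse (f x)) (at x) v) S" for v
    by (subst Ck_on_cong[OF \<open>open S\<close>]) auto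
  then show ?case using der by (auto simp: differentiable_def)
qed

lemma smooth_on_cong:
  assumes "open S" "\<And>x. x \<in> S \<Longrightarrow> f x = g x"
  shows "smooth_on S f \<longleftrightarrow> smooth_on S g"
  unfolding smooth_on_def by (simp add: Ck_on_cong[OF assms(1), of f g] assms(2))

lemma smooth_on_subset: "smooth_on S f \<Longrightarrow> T \<subseteq> S \<Longrightarrow> smooth_on T f"
  unfolding smooth_on_def using Ck_on_subset by blast

lemma smooth_on_const: "smooth_on S (\<lambda>x. c)"
  unfolding smooth_on_def using Ck_on_const by blast

lemma smooth_on_linear: "bounded_linear h \<Longrightarrow> smooth_on S h"
  unfolding smooth_on_def using Ck_on_linear by blast

lemma smooth_on_add: "open S \<Longrightarrow> smooth_on S f \<Longrightarrow> smooth_on S g \<Longrightarrow> smooth_on S (\<lambda>x. f x + g x)"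
  unfolding smooth_on_def using Ck_on_add by blast

lemma smooth_on_linear_compose:
  "bounded_linear h \<Longrightarrow> open S \<Longrightarrow> smooth_on S f \<Longrightarrow> smooth_on S (\<lambda>x. h (f x))"
  unfolding smooth_on_def using Ck_on_linear_compose by blast

lemma smooth_on_uminus: "open S \<Longrightarrow> smooth_on S f \<Longrightarrow> smooth_on S (\<lambda>x. - f x)"
  by (rule smooth_on_linear_compose[OF bounded_linear_minus[OF bounded_linear_ident]])

lemma smooth_on_diff: "open S \<Longrightarrow> smooth_on S f \<Longrightarrow> smooth_on S g \<Longrightarrow> smooth_on S (\<lambda>x. f x - g x)"
  using smooth_on_add[of S f "\<lambda>x. - g x"] smooth_on_uminus[of S g] by simp

lemma smooth_on_mult:
  fixes f g :: "'a::real_normed_vector \<Rightarrow> 'b::real_normed_algebra"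
  shows "open S \<Longrightarrow> smooth_on S f \<Longrightarrow> smooth_on S g \<Longrightarrow> smooth_on S (\<lambda>x. f x * g x)"
  unfolding smooth_on_def using Ck_on_bilinear[OF bounded_bilinear_mult] by blast

lemma smooth_on_inverse:
  fixes f :: "'a::real_normed_vector \<Rightarrow> 'b::real_normed_field"
  shows "open S \<Longrightarrow> smooth_on S f \<Longrightarrow> (\<And>x. x \<in> S \<Longrightarrow> f x \<noteq> 0) \<Longrightarrow> smooth_on S (\<lambda>x. inverse (f x))"
  unfolding smooth_on_def using Ck_on_inverse by blast

lemma smooth_on_compose:
  fixes f :: "'a::real_normed_vector \<Rightarrow> 'b::euclidean_space"
    and g :: "'b \<Rightarrow> 'c::real_normed_vector"
  shows "open S \<Longrightarrow> open T \<Longrightarrow> f ` S \<subseteq> T \<Longrightarrow> smooth_on S f \<Longrightarrow> smooth_on T g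
    \<Longrightarrow> smooth_on S (\<lambda>x. g (f x))"
  unfolding smooth_on_def using Ck_on_compose by blast

lemma smooth_on_continuous_on: "smooth_on S f \<Longrightarrow> continuous_on S f"
  unfolding smooth_on_def by (metis Ck_on.simps(1))

lemma smooth_on_has_derivative:
  assumes "smooth_on S f" "x \<in> S"
  shows "(f has_derivative frechet_derivative f (at x)) (at x)"
proof -
  have "Ck_on (Suc 0) f S" using assms unfolding smooth_on_def by blast
  then show ?thesis using assms(2) by (simp add: frechet_derivative_works)
qed

lemma smooth_on_frechet: "smooth_on S f \<Longrightarrow> smooth_on S (\<lambda>x. frechet_derivative f (at x) v)"
  unfolding smooth_on_def by (metis Ck_on.simps(2))

text \<open>Used to glue a function from its formula on an open set and from 0 outside a compact
  support.\<close>

lemma smooth_on_open_cover: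
  assumes "\<And>x. x \<in> S \<Longrightarrow> \<exists>T. open T \<and> x \<in> T \<and> smooth_on T f"
  shows "smooth_on S f"
proof -
  have "Ck_on n f S" if "\<And>x. x \<in> S \<Longrightarrow> \<exists>T. open T \<and> x \<in> T \<and> Ck_on n f T" for n
    using that
  proof (induction n arbitrary: f)
    case 0
    have "continuous (at x) f" if "x \<in> S" for x
      using 0[OF that] continuous_on_eq_continuous_at by auto
    then show ?case by (simp add: continuous_at_imp_continuous_on)
  next
    case (Suc n)
    have "f differentiable at x" if "x \<in> S" for x
      using Suc.prems[OF that] by auto
    moreover have "Ck_on n (\<lambda>x. frechet_derivative f (at x) v) S" for v
    proof (rule Suc.IH)
      fix x assume "x \<in> S"
      then obtain T where "open T" "x \<in> T" "Ck_on (Suc n) f T" using Suc.prems by blast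
      then show "\<exists>T. open T \<and> x \<in> T \<and> Ck_on n (\<lambda>x. frechet_derivative f (at x) v) T"
        by auto
    qed
    ultimately show ?case by simp
  qed
  then show ?thesis using assms unfolding smooth_on_def by meson
qed

lemma smooth_on_has_vector_derivative:
  fixes f :: "real \<Rightarrow> 'b::real_normed_vector"
  assumes "smooth_on S f" "x \<in> S"
  shows "(f has_vector_derivative frechet_derivative f (at x) 1) (at x)"
proof -
  have D: "(f has_derivative frechet_derivative f (at x)) (at x)"
    using smooth_on_has_derivative[OF assms] .
  have "frechet_derivative f (at x) h = h *\<^sub>R frechet_derivative f (at x) 1" for h
    using linear_cmul[OF has_derivative_linear[OF D], of h 1] by simp
  then have "frechet_derivative f (at x) = (\<lambda>h. h *\<^sub>R frechet_derivative f (at x) 1)"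
    by (rule ext)
  with D show ?thesis
    unfolding has_vector_derivative_def by simp
qed

lemma smooth_on_row: "smooth_on UNIV (\<lambda>x::real. (x, t::real))"
proof -
  have "smooth_on UNIV (\<lambda>x::real. (x, 0::real))"
    by (intro smooth_on_linear bounded_linear_Pair bounded_linear_ident bounded_linear_zero)
  from smooth_on_add[OF open_UNIV this smooth_on_const[of _ "(0, t)"]] show ?thesis by simp
qed

section \<open>Test functions on the line\<close>

text \<open>The polynomial factor makes the family closed under differentiation, so that smoothness
  of all members at 0 is one induction; \<open>flat 1\<close> is the usual flat function
  \<open>exp (- (1 / x))\<close>.\<close>

definition flat :: "real poly \<Rightarrow> real \<Rightarrow> real" where
  "flat p x = (if x > 0 then poly p (1 / x) * exp (- (1 / x)) else 0)"

lemma poly_mult_exp_tendsto_0: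
  fixes p :: "real poly"
  shows "((\<lambda>y. poly p y * exp (- y)) \<longlongrightarrow> 0) at_top"
proof -
  have "((\<lambda>y. \<Sum>i\<le>degree p. coeff p i * (y ^ i / exp y)) \<longlongrightarrow> (\<Sum>i\<le>degree p. coeff p i * 0)) at_top"
    by (intro tendsto_sum tendsto_mult tendsto_const tendsto_power_div_exp_0)
  then show ?thesis
    by (simp add: poly_altdef sum_distrib_right exp_minus field_simps sum_divide_distrib)
qed

text \<open>With \<open>y = 1 / x\<close> the operator \<open>d/dx\<close> is
  \<open>- y^2 d/dy\<close>, which turns \<open>p(y) exp (- y)\<close> into
  \<open>y^2 (p - p')(y) exp (- y)\<close>; \<open>[:0, 0, 1:]\<close> is the factor
  \<open>y^2\<close>. At 0 the right difference quotient is \<open>y p(y) exp (- y)\<close>, which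
  tends to 0.\<close>

lemma flat_has_real_derivative:
  "(flat p has_real_derivative flat ([:0, 0, 1:] * (p - pderiv p)) x) (at x)"
proof -
  consider "x > 0" | "x < 0" | "x = 0" by linarith
  then show ?thesis
  proof cases
    case 1
    have "((\<lambda>x. poly p (1 / x) * exp (- (1 / x))) has_real_derivative
        flat ([:0, 0, 1:] * (p - pderiv p)) x) (at x)"
      using 1 by (auto intro!: derivative_eq_intros simp: flat_def field_simps power2_eq_square)
    then show ?thesis
      by (rule has_field_derivative_transform_within_open[where S = "{0<..}"])
        (use 1 in \<open>auto simp: flat_def\<close>)
  next
    case 2
    have "((\<lambda>x. 0) has_real_derivative flat ([:0, 0, 1:] * (p - pderiv p)) x) (at x)"
      using 2 by (simp add: flat_def)
    then show ?thesis
      by (rule has_field_derivative_transform_within_open[where S = "{..<0}"])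
        (use 2 in \<open>auto simp: flat_def\<close>)
  next
    case 3
    have "((\<lambda>h. flat p h / h) \<longlongrightarrow> 0) (at_right 0)"
    proof -
      have "((\<lambda>h. poly ([:0, 1:] * p) (inverse h) * exp (- inverse h)) \<longlongrightarrow> 0) (at_right (0::real))"
        by (rule filterlim_compose[OF poly_mult_exp_tendsto_0 filterlim_inverse_at_top_right])
      moreover have "\<forall>\<^sub>F h in at_right 0.
          poly ([:0, 1:] * p) (inverse h) * exp (- inverse h) = flat p h / h"
        unfolding eventually_at_filter by (auto simp: flat_def field_simps)
      ultimately show ?thesis by (rule Lim_transform_eventually)
    qed
    moreover have "((\<lambda>h. flat p h / h) \<longlongrightarrow> 0) (at_left 0)"
      by (rule Lim_transform_eventually[OF tendsto_const])
        (auto simp: eventually_at_filter flat_def)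
    ultimately have "((\<lambda>h. flat p h / h) \<longlongrightarrow> 0) (at 0)"
      using filterlim_split_at_real by blast
    then show ?thesis
      using 3 by (simp add: DERIV_def flat_def)
  qed
qed

lemma smooth_on_flat: "smooth_on UNIV (flat p)"
proof -
  have "Ck_on n (flat p) UNIV" for n
  proof (induction n arbitrary: p)
    case 0
    then show ?case
      using flat_has_real_derivative DERIV_isCont
      by (metis Ck_on.simps(1) continuous_at_imp_continuous_on)
  next
    case (Suc n)
    have D: "(flat p has_derivative (\<lambda>v. v * flat ([:0, 0, 1:] * (p - pderiv p)) x)) (at x)" for x
      using flat_has_real_derivative[of p x]
      by (simp add: has_field_derivative_def mult.commute[of _ "flat _ _"])
    have "frechet_derivative (flat p) (at x) v = v * flat ([:0, 0, 1:] * (p - pderiv p)) x" for x v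
      using frechet_derivative_at[OF D[of x]] by metis
    moreover have "Ck_on n (\<lambda>x. v * flat ([:0, 0, 1:] * (p - pderiv p)) x) UNIV" for v
      by (rule Ck_on_linear_compose[OF bounded_linear_mult_right]) (use Suc in auto)
    moreover have "flat p differentiable at x" for x
      using D[of x] differentiableI by blast
    ultimately show ?case by simp
  qed
  then show ?thesis by (simp add: smooth_on_def)
qed

definition bump :: "real \<Rightarrow> real \<Rightarrow> real \<Rightarrow> real" where
  "bump a b x = flat 1 (x - a) * flat 1 (b - x)"

lemma bump_pos: "a < x \<Longrightarrow> x < b \<Longrightarrow> bump a b x > 0"
  by (simp add: bump_def flat_def)

lemma bump_nonneg: "bump a b x \<ge> 0"
  by (simp add: bump_def flat_def)

lemma bump_eq_0: "x \<le> a \<or> x \<ge> b \<Longrightarrow> bump a b x = 0"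
  by (auto simp: bump_def flat_def)

lemma smooth_on_bump: "smooth_on UNIV (bump a b)"
proof -
  have aff: "smooth_on UNIV (\<lambda>x::real. x - a)" "smooth_on UNIV (\<lambda>x::real. b - x)"
    by (intro smooth_on_diff smooth_on_const smooth_on_linear bounded_linear_ident open_UNIV)+
  have "smooth_on UNIV (\<lambda>x. flat 1 (x - a) * flat 1 (b - x))"
    by (intro smooth_on_mult smooth_on_compose[OF _ _ _ aff(1) smooth_on_flat]
        smooth_on_compose[OF _ _ _ aff(2) smooth_on_flat]) auto
  then show ?thesis by (simp add: bump_def[abs_def])
qed

lemma test_function_bump:
  assumes "{a..b} \<subseteq> W"
  shows "test_function W (\<lambda>x. c * of_real (bump a b x))"
  unfolding test_function_def
proof (intro conjI exI)
  show "smooth_on UNIV (\<lambda>x. c * complex_of_real (bump a b x))"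
    by (intro smooth_on_mult smooth_on_const smooth_on_linear_compose[OF bounded_linear_of_real]
        smooth_on_bump open_UNIV)
  show "\<forall>x. x \<notin> {a..b} \<longrightarrow> c * complex_of_real (bump a b x) = 0"
    by (auto simp: bump_eq_0)
qed (use assms in auto)

lemma test_function_smooth: "test_function W \<phi> \<Longrightarrow> smooth_on UNIV \<phi>"
  by (simp add: test_function_def)

lemma test_function_mono: "test_function W \<phi> \<Longrightarrow> W \<subseteq> W' \<Longrightarrow> test_function W' \<phi>"
  unfolding test_function_def by blast

text \<open>\<open>g\<close> is controlled on \<open>W\<close> only. The product is smooth on
  \<open>W\<close> and identically 0 on the complement of a compact subset of \<open>W\<close>, and
  these two open sets cover the space.\<close>

lemma test_function_mult_smooth:
  assumes "test_function W \<phi>" "open W" "smooth_on W g"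
  shows "test_function W (\<lambda>x. g x * \<phi> x)"
proof -
  obtain K where K: "compact K" "K \<subseteq> W" "\<And>x. x \<notin> K \<Longrightarrow> \<phi> x = 0"
    and sm: "smooth_on UNIV \<phi>"
    using assms(1) unfolding test_function_def by blast
  have "smooth_on UNIV (\<lambda>x. g x * \<phi> x)"
  proof (rule smooth_on_open_cover)
    fix x :: 'a
    show "\<exists>T. open T \<and> x \<in> T \<and> smooth_on T (\<lambda>x. g x * \<phi> x)"
    proof (cases "x \<in> W")
      case True
      then show ?thesis
        using smooth_on_mult[OF assms(2,3) smooth_on_subset[OF sm]] assms(2) by blast
    next
      case False
      have op: "open (- K)" using K(1) by (simp add: compact_imp_closed open_Compl)
      have "smooth_on (- K) (\<lambda>x. g x * \<phi> x) \<longleftrightarrow> smooth_on (- K) (\<lambda>x. 0::complex)"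
        by (rule smooth_on_cong[OF op]) (simp add: K)
      then show ?thesis using op False K(2) smooth_on_const by blast
    qed
  qed
  then show ?thesis unfolding test_function_def using K by force
qed

lemma test_function_frechet:
  assumes "test_function W \<phi>"
  shows "test_function W (\<lambda>x. frechet_derivative \<phi> (at x) v)"
proof -
  obtain K where K: "compact K" "K \<subseteq> W" "\<And>x. x \<notin> K \<Longrightarrow> \<phi> x = 0"
    and sm: "smooth_on UNIV \<phi>"
    using assms(1) unfolding test_function_def by blast
  have "frechet_derivative \<phi> (at x) v = 0" if "x \<notin> K" for x
  proof -
    have "open (- K)" using K(1) by (simp add: compact_imp_closed open_Compl)
    then have "(\<phi> has_derivative (\<lambda>v. 0)) (at x)"
      by (rule has_derivative_transform_within_open[OF has_derivative_const[of 0]]) (use that K in auto)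
    then show ?thesis using frechet_derivative_at by metis
  qed
  then show ?thesis unfolding test_function_def using K smooth_on_frechet[OF sm] by blast
qed

lemma test_function_add:
  assumes "test_function W \<phi>" "test_function W \<psi>"
  shows "test_function W (\<lambda>x. \<phi> x + \<psi> x)"
proof -
  obtain K K' where "compact K" "K \<subseteq> W" "\<And>x. x \<notin> K \<Longrightarrow> \<phi> x = 0"
    "compact K'" "K' \<subseteq> W" "\<And>x. x \<notin> K' \<Longrightarrow> \<psi> x = 0"
    using assms unfolding test_function_def by metis
  then have "compact (K \<union> K') \<and> K \<union> K' \<subseteq> W \<and> (\<forall>x. x \<notin> K \<union> K' \<longrightarrow> \<phi> x + \<psi> x = 0)"
    by auto
  then show ?thesis
    using assms smooth_on_add[of UNIV \<phi> \<psi>] unfolding test_function_def by blast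
qed

lemma test_function_cmult:
  assumes "test_function W \<phi>"
  shows "test_function W (\<lambda>x. c * \<phi> x)"
  using assms smooth_on_mult[OF open_UNIV smooth_on_const[of UNIV c], of \<phi>]
  unfolding test_function_def by auto

lemma continuous_on_mult_test_function:
  assumes "open W" "continuous_on W u" "test_function W \<phi>"
  shows "continuous_on UNIV (\<lambda>x. u x * \<phi> x)"
proof -
  obtain K where K: "compact K" "K \<subseteq> W" "\<And>x. x \<notin> K \<Longrightarrow> \<phi> x = 0"
    and sm: "smooth_on UNIV \<phi>"
    using assms(3) unfolding test_function_def by blast
  have "continuous_on W (\<lambda>x. u x * \<phi> x)"
    by (intro continuous_intros assms continuous_on_subset[OF smooth_on_continuous_on[OF sm]]) auto
  moreover have "continuous_on (- K) (\<lambda>x. u x * \<phi> x)"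
    by (rule continuous_on_eq[OF continuous_on_const[of _ 0]]) (simp add: K)
  ultimately have "continuous_on (W \<union> - K) (\<lambda>x. u x * \<phi> x)"
    using K(1) assms(1) by (intro continuous_on_open_Un) (auto simp: compact_imp_closed open_Compl)
  moreover have "W \<union> - K = UNIV" using K(2) by blast
  ultimately show ?thesis by simp
qed

section \<open>Integration by parts and the iterated du Bois-Reymond lemma\<close>

abbreviation deriv1 :: "(real \<Rightarrow> complex) \<Rightarrow> real \<Rightarrow> complex" where
  "deriv1 \<phi> \<equiv> (\<lambda>x. frechet_derivative \<phi> (at x) 1)"

text \<open>Compact support inside the open interval makes the product with \<phi> differentiable
  everywhere, so \<open>F\<close> may be arbitrary at the end points and no boundary terms
  occur.\<close>

lemma integral_test_by_parts:
  assumes "test_function {a<..<b} \<phi>" "a < b"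
    and F: "\<And>x. x \<in> {a<..<b} \<Longrightarrow> (F has_vector_derivative F' x) (at x)"
    and "continuous_on {a<..<b} F'"
  shows "integral {a..b} (\<lambda>x. F x * deriv1 \<phi> x) = - integral {a..b} (\<lambda>x. F' x * \<phi> x)"
proof -
  obtain K where K: "compact K" "K \<subseteq> {a<..<b}" "\<And>x. x \<notin> K \<Longrightarrow> \<phi> x = 0"
    and sm: "smooth_on UNIV \<phi>"
    using assms(1) unfolding test_function_def by blast
  have cF: "continuous_on {a<..<b} F"
    using F by (metis continuous_at_imp_continuous_on has_vector_derivative_continuous)
  have D\<phi>: "(\<phi> has_vector_derivative deriv1 \<phi> x) (at x)" for x
    using smooth_on_has_vector_derivative[OF sm] by simp
  have der: "((\<lambda>x. F x * \<phi> x) has_vector_derivative (F x * deriv1 \<phi> x + F' x * \<phi> x)) (at x)" for x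
  proof (cases "x \<in> {a<..<b}")
    case True
    show ?thesis by (rule has_vector_derivative_mult[OF F[OF True] D\<phi>])
  next
    case False
    then have x: "x \<in> - K" using K by blast
    have op: "open (- K)" using K(1) by (simp add: compact_imp_closed open_Compl)
    have 0: "((\<lambda>x. 0) has_vector_derivative 0) (at x)" by simp
    have "(\<phi> has_vector_derivative 0) (at x)"
      by (rule has_vector_derivative_transform_within_open[OF 0 op x]) (simp add: K)
    then have "deriv1 \<phi> x = 0" using D\<phi> vector_derivative_unique_at by blast
    moreover have "((\<lambda>x. F x * \<phi> x) has_vector_derivative 0) (at x)"
      by (rule has_vector_derivative_transform_within_open[OF 0 op x]) (simp add: K)
    ultimately show ?thesis using x K(3) by simp
  qed
  have "((\<lambda>x. F x * deriv1 \<phi> x + F' x * \<phi> x) has_integral F b * \<phi> b - F a * \<phi> a) {a..b}"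
    by (rule fundamental_theorem_of_calculus)
      (use assms(2) der in \<open>auto intro: has_vector_derivative_at_within\<close>)
  moreover have "\<phi> a = 0" "\<phi> b = 0" using K by force+
  ultimately have "integral {a..b} (\<lambda>x. F x * deriv1 \<phi> x + F' x * \<phi> x) = 0"
    by (simp add: integral_unique)
  moreover have "continuous_on UNIV (\<lambda>x. F x * deriv1 \<phi> x)"
    by (rule continuous_on_mult_test_function[OF _ cF test_function_frechet[OF assms(1)]]) auto
  moreover have "continuous_on UNIV (\<lambda>x. F' x * \<phi> x)"
    by (rule continuous_on_mult_test_function[OF _ assms(4) assms(1)]) auto
  ultimately have "integral {a..b} (\<lambda>x. F x * deriv1 \<phi> x) + integral {a..b} (\<lambda>x. F' x * \<phi> x) = 0"
    by (subst integral_add[symmetric])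
      (auto intro: integrable_continuous_interval continuous_on_subset)
  then show ?thesis by (simp add: add_eq_0_iff2)
qed

lemma fundamental_lemma_of_variations:
  fixes a b :: real
  assumes "a < b" "continuous_on {a<..<b} u"
    and 0: "\<And>\<phi>. test_function {a<..<b} \<phi> \<Longrightarrow> integral {a..b} (\<lambda>x. u x * \<phi> x) = 0"
    and "x0 \<in> {a<..<b}"
  shows "u x0 = (0::complex)"
proof (rule ccontr)
  assume nz: "u x0 \<noteq> 0"
  let ?w = "\<lambda>x. Re (u x * cnj (u x0))"
  have cw: "continuous_on {a<..<b} ?w" by (intro continuous_intros assms)
  have w0: "?w x0 > 0" using nz by (simp add: complex_mult_cnj sum_power2_gt_zero_iff complex_eq_iff)
  have "isCont ?w x0"
    using iffD1[OF continuous_on_eq_continuous_at[OF open_greaterThanLessThan] cw] assms(4)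
    by (rule bspec)
  then have "\<forall>\<^sub>F x in at x0. ?w x > 0"
    using w0 unfolding isCont_def by (rule order_tendstoD(1))
  then obtain e where "e > 0" "\<And>x. x \<noteq> x0 \<Longrightarrow> dist x x0 < e \<Longrightarrow> ?w x > 0"
    unfolding eventually_at by auto
  then have e: "e > 0" "\<And>x. dist x x0 < e \<Longrightarrow> ?w x > 0"
    using w0 by metis+
  define d where "d = Min {e / 2, (x0 - a) / 2, (b - x0) / 2}"
  have d: "d > 0" "d < e" "d < x0 - a" "d < b - x0"
    using e(1) assms(4) by (auto simp: d_def min_def)
  \<comment> \<open>The constant factor \<open>cnj (u x0)\<close> rotates \<open>u\<close> so that
    the real part of the integrand is nonnegative, and positive at \<open>x0\<close>.\<close>
  let ?\<phi> = "\<lambda>x. cnj (u x0) * of_real (bump (x0 - d) (x0 + d) x)"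
  have t: "test_function {a<..<b} ?\<phi>" by (rule test_function_bump) (use d in auto)
  have c: "continuous_on UNIV (\<lambda>x. u x * ?\<phi> x)"
    by (rule continuous_on_mult_test_function[OF _ assms(2) t]) auto
  have Re: "Re (u x * ?\<phi> x) = ?w x * bump (x0 - d) (x0 + d) x" for x
    by (simp add: algebra_simps)
  have "(\<lambda>x. u x * ?\<phi> x) integrable_on {a..b}"
    using c by (meson continuous_on_subset integrable_continuous_interval subset_UNIV)
  then have "integral {a..b} (\<lambda>x. Re (u x * ?\<phi> x)) = Re (integral {a..b} (\<lambda>x. u x * ?\<phi> x))"
    by (metis (mono_tags, lifting) bounded_linear_Re integral_linear o_def integral_cong)
  then have i0: "integral {a..b} (\<lambda>x. Re (u x * ?\<phi> x)) = 0" using 0[OF t] by simp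
  have "Re (u x * ?\<phi> x) \<ge> 0" for x
  proof (cases "dist x x0 < e")
    case True
    then show ?thesis unfolding Re using e(2)[OF True] bump_nonneg by simp
  next
    case False
    then have "x \<le> x0 - d \<or> x \<ge> x0 + d" using d by (auto simp: dist_real_def)
    then show ?thesis unfolding Re using bump_eq_0 by simp
  qed
  moreover have "continuous_on {a..b} (\<lambda>x. Re (u x * ?\<phi> x))"
    by (rule continuous_on_subset[OF continuous_on_Re[OF c]]) simp
  ultimately have "Re (u x0 * ?\<phi> x0) = 0"
    using i0 integral_eq_0_iff[of a b "\<lambda>x. Re (u x * ?\<phi> x)"] assms(1,4) by auto
  then show False unfolding Re using w0 bump_pos[of "x0 - d" x0 "x0 + d"] d(1) by simp
qed

lemma test_function_interval:
  assumes "test_function {a<..<b::real} \<phi>" "a < b"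
  obtains c d where "a < c" "c < d" "d < b" "\<And>x. x \<notin> {c..d} \<Longrightarrow> \<phi> x = 0"
proof -
  obtain K where K: "compact K" "K \<subseteq> {a<..<b}" "\<And>x. x \<notin> K \<Longrightarrow> \<phi> x = 0"
    using assms(1) unfolding test_function_def by blast
  \<comment> \<open>The two added points keep \<open>K'\<close> nonempty even if \<open>K\<close> is
    empty, and force its minimum below its maximum.\<close>
  define K' where "K' = insert ((3 * a + b) / 4) (insert ((a + 3 * b) / 4) K)"
  have K': "compact K'" "K' \<subseteq> {a<..<b}" "K' \<noteq> {}"
    using K assms(2) by (auto simp: K'_def field_simps)
  obtain c where c: "c \<in> K'" "\<And>x. x \<in> K' \<Longrightarrow> c \<le> x"
    using compact_attains_inf[OF K'(1,3)] by blast
  obtain d where d: "d \<in> K'" "\<And>x. x \<in> K' \<Longrightarrow> x \<le> d"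
    using compact_attains_sup[OF K'(1,3)] by blast
  have "c \<le> (3 * a + b) / 4" "(a + 3 * b) / 4 \<le> d"
    by (rule c(2) d(2), simp add: K'_def)+
  then have "c < d" using assms(2) by argo
  then show ?thesis
    using that[of c d] c d K' K(3) K'_def by (metis atLeastAtMost_iff greaterThanLessThan_iff insertI2 subsetD)
qed

lemma smooth_on_vector_derivative:
  assumes D: "\<And>x. (\<theta> has_vector_derivative \<psi> x) (at x)" and "smooth_on UNIV \<psi>"
  shows "smooth_on UNIV \<theta>" "deriv1 \<theta> = \<psi>"
proof -
  have f: "frechet_derivative \<theta> (at x) v = v *\<^sub>R \<psi> x" for x v
    using frechet_derivative_at[OF D[of x, unfolded has_vector_derivative_def], symmetric] by simp
  have "Ck_on n \<theta> UNIV" for n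
  proof (cases n)
    case 0
    then show ?thesis
      by (metis Ck_on.simps(1) D continuous_at_imp_continuous_on has_vector_derivative_continuous)
  next
    case (Suc m)
    have "Ck_on m (\<lambda>x. v *\<^sub>R \<psi> x) UNIV" for v
      by (rule Ck_on_linear_compose[OF bounded_linear_scaleR_right])
        (use assms(2) in \<open>auto simp: smooth_on_def\<close>)
    moreover have "\<theta> differentiable at x" for x
      using D[of x] differentiableI unfolding has_vector_derivative_def by blast
    ultimately show ?thesis by (simp add: Suc f)
  qed
  then show "smooth_on UNIV \<theta>" by (simp add: smooth_on_def)
  show "deriv1 \<theta> = \<psi>" by (simp add: f)
qed

text \<open>The primitive from \<open>a\<close> vanishes to the left of the support; to the right of
  the support it equals the total integral, so mean zero is exactly the condition for compact
  support.\<close>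

lemma test_function_primitive:
  assumes "test_function {a<..<b} \<psi>" "a < b" "integral {a..b} \<psi> = 0"
  obtains \<theta> where "test_function {a<..<b} \<theta>" "deriv1 \<theta> = \<psi>"
proof -
  obtain c d where cd: "a < c" "c < d" "d < b" and z: "\<And>x. x \<notin> {c..d} \<Longrightarrow> \<psi> x = 0"
    using test_function_interval[OF assms(1,2)] by metis
  have sm: "smooth_on UNIV \<psi>" using test_function_smooth[OF assms(1)] .
  have cont: "continuous_on {a..b} \<psi>"
    using smooth_on_continuous_on[OF sm] continuous_on_subset by blast
  define g where "g x = integral {a..x} \<psi>" for x
  have g: "(g has_vector_derivative \<psi> x) (at x within {a..b})" if "x \<in> {a..b}" for x
    unfolding g_def using integral_has_vector_derivative[OF cont that] .
  have g': "(g has_vector_derivative \<psi> x) (at x)" if "x \<in> {a<..<b}" for x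
    using g[of x] that at_within_interior[of x "{a..b}"] by simp
  have g1: "g x = 0" if "x \<le> c" for x
  proof -
    have "integral {a..x} \<psi> = integral {a..x} (\<lambda>x. 0)"
      by (rule integral_spike[of "{c}"]) (use z that in auto)
    then show ?thesis by (simp add: g_def)
  qed
  have g2: "g x = 0" if "d \<le> x" "x \<le> b" for x
  proof -
    have "integral {a..x} \<psi> + integral {x..b} \<psi> = integral {a..b} \<psi>"
      by (rule Henstock_Kurzweil_Integration.integral_combine)
        (use that cd cont in \<open>auto intro: integrable_continuous_interval\<close>)
    moreover have "integral {x..b} \<psi> = integral {x..b} (\<lambda>x. 0)"
      by (rule integral_spike[of "{d}"]) (use z that in auto)
    ultimately show ?thesis using assms(3) by (simp add: g_def)
  qed
  define \<theta> where "\<theta> x = (if x \<in> {a<..<b} then g x else 0)" for x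
  have \<theta>0: "\<theta> x = 0" if "x \<notin> {c..d}" for x
    using that g1 g2 by (auto simp: \<theta>_def)
  have "(\<theta> has_vector_derivative \<psi> x) (at x)" for x
  proof (cases "x \<in> {a<..<b}")
    case True
    show ?thesis
      by (rule has_vector_derivative_transform_within_open[OF g'[OF True] _ True]) (auto simp: \<theta>_def)
  next
    case False
    then have x: "x \<in> - {c..d}" using cd by auto
    have "((\<lambda>x. 0) has_vector_derivative 0) (at x)" by simp
    then have "(\<theta> has_vector_derivative 0) (at x)"
      by (rule has_vector_derivative_transform_within_open[of _ _ _ "- {c..d}"])
        (use x \<theta>0 in \<open>auto simp: open_Compl\<close>)
    then show ?thesis using z x by auto
  qed
  note \<theta> = smooth_on_vector_derivative[OF this sm]
  have "test_function {a<..<b} \<theta>"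
    unfolding test_function_def
    by (intro conjI exI[of _ "{c..d}"]) (use \<theta>(1) \<theta>0 cd in auto)
  then show ?thesis using that \<theta>(2) by blast
qed

text \<open>If \<open>m = 1 / w'\<close>, then \<open>m d/dx\<close> is differentiation with respect
  to \<open>w\<close>, and this operator is minus its transpose. Its iterates therefore carry
  derivatives with respect to \<open>w\<close> over to the test function.\<close>

definition twisted_deriv :: "(real \<Rightarrow> complex) \<Rightarrow> (real \<Rightarrow> complex) \<Rightarrow> real \<Rightarrow> complex" where
  "twisted_deriv m \<phi> = deriv1 (\<lambda>x. m x * \<phi> x)"

lemma test_function_twisted_deriv:
  assumes "smooth_on {a<..<b} m" "test_function {a<..<b} \<phi>"
  shows "test_function {a<..<b} ((twisted_deriv m ^^ k) \<phi>)"
proof (induction k)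
  case (Suc k)
  show ?case
    using test_function_frechet[OF test_function_mult_smooth[OF Suc _ assms(1)]]
    by (simp add: twisted_deriv_def)
qed (use assms in simp)

lemma twisted_deriv_linear:
  assumes "smooth_on {a<..<b} m" "test_function {a<..<b} \<phi>" "test_function {a<..<b} \<psi>"
  shows "(twisted_deriv m ^^ k) (\<lambda>x. \<phi> x + c * \<psi> x)
    = (\<lambda>x. (twisted_deriv m ^^ k) \<phi> x + c * (twisted_deriv m ^^ k) \<psi> x)"
proof (induction k)
  case (Suc k)
  let ?p = "\<lambda>x. m x * (twisted_deriv m ^^ k) \<phi> x" and ?q = "\<lambda>x. m x * (twisted_deriv m ^^ k) \<psi> x"
  have sm: "smooth_on UNIV ?p" "smooth_on UNIV ?q"
    using test_function_mult_smooth[OF test_function_twisted_deriv[OF assms(1)] _ assms(1)] assms(2,3)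
    by (auto intro: test_function_smooth)
  have "((\<lambda>x. ?p x + c * ?q x) has_derivative
      (\<lambda>v. frechet_derivative ?p (at x) v + c * frechet_derivative ?q (at x) v)) (at x)" for x
    by (intro has_derivative_add has_derivative_mult_right smooth_on_has_derivative[OF sm(1)]
        smooth_on_has_derivative[OF sm(2)]) auto
  from frechet_derivative_at[OF this, symmetric]
  have "deriv1 (\<lambda>x. ?p x + c * ?q x) x = deriv1 ?p x + c * deriv1 ?q x" for x by simp
  moreover have "(\<lambda>x. m x * ((twisted_deriv m ^^ k) \<phi> x + c * (twisted_deriv m ^^ k) \<psi> x))
      = (\<lambda>x. ?p x + c * ?q x)"
    by (simp add: algebra_simps)
  ultimately show ?case
    by (simp add: Suc twisted_deriv_def[of m "\<lambda>x. _ x + _ x"] twisted_deriv_def[of m "(_ ^^ _) _"])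
qed simp

text \<open>One integration by parts moves one operator onto the power as minus the derivative with
  respect to \<open>w\<close>, so \<open>w^(k+1) / (k+1)!\<close> becomes \<open>w^k / k!\<close>;
  the factor \<open>m\<close> cancels against \<open>w' = 1 / m\<close>.\<close>

lemma integral_power_twisted_deriv:
  assumes "a < b" "smooth_on {a<..<b} m" "\<And>x. x \<in> {a<..<b} \<Longrightarrow> m x \<noteq> 0"
    and w: "\<And>x. x \<in> {a<..<b} \<Longrightarrow> (w has_vector_derivative inverse (m x)) (at x)"
    and "test_function {a<..<b} \<psi>"
  shows "integral {a..b} (\<lambda>x. w x ^ k / fact k * (twisted_deriv m ^^ k) \<psi> x)
    = (-1) ^ k * integral {a..b} \<psi>"
proof (induction k)
  case (Suc k)
  let ?\<phi> = "(twisted_deriv m ^^ k) \<psi>"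
  have t: "test_function {a<..<b} ?\<phi>" by (rule test_function_twisted_deriv) (use assms in auto)
  have tm: "test_function {a<..<b} (\<lambda>x. m x * ?\<phi> x)"
    by (rule test_function_mult_smooth) (use t assms in auto)
  have der: "((\<lambda>x. w x ^ Suc k / fact (Suc k)) has_vector_derivative w x ^ k / fact k * inverse (m x)) (at x)"
    if "x \<in> {a<..<b}" for x
  proof -
    have "((\<lambda>z. z ^ Suc k / fact (Suc k)) has_field_derivative
        of_nat (Suc k) * w x ^ k / fact (Suc k)) (at (w x))"
      by (rule DERIV_cdivide) (auto intro!: derivative_eq_intros simp: algebra_simps simp flip: power_Suc2 power_Suc; cases k; simp)
    moreover have "of_nat (Suc k) * w x ^ k / fact (Suc k) = w x ^ k / fact k"
      unfolding fact_Suc by (simp del: of_nat_Suc)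
    ultimately have "((\<lambda>z. z ^ Suc k / fact (Suc k)) has_field_derivative w x ^ k / fact k) (at (w x))"
      by (simp only:)
    from field_vector_diff_chain_at[OF w[OF that] this] show ?thesis
      by (simp add: o_def mult.commute)
  qed
  have wc: "continuous_on {a<..<b} w"
    using w by (metis continuous_at_imp_continuous_on has_vector_derivative_continuous)
  have "integral {a..b} (\<lambda>x. w x ^ Suc k / fact (Suc k) * deriv1 (\<lambda>x. m x * ?\<phi> x) x)
    = - integral {a..b} (\<lambda>x. (w x ^ k / fact k * inverse (m x)) * (m x * ?\<phi> x))"
    by (rule integral_test_by_parts[OF tm assms(1) der])
      (use assms(3) in \<open>auto intro!: continuous_intros wc smooth_on_continuous_on[OF assms(2)]\<close>)
  also have "integral {a..b} (\<lambda>x. (w x ^ k / fact k * inverse (m x)) * (m x * ?\<phi> x))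
    = integral {a..b} (\<lambda>x. w x ^ k / fact k * ?\<phi> x)"
    by (rule integral_spike[of "{a, b}"]) (use assms(3) in auto)
  finally have "integral {a..b} (\<lambda>x. w x ^ Suc k / fact (Suc k) * twisted_deriv m ?\<phi> x)
      = - integral {a..b} (\<lambda>x. w x ^ k / fact k * ?\<phi> x)"
    by (simp only: twisted_deriv_def[of m ?\<phi>])
  then show ?case using Suc by (simp only: funpow.simps o_apply) simp
qed simp

text \<open>
  The induction removes one operator at a time: a test function with mean zero is a twisted
  derivative, and the mean is matched by a multiple of \<open>w\<^sup>k\<close>.
\<close>

lemma iterated_du_Bois_Reymond:
  assumes "a < b" "smooth_on {a<..<b} m" "\<And>x. x \<in> {a<..<b} \<Longrightarrow> m x \<noteq> 0"
    and w: "\<And>x. x \<in> {a<..<b} \<Longrightarrow> (w has_vector_derivative inverse (m x)) (at x)"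
    and "continuous_on {a<..<b} u"
    and "\<And>\<phi>. test_function {a<..<b} \<phi> \<Longrightarrow>
      integral {a..b} (\<lambda>x. u x * (twisted_deriv m ^^ k) \<phi> x) = 0"
  shows "\<exists>c. \<forall>x\<in>{a<..<b}. u x = (\<Sum>j<k. c j * w x ^ j)"
  using assms(5,6)
proof (induction k arbitrary: u)
  case 0
  then show ?case
    using fundamental_lemma_of_variations[OF assms(1)] by auto
next
  case (Suc k)
  let ?T = "twisted_deriv m"
  note tT = test_function_twisted_deriv[OF assms(2)]
  have int: "(\<lambda>x. v x * \<phi> x) integrable_on {a..b}"
    if "continuous_on {a<..<b} v" "test_function {a<..<b} \<phi>" for v \<phi>
    using continuous_on_mult_test_function[OF _ that]
    by (meson continuous_on_subset integrable_continuous_interval open_greaterThanLessThan subset_UNIV)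
  have wc: "continuous_on {a<..<b} w"
    using w by (metis continuous_at_imp_continuous_on has_vector_derivative_continuous)
  \<comment> \<open>A test function of integral 1: subtracting the right multiple of it gives any
    test function mean zero, hence a primitive.\<close>
  obtain \<omega> where \<omega>: "test_function {a<..<b} \<omega>" "integral {a..b} \<omega> = 1"
  proof -
    define c d where "c = (2 * a + b) / 3" and "d = (a + 2 * b) / 3"
    have cd: "a < c" "c < d" "d < b" using assms(1) by (auto simp: c_def d_def field_simps)
    let ?\<beta> = "\<lambda>x. 1 * complex_of_real (bump c d x)"
    have t: "test_function {a<..<b} ?\<beta>" by (rule test_function_bump) (use cd in auto)
    have "integral {a..b} ?\<beta> \<noteq> 0"
    proof
      assume 0: "integral {a..b} ?\<beta> = 0"
      have cb: "continuous_on {a..b} (bump c d)"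
        using smooth_on_continuous_on[OF smooth_on_bump] continuous_on_subset by blast
      then have "integral {a..b} ?\<beta> = of_real (integral {a..b} (bump c d))"
        using integral_linear[OF integrable_continuous_interval[OF cb] bounded_linear_of_real[where 'a = complex]]
        by (simp add: o_def)
      then have "integral {a..b} (bump c d) = 0" using 0 by simp
      then have "bump c d ((c + d) / 2) = 0"
        using integral_eq_0_iff[OF cb] assms(1) cd bump_nonneg by auto
      then show False using bump_pos[of c "(c + d) / 2" d] cd by simp
    qed
    then show ?thesis
      using that[of "\<lambda>x. inverse (integral {a..b} ?\<beta>) * ?\<beta> x"] test_function_cmult[OF t] by simp
  qed
  define A where "A = integral {a..b} (\<lambda>x. u x * (?T ^^ k) \<omega> x)"
  have key: "integral {a..b} (\<lambda>x. u x * (?T ^^ k) \<psi> x) = A * integral {a..b} \<psi>"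
    if \<psi>: "test_function {a<..<b} \<psi>" for \<psi>
  proof -
    define c where "c = integral {a..b} \<psi>"
    have t: "test_function {a<..<b} (\<lambda>x. \<psi> x + (- c) * \<omega> x)"
      by (intro test_function_add test_function_cmult \<psi> \<omega>(1))
    have i1: "(\<lambda>x. 1 * \<psi> x) integrable_on {a..b}" "(\<lambda>x. (- c) * \<omega> x) integrable_on {a..b}"
      by (rule int; use \<psi> \<omega> in simp)+
    have "integral {a..b} (\<lambda>x. \<psi> x + (- c) * \<omega> x) = 0"
      using integral_add[OF i1] \<omega>(2) by (simp add: c_def)
    then obtain \<theta> where \<theta>: "test_function {a<..<b} \<theta>" "deriv1 \<theta> = (\<lambda>x. \<psi> x + (- c) * \<omega> x)"
      using test_function_primitive[OF t assms(1)] by metis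
    \<comment> \<open>Division by \<open>m\<close> makes the derivative of \<theta> a twisted
      derivative. Outside the interval, where nothing is known about \<open>m\<close>, the function
      \<theta> vanishes.\<close>
    let ?\<phi> = "\<lambda>x. inverse (m x) * \<theta> x"
    have t\<phi>: "test_function {a<..<b} ?\<phi>"
      by (rule test_function_mult_smooth[OF \<theta>(1)])
        (use assms(2,3) in \<open>auto intro!: smooth_on_inverse\<close>)
    have "\<theta> x = 0" if "x \<notin> {a<..<b}" for x
      using \<theta>(1) that unfolding test_function_def by blast
    then have "m x * ?\<phi> x = \<theta> x" for x
      using assms(3)[of x] by (cases "x \<in> {a<..<b}") auto
    then have "(\<lambda>x. m x * ?\<phi> x) = \<theta>" by (rule ext)
    then have "?T ?\<phi> = (\<lambda>x. \<psi> x + (- c) * \<omega> x)" by (simp add: twisted_deriv_def \<theta>(2))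
    then have "(?T ^^ Suc k) ?\<phi> = (\<lambda>x. (?T ^^ k) \<psi> x + (- c) * (?T ^^ k) \<omega> x)"
      using twisted_deriv_linear[OF assms(2) \<psi> \<omega>(1), of k "- c"] by (simp only: funpow_Suc_right o_apply)
    then have "0 = integral {a..b} (\<lambda>x. u x * ((?T ^^ k) \<psi> x + (- c) * (?T ^^ k) \<omega> x))"
      using Suc.prems(2)[OF t\<phi>] by simp
    also have "\<dots> = integral {a..b} (\<lambda>x. u x * (?T ^^ k) \<psi> x + (- c) * (u x * (?T ^^ k) \<omega> x))"
      by (simp add: algebra_simps)
    also have "\<dots> = integral {a..b} (\<lambda>x. u x * (?T ^^ k) \<psi> x) + (- c) * A"
      unfolding A_def
      by (subst integral_add[OF int[OF Suc.prems(1) tT[OF \<psi>]]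
            integrable_on_mult_right[OF int[OF Suc.prems(1) tT[OF \<omega>(1)]]]]) simp
    finally show ?thesis by (simp add: c_def mult.commute)
  qed
  \<comment> \<open>The multiple of \<open>w^k\<close> whose pairing with the \<open>k\<close>-th
    twisted derivative of \<psi> is \<open>A\<close> times the integral of \<psi>; subtracting it
    leaves a function that is annihilated with one operator fewer.\<close>
  define q where "q x = (-1) ^ k * A * (w x ^ k / fact k)" for x
  have qc: "continuous_on {a<..<b} q" unfolding q_def by (intro continuous_intros wc) auto
  have "integral {a..b} (\<lambda>x. (u x - q x) * (?T ^^ k) \<psi> x) = 0"
    if \<psi>: "test_function {a<..<b} \<psi>" for \<psi>
  proof -
    have "integral {a..b} (\<lambda>x. q x * (?T ^^ k) \<psi> x)
      = (-1) ^ k * A * integral {a..b} (\<lambda>x. w x ^ k / fact k * (?T ^^ k) \<psi> x)"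
      by (simp add: q_def mult.assoc)
    also have "\<dots> = A * integral {a..b} \<psi>"
      by (subst integral_power_twisted_deriv[OF assms(1-3) w \<psi>]) (auto simp: power_mult_distrib[symmetric])
    finally show ?thesis
      using key[OF \<psi>]
        integral_diff[OF int[OF Suc.prems(1) tT[OF \<psi>, of k]] int[OF qc tT[OF \<psi>, of k]]]
      by (simp add: left_diff_distrib)
  qed
  then obtain c where c: "\<forall>x\<in>{a<..<b}. u x - q x = (\<Sum>j<k. c j * w x ^ j)"
    using Suc.IH[of "\<lambda>x. u x - q x"] Suc.prems(1) qc by (auto intro: continuous_intros)
  let ?c = "c(k := (-1) ^ k * A / fact k)"
  have "u x = (\<Sum>j<Suc k. ?c j * w x ^ j)" if "x \<in> {a<..<b}" for x
  proof -
    have "(\<Sum>j<k. ?c j * w x ^ j) = (\<Sum>j<k. c j * w x ^ j)" by (rule sum.cong) auto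
    then show ?thesis using c that by (auto simp: q_def algebra_simps)
  qed
  then show ?case by blast
qed

text \<open>Subtract from \<open>u\<close> a primitive of \<open>v\<close>: the difference has weak
  derivative 0 and is constant by du Bois-Reymond with \<open>m = 1\<close> and
  \<open>k = 1\<close>.\<close>

lemma weak_derivative_imp_integral:
  assumes "a < b" "continuous_on {a<..<b} u" "continuous_on {a<..<b} v"
    and 0: "\<And>\<phi>. test_function {a<..<b} \<phi> \<Longrightarrow>
      integral {a..b} (\<lambda>x. u x * deriv1 \<phi> x) = - integral {a..b} (\<lambda>x. v x * \<phi> x)"
    and xy: "a < x" "x \<le> y" "y < b"
  shows "u y - u x = integral {x..y} v"
proof -
  \<comment> \<open>A compact subinterval: \<open>v\<close> is continuous only on the open interval,
    so its primitive cannot start at \<open>a\<close>.\<close>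
  define c d where "c = (a + x) / 2" and "d = (y + b) / 2"
  have cd: "a < c" "c < x" "y < d" "d < b" using xy by (auto simp: c_def d_def)
  define V where "V z = integral {c..z} v" for z
  have cv: "continuous_on {c..d} v" by (rule continuous_on_subset[OF assms(3)]) (use cd in auto)
  have V: "(V has_vector_derivative v z) (at z)" if "z \<in> {c<..<d}" for z
    using integral_has_vector_derivative[OF cv, of z] that at_within_interior[of z "{c..d}"]
    by (simp add: V_def[abs_def])
  have Vc: "continuous_on {c<..<d} V"
    using V by (metis continuous_at_imp_continuous_on has_vector_derivative_continuous)
  have sub: "continuous_on {c<..<d} u" "continuous_on {c<..<d} v"
    using cd by (auto intro: continuous_on_subset[OF assms(2)] continuous_on_subset[OF assms(3)])
  have ext: "integral {c..d} (\<lambda>x. h x * \<phi> x) = integral {a..b} (\<lambda>x. h x * \<phi> x)"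
    if "\<And>x. x \<notin> {c<..<d} \<Longrightarrow> \<phi> x = 0" for h \<phi> :: "real \<Rightarrow> complex"
  proof (rule integral_spike_set)
    have "x \<in> {c<..<d}" if "h x * \<phi> x \<noteq> 0" for x
      using \<open>\<And>x. x \<notin> {c<..<d} \<Longrightarrow> \<phi> x = 0\<close>[of x] that by fastforce
    then have e1: "{x \<in> {c..d} - {a..b}. h x * \<phi> x \<noteq> 0} = {}" and e2: "{x \<in> {a..b} - {c..d}. h x * \<phi> x \<noteq> 0} = {}"
      using cd xy by force+
    show "negligible {x \<in> {c..d} - {a..b}. h x * \<phi> x \<noteq> 0}" unfolding e1 by simp
    show "negligible {x \<in> {a..b} - {c..d}. h x * \<phi> x \<noteq> 0}" unfolding e2 by simp
  qed
  have "\<exists>k. \<forall>z\<in>{c<..<d}. u z - V z = (\<Sum>j<1. k j * of_real z ^ j)"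
  proof (rule iterated_du_Bois_Reymond[where m = "\<lambda>_. 1"])
    fix \<phi> assume \<phi>: "test_function {c<..<d} \<phi>"
    then have \<phi>': "test_function {a<..<b} \<phi>"
      by (rule test_function_mono) (use cd in auto)
    have z: "\<phi> z = 0" "deriv1 \<phi> z = 0" if "z \<notin> {c<..<d}" for z
      using that \<phi> test_function_frechet[OF \<phi>] unfolding test_function_def by blast+
    have "integral {c..d} (\<lambda>x. u x * deriv1 \<phi> x) = integral {c..d} (\<lambda>x. V x * deriv1 \<phi> x)"
      using 0[OF \<phi>'] ext[of \<phi> v] ext[of "deriv1 \<phi>" u] z integral_test_by_parts[OF \<phi> _ V sub(2)] cd xy
      by simp
    moreover have "(\<lambda>x. h x * deriv1 \<phi> x) integrable_on {c..d}" if "continuous_on {c<..<d} h" for h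
      using continuous_on_mult_test_function[OF _ that test_function_frechet[OF \<phi>]]
      by (meson continuous_on_subset integrable_continuous_interval open_greaterThanLessThan subset_UNIV)
    ultimately show "integral {c..d} (\<lambda>x. (u x - V x) * (twisted_deriv (\<lambda>_. 1) ^^ 1) \<phi> x) = 0"
      using integral_diff[of "\<lambda>x. u x * deriv1 \<phi> x" "{c..d}" "\<lambda>x. V x * deriv1 \<phi> x"] sub Vc
      by (simp add: twisted_deriv_def left_diff_distrib)
  qed (use cd xy sub Vc in \<open>auto intro!: smooth_on_const continuous_intros has_vector_derivative_of_real
        has_vector_derivative_real_field derivative_eq_intros\<close>)
  then obtain k where k: "\<And>z. z \<in> {c<..<d} \<Longrightarrow> u z - V z = k 0" by auto
  have "V y = V x + integral {x..y} v"
    unfolding V_def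
    by (rule Henstock_Kurzweil_Integration.integral_combine[symmetric])
      (use cd xy in \<open>auto intro!: integrable_continuous_interval continuous_on_subset[OF cv]\<close>)
  then show ?thesis using k[of x] k[of y] cd xy by (simp add: algebra_simps)
qed

section \<open>Closed one-forms in the plane\<close>

text \<open>Only one of the partial derivatives has to exist nearby and be continuous; of the other
  one just its value at the point enters. Derivatives within \<open>X \<times> Y\<close> admit
  points on the edges of a rectangle.\<close>

lemma has_derivative_partials_within:
  fixes G P Q :: "real \<times> real \<Rightarrow> complex"
  assumes x: "((\<lambda>x. G (x, t0)) has_vector_derivative P (x0, t0)) (at x0 within X)"
    and t: "\<And>x t. x \<in> X \<Longrightarrow> t \<in> Y \<Longrightarrow> ((\<lambda>t. G (x, t)) has_vector_derivative Q (x, t)) (at t within Y)"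
    and Q: "continuous_on (X \<times> Y) Q" and "x0 \<in> X" "t0 \<in> Y" "convex Y"
  shows "(G has_derivative (\<lambda>v. fst v *\<^sub>R P (x0, t0) + snd v *\<^sub>R Q (x0, t0))) (at (x0, t0) within X \<times> Y)"
proof -
  have "((\<lambda>(x, t). G (x, t)) has_derivative
      (\<lambda>(h, k). h *\<^sub>R P (x0, t0) + blinfun_apply (blinfun_scaleR_left (Q (x0, t0))) k))
      (at (x0, t0) within X \<times> Y)"
  proof (rule has_derivative_partialsI[where fy = "\<lambda>x t. blinfun_scaleR_left (Q (x, t))"])
    show "((\<lambda>x. G (x, t0)) has_derivative (\<lambda>h. h *\<^sub>R P (x0, t0))) (at x0 within X)"
      using x by (simp add: has_vector_derivative_def)
    show "((\<lambda>t. G (x, t)) has_derivative blinfun_apply (blinfun_scaleR_left (Q (x, t)))) (at t within Y)"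
      if "x \<in> X" "t \<in> Y" for x t
      using t[OF that] by (simp add: has_vector_derivative_def)
    have "continuous_on (X \<times> Y) (\<lambda>z. blinfun_scaleR_left (Q z))"
      by (intro continuous_intros Q)
    then have "continuous (at (x0, t0) within X \<times> Y) (\<lambda>z. blinfun_scaleR_left (Q z))"
      using assms(4,5) by (simp add: continuous_on_eq_continuous_within)
    then show "continuous (at (x0, t0) within X \<times> Y) (\<lambda>(x, t). blinfun_scaleR_left (Q (x, t)))"
      by (simp add: case_prod_unfold)
  qed fact+
  then show ?thesis by (simp add: case_prod_unfold)
qed

text \<open>The integral of \<open>P dx + Q dt\<close> from the corner \<open>(a, d)\<close> along
  the top edge and then vertically down to \<open>(x, t)\<close>. It starts at the top because the
  forms of interest may be singular at the bottom edge, which the domains below exclude.\<close>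

definition corner_integral ::
  "(real \<times> real \<Rightarrow> complex) \<Rightarrow> (real \<times> real \<Rightarrow> complex) \<Rightarrow> real \<Rightarrow> real \<Rightarrow> real \<times> real \<Rightarrow> complex" where
  "corner_integral P Q a d = (\<lambda>(x, t). integral {a..x} (\<lambda>s. P (s, d)) - integral {t..d} (\<lambda>s. Q (x, s)))"

lemma corner_integral_deriv_t:
  assumes "continuous_on ({a..b} \<times> {c<..d}) Q" "x \<in> {a..b}" "t \<in> {c<..d}"
  shows "((\<lambda>t. corner_integral P Q a d (x, t)) has_vector_derivative Q (x, t)) (at t within {c<..d})"
proof -
  define c' where "c' = (c + t) / 2"
  have c': "c < c'" "c' < t" using assms(3) by (auto simp: c'_def)
  have "continuous_on {c'..d} (\<lambda>s. Q (x, s))"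
    by (rule continuous_on_compose2[OF assms(1)]) (use c' assms in \<open>auto intro!: continuous_intros\<close>)
  then have "((\<lambda>t. integral {t..d} (\<lambda>s. Q (x, s))) has_vector_derivative - Q (x, t)) (at t within {c'..d})"
    by (rule integral_has_vector_derivative') (use c' assms in auto)
  then have "((\<lambda>t. corner_integral P Q a d (x, t)) has_vector_derivative (0 - (- Q (x, t)))) (at t within {c'..d})"
    unfolding corner_integral_def prod.case by (intro has_vector_derivative_diff has_vector_derivative_const)
  moreover have "at t within {c'..d} = at t within {c<..d}"
    by (rule at_within_nhd[where S = "{c'<..}"]) (use c' in auto)
  ultimately show ?thesis by simp
qed

lemma corner_integral_has_derivative:
  assumes cP: "continuous_on ({a..b} \<times> {c<..d}) P" and cQ: "continuous_on ({a..b} \<times> {c<..d}) Q"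
    and x: "\<And>x t. x \<in> {a..b} \<Longrightarrow> t \<in> {c<..d} \<Longrightarrow>
      ((\<lambda>x. corner_integral P Q a d (x, t)) has_vector_derivative P (x, t)) (at x within {a..b})"
    and p: "p \<in> {a..b} \<times> {c<..d}"
  shows "(corner_integral P Q a d has_derivative (\<lambda>v. fst v *\<^sub>R P p + snd v *\<^sub>R Q p))
    (at p within {a..b} \<times> {c<..d})"
proof -
  obtain x0 t0 where p': "p = (x0, t0)" "x0 \<in> {a..b}" "t0 \<in> {c<..d}" using p by auto
  show ?thesis
    unfolding p'(1)
    by (rule has_derivative_partials_within[where G = "corner_integral P Q a d" and P = P and Q = Q])
      (use p' x corner_integral_deriv_t[OF cQ] cQ in auto)
qed

text \<open>On the top edge the derivative is right by construction. Whether it is right at height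
  \<open>t\<close> is locally constant in \<open>t\<close>, because near each height a local
  primitive \<open>H\<close> differs from the corner integral by a function of the first variable
  alone. Connectedness of \<open>{c<..d}\<close> carries the property down.\<close>

lemma corner_integral_deriv_x_local:
  assumes "c < d" and cP: "continuous_on ({a..b} \<times> {c<..d}) P" and cQ: "continuous_on ({a..b} \<times> {c<..d}) Q"
    and loc: "\<And>p. p \<in> {a..b} \<times> {c<..d} \<Longrightarrow> \<exists>e>0. \<exists>H. \<forall>q\<in>ball p e.
      (H has_derivative (\<lambda>v. fst v *\<^sub>R P q + snd v *\<^sub>R Q q)) (at q)"
    and x: "x \<in> {a..b}" and t: "t \<in> {c<..d}"
  shows "((\<lambda>x. corner_integral P Q a d (x, t)) has_vector_derivative P (x, t)) (at x within {a..b})"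
proof -
  let ?G = "corner_integral P Q a d"
  let ?E = "\<lambda>t. ((\<lambda>x. ?G (x, t)) has_vector_derivative P (x, t)) (at x within {a..b})"
  have start: "?E d"
  proof -
    have "continuous_on {a..b} (\<lambda>s. P (s, d))"
      by (rule continuous_on_compose2[OF cP]) (use \<open>c < d\<close> in \<open>auto intro!: continuous_intros\<close>)
    then show ?thesis
      using integral_has_vector_derivative[OF _ x] by (simp add: corner_integral_def)
  qed
  have "?E t = ?E d"
  proof (rule connected_local_const[where f = ?E and A = "{c<..d}"])
    show "connected {c<..d}" by simp
    show "\<forall>t\<in>{c<..d}. \<forall>\<^sub>F s in at t within {c<..d}. ?E t = ?E s"
    proof
      fix t0 assume t0: "t0 \<in> {c<..d}"
      obtain e H where e: "e > 0" and H: "\<And>q. q \<in> ball (x, t0) e \<Longrightarrow>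
          (H has_derivative (\<lambda>v. fst v *\<^sub>R P q + snd v *\<^sub>R Q q)) (at q)"
        using loc[of "(x, t0)"] x t0 by blast
      define J where "J = {c<..d} \<inter> {t0 - e / 2<..<t0 + e / 2}"
      have inb: "(y, s) \<in> ball (x, t0) e" if "\<bar>y - x\<bar> < e / 2" "\<bar>s - t0\<bar> < e / 2" for y s
      proof -
        have "dist (x, t0) (y, s) \<le> \<bar>y - x\<bar> + \<bar>s - t0\<bar>"
          using sqrt_sum_squares_le_sum_abs[of "x - y" "s - t0"]
          by (simp add: dist_prod_def dist_real_def abs_minus_commute power2_commute)
        then show ?thesis using that by simp
      qed
      have Ht: "((\<lambda>s. H (y, s)) has_vector_derivative Q (y, s)) (at s)"
        and Hx: "((\<lambda>y. H (y, s)) has_vector_derivative P (y, s)) (at y)"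
        if "\<bar>y - x\<bar> < e / 2" "\<bar>s - t0\<bar> < e / 2" for y s
      proof -
        have "((\<lambda>s. (y, s)) has_derivative (\<lambda>h. (0, h))) (at s)"
          "((\<lambda>y. (y, s)) has_derivative (\<lambda>h. (h, 0))) (at y)"
          by (auto intro!: derivative_eq_intros)
        from this[THEN has_derivative_compose, OF H[OF inb[OF that]]]
        show "((\<lambda>s. H (y, s)) has_vector_derivative Q (y, s)) (at s)"
          "((\<lambda>y. H (y, s)) has_vector_derivative P (y, s)) (at y)"
          by (simp_all add: has_vector_derivative_def)
      qed
      \<comment> \<open>Both functions have \<open>t\<close>-derivative \<open>Q\<close>, so the
        difference does not depend on the height as long as the point stays in the ball of
        \<open>H\<close>.\<close>
      have const: "?G (y, s) - H (y, s) = ?G (y, t0) - H (y, t0)"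
        if "\<bar>y - x\<bar> < e / 2" "y \<in> {a..b}" "s \<in> J" for y s
      proof -
        have "\<bar>s - t0\<bar> < e / 2" if "s \<in> J" for s
          using that unfolding J_def abs_less_iff Int_iff greaterThanLessThan_iff by linarith
        then have "((\<lambda>s. ?G (y, s) - H (y, s)) has_vector_derivative 0) (at s within J)" if "s \<in> J" for s
          using has_vector_derivative_diff[OF
              has_vector_derivative_within_subset[OF corner_integral_deriv_t[OF cQ \<open>y \<in> {a..b}\<close>, of s P], of J]
              has_vector_derivative_at_within[OF Ht[of y s], of J]] that \<open>\<bar>y - x\<bar> < e / 2\<close>
          by (auto simp: J_def)
        moreover have "convex J" by (auto simp: J_def convex_Int)
        ultimately have "\<exists>k. \<forall>s\<in>J. ?G (y, s) - H (y, s) = k"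
          by (intro has_derivative_zero_constant) (simp_all add: has_vector_derivative_def)
        moreover have "t0 \<in> J" using e t0 by (simp add: J_def)
        ultimately show ?thesis using that(3) by metis
      qed
      have EH: "?E s \<longleftrightarrow> ((\<lambda>y. ?G (y, s) - H (y, s)) has_vector_derivative 0) (at x within {a..b})"
        if "s \<in> J" for s
      proof
        have hx: "((\<lambda>y. H (y, s)) has_vector_derivative P (x, s)) (at x within {a..b})"
        proof (rule Hx[THEN has_vector_derivative_at_within])
          show "\<bar>s - t0\<bar> < e / 2"
            using that unfolding J_def abs_less_iff Int_iff greaterThanLessThan_iff by linarith
        qed (use e in simp)
        show "((\<lambda>y. ?G (y, s) - H (y, s)) has_vector_derivative 0) (at x within {a..b})" if "?E s"
          using has_vector_derivative_diff[OF that hx] by simp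
        show "?E s" if "((\<lambda>y. ?G (y, s) - H (y, s)) has_vector_derivative 0) (at x within {a..b})"
          using has_vector_derivative_add[OF that hx] by simp
      qed
      have tr: "((\<lambda>y. ?G (y, s) - H (y, s)) has_vector_derivative 0) (at x within {a..b})"
        if "((\<lambda>y. ?G (y, s') - H (y, s')) has_vector_derivative 0) (at x within {a..b})"
          "s \<in> J" "s' \<in> J" for s s'
        by (rule has_vector_derivative_transform_within[OF that(1), of "e / 2"])
          (use e x const[OF _ _ that(2)] const[OF _ _ that(3)] in \<open>auto simp: dist_real_def\<close>)
      have "\<forall>\<^sub>F s in at t0 within {c<..d}. s \<in> J"
        unfolding eventually_at J_def Int_iff greaterThanLessThan_iff dist_real_def abs_less_iff
        by (rule exI[of _ "e / 2"]) (use e in auto)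
      then show "\<forall>\<^sub>F s in at t0 within {c<..d}. ?E t0 = ?E s"
      proof (rule eventually_mono)
        fix s assume s: "s \<in> J"
        have t0J: "t0 \<in> J" using t0 e by (auto simp: J_def)
        show "?E t0 = ?E s"
          unfolding EH[OF s] EH[OF t0J] using tr[OF _ s t0J] tr[OF _ t0J s] by blast
      qed
    qed
  qed (use t \<open>c < d\<close> in auto)
  then show ?thesis using start by simp
qed

text \<open>Differentiation under the integral gives
  \<open>P (x, d) - (P (x, d) - P (x, t))\<close>, because closedness is available in the classical
  form that \<open>R\<close> is both \<open>dP/dt\<close> and \<open>dQ/dx\<close>. One-sided
  derivatives on the vertical edges are included.\<close>

lemma corner_integral_deriv_x_C1:
  assumes "c < d" and cP: "continuous_on ({a..b} \<times> {c<..d}) P" and cQ: "continuous_on ({a..b} \<times> {c<..d}) Q"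
    and cR: "continuous_on ({a..b} \<times> {c<..d}) R"
    and Pt: "\<And>x t. x \<in> {a..b} \<Longrightarrow> t \<in> {c<..d} \<Longrightarrow>
      ((\<lambda>t. P (x, t)) has_vector_derivative R (x, t)) (at t within {c<..d})"
    and Qx: "\<And>x t. x \<in> {a..b} \<Longrightarrow> t \<in> {c<..d} \<Longrightarrow>
      ((\<lambda>x. Q (x, t)) has_vector_derivative R (x, t)) (at x within {a..b})"
    and x: "x \<in> {a..b}" and t: "t \<in> {c<..d}"
  shows "((\<lambda>x. corner_integral P Q a d (x, t)) has_vector_derivative P (x, t)) (at x within {a..b})"
proof -
  have "continuous_on {a..b} (\<lambda>s. P (s, d))"
    by (rule continuous_on_compose2[OF cP]) (use \<open>c < d\<close> in \<open>auto intro!: continuous_intros\<close>)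
  then have 1: "((\<lambda>x. integral {a..x} (\<lambda>s. P (s, d))) has_vector_derivative P (x, d)) (at x within {a..b})"
    by (rule integral_has_vector_derivative) (rule x)
  have "((\<lambda>x. integral (cbox t d) (\<lambda>s. Q (x, s))) has_vector_derivative
      integral (cbox t d) (\<lambda>s. R (x, s))) (at x within {a..b})"
  proof (rule leibniz_rule_vector_derivative)
    show "continuous_on ({a..b} \<times> cbox t d) (\<lambda>(x, s). R (x, s))"
      using continuous_on_subset[OF cR] t by (simp add: case_prod_unfold subset_iff)
    show "(\<lambda>s. Q (y, s)) integrable_on cbox t d" if "y \<in> {a..b}" for y
      by (intro integrable_continuous continuous_on_compose2[OF cQ])
        (use that t in \<open>auto intro!: continuous_intros\<close>)
  qed (use Qx x t in auto)
  moreover have "((\<lambda>s. R (x, s)) has_integral P (x, d) - P (x, t)) {t..d}"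
    by (rule fundamental_theorem_of_calculus)
      (use t x in \<open>auto intro!: has_vector_derivative_within_subset[OF Pt]\<close>)
  ultimately have 2: "((\<lambda>x. integral {t..d} (\<lambda>s. Q (x, s))) has_vector_derivative
      P (x, d) - P (x, t)) (at x within {a..b})"
    by (simp add: integral_unique)
  show ?thesis
    unfolding corner_integral_def prod.case
    using has_vector_derivative_diff[OF 1 2] by simp
qed

text \<open>Schwarz's theorem by integration: \<open>f (x, t) - f (x0, t)\<close> is the integral of
  the \<open>x\<close>-derivative; differentiate it in \<open>t\<close> under the integral, then in
  \<open>x\<close> at \<open>x0\<close>. A segment to the right of \<open>x0\<close> is enough, as
  derivatives within an interval are unique at its end point too.\<close>

lemma smooth_on_symmetric_derivative:
  fixes f :: "real \<times> real \<Rightarrow> complex"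
  assumes "open S" "smooth_on S f" "p \<in> S"
  shows "frechet_derivative (\<lambda>z. frechet_derivative f (at z) (1, 0)) (at p) (0, 1)
    = frechet_derivative (\<lambda>z. frechet_derivative f (at z) (0, 1)) (at p) (1, 0)"
proof -
  let ?x = "\<lambda>g z. frechet_derivative g (at z) (1, 0)" and ?t = "\<lambda>g z. frechet_derivative g (at z) (0, 1)"
  obtain x0 t0 where p: "p = (x0, t0)" by force
  obtain e where e: "e > 0" "ball p e \<subseteq> S" using assms(1,3) openE by blast
  have inS: "(x, t) \<in> S" if "\<bar>x - x0\<bar> < e / 2" "\<bar>t - t0\<bar> < e / 2" for x t
  proof -
    have "dist (x0, t0) (x, t) \<le> \<bar>x - x0\<bar> + \<bar>t - t0\<bar>"
      using sqrt_sum_squares_le_sum_abs[of "x - x0" "t - t0"]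
      by (simp add: dist_prod_def dist_real_def abs_minus_commute power2_commute)
    then show ?thesis using that e p by auto
  qed
  have part: "((\<lambda>x. g (x, t)) has_vector_derivative ?x g (x, t)) (at x)"
      "((\<lambda>t. g (x, t)) has_vector_derivative ?t g (x, t)) (at t)"
    if "smooth_on S g" "(x, t) \<in> S" for g :: "real \<times> real \<Rightarrow> complex" and x t
  proof -
    note D = smooth_on_has_derivative[OF that]
    have lin: "frechet_derivative g (at (x, t)) (c *\<^sub>R v) = c *\<^sub>R frechet_derivative g (at (x, t)) v" for c v
      using linear_cmul[OF has_derivative_linear[OF D]] .
    have "((\<lambda>x. (x, t)) has_derivative (\<lambda>h. (h, 0))) (at x)"
      "((\<lambda>t. (x, t)) has_derivative (\<lambda>h. (0, h))) (at t)"
      by (auto intro!: derivative_eq_intros)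
    note D' = this[THEN has_derivative_compose, OF D]
    have "(\<lambda>h. frechet_derivative g (at (x, t)) (h, 0)) = (\<lambda>h. h *\<^sub>R ?x g (x, t))"
      "(\<lambda>h. frechet_derivative g (at (x, t)) (0, h)) = (\<lambda>h. h *\<^sub>R ?t g (x, t))"
      by (rule ext, use lin[of _ "(1, 0)"] lin[of _ "(0, 1)"] in \<open>metis mult.right_neutral mult_zero_right scaleR_Pair real_scaleR_def\<close>)+
    with D' show "((\<lambda>x. g (x, t)) has_vector_derivative ?x g (x, t)) (at x)"
      "((\<lambda>t. g (x, t)) has_vector_derivative ?t g (x, t)) (at t)"
      unfolding has_vector_derivative_def by metis+
  qed
  define fx where "fx = ?x f"
  define ft where "ft = ?t f"
  have sx: "smooth_on S fx" and st: "smooth_on S ft"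
    unfolding fx_def ft_def by (rule smooth_on_frechet[OF assms(2)])+
  have f_t: "((\<lambda>t. f (x, t)) has_vector_derivative ft (x, t)) (at t)"
    and f_x: "((\<lambda>x. f (x, t)) has_vector_derivative fx (x, t)) (at x)"
    and fx_t: "((\<lambda>t. fx (x, t)) has_vector_derivative ?t fx (x, t)) (at t)"
    and ft_x: "((\<lambda>x. ft (x, t)) has_vector_derivative ?x ft (x, t)) (at x)"
    if "(x, t) \<in> S" for x t
    using part[OF assms(2) that] part[OF sx that] part[OF st that] by (simp_all add: fx_def ft_def)
  have cont: "continuous_on S (\<lambda>z. ?t fx z)" "continuous_on S (\<lambda>z. fx z)"
    using smooth_on_continuous_on[OF smooth_on_frechet[OF sx]] smooth_on_continuous_on[OF sx] by auto
  define b where "b = x0 + e / 4"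
  have b: "x0 < b" "b < x0 + e / 2" using e by (auto simp: b_def)
  define J where "J = {t0 - e / 4..t0 + e / 4}"
  have J: "t0 \<in> J" "convex J" using e by (auto simp: J_def)
  have J3: "\<bar>t - t0\<bar> < e / 2" if "t \<in> J" for t
    using that e unfolding J_def abs_less_iff atLeastAtMost_iff by linarith
  have box: "(s, t) \<in> S" if "t \<in> J" "x0 \<le> s" "s \<le> b" for s t
    by (rule inS[OF _ J3[OF that(1)]]) (use that b in simp)
  have main: "ft (x, t0) - ft (x0, t0) = integral {x0..x} (\<lambda>s. ?t fx (s, t0))" if "x \<in> {x0..b}" for x
  proof -
    have i1: "((\<lambda>t. integral (cbox x0 x) (\<lambda>s. fx (s, t))) has_vector_derivative
        integral (cbox x0 x) (\<lambda>s. ?t fx (s, t0))) (at t0 within J)"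
    proof (rule leibniz_rule_vector_derivative)
      show "((\<lambda>t. fx (s, t)) has_vector_derivative ?t fx (s, t)) (at t within J)"
        if "t \<in> J" "s \<in> cbox x0 x" for t s
        by (rule fx_t[THEN has_vector_derivative_at_within], rule box) (use that \<open>x \<in> {x0..b}\<close> in auto)
      show "(\<lambda>s. fx (s, t)) integrable_on cbox x0 x" if "t \<in> J" for t
      proof (rule integrable_continuous, rule continuous_on_compose2[OF cont(2)])
        show "continuous_on (cbox x0 x) (\<lambda>s. (s, t))" by (intro continuous_intros)
        show "(\<lambda>s. (s, t)) ` cbox x0 x \<subseteq> S" using that \<open>x \<in> {x0..b}\<close> box by auto
      qed
      show "continuous_on (J \<times> cbox x0 x) (\<lambda>(t, s). ?t fx (s, t))"
        unfolding case_prod_unfold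
        by (rule continuous_on_compose2[OF cont(1)])
          (use \<open>x \<in> {x0..b}\<close> in \<open>auto intro!: continuous_intros box\<close>)
    qed (use J in auto)
    have i2: "integral (cbox x0 x) (\<lambda>s. fx (s, t)) = f (x, t) - f (x0, t)" if "t \<in> J" for t
      unfolding cbox_interval
      by (intro integral_unique fundamental_theorem_of_calculus
          f_x[THEN has_vector_derivative_at_within] box) (use that \<open>x \<in> {x0..b}\<close> in auto)
    have "((\<lambda>t. f (x, t) - f (x0, t)) has_vector_derivative
        integral {x0..x} (\<lambda>s. ?t fx (s, t0))) (at t0 within J)"
      by (rule has_vector_derivative_transform[OF J(1) _ i1[unfolded cbox_interval]])
        (simp add: i2[unfolded cbox_interval])
    moreover have "((\<lambda>t. f (x, t) - f (x0, t)) has_vector_derivative ft (x, t0) - ft (x0, t0)) (at t0 within J)"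
      by (intro has_vector_derivative_diff f_t[THEN has_vector_derivative_at_within] box)
        (use \<open>x \<in> {x0..b}\<close> J b in auto)
    ultimately show ?thesis
      using vector_derivative_unique_within_closed_interval[of "t0 - e / 4" "t0 + e / 4" t0] e
      unfolding J_def cbox_interval by force
  qed
  have "continuous_on {x0..b} (\<lambda>s. ?t fx (s, t0))"
    by (rule continuous_on_compose2[OF cont(1)]) (use J b in \<open>auto intro!: continuous_intros box\<close>)
  then have "((\<lambda>x. integral {x0..x} (\<lambda>s. ?t fx (s, t0))) has_vector_derivative ?t fx (x0, t0))
      (at x0 within {x0..b})"
    by (rule integral_has_vector_derivative) (use b in auto)
  then have "((\<lambda>x. ft (x, t0) - ft (x0, t0)) has_vector_derivative ?t fx (x0, t0)) (at x0 within {x0..b})"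
    by (rule has_vector_derivative_transform[rotated 2]) (use b main in auto)
  moreover have "((\<lambda>x. ft (x, t0) - ft (x0, t0)) has_vector_derivative ?x ft (x0, t0) - 0) (at x0 within {x0..b})"
    by (intro has_vector_derivative_diff ft_x[THEN has_vector_derivative_at_within]
        has_vector_derivative_const box) (use J b in auto)
  ultimately show ?thesis
    using vector_derivative_unique_within_closed_interval[of x0 b x0] b
    unfolding p cbox_interval fx_def ft_def by force
qed

section \<open>Weak solutions have primitives\<close>

lemma lebesgue_integral_eq_integral_cbox:
  fixes h :: "'a::euclidean_space \<Rightarrow> complex"
  assumes "continuous_on (cbox a b) h" "\<And>x. x \<notin> cbox a b \<Longrightarrow> h x = 0"
  shows "(LINT x|lebesgue. h x) = integral (cbox a b) h"
proof -
  have "h absolutely_integrable_on cbox a b"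
    using assms(1) by (rule absolutely_integrable_continuous)
  then have "(LINT x:cbox a b|lebesgue. h x) = integral (cbox a b) h"
    by (rule set_lebesgue_integral_eq_integral(2))
  moreover have "(\<lambda>x. indicator (cbox a b) x *\<^sub>R h x) = h"
    using assms(2) by (auto simp: fun_eq_iff indicator_def)
  ultimately show ?thesis by (simp add: set_lebesgue_integral_def)
qed

lemma test_function_tensor:
  assumes "test_function {a<..<b} \<alpha>" "test_function {c<..<d} \<beta>"
  defines "\<psi> \<equiv> \<lambda>q::real \<times> real. \<alpha> (fst q) * \<beta> (snd q)"
  shows "test_function ({a<..<b} \<times> {c<..<d}) \<psi>"
    and "partial_x \<psi> q = deriv1 \<alpha> (fst q) * \<beta> (snd q)"
    and "partial_y \<psi> q = \<alpha> (fst q) * deriv1 \<beta> (snd q)"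
proof -
  note sm = test_function_smooth[OF assms(1)] test_function_smooth[OF assms(2)]
  have sm': "smooth_on UNIV (\<lambda>q::real \<times> real. \<alpha> (fst q))" "smooth_on UNIV (\<lambda>q::real \<times> real. \<beta> (snd q))"
    by (rule smooth_on_compose[OF _ _ _ smooth_on_linear[OF bounded_linear_fst] sm(1)]
        smooth_on_compose[OF _ _ _ smooth_on_linear[OF bounded_linear_snd] sm(2)]; simp)+
  obtain K K' where K: "compact K" "K \<subseteq> {a<..<b}" "\<And>x. x \<notin> K \<Longrightarrow> \<alpha> x = 0"
    "compact K'" "K' \<subseteq> {c<..<d}" "\<And>x. x \<notin> K' \<Longrightarrow> \<beta> x = 0"
    using assms(1,2) unfolding test_function_def by metis
  show "test_function ({a<..<b} \<times> {c<..<d}) \<psi>"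
    unfolding test_function_def \<psi>_def
    by (intro conjI smooth_on_mult sm' exI[of _ "K \<times> K'"]) (use K in \<open>auto intro: compact_Times\<close>)
  have D: "(\<psi> has_derivative (\<lambda>v. \<alpha> (fst q) * frechet_derivative \<beta> (at (snd q)) (snd v)
      + frechet_derivative \<alpha> (at (fst q)) (fst v) * \<beta> (snd q))) (at q)"
    unfolding \<psi>_def
    by (intro has_derivative_mult
        has_derivative_compose[OF has_derivative_fst[OF has_derivative_ident] smooth_on_has_derivative[OF sm(1)]]
        has_derivative_compose[OF has_derivative_snd[OF has_derivative_ident] smooth_on_has_derivative[OF sm(2)]])
      simp_all
  have z: "frechet_derivative \<alpha> (at x) 0 = 0" "frechet_derivative \<beta> (at x) 0 = 0" for x
    using smooth_on_has_derivative[OF sm(1), of x] smooth_on_has_derivative[OF sm(2), of x]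
    by (auto intro!: linear_0 has_derivative_linear)
  note F = frechet_derivative_at[OF D, symmetric]
  show "partial_x \<psi> q = deriv1 \<alpha> (fst q) * \<beta> (snd q)"
    and "partial_y \<psi> q = \<alpha> (fst q) * deriv1 \<beta> (snd q)"
    by (simp_all add: partial_x_def partial_y_def F z)
qed

text \<open>Green's identity for a merely continuous form. Testing with products \<alpha>(x)
  \<beta>(y) decouples the variables: for fixed \<beta> the hypothesis is a weak derivative in
  \<open>x\<close>, which integrates to an identity over \<open>{x1..x2}\<close>; that identity,
  valid for every \<beta>, is a weak derivative in \<open>y\<close>.\<close>

lemma rectangle_identity:
  fixes P Q :: "real \<times> real \<Rightarrow> complex"
  assumes cP: "continuous_on (cbox (a, c) (b, d)) P" and cQ: "continuous_on (cbox (a, c) (b, d)) Q"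
    and weak: "\<And>\<alpha> \<beta>. test_function {a<..<b} \<alpha> \<Longrightarrow> test_function {c<..<d} \<beta> \<Longrightarrow>
      integral (cbox (a, c) (b, d))
        (\<lambda>(x, y). Q (x, y) * (deriv1 \<alpha> x * \<beta> y) - P (x, y) * (\<alpha> x * deriv1 \<beta> y)) = 0"
    and x: "a < x1" "x1 \<le> x2" "x2 < b" and y: "c < y1" "y1 \<le> y2" "y2 < d"
  shows "integral {x1..x2} (\<lambda>x. P (x, y2)) - integral {x1..x2} (\<lambda>x. P (x, y1))
    = integral {y1..y2} (\<lambda>y. Q (x2, y) - Q (x1, y))"
proof -
  have ab: "a < b" "c < d" using x y by auto
  have tc: "continuous_on S \<phi>" "continuous_on S (deriv1 \<phi>)"
    if "test_function W \<phi>" for S W \<phi>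
    using smooth_on_continuous_on[OF test_function_smooth[OF that]]
      smooth_on_continuous_on[OF test_function_smooth[OF test_function_frechet[OF that]]]
      continuous_on_subset by blast+
  have comp: "continuous_on S (\<lambda>z. h (g z))" if "continuous_on UNIV h" "continuous_on S g"
    for S :: "(real \<times> real) set" and h :: "real \<Rightarrow> complex" and g
    using continuous_on_compose2[OF that] by auto
  have box: "cbox (a, c) (b, d) = {a..b} \<times> {c..d}" by (auto simp: cbox_Pair_eq)
  have inner: "continuous_on {c..d} (\<lambda>y. R (x, y))"
    if "continuous_on (cbox (a, c) (b, d)) R" "x \<in> {a..b}" for R :: "real \<times> real \<Rightarrow> complex" and x
    by (rule continuous_on_compose2[OF that(1)]) (use that(2) in \<open>auto intro!: continuous_intros simp: box\<close>)
  have param: "continuous_on {a..b} (\<lambda>x. integral {c..d} (\<lambda>y. R (x, y) * \<phi> y))"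
    if "continuous_on (cbox (a, c) (b, d)) R" "continuous_on UNIV \<phi>"
    for R :: "real \<times> real \<Rightarrow> complex" and \<phi> :: "real \<Rightarrow> complex"
    unfolding cbox_interval[symmetric]
    by (intro integral_continuous_on_param)
      (use that in \<open>auto intro!: continuous_intros comp simp: case_prod_unfold box\<close>)
  \<comment> \<open>As a function of \<open>x\<close>, the integral of \<open>Q \<beta>\<close> over
    \<open>y\<close> has as weak derivative minus the integral of \<open>P\<close> times the
    derivative of \<beta>.\<close>
  have step1: "integral {c..d} (\<lambda>y. Q (x2, y) * \<beta> y) - integral {c..d} (\<lambda>y. Q (x1, y) * \<beta> y)
      = integral {x1..x2} (\<lambda>x. - integral {c..d} (\<lambda>y. P (x, y) * deriv1 \<beta> y))"
    if \<beta>: "test_function {c<..<d} \<beta>" for \<beta>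
  proof (rule weak_derivative_imp_integral[OF ab(1) _ _ _ x])
    have c1: "continuous_on {a..b} (\<lambda>x. integral {c..d} (\<lambda>y. Q (x, y) * \<beta> y))"
      and c2: "continuous_on {a..b} (\<lambda>x. - integral {c..d} (\<lambda>y. P (x, y) * deriv1 \<beta> y))"
      by (intro continuous_intros param cP cQ tc[OF \<beta>])+
    show "continuous_on {a<..<b} (\<lambda>x. integral {c..d} (\<lambda>y. Q (x, y) * \<beta> y))"
      "continuous_on {a<..<b} (\<lambda>x. - integral {c..d} (\<lambda>y. P (x, y) * deriv1 \<beta> y))"
      using c1 c2 by (auto intro: continuous_on_subset)
    fix \<alpha> assume \<alpha>: "test_function {a<..<b} \<alpha>"
    have cc: "continuous_on (cbox (a, c) (b, d))
        (\<lambda>z. Q z * (deriv1 \<alpha> (fst z) * \<beta> (snd z)) - P z * (\<alpha> (fst z) * deriv1 \<beta> (snd z)))"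
      by (intro continuous_intros cP cQ comp tc[OF \<alpha>] tc[OF \<beta>])
    have i1: "(\<lambda>y. Q (x, y) * \<beta> y) integrable_on {c..d}" "(\<lambda>y. P (x, y) * deriv1 \<beta> y) integrable_on {c..d}"
      if "x \<in> {a..b}" for x
      by (intro integrable_continuous_interval continuous_intros inner[OF _ that] cP cQ tc[OF \<beta>])+
    have "0 = integral {a..b} (\<lambda>x. integral {c..d}
        (\<lambda>y. Q (x, y) * (deriv1 \<alpha> x * \<beta> y) - P (x, y) * (\<alpha> x * deriv1 \<beta> y)))"
      using integral_prod_continuous[OF cc] weak[OF \<alpha> \<beta>] by (simp add: case_prod_unfold)
    also have "\<dots> = integral {a..b} (\<lambda>x. integral {c..d} (\<lambda>y. Q (x, y) * \<beta> y) * deriv1 \<alpha> x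
        - integral {c..d} (\<lambda>y. P (x, y) * deriv1 \<beta> y) * \<alpha> x)"
    proof (rule integral_cong)
      fix x assume "x \<in> {a..b}"
      note i = i1[OF this]
      have "(\<lambda>y. Q (x, y) * (deriv1 \<alpha> x * \<beta> y) - P (x, y) * (\<alpha> x * deriv1 \<beta> y))
        = (\<lambda>y. (Q (x, y) * \<beta> y) * deriv1 \<alpha> x - (P (x, y) * deriv1 \<beta> y) * \<alpha> x)"
        by (simp add: mult_ac)
      then show "integral {c..d} (\<lambda>y. Q (x, y) * (deriv1 \<alpha> x * \<beta> y) - P (x, y) * (\<alpha> x * deriv1 \<beta> y))
        = integral {c..d} (\<lambda>y. Q (x, y) * \<beta> y) * deriv1 \<alpha> x
        - integral {c..d} (\<lambda>y. P (x, y) * deriv1 \<beta> y) * \<alpha> x"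
        using i by (simp add: integral_diff integrable_on_mult_left)
    qed
    also have "\<dots> = integral {a..b} (\<lambda>x. integral {c..d} (\<lambda>y. Q (x, y) * \<beta> y) * deriv1 \<alpha> x)
        - integral {a..b} (\<lambda>x. integral {c..d} (\<lambda>y. P (x, y) * deriv1 \<beta> y) * \<alpha> x)"
      by (intro integral_diff integrable_continuous_interval continuous_intros param cP cQ tc[OF \<beta>] tc[OF \<alpha>])
    finally show "integral {a..b} (\<lambda>x. integral {c..d} (\<lambda>y. Q (x, y) * \<beta> y) * deriv1 \<alpha> x)
        = - integral {a..b} (\<lambda>x. - integral {c..d} (\<lambda>y. P (x, y) * deriv1 \<beta> y) * \<alpha> x)"
      by simp
  qed
  have sub: "cbox (x1, c) (x2, d) \<subseteq> cbox (a, c) (b, d)" using x by (auto simp: cbox_Pair_eq)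
  have cu: "continuous_on {c..d} (\<lambda>y. integral {x1..x2} (\<lambda>x. P (x, y)))"
    unfolding cbox_interval[symmetric]
    by (intro integral_continuous_on_param continuous_on_compose2[OF cP, where f = "\<lambda>z. (snd z, fst z)", simplified])
      (use x in \<open>auto intro!: continuous_on_compose2[OF cP] continuous_intros simp: case_prod_unfold box\<close>)
  have cv: "continuous_on {c..d} (\<lambda>y. Q (x2, y) - Q (x1, y))"
    by (intro continuous_intros inner cQ) (use x in auto)
  show ?thesis
  proof (rule weak_derivative_imp_integral[OF ab(2) _ _ _ y])
    show "continuous_on {c<..<d} (\<lambda>y. integral {x1..x2} (\<lambda>x. P (x, y)))"
      "continuous_on {c<..<d} (\<lambda>y. Q (x2, y) - Q (x1, y))"
      using cu cv by (auto intro: continuous_on_subset)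
    fix \<beta> assume \<beta>: "test_function {c<..<d} \<beta>"
    have cc: "continuous_on (cbox (x1, c) (x2, d)) (\<lambda>(x, y). P (x, y) * deriv1 \<beta> y)"
      unfolding case_prod_unfold prod.collapse
      by (intro continuous_intros continuous_on_subset[OF cP sub] comp tc[OF \<beta>])
    have ix: "(\<lambda>x. P (x, y)) integrable_on {x1..x2}" if "y \<in> {c..d}" for y
      by (intro integrable_continuous_interval continuous_on_compose2[OF cP])
        (use that x in \<open>auto intro!: continuous_intros simp: box\<close>)
    have "integral {c..d} (\<lambda>y. integral {x1..x2} (\<lambda>x. P (x, y)) * deriv1 \<beta> y)
        = integral {c..d} (\<lambda>y. integral {x1..x2} (\<lambda>x. P (x, y) * deriv1 \<beta> y))"
      by (rule integral_cong) simp
    also have "\<dots> = integral {x1..x2} (\<lambda>x. integral {c..d} (\<lambda>y. P (x, y) * deriv1 \<beta> y))"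
      using integral_swap_continuous[OF cc] by simp
    also have "\<dots> = - (integral {c..d} (\<lambda>y. Q (x2, y) * \<beta> y) - integral {c..d} (\<lambda>y. Q (x1, y) * \<beta> y))"
      unfolding step1[OF \<beta>] by simp
    also have "\<dots> = - integral {c..d} (\<lambda>y. (Q (x2, y) - Q (x1, y)) * \<beta> y)"
      unfolding left_diff_distrib
      by (subst integral_diff)
        (use x in \<open>auto intro!: integrable_continuous_interval continuous_intros inner cQ tc[OF \<beta>]\<close>)
    finally show "integral {c..d} (\<lambda>y. integral {x1..x2} (\<lambda>x. P (x, y)) * deriv1 \<beta> y)
        = - integral {c..d} (\<lambda>y. (Q (x2, y) - Q (x1, y)) * \<beta> y)" .
  qed
qed

text \<open>By the rectangle identity the corner integral agrees with the integral along the other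
  two sides, down the left edge and then horizontally, whose \<open>x\<close>-derivative is
  \<open>P\<close> by the fundamental theorem.\<close>

lemma weakly_closed_imp_local_primitive:
  fixes P Q :: "real \<times> real \<Rightarrow> complex"
  assumes "open W" "p \<in> W" and cP: "continuous_on W P" and cQ: "continuous_on W Q"
    and weak: "\<And>\<psi>. test_function W \<psi> \<Longrightarrow>
      (LINT q|lebesgue. Q q * partial_x \<psi> q - P q * partial_y \<psi> q) = 0"
  shows "\<exists>e>0. \<exists>H. \<forall>q\<in>ball p e. (H has_derivative (\<lambda>v. fst v *\<^sub>R P q + snd v *\<^sub>R Q q)) (at q)"
proof -
  obtain x0 y0 where p: "p = (x0, y0)" by force
  obtain r where r: "r > 0" "ball p r \<subseteq> W" using assms(1,2) openE by blast
  define h where "h = r / 8"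
  have h: "h > 0" using r by (simp add: h_def)
  define a b c d where "a = x0 - 2 * h" and "b = x0 + 2 * h" and "c = y0 - 2 * h" and "d = y0 + 2 * h"
  have sub: "cbox (a, c) (b, d) \<subseteq> W"
  proof
    fix q assume "q \<in> cbox (a, c) (b, d)"
    then have "\<bar>fst q - x0\<bar> \<le> 2 * h" "\<bar>snd q - y0\<bar> \<le> 2 * h"
      by (auto simp: cbox_Pair_eq a_def b_def c_def d_def abs_le_iff)
    moreover have "dist p q \<le> \<bar>fst q - x0\<bar> + \<bar>snd q - y0\<bar>"
      using sqrt_sum_squares_le_sum_abs[of "x0 - fst q" "y0 - snd q"]
      by (simp add: p dist_prod_def dist_real_def abs_minus_commute)
    ultimately have "dist p q \<le> 4 * h" by linarith
    then show "q \<in> W" using r h by (auto simp: h_def)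
  qed
  have rect: "integral {x1..x2} (\<lambda>x. P (x, y2)) - integral {x1..x2} (\<lambda>x. P (x, y1))
      = integral {y1..y2} (\<lambda>y. Q (x2, y) - Q (x1, y))"
    if "a < x1" "x1 \<le> x2" "x2 < b" "c < y1" "y1 \<le> y2" "y2 < d" for x1 x2 y1 y2
  proof (rule rectangle_identity[OF _ _ _ that])
    show cPQ: "continuous_on (cbox (a, c) (b, d)) P" "continuous_on (cbox (a, c) (b, d)) Q"
      using cP cQ sub continuous_on_subset by blast+
    fix \<alpha> \<beta> assume t: "test_function {a<..<b} \<alpha>" "test_function {c<..<d} \<beta>"
    let ?\<psi> = "\<lambda>q::real \<times> real. \<alpha> (fst q) * \<beta> (snd q)"
    let ?h = "\<lambda>q. Q q * partial_x ?\<psi> q - P q * partial_y ?\<psi> q"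
    note T = test_function_tensor[OF t]
    have tW: "test_function W ?\<psi>"
      by (rule test_function_mono[OF T(1)]) (use sub in \<open>force simp: cbox_Pair_eq\<close>)
    have pd: "partial_x ?\<psi> = (\<lambda>q. frechet_derivative ?\<psi> (at q) (1, 0))"
      "partial_y ?\<psi> = (\<lambda>q. frechet_derivative ?\<psi> (at q) (0, 1))"
      by (auto simp: partial_x_def partial_y_def)
    have tt: "test_function ({a<..<b} \<times> {c<..<d}) (partial_x ?\<psi>)"
      "test_function ({a<..<b} \<times> {c<..<d}) (partial_y ?\<psi>)"
      unfolding pd by (rule test_function_frechet[OF T(1)])+
    have "(LINT q|lebesgue. ?h q) = integral (cbox (a, c) (b, d)) ?h"
    proof (rule lebesgue_integral_eq_integral_cbox)
      show "continuous_on (cbox (a, c) (b, d)) ?h"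
        by (intro continuous_intros cPQ continuous_on_subset[OF smooth_on_continuous_on[OF test_function_smooth[OF tt(1)]]]
            continuous_on_subset[OF smooth_on_continuous_on[OF test_function_smooth[OF tt(2)]]]) auto
      have z: "\<theta> q = 0" if \<theta>: "test_function ({a<..<b} \<times> {c<..<d}) \<theta>" and q: "q \<notin> cbox (a, c) (b, d)"
        for \<theta> :: "real \<times> real \<Rightarrow> complex" and q
      proof -
        from \<theta> obtain K where K: "K \<subseteq> {a<..<b} \<times> {c<..<d}" "\<forall>x. x \<notin> K \<longrightarrow> \<theta> x = 0"
          unfolding test_function_def by (elim conjE exE) 
        have "q \<notin> {a<..<b} \<times> {c<..<d}"
          using q by (cases q) (auto simp: cbox_Pair_eq)
        then show ?thesis using K by blast
      qed
      show "?h q = 0" if "q \<notin> cbox (a, c) (b, d)" for q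
        using z[OF tt(1) that] z[OF tt(2) that] by simp
    qed
    then have "integral (cbox (a, c) (b, d)) ?h = 0" using weak[OF tW] by simp
    then show "integral (cbox (a, c) (b, d))
        (\<lambda>(x, y). Q (x, y) * (deriv1 \<alpha> x * \<beta> y) - P (x, y) * (\<alpha> x * deriv1 \<beta> y)) = 0"
      by (simp add: T(2,3) case_prod_unfold)
  qed
  \<comment> \<open>Half the size, because \<open>rect\<close> covers only rectangles in the
    interior of the test square.\<close>
  define a' b' c' d' where "a' = x0 - h" and "b' = x0 + h" and "c' = y0 - h" and "d' = y0 + h"
  let ?S = "{a'..b'} \<times> {c'<..d'}"
  have SW: "?S \<subseteq> cbox (a, c) (b, d)"
    using h by (auto simp: cbox_Pair_eq a_def b_def c_def d_def a'_def b'_def c'_def d'_def)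
  let ?H = "corner_integral P Q a' d'"
  have H1: "(?H has_derivative (\<lambda>v. fst v *\<^sub>R P q + snd v *\<^sub>R Q q)) (at q within ?S)" if "q \<in> ?S" for q
  proof (rule corner_integral_has_derivative)
    show cS: "continuous_on ?S P" "continuous_on ?S Q"
      using cP cQ sub SW continuous_on_subset by (meson order_trans)+
    fix x t assume x: "x \<in> {a'..b'}" and t: "t \<in> {c'<..d'}"
    have "continuous_on {a'..b'} (\<lambda>s. P (s, t))"
      by (rule continuous_on_compose2[OF cS(1)]) (use t in \<open>auto intro!: continuous_intros\<close>)
    then have D: "((\<lambda>x. integral {a'..x} (\<lambda>s. P (s, t)) - integral {t..d'} (\<lambda>s. Q (a', s)))
        has_vector_derivative (P (x, t) - 0)) (at x within {a'..b'})"
      by (intro has_vector_derivative_diff has_vector_derivative_const integral_has_vector_derivative x)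
    show "((\<lambda>x. ?H (x, t)) has_vector_derivative P (x, t)) (at x within {a'..b'})"
    proof (rule has_vector_derivative_transform[OF x _ D[simplified]])
      fix y assume y: "y \<in> {a'..b'}"
      have iQ: "(\<lambda>s. Q (z, s)) integrable_on {t..d'}" if "z \<in> {a'..b'}" for z
        by (intro integrable_continuous_interval continuous_on_compose2[OF cS(2)])
          (use that t in \<open>auto intro!: continuous_intros\<close>)
      have "integral {a'..y} (\<lambda>x. P (x, d')) - integral {a'..y} (\<lambda>x. P (x, t))
          = integral {t..d'} (\<lambda>s. Q (y, s) - Q (a', s))"
        by (rule rect) (use y t h in \<open>auto simp: a_def b_def c_def d_def a'_def b'_def c'_def d'_def\<close>)
      also have "\<dots> = integral {t..d'} (\<lambda>s. Q (y, s)) - integral {t..d'} (\<lambda>s. Q (a', s))"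
        by (rule integral_diff) (use iQ y h in \<open>auto simp: a'_def b'_def\<close>)
      finally show "?H (y, t) = integral {a'..y} (\<lambda>s. P (s, t)) - integral {t..d'} (\<lambda>s. Q (a', s))"
        unfolding corner_integral_def prod.case by (simp add: algebra_simps)
    qed
  qed (use that in auto)
  have W1: "at q within ?S = at q \<and> q \<in> ?S" if "q \<in> ball p h" for q
  proof -
    have "\<bar>fst q - x0\<bar> < h" "\<bar>snd q - y0\<bar> < h"
      using that dist_fst_le[of p q] dist_snd_le[of p q]
      by (auto simp: p dist_real_def abs_minus_commute)
    then have "q \<in> {a'<..<b'} \<times> {c'<..<d'}"
      by (auto simp: mem_Times_iff a'_def b'_def c'_def d'_def abs_less_iff)
    moreover have "open ({a'<..<b'} \<times> {c'<..<d'})" "{a'<..<b'} \<times> {c'<..<d'} \<subseteq> ?S"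
      by (auto intro: open_Times)
    ultimately have "q \<in> interior ?S" using interiorI by blast
    then show ?thesis using at_within_interior interior_subset by blast
  qed
  have "\<forall>q\<in>ball p h. (?H has_derivative (\<lambda>v. fst v *\<^sub>R P q + snd v *\<^sub>R Q q)) (at q)"
  proof
    fix q assume "q \<in> ball p h"
    note W = W1[OF this]
    show "(?H has_derivative (\<lambda>v. fst v *\<^sub>R P q + snd v *\<^sub>R Q q)) (at q)"
      using H1[OF conjunct2[OF W]] unfolding conjunct1[OF W] .
  qed
  then show ?thesis using h by blast
qed

text \<open>As \<open>L Z = 0\<close>, the coefficients of \<open>L\<close> are proportional to
  \<open>(Z_y, - Z_x)\<close>. With the smooth factor \<mu> the test function \<mu> \<psi> turns the
  transposed equation into weak closedness of \<open>f dZ\<close>; the terms in which a derivative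
  falls on the coefficients cancel by symmetry of second derivatives.\<close>

lemma continuous_solution_weakly_closed:
  assumes sol: "continuous_solution L W f" and "open W" "open V" "smooth_on V L"
    and nz: "\<And>q. q \<in> V \<Longrightarrow> L q \<noteq> 0" and Z: "first_integral L V Z"
    and \<psi>: "test_function (W \<inter> V) \<psi>"
  shows "(LINT q|lebesgue. f q * partial_y Z q * partial_x \<psi> q - f q * partial_x Z q * partial_y \<psi> q) = 0"
proof -
  define A B where "A q = fst (L q)" and "B q = snd (L q)" for q
  have sZ: "smooth_on V Z" and LZ: "\<And>q. q \<in> V \<Longrightarrow> A q * partial_x Z q + B q * partial_y Z q = 0"
    using Z by (auto simp: first_integral_def vf_apply_def A_def B_def)
  have sA: "smooth_on V A" "smooth_on V B"
    unfolding A_def[abs_def] B_def[abs_def]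
    by (intro smooth_on_linear_compose[OF bounded_linear_fst] smooth_on_linear_compose[OF bounded_linear_snd] assms)+
  have sx: "smooth_on V (partial_x Z)" and sy: "smooth_on V (partial_y Z)"
    unfolding partial_x_def[abs_def] partial_y_def[abs_def] by (intro smooth_on_frechet sZ)+
  define n where "n q = A q * cnj (A q) + B q * cnj (B q)" for q
  have n0: "n q \<noteq> 0" if "q \<in> V" for q
  proof -
    have "n q = of_real ((cmod (A q))\<^sup>2 + (cmod (B q))\<^sup>2)"
      by (simp add: n_def complex_norm_square[symmetric])
    moreover have "A q \<noteq> 0 \<or> B q \<noteq> 0"
      using nz[OF that] by (auto simp: A_def B_def prod_eq_iff)
    ultimately show ?thesis
      by (simp only: of_real_eq_0_iff sum_power2_eq_zero_iff norm_eq_zero) blast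
  qed
  \<comment> \<open>The Hermitian projection coefficient of \<open>(Z_y, - Z_x)\<close> on
    \<open>(A, B)\<close>: it divides by \<open>|A|^2 + |B|^2\<close> and avoids a distinction as to
    which coefficient is nonzero.\<close>
  define \<mu> where "\<mu> q = (partial_y Z q * cnj (A q) - partial_x Z q * cnj (B q)) * inverse (n q)" for q
  have scnj: "smooth_on V (\<lambda>q. cnj (A q))" "smooth_on V (\<lambda>q. cnj (B q))"
    by (intro smooth_on_linear_compose[OF bounded_linear_cnj] sA assms)+
  have s\<mu>: "smooth_on V \<mu>"
    unfolding \<mu>_def[abs_def]
  proof (intro smooth_on_mult smooth_on_diff smooth_on_inverse sx sy scnj \<open>open V\<close>)
    show "smooth_on V n"
      unfolding n_def[abs_def] by (intro smooth_on_add smooth_on_mult sA scnj \<open>open V\<close>)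
  qed (rule n0)
  have \<mu>A: "A q * \<mu> q = partial_y Z q" and \<mu>B: "B q * \<mu> q = - partial_x Z q" if "q \<in> V" for q
  proof -
    have "A q * (partial_y Z q * cnj (A q) - partial_x Z q * cnj (B q)) = partial_y Z q * n q"
      "B q * (partial_y Z q * cnj (A q) - partial_x Z q * cnj (B q)) = - (partial_x Z q * n q)"
      using LZ[OF that] unfolding n_def by algebra+
    then show "A q * \<mu> q = partial_y Z q" "B q * \<mu> q = - partial_x Z q"
      using n0[OF that] by (simp_all add: \<mu>_def mult.assoc[symmetric])
  qed
  define \<phi> where "\<phi> q = \<mu> q * \<psi> q" for q
  have t\<phi>: "test_function (W \<inter> V) \<phi>"
    unfolding \<phi>_def[abs_def]
    by (rule test_function_mult_smooth[OF \<psi>]) (use assms(2,3) smooth_on_subset[OF s\<mu>] in auto)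
  obtain K where K: "compact K" "K \<subseteq> W \<inter> V" "\<And>q. q \<notin> K \<Longrightarrow> \<psi> q = 0"
    using \<psi> unfolding test_function_def by blast
  have A\<phi>: "(\<lambda>z. fst (L z) * \<phi> z) = (\<lambda>z. partial_y Z z * \<psi> z)"
    and B\<phi>: "(\<lambda>z. snd (L z) * \<phi> z) = (\<lambda>z. - (partial_x Z z * \<psi> z))"
  proof -
    have "A z * \<phi> z = partial_y Z z * \<psi> z \<and> B z * \<phi> z = - (partial_x Z z * \<psi> z)" for z
    proof (cases "z \<in> V")
      case True
      then show ?thesis
        using \<mu>A[OF True] \<mu>B[OF True] by (simp add: \<phi>_def mult.assoc[symmetric])
    next
      case False
      then have "\<psi> z = 0" using K by blast
      then show ?thesis by (simp add: \<phi>_def)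
    qed
    then show "(\<lambda>z. fst (L z) * \<phi> z) = (\<lambda>z. partial_y Z z * \<psi> z)"
      "(\<lambda>z. snd (L z) * \<phi> z) = (\<lambda>z. - (partial_x Z z * \<psi> z))"
      by (auto simp: A_def B_def)
  qed
  have s\<psi>: "smooth_on UNIV \<psi>" using test_function_smooth[OF \<psi>] .
  have tr: "vf_transpose L \<phi> q = - (partial_y Z q * partial_x \<psi> q - partial_x Z q * partial_y \<psi> q)" for q
  proof (cases "q \<in> V")
    case True
    have D1: "((\<lambda>z. partial_y Z z * \<psi> z) has_derivative (\<lambda>v. partial_y Z q * frechet_derivative \<psi> (at q) v
        + frechet_derivative (partial_y Z) (at q) v * \<psi> q)) (at q)"
      and D2: "((\<lambda>z. - (partial_x Z z * \<psi> z)) has_derivative (\<lambda>v. - (partial_x Z q * frechet_derivative \<psi> (at q) v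
        + frechet_derivative (partial_x Z) (at q) v * \<psi> q))) (at q)"
      by (intro has_derivative_minus has_derivative_mult smooth_on_has_derivative[OF sx True]
          smooth_on_has_derivative[OF sy True] smooth_on_has_derivative[OF s\<psi>] UNIV_I)+
    have "frechet_derivative (partial_x Z) (at q) (0, 1) = frechet_derivative (partial_y Z) (at q) (1, 0)"
      using smooth_on_symmetric_derivative[OF \<open>open V\<close> sZ True]
      by (simp add: partial_x_def[abs_def] partial_y_def[abs_def])
    then show ?thesis
      unfolding vf_transpose_def A\<phi> B\<phi>
      unfolding partial_x_def[of "\<lambda>z. _ z * _ z"] partial_y_def[of "\<lambda>z. - _ z"]
        frechet_derivative_at[OF D1, symmetric] frechet_derivative_at[OF D2, symmetric]
      by (simp add: partial_x_def[of \<psi>] partial_y_def[of \<psi>])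
  next
    case False
    have op: "open (- K)" "q \<in> - K" using K False by (auto simp: compact_imp_closed open_Compl)
    have "(h has_derivative (\<lambda>v. 0)) (at q)" if "\<And>z. z \<notin> K \<Longrightarrow> h z = 0" for h :: "plane \<Rightarrow> complex"
      by (rule has_derivative_transform_within_open[OF has_derivative_const[of 0] op]) (use that in auto)
    from frechet_derivative_at[OF this, symmetric]
    have "frechet_derivative h (at q) = (\<lambda>v. 0)" if "\<And>z. z \<notin> K \<Longrightarrow> h z = 0" for h :: "plane \<Rightarrow> complex"
      using that by blast
    then show ?thesis
      unfolding vf_transpose_def A\<phi> B\<phi> partial_x_def[of "\<lambda>z. _ z * _ z"] partial_y_def[of "\<lambda>z. - _ z"]
        partial_x_def[of \<psi>] partial_y_def[of \<psi>]
      using K(3) by simp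
  qed
  have "f q * vf_transpose L \<phi> q
      = - (f q * partial_y Z q * partial_x \<psi> q - f q * partial_x Z q * partial_y \<psi> q)" for q
    unfolding tr by (simp add: algebra_simps)
  moreover have "(LINT q|lebesgue. f q * vf_transpose L \<phi> q) = 0"
    using sol test_function_mono[OF t\<phi>, of W] by (auto simp: continuous_solution_def)
  ultimately have "(LINT q|lebesgue.
      - (f q * partial_y Z q * partial_x \<psi> q - f q * partial_x Z q * partial_y \<psi> q)) = 0"
    by (simp only:)
  then show ?thesis by (simp only: integral_minus neg_equal_0_iff_equal)
qed

lemma continuous_solution_local_primitive:
  assumes sol: "continuous_solution L W f" and "open W" "open V" "smooth_on V L"
    and nz: "\<And>q. q \<in> V \<Longrightarrow> L q \<noteq> 0" and Z: "first_integral L V Z" and p: "p \<in> W \<inter> V"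
  shows "\<exists>e>0. \<exists>H. \<forall>q\<in>ball p e.
    (H has_derivative (\<lambda>v. f q * frechet_derivative Z (at q) v)) (at q)"
proof -
  have sZ: "smooth_on V Z" using Z by (auto simp: first_integral_def)
  have cf: "continuous_on (W \<inter> V) f"
    using sol continuous_on_subset by (fastforce simp: continuous_solution_def)
  have "continuous_on V (partial_x Z)" "continuous_on V (partial_y Z)"
    unfolding partial_x_def[abs_def] partial_y_def[abs_def]
    by (intro smooth_on_continuous_on smooth_on_frechet sZ)+
  then have c: "continuous_on (W \<inter> V) (\<lambda>q. f q * partial_x Z q)" "continuous_on (W \<inter> V) (\<lambda>q. f q * partial_y Z q)"
    by (auto intro!: continuous_intros cf intro: continuous_on_subset)
  have "\<exists>e>0. \<exists>H. \<forall>q\<in>ball p e.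
      (H has_derivative (\<lambda>v. fst v *\<^sub>R (f q * partial_x Z q) + snd v *\<^sub>R (f q * partial_y Z q))) (at q)"
    by (rule weakly_closed_imp_local_primitive[OF open_Int[OF assms(2,3)] p c])
      (rule continuous_solution_weakly_closed[OF assms(1-5) Z])
  then obtain e H where e: "e > 0" and H: "\<And>q. q \<in> ball p e \<Longrightarrow>
      (H has_derivative (\<lambda>v. fst v *\<^sub>R (f q * partial_x Z q) + snd v *\<^sub>R (f q * partial_y Z q))) (at q)"
    by blast
  obtain e' where e': "e' > 0" "ball p e' \<subseteq> V" using p \<open>open V\<close> openE by blast
  have "(H has_derivative (\<lambda>v. f q * frechet_derivative Z (at q) v)) (at q)" if "q \<in> ball p (min e e')" for q
  proof -
    have "q \<in> V" using that e' by auto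
    note lin = has_derivative_linear[OF smooth_on_has_derivative[OF sZ this]]
    have "frechet_derivative Z (at q) v = fst v *\<^sub>R partial_x Z q + snd v *\<^sub>R partial_y Z q" for v
    proof -
      have "v = fst v *\<^sub>R (1, 0) + snd v *\<^sub>R (0, 1)" by (simp add: prod_eq_iff)
      then show ?thesis
        by (metis linear_add[OF lin] linear_cmul[OF lin] partial_x_def partial_y_def)
    qed
    then have "(\<lambda>v. f q * frechet_derivative Z (at q) v)
        = (\<lambda>v. fst v *\<^sub>R (f q * partial_x Z q) + snd v *\<^sub>R (f q * partial_y Z q))"
      by (simp add: algebra_simps)
    then show ?thesis using H[of q] that by simp
  qed
  then show ?thesis
    by (intro exI[of _ "min e e'"] conjI exI[of _ H] ballI) (use e e'(1) in auto)
qed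

section \<open>Repeated primitives along a first integral\<close>

lemma has_derivative_within_Times_partials:
  fixes G :: "real \<times> real \<Rightarrow> complex"
  assumes D: "(G has_derivative D) (at (x, t) within X \<times> Y)" and "x \<in> X" "t \<in> Y"
  shows "((\<lambda>x. G (x, t)) has_vector_derivative D (1, 0)) (at x within X)"
    and "((\<lambda>t. G (x, t)) has_vector_derivative D (0, 1)) (at t within Y)"
proof -
  note lin = has_derivative_linear[OF D]
  have 1: "((\<lambda>x. (x, t)) has_derivative (\<lambda>h. (h, 0))) (at x within X)"
    and 2: "((\<lambda>t. (x, t)) has_derivative (\<lambda>h. (0, h))) (at t within Y)"
    by (auto intro!: derivative_eq_intros)
  have "((\<lambda>x. G (x, t)) has_derivative (\<lambda>h. D (h, 0))) (at x within X)"
    by (rule has_derivative_in_compose[OF 1 has_derivative_subset[OF D]]) (use assms in auto)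
  moreover have "((\<lambda>t. G (x, t)) has_derivative (\<lambda>h. D (0, h))) (at t within Y)"
    by (rule has_derivative_in_compose[OF 2 has_derivative_subset[OF D]]) (use assms in auto)
  moreover have "D (h, 0) = h *\<^sub>R D (1, 0)" "D (0, h) = h *\<^sub>R D (0, 1)" for h
    using linear_cmul[OF lin, of h "(1, 0)"] linear_cmul[OF lin, of h "(0, 1)"] by auto
  then have "(\<lambda>h. D (h, 0)) = (\<lambda>h. h *\<^sub>R D (1, 0))" "(\<lambda>h. D (0, h)) = (\<lambda>h. h *\<^sub>R D (0, 1))"
    by blast+
  ultimately show "((\<lambda>x. G (x, t)) has_vector_derivative D (1, 0)) (at x within X)"
    "((\<lambda>t. G (x, t)) has_vector_derivative D (0, 1)) (at t within Y)"
    by (simp_all add: has_vector_derivative_def)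
qed

lemma linear_plane:
  assumes "linear D"
  shows "D v = fst v *\<^sub>R D (1, 0) + snd v *\<^sub>R D (0, 1 :: real)"
proof -
  have "v = fst v *\<^sub>R (1, 0) + snd v *\<^sub>R (0, 1)" by (simp add: prod_eq_iff)
  then show ?thesis
    using linear_add[OF assms, of "fst v *\<^sub>R (1, 0)" "snd v *\<^sub>R (0, 1)"]
      linear_cmul[OF assms, of "fst v" "(1, 0)"] linear_cmul[OF assms, of "snd v" "(0, 1)"]
    by simp
qed

text \<open>The open set \<open>D\<close> reaches across \<open>t = 0\<close>, so \<zeta> is smooth
  up to the boundary, whereas the solution lives on \<open>strip\<close>, which omits
  \<open>t = 0\<close> and contains its other edges. \<open>T \<le> 1\<close> makes negative powers
  of \<open>t\<close> at least 1 and monotone in the exponent.\<close>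

locale boundary_strip =
  fixes \<zeta> :: "real \<times> real \<Rightarrow> complex" and r T :: real and D :: "(real \<times> real) set"
  assumes r: "r > 0" and T: "0 < T" "T \<le> 1"
    and D: "open D" "{-r..r} \<times> {0..T} \<subseteq> D"
    and smooth: "smooth_on D \<zeta>"
begin

abbreviation "strip \<equiv> {-r..r} \<times> {0<..T}"
abbreviation "d\<zeta> p \<equiv> frechet_derivative \<zeta> (at p)"
abbreviation "\<zeta>x p \<equiv> frechet_derivative \<zeta> (at p) (1, 0)"
abbreviation "\<zeta>t p \<equiv> frechet_derivative \<zeta> (at p) (0, 1)"

lemma strip_D: "p \<in> {-r..r} \<times> {0..T} \<Longrightarrow> p \<in> D" and strip_D': "p \<in> strip \<Longrightarrow> p \<in> D"
  using D by force+

lemma smooth_partials: "smooth_on D \<zeta>x" "smooth_on D \<zeta>t"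
  by (rule smooth_on_frechet[OF smooth])+

lemma \<zeta>_has_derivative: "p \<in> D \<Longrightarrow> (\<zeta> has_derivative d\<zeta> p) (at p within A)"
  by (rule has_derivative_at_withinI[OF smooth_on_has_derivative[OF smooth]])

lemma d\<zeta>_eq: "p \<in> D \<Longrightarrow> d\<zeta> p v = fst v *\<^sub>R \<zeta>x p + snd v *\<^sub>R \<zeta>t p"
  by (rule linear_plane[OF has_derivative_linear[OF \<zeta>_has_derivative]])

lemma mult_d\<zeta>_eq:
  assumes "p \<in> D"
  shows "(\<lambda>v. c * d\<zeta> p v) = (\<lambda>v. fst v *\<^sub>R (c * \<zeta>x p) + snd v *\<^sub>R (c * \<zeta>t p))"
proof
  fix v
  show "c * d\<zeta> p v = fst v *\<^sub>R (c * \<zeta>x p) + snd v *\<^sub>R (c * \<zeta>t p)"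
    by (subst d\<zeta>_eq[OF assms]) (simp add: distrib_left)
qed

lemma \<zeta>_partials:
  assumes "(x, t) \<in> D" "x \<in> A" "t \<in> A'"
  shows "((\<lambda>x. \<zeta> (x, t)) has_vector_derivative \<zeta>x (x, t)) (at x within A)"
    and "((\<lambda>t. \<zeta> (x, t)) has_vector_derivative \<zeta>t (x, t)) (at t within A')"
    and "((\<lambda>t. \<zeta>x (x, t)) has_vector_derivative frechet_derivative \<zeta>x (at (x, t)) (0, 1)) (at t within A')"
    and "((\<lambda>x. \<zeta>t (x, t)) has_vector_derivative frechet_derivative \<zeta>x (at (x, t)) (0, 1)) (at x within A)"
proof -
  note sx = smooth_on_has_derivative[OF smooth_partials(1) assms(1), THEN has_derivative_at_withinI]
    and st = smooth_on_has_derivative[OF smooth_partials(2) assms(1), THEN has_derivative_at_withinI]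
  show "((\<lambda>x. \<zeta> (x, t)) has_vector_derivative \<zeta>x (x, t)) (at x within A)"
    "((\<lambda>t. \<zeta> (x, t)) has_vector_derivative \<zeta>t (x, t)) (at t within A')"
    by (rule has_derivative_within_Times_partials[OF \<zeta>_has_derivative assms(2,3)], rule assms)+
  show "((\<lambda>t. \<zeta>x (x, t)) has_vector_derivative frechet_derivative \<zeta>x (at (x, t)) (0, 1)) (at t within A')"
    by (rule has_derivative_within_Times_partials(2)[OF sx assms(2,3)])
  show "((\<lambda>x. \<zeta>t (x, t)) has_vector_derivative frechet_derivative \<zeta>x (at (x, t)) (0, 1)) (at x within A)"
    unfolding smooth_on_symmetric_derivative[OF D(1) smooth assms(1)]
    by (rule has_derivative_within_Times_partials(1)[OF st assms(2,3)])
qed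

lemma continuous_partials:
  assumes "A \<subseteq> D"
  shows "continuous_on A \<zeta>" "continuous_on A \<zeta>x" "continuous_on A \<zeta>t"
    "continuous_on A (\<lambda>p. frechet_derivative \<zeta>x (at p) (0, 1))"
  using smooth_on_continuous_on[OF smooth] smooth_on_continuous_on[OF smooth_partials(1)]
    smooth_on_continuous_on[OF smooth_partials(2)]
    smooth_on_continuous_on[OF smooth_on_frechet[OF smooth_partials(1)]] assms continuous_on_subset
  by blast+

lemma bounded_partials:
  obtains K where "K > 0" "\<And>p. p \<in> {-r..r} \<times> {0..T} \<Longrightarrow> norm (\<zeta>x p) \<le> K"
    "\<And>p. p \<in> {-r..r} \<times> {0..T} \<Longrightarrow> norm (\<zeta>t p) \<le> K"
proof -
  have c: "compact ({-r..r} \<times> {0..T})" by (simp add: compact_Times)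
  have "bounded (\<zeta>x ` ({-r..r} \<times> {0..T}))" "bounded (\<zeta>t ` ({-r..r} \<times> {0..T}))"
    by (intro compact_imp_bounded compact_continuous_image continuous_partials D c)+
  then obtain K1 K2 where "\<And>p. p \<in> {-r..r} \<times> {0..T} \<Longrightarrow> norm (\<zeta>x p) \<le> K1"
    "\<And>p. p \<in> {-r..r} \<times> {0..T} \<Longrightarrow> norm (\<zeta>t p) \<le> K2"
    unfolding bounded_iff by blast
  then show ?thesis by (intro that[of "max 1 (max K1 K2)"]) fastforce+
qed

definition primitive :: "(real \<times> real \<Rightarrow> complex) \<Rightarrow> real \<times> real \<Rightarrow> complex" where
  "primitive g = corner_integral (\<lambda>p. g p * \<zeta>x p) (\<lambda>p. g p * \<zeta>t p) (- r) T"

definition is_primitive :: "(real \<times> real \<Rightarrow> complex) \<Rightarrow> (real \<times> real \<Rightarrow> complex) \<Rightarrow> bool" where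
  "is_primitive u g \<longleftrightarrow> (\<forall>p\<in>strip. (u has_derivative (\<lambda>v. g p * d\<zeta> p v)) (at p within strip))"

lemma is_primitive_continuous: "is_primitive u g \<Longrightarrow> continuous_on strip u"
  unfolding is_primitive_def by (metis continuous_on_eq_continuous_within has_derivative_continuous)

lemma is_primitive_partials:
  assumes "is_primitive u g" "x \<in> {-r..r}" "t \<in> {0<..T}"
  shows "((\<lambda>x. u (x, t)) has_vector_derivative g (x, t) * \<zeta>x (x, t)) (at x within {-r..r})"
    and "((\<lambda>t. u (x, t)) has_vector_derivative g (x, t) * \<zeta>t (x, t)) (at t within {0<..T})"
proof -
  have "(u has_derivative (\<lambda>v. g (x, t) * d\<zeta> (x, t) v)) (at (x, t) within strip)"
    using assms unfolding is_primitive_def by blast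
  from has_derivative_within_Times_partials[OF this assms(2,3)]
  show "((\<lambda>x. u (x, t)) has_vector_derivative g (x, t) * \<zeta>x (x, t)) (at x within {-r..r})"
    "((\<lambda>t. u (x, t)) has_vector_derivative g (x, t) * \<zeta>t (x, t)) (at t within {0<..T})" .
qed

lemma primitive_derivD:
  assumes "continuous_on strip g"
    and "\<And>x t. x \<in> {-r..r} \<Longrightarrow> t \<in> {0<..T} \<Longrightarrow>
      ((\<lambda>x. primitive g (x, t)) has_vector_derivative g (x, t) * \<zeta>x (x, t)) (at x within {-r..r})"
  shows "is_primitive (primitive g) g"
  unfolding is_primitive_def
proof
  fix p assume p: "p \<in> strip"
  have "(primitive g has_derivative (\<lambda>v. fst v *\<^sub>R (g p * \<zeta>x p) + snd v *\<^sub>R (g p * \<zeta>t p))) (at p within strip)"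
    unfolding primitive_def
    by (rule corner_integral_has_derivative[OF _ _ _ p])
      (use assms(2) in \<open>auto intro!: continuous_intros assms(1) continuous_partials strip_D' simp: primitive_def\<close>)
  then show "(primitive g has_derivative (\<lambda>v. g p * d\<zeta> p v)) (at p within strip)"
    unfolding mult_d\<zeta>_eq[OF strip_D'[OF p]] .
qed

text \<open>Serves for the solution itself, which is merely continuous: closedness of its product
  with \<open>d\<zeta>\<close> is available only through local primitives.\<close>

lemma is_primitive_primitive_local:
  assumes g: "continuous_on strip g"
    and loc: "\<And>p. p \<in> strip \<Longrightarrow> \<exists>e>0. \<exists>H. \<forall>q\<in>ball p e. (H has_derivative (\<lambda>v. g q * d\<zeta> q v)) (at q)"
  shows "is_primitive (primitive g) g"
proof (rule primitive_derivD[OF g])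
  fix x t assume xt: "x \<in> {-r..r}" "t \<in> {0<..T}"
  show "((\<lambda>x. primitive g (x, t)) has_vector_derivative g (x, t) * \<zeta>x (x, t)) (at x within {-r..r})"
    unfolding primitive_def
  proof (rule corner_integral_deriv_x_local[where P = "\<lambda>p. g p * \<zeta>x p", OF T(1) _ _ _ xt])
    show "continuous_on strip (\<lambda>p. g p * \<zeta>x p)" "continuous_on strip (\<lambda>p. g p * \<zeta>t p)"
      by (auto intro!: continuous_intros g continuous_partials strip_D')
    fix p assume p: "p \<in> strip"
    obtain e H where e: "e > 0" and H: "\<And>q. q \<in> ball p e \<Longrightarrow> (H has_derivative (\<lambda>v. g q * d\<zeta> q v)) (at q)"
      using loc[OF p] by blast
    obtain e' where e': "e' > 0" "ball p e' \<subseteq> D" using strip_D'[OF p] D(1) openE by blast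
    have "\<forall>q\<in>ball p (min e e').
        (H has_derivative (\<lambda>v. fst v *\<^sub>R (g q * \<zeta>x q) + snd v *\<^sub>R (g q * \<zeta>t q))) (at q)"
    proof
      fix q assume q: "q \<in> ball p (min e e')"
      then have "q \<in> D" using e' by auto
      from mult_d\<zeta>_eq[OF this] show "(H has_derivative (\<lambda>v. fst v *\<^sub>R (g q * \<zeta>x q) + snd v *\<^sub>R (g q * \<zeta>t q))) (at q)"
        using H[of q] q by (simp only: mem_ball min_less_iff_conj)
    qed
    then show "\<exists>e>0. \<exists>H. \<forall>q\<in>ball p e.
        (H has_derivative (\<lambda>v. fst v *\<^sub>R (g q * \<zeta>x q) + snd v *\<^sub>R (g q * \<zeta>t q))) (at q)"
      by (intro exI[of _ "min e e'"] conjI exI[of _ H]) (use e e'(1) in auto)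
  qed
qed

text \<open>If \<open>dg = h d\<zeta>\<close>, then \<open>g d\<zeta>\<close> is closed in the
  classical sense, since \<open>h d\<zeta> \<and> d\<zeta> = 0\<close> as a wedge product; both
  mixed derivatives are the expression \<open>?R\<close>.\<close>

lemma is_primitive_primitive:
  assumes "is_primitive g h" and h: "continuous_on strip h"
  shows "is_primitive (primitive g) g"
proof (rule primitive_derivD)
  show g: "continuous_on strip g" using is_primitive_continuous[OF assms(1)] .
  fix x t assume xt: "x \<in> {-r..r}" "t \<in> {0<..T}"
  let ?R = "\<lambda>p. g p * frechet_derivative \<zeta>x (at p) (0, 1) + (h p * \<zeta>t p) * \<zeta>x p"
  show "((\<lambda>x. primitive g (x, t)) has_vector_derivative g (x, t) * \<zeta>x (x, t)) (at x within {-r..r})"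
    unfolding primitive_def
  proof (rule corner_integral_deriv_x_C1[where P = "\<lambda>p. g p * \<zeta>x p" and R = ?R, OF T(1) _ _ _ _ _ xt])
    show "continuous_on strip (\<lambda>p. g p * \<zeta>x p)" "continuous_on strip (\<lambda>p. g p * \<zeta>t p)" "continuous_on strip ?R"
      by (auto intro!: continuous_intros g h continuous_partials strip_D')
    fix x t assume xt: "x \<in> {-r..r}" "t \<in> {0<..T}"
    have "(x, t) \<in> D" using xt strip_D' by auto
    note Z = \<zeta>_partials[OF this xt]
    show "((\<lambda>t. g (x, t) * \<zeta>x (x, t)) has_vector_derivative ?R (x, t)) (at t within {0<..T})"
      using has_vector_derivative_mult[OF is_primitive_partials(2)[OF assms(1) xt] Z(3)] .
    show "((\<lambda>x. g (x, t) * \<zeta>t (x, t)) has_vector_derivative ?R (x, t)) (at x within {-r..r})"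
      using has_vector_derivative_mult[OF is_primitive_partials(1)[OF assms(1) xt] Z(4)]
      by (simp add: mult_ac)
  qed
qed

text \<open>Integrating \<open>g \<zeta>t\<close> from \<open>t\<close> up to \<open>T\<close>
  lowers the exponent by one; for an exponent below 1 the integral stays bounded. The exponent 1
  would produce a logarithm and is excluded.\<close>

lemma primitive_growth_step:
  assumes ug: "is_primitive u g" and "\<beta> \<noteq> 1" "C \<ge> 0"
    and C: "\<And>x t. x \<in> {-r..r} \<Longrightarrow> t \<in> {0<..T} \<Longrightarrow> norm (g (x, t)) \<le> C * t powr (- \<beta>)"
  shows "\<exists>C'\<ge>0. \<forall>x\<in>{-r..r}. \<forall>t\<in>{0<..T}. norm (u (x, t)) \<le> C' * t powr (- max 0 (\<beta> - 1))"
proof -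
  obtain K where K: "K > 0" "\<And>p. p \<in> {-r..r} \<times> {0..T} \<Longrightarrow> norm (\<zeta>t p) \<le> K"
    using bounded_partials by metis
  have cu: "continuous_on strip u" using is_primitive_continuous[OF ug] .
  have "continuous_on {-r..r} (\<lambda>x. u (x, T))"
    by (rule continuous_on_compose2[OF cu]) (use T in \<open>auto intro!: continuous_intros\<close>)
  then have "bounded ((\<lambda>x. u (x, T)) ` {-r..r})"
    by (intro compact_imp_bounded compact_continuous_image) auto
  then obtain B where "\<forall>y\<in>(\<lambda>x. u (x, T)) ` {-r..r}. norm y \<le> B"
    unfolding bounded_iff by blast
  then have B: "\<And>x. x \<in> {-r..r} \<Longrightarrow> norm (u (x, T)) \<le> B" by blast
  have "norm (u (0, T)) \<le> B" using r by (intro B) auto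
  then have B0: "B \<ge> 0" using norm_ge_zero order_trans by blast
  define A where "A = K * C / \<bar>1 - \<beta>\<bar>"
  have A: "A \<ge> 0" using K \<open>C \<ge> 0\<close> by (simp add: A_def)
  have main: "norm (u (x, t)) \<le> (B + A) * t powr (- max 0 (\<beta> - 1))"
    if x: "x \<in> {-r..r}" and t: "t \<in> {0<..T}" for x t
  proof -
    let ?\<phi> = "\<lambda>s. K * C * (s powr (1 - \<beta>) / (1 - \<beta>))"
    have d: "norm (u (x, T) - u (x, t)) \<le> ?\<phi> T - ?\<phi> t"
    proof (cases "t = T")
      case False
      then have tT: "t < T" using t by simp
      show ?thesis
      proof (rule differentiable_bound_general[OF tT, where f = "\<lambda>s. u (x, s)"
            and f' = "\<lambda>s. g (x, s) * \<zeta>t (x, s)" and \<phi>' = "\<lambda>s. K * C * s powr (- \<beta>)"])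
        show "continuous_on {t..T} (\<lambda>s. u (x, s))"
          by (rule continuous_on_compose2[OF cu]) (use x t in \<open>auto intro!: continuous_intros\<close>)
        show "continuous_on {t..T} ?\<phi>"
          using t \<open>\<beta> \<noteq> 1\<close> by (auto intro!: continuous_intros)
        fix s assume s: "t < s" "s < T"
        have "at s within {0<..T} = at s"
          by (rule at_within_open_subset[of _ "{0<..<T}"]) (use s t in auto)
        then show "((\<lambda>s. u (x, s)) has_vector_derivative g (x, s) * \<zeta>t (x, s)) (at s)"
          using is_primitive_partials(2)[OF ug x, of s] s t by simp
        have "((\<lambda>s. s powr (1 - \<beta>) / (1 - \<beta>)) has_real_derivative s powr (- \<beta>)) (at s)"
          using DERIV_cdivide[OF has_real_derivative_powr[of s "1 - \<beta>"], of "1 - \<beta>"] s t \<open>\<beta> \<noteq> 1\<close>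
          by simp
        from DERIV_cmult[OF this, of "K * C"]
        show "(?\<phi> has_vector_derivative K * C * s powr (- \<beta>)) (at s)"
          by (simp only: has_real_derivative_iff_has_vector_derivative)
        have "norm (g (x, s) * \<zeta>t (x, s)) \<le> (C * s powr (- \<beta>)) * K"
          unfolding norm_mult by (intro mult_mono C K) (use x s t \<open>C \<ge> 0\<close> in auto)
        then show "norm (g (x, s) * \<zeta>t (x, s)) \<le> K * C * s powr (- \<beta>)" by (simp add: mult_ac)
      qed
    qed simp
    have pw: "1 \<le> t powr (- max 0 (\<beta> - 1))"
      using t T powr_mono'[of "- max 0 (\<beta> - 1)" 0 t] by (auto simp: max_def)
    have "?\<phi> T - ?\<phi> t \<le> A * t powr (- max 0 (\<beta> - 1))"
    proof (cases "\<beta> > 1")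
      case True
      have "?\<phi> T - ?\<phi> t = A * (t powr (1 - \<beta>) - T powr (1 - \<beta>))"
      proof -
        have "y / (1 - \<beta>) = - (y / (\<beta> - 1))" for y
          using minus_divide_right[of y "\<beta> - 1"] by simp
        then show ?thesis using True by (simp add: A_def right_diff_distrib)
      qed
      also have "\<dots> \<le> A * t powr (1 - \<beta>)" by (intro mult_left_mono A) simp
      finally show ?thesis using True by simp
    next
      case False
      have T1: "T powr (1 - \<beta>) \<le> 1"
        using False T powr_mono'[of 0 "1 - \<beta>" T] by simp
      have "?\<phi> T - ?\<phi> t = A * (T powr (1 - \<beta>) - t powr (1 - \<beta>))"
        using False \<open>\<beta> \<noteq> 1\<close> by (simp add: A_def right_diff_distrib)
      also have "\<dots> \<le> A * 1" using T1 by (intro mult_left_mono A) (smt (verit) powr_ge_zero)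
      also have "\<dots> \<le> A * t powr (- max 0 (\<beta> - 1))" by (intro mult_left_mono A pw)
      finally show ?thesis .
    qed
    moreover have "norm (u (x, t)) \<le> norm (u (x, T)) + norm (u (x, T) - u (x, t))"
      using norm_triangle_ineq4[of "u (x, T)" "u (x, T) - u (x, t)"] by simp
    moreover have "B \<le> B * t powr (- max 0 (\<beta> - 1))"
      using mult_left_mono[OF pw B0] by simp
    ultimately show ?thesis using B[OF x] d by (simp add: distrib_right)
  qed
  show ?thesis
    by (rule exI[of _ "B + A"]) (use main B0 A in auto)
qed

text \<open>
  Integrating in \<open>x\<close> turns the integral bound into a bound for the oscillation of the primitive;
  its mean over \<open>{-r..r}\<close> is controlled by integrating in \<open>t\<close>.
\<close>

lemma primitive_growth_base:
  assumes ug: "is_primitive u g" and g: "continuous_on strip g" and "\<beta> \<ge> 0" "C \<ge> 0"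
    and C: "\<And>t. t \<in> {0<..T} \<Longrightarrow> integral {-r..r} (\<lambda>x. norm (g (x, t))) \<le> C * t powr (- \<beta>)"
  shows "\<exists>C'\<ge>0. \<forall>x\<in>{-r..r}. \<forall>t\<in>{0<..T}. norm (u (x, t)) \<le> C' * t powr (- \<beta>)"
proof -
  obtain K where K: "K > 0" "\<And>p. p \<in> {-r..r} \<times> {0..T} \<Longrightarrow> norm (\<zeta>x p) \<le> K"
    "\<And>p. p \<in> {-r..r} \<times> {0..T} \<Longrightarrow> norm (\<zeta>t p) \<le> K"
    by (rule bounded_partials) blast
  have cu: "continuous_on strip u" using is_primitive_continuous[OF ug] .
  have row: "continuous_on {-r..r} (\<lambda>x. k (x, t))" if "continuous_on strip k" "t \<in> {0<..T}"
    for k :: "real \<times> real \<Rightarrow> complex" and t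
    by (rule continuous_on_compose2[OF that(1)]) (use that(2) in \<open>auto intro!: continuous_intros\<close>)
  have cgx: "continuous_on strip (\<lambda>p. g p * \<zeta>x p)" and cgt: "continuous_on strip (\<lambda>p. g p * \<zeta>t p)"
    by (auto intro!: continuous_intros g continuous_partials strip_D')
  have int: "norm (integral {a..b} (\<lambda>x. g (x, t) * k (x, t))) \<le> K * (C * t powr (- \<beta>))"
    if t: "t \<in> {0<..T}" and ab: "{a..b} \<subseteq> {-r..r}"
      and k: "\<And>p. p \<in> {-r..r} \<times> {0..T} \<Longrightarrow> norm (k p) \<le> K" "continuous_on strip (\<lambda>p. g p * k p)"
    for a b t k
  proof -
    have i: "(\<lambda>x. norm (g (x, t))) integrable_on {-r..r}"
      by (intro integrable_continuous_interval continuous_intros row g t)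
    then have i': "(\<lambda>x. norm (g (x, t))) integrable_on {a..b}"
      using integrable_on_subinterval ab by blast
    have "norm (integral {a..b} (\<lambda>x. g (x, t) * k (x, t))) \<le> integral {a..b} (\<lambda>x. K * norm (g (x, t)))"
    proof (rule integral_norm_bound_integral)
      show "(\<lambda>x. g (x, t) * k (x, t)) integrable_on {a..b}"
        by (rule integrable_on_subinterval[OF integrable_continuous_interval[OF row[OF k(2) t]] ab])
      show "(\<lambda>x. K * norm (g (x, t))) integrable_on {a..b}" using i' by (rule integrable_on_mult_right)
      show "norm (g (x, t) * k (x, t)) \<le> K * norm (g (x, t))" if "x \<in> {a..b}" for x
        unfolding norm_mult using k(1)[of "(x, t)"] that ab t
        by (subst mult.commute) (intro mult_right_mono, auto)
    qed
    also have "\<dots> = K * integral {a..b} (\<lambda>x. norm (g (x, t)))" by simp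
    also have "\<dots> \<le> K * integral {-r..r} (\<lambda>x. norm (g (x, t)))"
      using K(1) by (intro mult_left_mono integral_subset_le ab i i') auto
    also have "\<dots> \<le> K * (C * t powr (- \<beta>))" using K(1) C[OF t] by (intro mult_left_mono) auto
    finally show ?thesis .
  qed
  have osc: "norm (u (x, t) - u (y, t)) \<le> K * (C * t powr (- \<beta>))"
    if "x \<in> {-r..r}" "y \<in> {-r..r}" "t \<in> {0<..T}" for x y t
  proof -
    have *: "norm (u (x, t) - u (y, t)) \<le> K * (C * t powr (- \<beta>))"
      if "x \<in> {-r..r}" "y \<in> {-r..r}" "t \<in> {0<..T}" "y \<le> x" for x y t
    proof -
      have "((\<lambda>x. g (x, t) * \<zeta>x (x, t)) has_integral u (x, t) - u (y, t)) {y..x}"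
        by (rule fundamental_theorem_of_calculus[OF \<open>y \<le> x\<close>],
            rule has_vector_derivative_within_subset[OF is_primitive_partials(1)[OF ug]])
          (use that in auto)
      then show ?thesis
        using int[OF that(3) _ K(2) cgx, of y x] that by (simp add: integral_unique)
    qed
    show ?thesis using *[OF that] *[OF that(2,1,3)] by (cases "y \<le> x") (auto simp: norm_minus_commute)
  qed
  define a where "a t = integral {-r..r} (\<lambda>x. u (x, t))" for t
  have a: "(a has_vector_derivative integral {-r..r} (\<lambda>x. g (x, t) * \<zeta>t (x, t))) (at t within {0<..T})"
    if "t \<in> {0<..T}" for t
    unfolding a_def[abs_def] cbox_interval[symmetric]
  proof (rule leibniz_rule_vector_derivative)
    show "continuous_on ({0<..T} \<times> cbox (-r) r) (\<lambda>(t, x). g (x, t) * \<zeta>t (x, t))"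
      unfolding case_prod_unfold
      by (rule continuous_on_compose2[OF cgt]) (auto intro!: continuous_intros)
  qed (use that is_primitive_partials(2)[OF ug] row[OF cu] in \<open>auto intro: integrable_continuous_interval\<close>)
  have "norm (a T - a t) \<le> K * (C * t powr (- \<beta>))" if t: "t \<in> {0<..T}" for t
  proof -
    have "norm (a T - a t) \<le> K * (C * t powr (- \<beta>)) * norm (T - t)"
    proof (rule differentiable_bound[of "{t..T}" a "\<lambda>t h. h *\<^sub>R integral {-r..r} (\<lambda>x. g (x, t) * \<zeta>t (x, t))"])
      fix s assume s: "s \<in> {t..T}"
      show "(a has_derivative (\<lambda>h. h *\<^sub>R integral {-r..r} (\<lambda>x. g (x, s) * \<zeta>t (x, s)))) (at s within {t..T})"
        unfolding has_vector_derivative_def[symmetric]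
        by (rule has_vector_derivative_within_subset[OF a]) (use s t in auto)
      have "norm (integral {-r..r} (\<lambda>x. g (x, s) * \<zeta>t (x, s))) \<le> K * (C * s powr (- \<beta>))"
        by (rule int[OF _ _ K(3) cgt]) (use s t in auto)
      \<comment> \<open>On \<open>{t..T}\<close> the bound is largest at \<open>t\<close>. No power
        is gained here: the first primitive only exchanges the integral bound for a pointwise
        one.\<close>
      also have "\<dots> \<le> K * (C * t powr (- \<beta>))"
        using s t \<open>\<beta> \<ge> 0\<close> K(1) \<open>C \<ge> 0\<close> by (intro mult_left_mono powr_mono2') auto
      finally have "norm (h *\<^sub>R integral {-r..r} (\<lambda>x. g (x, s) * \<zeta>t (x, s)))
          \<le> K * (C * t powr (- \<beta>)) * norm h" for h :: real
        by (simp add: mult.commute mult_left_mono)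
      then show "onorm (\<lambda>h. h *\<^sub>R integral {-r..r} (\<lambda>x. g (x, s) * \<zeta>t (x, s))) \<le> K * (C * t powr (- \<beta>))"
        by (rule onorm_le)
    qed (use t in auto)
    also have "\<dots> \<le> K * (C * t powr (- \<beta>)) * 1"
      using t T K(1) \<open>C \<ge> 0\<close> by (intro mult_left_mono) auto
    finally show ?thesis by simp
  qed
  then have at: "norm (a t) \<le> norm (a T) + K * (C * t powr (- \<beta>))" if "t \<in> {0<..T}" for t
    using norm_triangle_ineq4[of "a T" "a T - a t"] that by fastforce
  have main: "norm (u (x, t)) \<le> ((norm (a T) + K * C) / (2 * r) + K * C) * t powr (- \<beta>)"
    if x: "x \<in> {-r..r}" and t: "t \<in> {0<..T}" for x t
  proof -
    have pw: "1 \<le> t powr (- \<beta>)" using t T powr_mono'[of "- \<beta>" 0 t] \<open>\<beta> \<ge> 0\<close> by auto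
    have iu: "(\<lambda>y. u (y, t)) integrable_on {-r..r}" by (rule integrable_continuous_interval[OF row[OF cu t]])
    have "integral {-r..r} (\<lambda>y. u (x, t) - u (y, t)) = of_real (2 * r) * u (x, t) - a t"
      using r by (subst integral_diff[OF _ iu]) (auto simp: a_def scaleR_conv_of_real)
    moreover have "norm (integral {-r..r} (\<lambda>y. u (x, t) - u (y, t))) \<le> integral {-r..r} (\<lambda>y. K * (C * t powr (- \<beta>)))"
      by (rule integral_norm_bound_integral) (use x t osc iu in \<open>auto intro: integrable_diff\<close>)
    ultimately have "norm (of_real (2 * r) * u (x, t) - a t) \<le> 2 * r * (K * (C * t powr (- \<beta>)))"
      using r by (simp add: mult_ac)
    then have "norm (complex_of_real (2 * r) * u (x, t)) \<le> 2 * r * (K * (C * t powr (- \<beta>))) + norm (a t)"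
      using norm_triangle_sub[of "of_real (2 * r) * u (x, t)" "a t"] by linarith
    then have "2 * r * norm (u (x, t)) \<le> 2 * r * (K * (C * t powr (- \<beta>))) + (norm (a T) + K * (C * t powr (- \<beta>)))"
      using r at[OF t] by (simp add: norm_mult)
    also have "\<dots> \<le> 2 * r * (K * (C * t powr (- \<beta>))) + (norm (a T) * t powr (- \<beta>) + K * (C * t powr (- \<beta>)))"
      using mult_left_mono[OF pw norm_ge_zero[of "a T"]] by simp
    also have "\<dots> = 2 * r * (((norm (a T) + K * C) / (2 * r) + K * C) * t powr (- \<beta>))"
    proof -
      define X A where "X = t powr (- \<beta>)" and "A = norm (a T)"
      have "2 * r * (K * (C * X)) + (A * X + K * (C * X)) = 2 * r * (((A + K * C) / (2 * r) + K * C) * X)"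
        using r by (simp add: field_simps)
      then show ?thesis by (simp only: X_def A_def)
    qed
    finally show ?thesis using r by simp
  qed
  show ?thesis
    by (rule exI[of _ "(norm (a T) + K * C) / (2 * r) + K * C"]) (use main r K(1) \<open>C \<ge> 0\<close> in auto)
qed

text \<open>A bounded \<open>g\<close> makes \<open>u\<close> Lipschitz on the convex strip, and a
  uniformly continuous function extends to the closure.\<close>

lemma primitive_extends:
  assumes ug: "is_primitive u g" and B: "\<And>p. p \<in> strip \<Longrightarrow> norm (g p) \<le> B"
  obtains w where "continuous_on ({-r..r} \<times> {0..T}) w" "\<And>p. p \<in> strip \<Longrightarrow> w p = u p"
proof -
  obtain K where K: "K > 0" "\<And>p. p \<in> {-r..r} \<times> {0..T} \<Longrightarrow> norm (\<zeta>x p) \<le> K"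
    "\<And>p. p \<in> {-r..r} \<times> {0..T} \<Longrightarrow> norm (\<zeta>t p) \<le> K"
    by (rule bounded_partials) blast
  have "norm (g (0, T)) \<le> B" using r T by (intro B) auto
  then have B0: "B \<ge> 0" using norm_ge_zero order_trans by blast
  have lip: "norm (u p - u q) \<le> B * (2 * K) * norm (p - q)" if "p \<in> strip" "q \<in> strip" for p q
  proof (rule differentiable_bound[where f' = "\<lambda>p v. g p * d\<zeta> p v", OF _ _ _ that])
    show "convex strip" by (intro convex_Times) auto
    show "(u has_derivative (\<lambda>v. g p * d\<zeta> p v)) (at p within strip)" if "p \<in> strip" for p
      using ug[unfolded is_primitive_def] that by blast
    fix p assume p: "p \<in> strip"
    show "onorm (\<lambda>v. g p * d\<zeta> p v) \<le> B * (2 * K)"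
    proof (rule onorm_le)
      fix v :: "real \<times> real"
      have "norm (d\<zeta> p v) \<le> \<bar>fst v\<bar> * norm (\<zeta>x p) + \<bar>snd v\<bar> * norm (\<zeta>t p)"
        by (subst d\<zeta>_eq[OF strip_D'[OF p]]) (rule norm_triangle_le, simp)
      also have "\<dots> \<le> norm v * K + norm v * K"
        using norm_fst_le[of "fst v" "snd v"] norm_snd_le[of "snd v" "fst v"] K p by (intro add_mono mult_mono) auto
      finally have "norm (g p) * norm (d\<zeta> p v) \<le> B * (2 * K * norm v)"
        using B[OF p] B0 by (intro mult_mono) auto
      then show "norm (g p * d\<zeta> p v) \<le> B * (2 * K) * norm v" by (simp add: norm_mult mult_ac)
    qed
  qed
  have "uniformly_continuous_on strip u"
    unfolding uniformly_continuous_on_def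
  proof (intro allI impI)
    fix e :: real assume "e > 0"
    define c where "c = B * (2 * K) + 1"
    have c: "c > 0" using B0 K by (simp add: c_def add_nonneg_pos)
    show "\<exists>d>0. \<forall>p\<in>strip. \<forall>q\<in>strip. dist q p < d \<longrightarrow> dist (u q) (u p) < e"
    proof (intro exI[of _ "e / c"] conjI ballI impI)
      fix p q assume pq: "p \<in> strip" "q \<in> strip" "dist q p < e / c"
      have "dist (u q) (u p) \<le> c * dist q p"
        using lip[OF pq(2,1)] by (simp add: dist_norm c_def distrib_right)
          (metis add_increasing2 norm_ge_zero)
      also have "\<dots> < e" using pq(3) c by (simp add: field_simps)
      finally show "dist (u q) (u p) < e" .
    qed (use c \<open>e > 0\<close> in auto)
  qed
  then obtain w where w: "uniformly_continuous_on (closure strip) w" "\<And>p. p \<in> strip \<Longrightarrow> u p = w p"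
    using uniformly_continuous_on_extension_on_closure by metis
  have "closure strip = {-r..r} \<times> {0..T}" using T by (simp add: closure_Times)
  then show ?thesis using that[of w] w uniformly_continuous_imp_continuous by metis
qed

end

section \<open>Indefinite integrals of integrable functions\<close>

text \<open>The one-sided differentiation theorem yields right derivatives off \<open>N1\<close>;
  left derivatives come from the reflected function, off the reflection of \<open>N2\<close>.
  Extension by 0 makes \<open>f\<close> integrable on every interval.\<close>

lemma indefinite_integral_has_vector_derivative_ae:
  fixes k :: "real \<Rightarrow> complex"
  assumes k: "k integrable_on {a..b}"
  obtains N where "negligible N"
    "\<And>x. x \<in> {a<..<b} \<Longrightarrow> x \<notin> N \<Longrightarrow> ((\<lambda>x. integral {a..x} k) has_vector_derivative k x) (at x)"
proof -
  define f where "f x = (if x \<in> {a..b} then k x else 0)" for x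
  have fU: "f integrable_on UNIV"
    unfolding f_def[abs_def] using k by (simp only: integrable_restrict_UNIV)
  have f: "f integrable_on cbox c d" for c d
    using fU integrable_on_subcbox by blast
  have f': "(\<lambda>x. f (- x)) integrable_on cbox c d" for c d
    using f[of "-d" "-c"] Henstock_Kurzweil_Integration.integrable_reflect_real[where f = f and a = "-d" and b = "-c"] by simp
  have right: "\<exists>N. negligible N \<and> (\<forall>x e. x \<notin> N \<longrightarrow> 0 < e \<longrightarrow>
      (\<exists>d>0. \<forall>h. 0 < h \<and> h < d \<longrightarrow> norm (integral {x..x + h} f /\<^sub>R h - f x) < e))"
    if int: "\<And>c d. f integrable_on cbox c d" for f :: "real \<Rightarrow> complex"
  proof -
    obtain N where N: "negligible N" and d: "\<And>x e. x \<notin> N \<Longrightarrow> 0 < e \<Longrightarrow>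
        \<exists>d>0. \<forall>h. 0 < h \<and> h < d \<longrightarrow> norm (integral (cbox x (x + h *\<^sub>R One)) f /\<^sub>R h ^ DIM(real) - f x) < e"
      by (rule integrable_ccontinuous_explicit[OF int]) blast
    have "integral (cbox x (x + h *\<^sub>R One)) f /\<^sub>R h ^ DIM(real) = integral {x..x + h} f /\<^sub>R h" for x h
      by simp
    with N d show ?thesis by (simp only:) blast
  qed
  obtain N1 where N1: "negligible N1" and d1: "\<And>x e. x \<notin> N1 \<Longrightarrow> 0 < e \<Longrightarrow>
      \<exists>d>0. \<forall>h. 0 < h \<and> h < d \<longrightarrow> norm (integral {x..x + h} f /\<^sub>R h - f x) < e"
    using right[OF f] by (elim exE conjE) blast
  obtain N2 where N2: "negligible N2" and d2: "\<And>x e. x \<notin> N2 \<Longrightarrow> 0 < e \<Longrightarrow>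
      \<exists>d>0. \<forall>h. 0 < h \<and> h < d \<longrightarrow> norm (integral {x..x + h} (\<lambda>x. f (- x)) /\<^sub>R h - f (- x)) < e"
    using right[OF f'] by (elim exE conjE) blast
  have neg: "negligible (N1 \<union> uminus ` N2)"
    by (intro negligible_Un N1 negligible_differentiable_image_negligible N2)
      (auto simp: differentiable_on_def intro!: derivative_intros)
  moreover have "((\<lambda>x. integral {a..x} k) has_vector_derivative k x) (at x)"
    if x: "x \<in> {a<..<b}" "x \<notin> N1 \<union> uminus ` N2" for x
  proof -
    have comb: "integral {a..z} k - integral {a..y} k = integral {y..z} f" if "a \<le> y" "y \<le> z" "z \<le> b" for y z
    proof -
      have "integral {a..y} k + integral {y..z} k = integral {a..z} k"
        by (rule Henstock_Kurzweil_Integration.integral_combine)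
          (use that k in \<open>auto intro: integrable_on_subinterval\<close>)
      moreover have "integral {y..z} k = integral {y..z} f"
        by (rule integral_cong) (use that in \<open>auto simp: f_def\<close>)
      ultimately show ?thesis by (simp add: algebra_simps)
    qed
    have "- x \<notin> N2" using x by force
    show ?thesis
      unfolding has_vector_derivative_def has_derivative_at_alt
    proof (intro conjI allI impI)
      show "bounded_linear (\<lambda>h. h *\<^sub>R k x)" by (rule bounded_linear_scaleR_left)
      fix e :: real assume e: "e > 0"
      obtain e1 where e1: "e1 > 0" "\<And>h. 0 < h \<Longrightarrow> h < e1 \<Longrightarrow> norm (integral {x..x + h} f /\<^sub>R h - f x) < e"
        using d1[of x e] x e by blast
      obtain e2 where e2: "e2 > 0" "\<And>h. 0 < h \<Longrightarrow> h < e2 \<Longrightarrow>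
          norm (integral {-x..-x + h} (\<lambda>x. f (- x)) /\<^sub>R h - f x) < e"
        using d2[of "-x" e] \<open>- x \<notin> N2\<close> e by auto
      have fx: "f x = k x" using x by (simp add: f_def)
      define d where "d = Min {e1, e2, x - a, b - x}"
      have d: "d > 0" "d \<le> e1" "d \<le> e2" "d \<le> x - a" "d \<le> b - x" using x e1 e2 by (auto simp: d_def)
      have est: "norm (I - h *\<^sub>R k x) \<le> e * \<bar>h\<bar>"
        if "norm (I /\<^sub>R h - k x) < e" "h > 0" for I :: complex and h
      proof -
        have "I - h *\<^sub>R k x = h *\<^sub>R (I /\<^sub>R h - k x)" using that(2) by (simp add: scaleR_right_diff_distrib)
        then have "norm (I - h *\<^sub>R k x) = \<bar>h\<bar> * norm (I /\<^sub>R h - k x)" by simp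
        then show ?thesis using that by (simp add: mult.commute)
      qed
      show "\<exists>d>0. \<forall>y. norm (y - x) < d \<longrightarrow>
          norm (integral {a..y} k - integral {a..x} k - (y - x) *\<^sub>R k x) \<le> e * norm (y - x)"
      proof (intro exI[of _ d] conjI allI impI)
        fix y assume y: "norm (y - x) < d"
        then have ya: "a \<le> y" "y \<le> b" using d by (auto simp: abs_less_iff)
        consider "y > x" | "y = x" | "y < x" by linarith
        then show "norm (integral {a..y} k - integral {a..x} k - (y - x) *\<^sub>R k x) \<le> e * norm (y - x)"
        proof cases
          case 1
          have "norm (integral {x..y} f /\<^sub>R (y - x) - k x) < e"
            using e1(2)[of "y - x"] 1 y d fx by simp
          from est[OF this] show ?thesis
            using comb[of x y] 1 ya x by simp
        next
          case 3
          have "integral {-x..-x + (x - y)} (\<lambda>x. f (- x)) = integral {y..x} f"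
            using integral_reflect_real[of x y f] by simp
          then have "norm (integral {y..x} f /\<^sub>R (x - y) - k x) < e"
            using e2(2)[of "x - y"] 3 y d fx by simp
          from est[OF this] have "norm (integral {y..x} f - (x - y) *\<^sub>R k x) \<le> e * \<bar>x - y\<bar>" using 3 by simp
          moreover have "integral {a..y} k - integral {a..x} k - (y - x) *\<^sub>R k x
              = - (integral {y..x} f - (x - y) *\<^sub>R k x)"
            using comb[of y x] 3 ya x by (simp add: algebra_simps)
          ultimately show ?thesis by (simp only: norm_minus_cancel real_norm_def abs_minus_commute[of y x])
        qed simp
      qed (use d in simp)
    qed
  qed
  ultimately show ?thesis using that by blast
qed

text \<open>
  The increment of \<open>b\<^sub>1 \<psi> - \<integral> (b\<^sub>1 \<psi>' + k \<psi>)\<close>, \<open>b\<^sub>1 = \<integral> k\<close>, over an interval is at most a multiple of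
  its length times \<open>\<integral> |k|\<close> over it, hence its derivative vanishes everywhere.
\<close>

lemma integral_by_parts_absolutely_integrable:
  fixes k \<psi> \<psi>' :: "real \<Rightarrow> complex"
  assumes k: "k absolutely_integrable_on {a..b}" and "a < b"
    and \<psi>: "\<And>x. (\<psi> has_vector_derivative \<psi>' x) (at x)" and c\<psi>': "continuous_on UNIV \<psi>'"
  shows "integral {a..b} (\<lambda>x. integral {a..x} k * \<psi>' x)
    = integral {a..b} k * \<psi> b - integral {a..b} (\<lambda>x. k x * \<psi> x)"
    and "(\<lambda>x. k x * \<psi> x) integrable_on {a..b}"
proof -
  define B where "B x = integral {a..x} k" for x
  have ki: "k integrable_on {a..b}" and ni: "(\<lambda>x. norm (k x)) integrable_on {a..b}"
    using k by (auto simp: absolutely_integrable_on_def)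
  have c\<psi>: "continuous_on S \<psi>" for S
    using \<psi> by (meson continuous_at_imp_continuous_on has_vector_derivative_continuous)
  have cB: "continuous_on {a..b} B"
    unfolding B_def by (rule indefinite_integral_continuous_1[OF ki])
  have kpsi: "(\<lambda>x. \<psi> x * k x) absolutely_integrable_on {a..b}"
    by (rule absolutely_integrable_bounded_measurable_product
        [OF bounded_bilinear_mult[THEN bilinear_conv_bounded_bilinear[THEN iffD2]] _ _ _ k])
      (auto intro!: compact_imp_bounded compact_continuous_image c\<psi> continuous_imp_measurable_on_sets_lebesgue)
  then have kp: "(\<lambda>x. k x * \<psi> x) integrable_on {a..b}"
    by (simp add: absolutely_integrable_on_def mult.commute)
  then show "(\<lambda>x. k x * \<psi> x) integrable_on {a..b}" .
  have bp: "(\<lambda>x. B x * \<psi>' x) integrable_on {a..b}"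
    by (intro integrable_continuous_interval continuous_intros cB continuous_on_subset[OF c\<psi>']) auto
  define \<Phi> where "\<Phi> x = B x * \<psi> x - integral {a..x} (\<lambda>s. B s * \<psi>' s + k s * \<psi> s)" for x
  define A where "A x = integral {a..x} (\<lambda>s. norm (k s))" for x
  have cA: "continuous_on {a..b} A"
    unfolding A_def by (rule indefinite_integral_continuous_1[OF ni])
  have "compact (\<psi>' ` {a..b})"
    by (intro compact_continuous_image continuous_on_subset[OF c\<psi>']) auto
  then obtain M0 where M0: "\<forall>y\<in>\<psi>' ` {a..b}. norm y \<le> M0"
    using compact_imp_bounded[of "\<psi>' ` {a..b}"] unfolding bounded_iff by blast
  define M where "M = max 0 M0"
  have M: "M \<ge> 0" "\<And>x. x \<in> {a..b} \<Longrightarrow> norm (\<psi>' x) \<le> M" using M0 by (auto simp: M_def max.coboundedI2)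
  have lip: "norm (\<psi> y - \<psi> x) \<le> M * (y - x)" if "a \<le> x" "x \<le> y" "y \<le> b" for x y
  proof -
    have "(\<psi>' has_integral \<psi> y - \<psi> x) {x..y}"
      by (rule fundamental_theorem_of_calculus[OF that(2)], rule has_vector_derivative_at_within[OF \<psi>])
    then have "norm (\<psi> y - \<psi> x) \<le> M * measure lborel (cbox x y)"
      using has_integral_bound[of M \<psi>' "\<psi> y - \<psi> x" x y] M that by auto
    then show ?thesis using that by simp
  qed
  have sub: "f integrable_on {x..y}" if "f integrable_on {a..b}" "a \<le> x" "y \<le> b" for f :: "real \<Rightarrow> complex" and x y
    using integrable_on_subinterval[OF that(1)] that(2,3) by auto
  have subr: "f integrable_on {x..y}" if "f integrable_on {a..b}" "a \<le> x" "y \<le> b" for f :: "real \<Rightarrow> real" and x y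
    using integrable_on_subinterval[OF that(1)] that(2,3) by auto
  have comb: "integral {a..y} f = integral {a..x} f + integral {x..y} f"
    if "f integrable_on {a..b}" "a \<le> x" "x \<le> y" "y \<le> b" for f :: "real \<Rightarrow> complex" and x y
    by (rule Henstock_Kurzweil_Integration.integral_combine[symmetric]) (use that sub[of f a y] in auto)
  have combr: "integral {a..y} f = integral {a..x} f + integral {x..y} f"
    if "f integrable_on {a..b}" "a \<le> x" "x \<le> y" "y \<le> b" for f :: "real \<Rightarrow> real" and x y
    by (rule Henstock_Kurzweil_Integration.integral_combine[symmetric]) (use that subr[of f a y] in auto)
  have Bdiff: "norm (B s - B x) \<le> A y - A x" if "a \<le> x" "x \<le> s" "s \<le> y" "y \<le> b" for x s y
  proof -
    have "norm (B s - B x) = norm (integral {x..s} k)" using comb[OF ki, of x s] that by (simp add: B_def)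
    also have "\<dots> \<le> integral {x..s} (\<lambda>s. norm (k s))"
      by (rule integral_norm_bound_integral) (use sub[OF ki] subr[OF ni] that in auto)
    also have "\<dots> \<le> integral {x..y} (\<lambda>s. norm (k s))"
      by (rule integral_subset_le) (use subr[OF ni] that in auto)
    also have "\<dots> = A y - A x" using combr[OF ni, of x y] that by (simp add: A_def)
    finally show ?thesis .
  qed
  have inc: "norm (\<Phi> y - \<Phi> x) \<le> 2 * M * (y - x) * (A y - A x)" if xy: "a \<le> x" "x \<le> y" "y \<le> b" for x y
  proof -
    have i1: "k integrable_on {x..y}" "(\<lambda>s. k s * \<psi> s) integrable_on {x..y}" "(\<lambda>s. B s * \<psi>' s) integrable_on {x..y}"
      by (rule sub; use xy ki kp bp in simp)+
    have i2: "\<psi>' integrable_on {x..y}"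
      by (intro integrable_continuous_interval continuous_on_subset[OF c\<psi>']) auto
    have F: "integral {x..y} \<psi>' = \<psi> y - \<psi> x"
      by (rule integral_unique, rule fundamental_theorem_of_calculus[OF xy(2)], rule has_vector_derivative_at_within[OF \<psi>])
    have AA: "A y - A x = integral {x..y} (\<lambda>s. norm (k s))" using combr[OF ni xy] by (simp add: A_def)
    have A0: "0 \<le> A y - A x" unfolding AA by (rule integral_nonneg) (use subr[OF ni] xy in auto)
    have "\<Phi> y - \<Phi> x = (B y - B x) * \<psi> y + B x * (\<psi> y - \<psi> x) - integral {x..y} (\<lambda>s. B s * \<psi>' s + k s * \<psi> s)"
      using comb[OF integrable_add[OF bp kp] xy] by (simp add: \<Phi>_def algebra_simps)
    \<comment> \<open>Recentring at \<open>\<psi> y\<close> and at \<open>B x\<close> leaves two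
      integrals; in each, one factor contributes the length \<open>y - x\<close> and the other the
      mass of \<open>k\<close> on the interval.\<close>
    also have "\<dots> = integral {x..y} (\<lambda>s. k s * (\<psi> y - \<psi> s)) - integral {x..y} (\<lambda>s. (B s - B x) * \<psi>' s)"
    proof -
      have "integral {x..y} (\<lambda>s. k s * (\<psi> y - \<psi> s)) = (B y - B x) * \<psi> y - integral {x..y} (\<lambda>s. k s * \<psi> s)"
        unfolding right_diff_distrib using i1 comb[OF ki xy]
        by (subst integral_diff) (auto simp: B_def intro: integrable_on_mult_left)
      moreover have "integral {x..y} (\<lambda>s. (B s - B x) * \<psi>' s) = integral {x..y} (\<lambda>s. B s * \<psi>' s) - B x * (\<psi> y - \<psi> x)"
        unfolding left_diff_distrib using i1 i2 F
        by (subst integral_diff) (auto intro: integrable_on_mult_right)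
      ultimately show ?thesis using i1 by (simp add: integral_add)
    qed
    also have "norm \<dots> \<le> M * (y - x) * (A y - A x) + (A y - A x) * M * (y - x)"
    proof (rule norm_triangle_le_diff, rule add_mono)
      have "norm (integral {x..y} (\<lambda>s. k s * (\<psi> y - \<psi> s))) \<le> integral {x..y} (\<lambda>s. M * (y - x) * norm (k s))"
      proof (rule integral_norm_bound_integral)
        show "(\<lambda>s. k s * (\<psi> y - \<psi> s)) integrable_on {x..y}"
          unfolding right_diff_distrib by (intro integrable_diff integrable_on_mult_left i1)
        show "(\<lambda>s. M * (y - x) * norm (k s)) integrable_on {x..y}"
          by (intro integrable_on_mult_right subr[OF ni] xy)
        fix s assume s: "s \<in> {x..y}"
        have "norm (\<psi> y - \<psi> s) \<le> M * (y - s)" using lip[of s y] s xy by auto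
        also have "\<dots> \<le> M * (y - x)" using M s by (intro mult_left_mono) auto
        finally show "norm (k s * (\<psi> y - \<psi> s)) \<le> M * (y - x) * norm (k s)"
          unfolding norm_mult by (subst mult.commute) (rule mult_right_mono, auto)
      qed
      then show "norm (integral {x..y} (\<lambda>s. k s * (\<psi> y - \<psi> s))) \<le> M * (y - x) * (A y - A x)"
        by (simp add: AA)
      have "norm (integral {x..y} (\<lambda>s. (B s - B x) * \<psi>' s)) \<le> integral {x..y} (\<lambda>s. (A y - A x) * M)"
      proof (rule integral_norm_bound_integral)
        show "(\<lambda>s. (B s - B x) * \<psi>' s) integrable_on {x..y}"
          unfolding left_diff_distrib by (intro integrable_diff integrable_on_mult_right i1 i2)
        fix s assume s: "s \<in> {x..y}"
        show "norm ((B s - B x) * \<psi>' s) \<le> (A y - A x) * M"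
          unfolding norm_mult using s xy A0 by (intro mult_mono Bdiff M) auto
      qed auto
      then show "norm (integral {x..y} (\<lambda>s. (B s - B x) * \<psi>' s)) \<le> (A y - A x) * M * (y - x)"
        using xy by (simp add: mult_ac)
    qed
    finally show ?thesis by (simp add: algebra_simps)
  qed
  \<comment> \<open>\<open>A\<close> is continuous, so the factor \<open>A y - A x\<close> tends to
    0 and the increment of \<Phi> is \<open>o(y - x)\<close>.\<close>
  have d0: "(\<Phi> has_derivative (\<lambda>h. 0)) (at x within {a..b})" if x: "x \<in> {a..b}" for x
    unfolding has_derivative_within_alt
  proof (intro conjI allI impI)
    fix e :: real assume e: "e > 0"
    have "e / (2 * M + 1) > 0" using e M by simp
    then obtain d where d: "d > 0" "\<And>y. y \<in> {a..b} \<Longrightarrow> dist y x < d \<Longrightarrow> dist (A y) (A x) < e / (2 * M + 1)"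
      using cA x unfolding continuous_on_iff by meson
    show "\<exists>d>0. \<forall>y\<in>{a..b}. norm (y - x) < d \<longrightarrow> norm (\<Phi> y - \<Phi> x - 0) \<le> e * norm (y - x)"
    proof (intro exI[of _ d] conjI ballI impI d)
      fix y assume y: "y \<in> {a..b}" "norm (y - x) < d"
      have "\<bar>A y - A x\<bar> * (2 * M) \<le> e"
      proof -
        define X where "X = \<bar>A y - A x\<bar>"
        have X: "X \<ge> 0" "X < e / (2 * M + 1)" using d(2)[OF y(1)] y(2) by (simp_all add: X_def dist_norm)
        then have "X * (2 * M + 1) < e" using M by (simp add: pos_less_divide_eq)
        then have "X * (2 * M) \<le> e" using X unfolding distrib_left by linarith
        then show ?thesis unfolding X_def .
      qed
      moreover have "norm (\<Phi> y - \<Phi> x) \<le> \<bar>A y - A x\<bar> * (2 * M) * \<bar>y - x\<bar>"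
      proof (cases "x \<le> y")
        case True
        have "norm (\<Phi> y - \<Phi> x) \<le> 2 * M * (y - x) * (A y - A x)" using inc[of x y] x y True by auto
        also have "\<dots> \<le> 2 * M * (y - x) * \<bar>A y - A x\<bar>" using M True by (intro mult_left_mono) auto
        finally show ?thesis using True by (simp add: algebra_simps)
      next
        case False
        have "norm (\<Phi> x - \<Phi> y) \<le> 2 * M * (x - y) * (A x - A y)" using inc[of y x] x y False by auto
        also have "\<dots> \<le> 2 * M * (x - y) * \<bar>A y - A x\<bar>" using M False by (intro mult_left_mono) auto
        finally show ?thesis using False by (simp add: algebra_simps norm_minus_commute)
      qed
      ultimately show "norm (\<Phi> y - \<Phi> x - 0) \<le> e * norm (y - x)"
        by (metis abs_ge_zero diff_zero mult_right_mono order_trans real_norm_def)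
    qed
  qed simp
  have "\<exists>c. \<forall>x\<in>{a..b}. \<Phi> x = c"
    by (rule has_derivative_zero_constant[OF _ d0]) auto
  then have "\<Phi> b = \<Phi> a" using \<open>a < b\<close> by auto
  then have "integral {a..b} (\<lambda>s. B s * \<psi>' s + k s * \<psi> s) = B b * \<psi> b"
    by (simp add: \<Phi>_def B_def)
  then show "integral {a..b} (\<lambda>x. integral {a..x} k * \<psi>' x)
      = integral {a..b} k * \<psi> b - integral {a..b} (\<lambda>x. k x * \<psi> x)"
    using integral_add[OF bp kp] by (simp add: B_def algebra_simps)
qed

section \<open>Peano expansions\<close>

text \<open>\<open>c\<close> plays the role of the \<open>k\<close>-th derivative of
  \<open>g\<close> with respect to \<open>w\<close> at \<open>x0\<close>. Only the top coefficient
  is prescribed. Measuring the error in \<open>w\<close> makes the notion independent of the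
  parameter; \<open>nhds\<close> includes \<open>x0\<close> itself.\<close>

definition peano_expansion ::
  "(real \<Rightarrow> complex) \<Rightarrow> (real \<Rightarrow> complex) \<Rightarrow> nat \<Rightarrow> real \<Rightarrow> complex \<Rightarrow> bool" where
  "peano_expansion g w k x0 c \<longleftrightarrow> (\<exists>q. degree q \<le> k \<and> coeff q k = c / fact k \<and>
     (\<forall>e>0. \<forall>\<^sub>F x in nhds x0. norm (g x - poly q (w x - w x0)) \<le> e * norm (w x - w x0) ^ k))"

text \<open>For a chain in which \<open>g (Suc j)\<close> has the derivative
  \<open>g j * w'\<close>, the \<open>i\<close>-th derivative of \<open>g k\<close> with respect to
  \<open>w\<close> is \<open>g (k - i)\<close>; this explains the indices. The top coefficient is a
  separate number \<open>c\<close>, as \<open>g 0\<close> may be just an integrable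
  function.\<close>

definition taylor_sum :: "(nat \<Rightarrow> complex) \<Rightarrow> complex \<Rightarrow> nat \<Rightarrow> complex \<Rightarrow> complex" where
  "taylor_sum a c k z = (\<Sum>i<k. a (k - i) * z ^ i / fact i) + c * z ^ k / fact k"

lemma taylor_sum_has_field_derivative:
  "(taylor_sum a c (Suc k) has_field_derivative taylor_sum a c k z) (at z)"
proof -
  have pw: "((\<lambda>z. b * z ^ i / fact i) has_field_derivative b * (of_nat i * z ^ (i - 1)) / fact i) (at z)"
    for b :: complex and i
    using DERIV_cdivide[OF DERIV_cmult[OF DERIV_power[OF DERIV_ident]]] by simp
  have fact: "b * (of_nat (Suc i) * y) / fact (Suc i) = b * y / fact i" for b y :: complex and i
    unfolding fact_Suc by (simp del: of_nat_Suc)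
  have "(taylor_sum a c (Suc k) has_field_derivative
      (\<Sum>i<Suc k. a (Suc k - i) * (of_nat i * z ^ (i - 1)) / fact i)
        + c * (of_nat (Suc k) * z ^ (Suc k - 1)) / fact (Suc k)) (at z)"
    unfolding taylor_sum_def[abs_def] by (intro DERIV_add DERIV_sum pw)
  also have "(\<Sum>i<Suc k. a (Suc k - i) * (of_nat i * z ^ (i - 1)) / fact i) = (\<Sum>i<k. a (k - i) * z ^ i / fact i)"
    unfolding sum.lessThan_Suc_shift using fact by (simp del: of_nat_Suc fact_Suc)
  also have "c * (of_nat (Suc k) * z ^ (Suc k - 1)) / fact (Suc k) = c * z ^ k / fact k"
    using fact[of c k "z ^ k"] by simp
  finally show ?thesis unfolding taylor_sum_def[of a c k z] .
qed

lemma taylor_sum_poly: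
  obtains q where "degree q \<le> k" "coeff q k = c / fact k" "\<And>z. poly q z = taylor_sum a c k z"
proof
  let ?q = "(\<Sum>i<k. monom (a (k - i) / fact i) i) + monom (c / fact k) k"
  show "degree ?q \<le> k"
    by (intro degree_add_le degree_sum_le) (auto intro: order_trans[OF degree_monom_le])
  have "(\<Sum>i<k. coeff (monom (a (k - i) / fact i) i) k) = 0"
    by (rule sum.neutral) auto
  then show "coeff ?q k = c / fact k" by (simp add: coeff_sum)
  show "poly ?q z = taylor_sum a c k z" for z
    by (simp add: taylor_sum_def poly_sum poly_monom)
qed

text \<open>Each further integration along \<open>w\<close> gains one order, by the mean value inequality.\<close>

lemma peano_expansion_chain:
  fixes g :: "nat \<Rightarrow> real \<Rightarrow> complex"
  assumes x0: "x0 \<in> {a<..<b}" and w: "\<And>x. x \<in> {a<..<b} \<Longrightarrow> (w has_vector_derivative w' x) (at x)"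
    and cw': "continuous_on {a<..<b} w'" and nz: "w' x0 \<noteq> 0"
    and g: "\<And>j x. 1 \<le> j \<Longrightarrow> x \<in> {a<..<b} \<Longrightarrow> (g (Suc j) has_vector_derivative g j x * w' x) (at x)"
    and g1: "(g 1 has_vector_derivative c * w' x0) (at x0)" and k: "1 \<le> k"
  shows "peano_expansion (g k) w k x0 c"
proof -
  let ?p = "taylor_sum (\<lambda>i. g i x0) c"
  define R where "R j x = g j x - ?p j (w x - w x0)" for j x
  have W: "((\<lambda>x. w x - w x0) has_vector_derivative w' x) (at x)" if "x \<in> {a<..<b}" for x
    using has_vector_derivative_diff[OF w[OF that] has_vector_derivative_const] by simp
  have R0: "R j x0 = 0" if "1 \<le> j" for j
  proof -
    have "(\<Sum>i<j. g (j - i) x0 * 0 ^ i / fact i) = (\<Sum>i<j. if i = 0 then g j x0 else 0)"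
      by (rule sum.cong) auto
    then show ?thesis using that by (simp add: R_def taylor_sum_def power_0_left)
  qed
  obtain B where B: "B > 0" "\<forall>\<^sub>F x in nhds x0. norm (w' x) < B"
  proof -
    have "isCont w' x0" using cw' x0 by (simp add: continuous_on_eq_continuous_at)
    then have "((\<lambda>x. norm (w' x)) \<longlongrightarrow> norm (w' x0)) (nhds x0)"
      by (intro tendsto_norm) (simp add: continuous_at tendsto_nhds_iff)
    then have "\<forall>\<^sub>F x in nhds x0. norm (w' x) < norm (w' x0) + 1"
      by (rule order_tendstoD) simp
    then show ?thesis by (intro that[of "norm (w' x0) + 1"]) (auto simp: add_nonneg_pos)
  qed
  have inI: "\<forall>\<^sub>F x in nhds x0. x \<in> {a<..<b}"
    using x0 by (intro eventually_nhds_in_open) auto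
  have est: "\<forall>e>0. \<exists>d>0. \<forall>x. \<bar>x - x0\<bar> < d \<longrightarrow> norm (R j x) \<le> e * \<bar>x - x0\<bar> ^ j" if "1 \<le> j" for j
    using that
  proof (induction j rule: dec_induct)
    case base
    \<comment> \<open>Order one is plain differentiability of \<open>g 1\<close> at the single point
      \<open>x0\<close>; this is the only place where \<open>x0\<close> has to be a good
      point.\<close>
    have "((\<lambda>x. g 1 x - c * (w x - w x0)) has_vector_derivative c * w' x0 - c * w' x0) (at x0)"
      by (intro has_vector_derivative_diff g1 bounded_linear.has_vector_derivative[OF bounded_linear_mult_right W] x0)
    then have "((\<lambda>x. g 1 x - c * (w x - w x0)) has_derivative (\<lambda>h. 0)) (at x0)"
      by (simp add: has_vector_derivative_def)
    then have "\<forall>e>0. \<exists>d>0. \<forall>x. norm (x - x0) < d \<longrightarrow>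
        norm (g 1 x - c * (w x - w x0) - (g 1 x0 - c * (w x0 - w x0)) - 0) \<le> e * norm (x - x0)"
      unfolding has_derivative_at_alt by blast
    then show ?case by (simp add: R_def taylor_sum_def algebra_simps)
  next
    case (step j)
    show ?case
    proof (intro allI impI)
      fix e :: real assume "e > 0"
      then have "e / B > 0" using B by simp
      then obtain d1 where d1: "d1 > 0" "\<And>x. \<bar>x - x0\<bar> < d1 \<Longrightarrow> norm (R j x) \<le> e / B * \<bar>x - x0\<bar> ^ j"
        using step.IH by blast
      obtain d2 where d2: "d2 > 0" "\<And>x. \<bar>x - x0\<bar> < d2 \<Longrightarrow> norm (w' x) < B \<and> x \<in> {a<..<b}"
        using eventually_conj[OF B(2) inI] unfolding eventually_nhds_metric dist_real_def by blast
      show "\<exists>d>0. \<forall>x. \<bar>x - x0\<bar> < d \<longrightarrow> norm (R (Suc j) x) \<le> e * \<bar>x - x0\<bar> ^ Suc j"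
      proof (intro exI[of _ "min d1 d2"] conjI allI impI)
        fix x assume x: "\<bar>x - x0\<bar> < min d1 d2"
        have "norm (R (Suc j) x - R (Suc j) x0) \<le> (e * \<bar>x - x0\<bar> ^ j) * norm (x - x0)"
        proof (rule differentiable_bound[where f' = "\<lambda>y h. h *\<^sub>R (R j y * w' y)"])
          show "convex (cball x0 \<bar>x - x0\<bar>)" by simp
          fix y assume y: "y \<in> cball x0 \<bar>x - x0\<bar>"
          then have y': "\<bar>y - x0\<bar> \<le> \<bar>x - x0\<bar>" by (simp add: dist_real_def abs_minus_commute)
          then have y2: "norm (w' y) < B" "y \<in> {a<..<b}" using d2(2)[of y] x by auto
          have "(R (Suc j) has_vector_derivative g j y * w' y - w' y * ?p j (w y - w x0)) (at y)"
            unfolding R_def[abs_def]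
            by (intro has_vector_derivative_diff g step y2
                field_vector_diff_chain_at[OF W taylor_sum_has_field_derivative, unfolded o_def])
          moreover have "g j y * w' y - w' y * ?p j (w y - w x0) = R j y * w' y"
            by (simp add: R_def algebra_simps)
          ultimately show "(R (Suc j) has_derivative (\<lambda>h. h *\<^sub>R (R j y * w' y))) (at y within cball x0 \<bar>x - x0\<bar>)"
            by (simp add: has_vector_derivative_def has_derivative_at_withinI)
          have "norm (R j y) * norm (w' y) \<le> (e / B * \<bar>x - x0\<bar> ^ j) * B"
          proof (rule mult_mono)
            have "norm (R j y) \<le> e / B * \<bar>y - x0\<bar> ^ j" using d1(2)[of y] y' x by auto
            also have "\<dots> \<le> e / B * \<bar>x - x0\<bar> ^ j"
              using y' \<open>e / B > 0\<close> by (intro mult_left_mono power_mono) auto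
            finally show "norm (R j y) \<le> e / B * \<bar>x - x0\<bar> ^ j" .
          qed (use y2 \<open>e > 0\<close> B(1) in auto)
          then have "norm (R j y * w' y) \<le> e * \<bar>x - x0\<bar> ^ j" using B by (simp add: norm_mult)
          then have "norm (h *\<^sub>R (R j y * w' y)) \<le> (e * \<bar>x - x0\<bar> ^ j) * norm h" for h :: real
            by (simp add: mult.commute mult_left_mono)
          then show "onorm (\<lambda>h. h *\<^sub>R (R j y * w' y)) \<le> e * \<bar>x - x0\<bar> ^ j" by (rule onorm_le)
        qed (auto simp: dist_real_def)
        then show "norm (R (Suc j) x) \<le> e * \<bar>x - x0\<bar> ^ Suc j" using R0[of "Suc j"] by (simp add: mult_ac)
      qed (use d1 d2 in auto)
    qed
  qed
  define m where "m = norm (w' x0) / 2"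
  have m: "m > 0" using nz by (simp add: m_def)
  \<comment> \<open>The estimates so far are in powers of \<open>x - x0\<close>. As
    \<open>w' x0 \<noteq> 0\<close>, this is bounded by a multiple of \<open>w x - w x0\<close>, and
    the factor \<open>m ^ k\<close> is absorbed in the choice of the constant.\<close>
  have low: "\<forall>\<^sub>F x in nhds x0. m * \<bar>x - x0\<bar> \<le> norm (w x - w x0)"
  proof -
    have "(w has_derivative (\<lambda>h. h *\<^sub>R w' x0)) (at x0)" using w[OF x0] by (simp add: has_vector_derivative_def)
    then obtain d where d: "d > 0" "\<And>x. norm (x - x0) < d \<Longrightarrow>
        norm (w x - w x0 - (x - x0) *\<^sub>R w' x0) \<le> m * norm (x - x0)"
      using m unfolding has_derivative_at_alt by blast
    have "m * \<bar>x - x0\<bar> \<le> norm (w x - w x0)" if "dist x x0 < d" for x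
    proof -
      have "norm ((x - x0) *\<^sub>R w' x0) \<le> norm (w x - w x0) + norm (w x - w x0 - (x - x0) *\<^sub>R w' x0)"
        by (metis norm_minus_commute norm_triangle_sub)
      moreover have "norm ((x - x0) *\<^sub>R w' x0) = 2 * m * \<bar>x - x0\<bar>" by (simp add: m_def)
      moreover have "norm (w x - w x0 - (x - x0) *\<^sub>R w' x0) \<le> m * \<bar>x - x0\<bar>"
        using d(2)[of x] that by (simp add: dist_norm)
      ultimately show ?thesis by linarith
    qed
    then show ?thesis unfolding eventually_nhds_metric using d by blast
  qed
  obtain q where q: "degree q \<le> k" "coeff q k = c / fact k" "\<And>z. poly q z = ?p k z"
    by (rule taylor_sum_poly) blast
  have "\<forall>\<^sub>F x in nhds x0. norm (g k x - poly q (w x - w x0)) \<le> e * norm (w x - w x0) ^ k" if "e > 0" for e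
  proof -
    have "e * m ^ k > 0" using that m by simp
    then have "\<forall>\<^sub>F x in nhds x0. norm (R k x) \<le> e * m ^ k * \<bar>x - x0\<bar> ^ k"
      using est[OF k] unfolding eventually_nhds_metric dist_real_def by blast
    then show ?thesis
      using low
    proof eventually_elim
      case (elim x)
      have "(m * \<bar>x - x0\<bar>) ^ k \<le> norm (w x - w x0) ^ k" using elim(2) m by (intro power_mono) auto
      then have "e * (m ^ k * \<bar>x - x0\<bar> ^ k) \<le> e * norm (w x - w x0) ^ k"
        using that by (simp add: power_mult_distrib)
      then show ?case using elim(1) by (simp add: R_def q mult.assoc)
    qed
  qed
  then show ?thesis unfolding peano_expansion_def using q by blast
qed

text \<open>Recentring \<open>p\<close> at \<open>w x0\<close> keeps its degree, so a vanishing
  coefficient at \<open>k\<close> stays zero: either the degree is below \<open>k\<close> or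
  \<open>p = 0\<close>.\<close>

lemma peano_expansion_add_poly:
  assumes "peano_expansion g w k x0 c" and "\<forall>\<^sub>F x in nhds x0. g' x = g x + poly p (w x)"
    and "coeff p k = 0" "degree p \<le> k"
  shows "peano_expansion g' w k x0 c"
proof -
  obtain q where q: "degree q \<le> k" "coeff q k = c / fact k"
    and e: "\<And>e. e > 0 \<Longrightarrow> \<forall>\<^sub>F x in nhds x0. norm (g x - poly q (w x - w x0)) \<le> e * norm (w x - w x0) ^ k"
    using assms(1) unfolding peano_expansion_def by blast
  define p' where "p' = pcompose p [:w x0, 1:]"
  have p': "poly p' (z - w x0) = poly p z" for z by (simp add: p'_def poly_pcompose)
  have dp': "degree p' = degree p" by (simp add: p'_def degree_pcompose)
  have "coeff p' k = 0"
  proof (cases "degree p = k")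
    case True
    then have "p = 0" using assms(3) leading_coeff_0_iff by metis
    then show ?thesis by (simp add: p'_def)
  next
    case False
    then show ?thesis using assms(4) dp' by (intro coeff_eq_0) simp
  qed
  moreover have "\<forall>\<^sub>F x in nhds x0. norm (g' x - poly (q + p') (w x - w x0)) \<le> e * norm (w x - w x0) ^ k"
    if "e > 0" for e
    using e[OF that] assms(2) by eventually_elim (simp add: p')
  ultimately show ?thesis
    unfolding peano_expansion_def
    by (intro exI[of _ "q + p'"]) (use q dp' assms(4) in \<open>auto intro: degree_add_le\<close>)
qed

text \<open>Letting \<open>z n\<close> tend to 0 kills the constant coefficient; division by
  \<open>z n\<close> then lowers the degree and the order together.\<close>

lemma small_poly_eq_0:
  fixes q :: "complex poly" and z :: "nat \<Rightarrow> complex"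
  assumes "degree q \<le> k" and z: "z \<longlonglongrightarrow> 0" "\<And>n. z n \<noteq> 0"
    and small: "\<And>e. e > 0 \<Longrightarrow> \<forall>\<^sub>F n in sequentially. norm (poly q (z n)) \<le> e * norm (z n) ^ k"
  shows "q = 0"
  using assms(1) small
proof (induction k arbitrary: q)
  case 0
  then obtain a where a: "q = [:a:]" using degree_eq_zeroE[of q] by auto
  show ?case
  proof (rule ccontr)
    assume "q \<noteq> 0"
    then have "norm a / 2 > 0" using a by simp
    from 0(2)[OF this] obtain n where "norm (poly q (z n)) \<le> norm a / 2 * norm (z n) ^ 0"
      using eventually_happens by force
    then show False using \<open>norm a / 2 > 0\<close> a by simp
  qed
next
  case (Suc k)
  obtain a q' where q: "q = pCons a q'" by (metis pCons_cases)
  have "a = 0"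
  proof -
    have t1: "(\<lambda>n. poly q (z n)) \<longlonglongrightarrow> poly q 0" by (intro tendsto_intros z)
    have "(\<lambda>n. norm (z n) ^ Suc k) \<longlonglongrightarrow> norm (0::complex) ^ Suc k" by (intro tendsto_intros z)
    then have "(\<lambda>n. norm (z n) ^ Suc k) \<longlonglongrightarrow> 0" by simp
    moreover have "\<forall>\<^sub>F n in sequentially. norm (poly q (z n)) \<le> norm (z n) ^ Suc k"
      using Suc.prems(2)[of 1] by simp
    ultimately have "(\<lambda>n. poly q (z n)) \<longlonglongrightarrow> 0" by (rule Lim_null_comparison[rotated])
    then have "poly q 0 = 0" using t1 LIMSEQ_unique by blast
    then show "a = 0" by (simp add: q)
  qed
  have "q' = 0"
  proof (rule Suc.IH)
    show "degree q' \<le> k" using Suc.prems(1) by (cases "q' = 0") (auto simp: q)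
    show "\<forall>\<^sub>F n in sequentially. norm (poly q' (z n)) \<le> e * norm (z n) ^ k" if "e > 0" for e
      using Suc.prems(2)[OF that]
    proof eventually_elim
      case (elim n)
      then have "norm (z n) * norm (poly q' (z n)) \<le> norm (z n) * (e * norm (z n) ^ k)"
        by (simp add: q \<open>a = 0\<close> norm_mult mult_ac)
      then show ?case using z(2)[of n] by simp
    qed
  qed
  then show ?case by (simp add: q \<open>a = 0\<close>)
qed

text \<open>Along the sequence both polynomials approximate the same values at the same argument
  \<open>z n \<noteq> 0\<close>, so their difference is \<open>o(|z n|^k)\<close> there and vanishes
  identically.\<close>

lemma peano_expansion_coincide:
  assumes 1: "peano_expansion g1 w1 k x0 c1" and 2: "peano_expansion g2 w2 k x0 c2"
    and x: "x \<longlonglongrightarrow> x0" "\<And>n. w1 (x n) \<noteq> w1 x0" "isCont w1 x0"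
    and eq: "\<And>n. g1 (x n) = g2 (x n)" "\<And>n. w1 (x n) = w2 (x n)" "w1 x0 = w2 x0"
  shows "c1 = c2"
proof -
  obtain q1 where q1: "degree q1 \<le> k" "coeff q1 k = c1 / fact k"
    and e1: "\<And>e. e > 0 \<Longrightarrow> \<forall>\<^sub>F x in nhds x0. norm (g1 x - poly q1 (w1 x - w1 x0)) \<le> e * norm (w1 x - w1 x0) ^ k"
    using 1 unfolding peano_expansion_def by blast
  obtain q2 where q2: "degree q2 \<le> k" "coeff q2 k = c2 / fact k"
    and e2: "\<And>e. e > 0 \<Longrightarrow> \<forall>\<^sub>F x in nhds x0. norm (g2 x - poly q2 (w2 x - w2 x0)) \<le> e * norm (w2 x - w2 x0) ^ k"
    using 2 unfolding peano_expansion_def by blast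
  have seq: "\<forall>\<^sub>F n in sequentially. P (x n)" if "\<forall>\<^sub>F x in nhds x0. P x" for P
    using x(1) that by (simp add: filterlim_iff)
  have "q1 - q2 = 0"
  proof (rule small_poly_eq_0[where z = "\<lambda>n. w1 (x n) - w1 x0"])
    show "degree (q1 - q2) \<le> k" using q1 q2 by (intro degree_diff_le)
    have "(\<lambda>n. w1 (x n)) \<longlonglongrightarrow> w1 x0" using x(1,3) by (rule isCont_tendsto_compose[rotated])
    then show "(\<lambda>n. w1 (x n) - w1 x0) \<longlonglongrightarrow> 0" by (simp add: LIM_zero_iff)
    show "w1 (x n) - w1 x0 \<noteq> 0" for n using x(2) by simp
    fix e :: real assume "e > 0"
    then have e: "e / 2 > 0" by simp
    show "\<forall>\<^sub>F n in sequentially. norm (poly (q1 - q2) (w1 (x n) - w1 x0)) \<le> e * norm (w1 (x n) - w1 x0) ^ k"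
      using seq[OF e1[OF e]] seq[OF e2[OF e]]
    proof eventually_elim
      case (elim n)
      let ?z = "w1 (x n) - w1 x0"
      have "poly (q1 - q2) ?z = (g2 (x n) - poly q2 ?z) - (g1 (x n) - poly q1 ?z)" by (simp add: eq)
      then have "norm (poly (q1 - q2) ?z) \<le> norm (g2 (x n) - poly q2 ?z) + norm (g1 (x n) - poly q1 ?z)"
        using norm_triangle_ineq4 by metis
      also have "\<dots> \<le> e / 2 * norm ?z ^ k + e / 2 * norm ?z ^ k"
        using elim eq by (intro add_mono) auto
      finally show ?case by (simp add: field_simps)
    qed
  qed
  then show ?thesis using q1 q2 by simp
qed

section \<open>The trace\<close>

context boundary_strip
begin

text \<open>This is \<open>twisted_deriv\<close> with \<open>m = 1 / \<zeta>x\<close> on all slices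
  at once: as functions on the plane its iterates are jointly continuous in \<open>(x, t)\<close>,
  which the limit \<open>t \<rightarrow> 0\<close> requires.\<close>

definition slice_deriv :: "(real \<times> real \<Rightarrow> complex) \<Rightarrow> real \<times> real \<Rightarrow> complex" where
  "slice_deriv \<phi> p = frechet_derivative (\<lambda>p. inverse (\<zeta>x p) * \<phi> p) (at p) (1, 0)"

definition noncritical :: "(real \<times> real) set" where
  "noncritical = {p \<in> D. \<zeta>x p \<noteq> 0}"

lemma open_noncritical: "open noncritical"
proof -
  have "open (D \<inter> \<zeta>x -` (- {0}))"
    by (intro continuous_open_preimage continuous_partials D) auto
  moreover have "D \<inter> \<zeta>x -` (- {0}) = noncritical" by (auto simp: noncritical_def)
  ultimately show ?thesis by simp
qed

lemma smooth_inverse_\<zeta>x: "smooth_on noncritical (\<lambda>p. inverse (\<zeta>x p))"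
  by (rule smooth_on_inverse[OF open_noncritical smooth_on_subset[OF smooth_partials(1)]])
    (auto simp: noncritical_def)

lemma smooth_row_inverse_\<zeta>x:
  assumes "\<And>x. x \<in> {-r<..<r} \<Longrightarrow> (x, t) \<in> noncritical"
  shows "smooth_on {-r<..<r} (\<lambda>x. inverse (\<zeta>x (x, t)))"
  by (rule smooth_on_compose[OF _ open_noncritical _ smooth_on_subset[OF smooth_on_row] smooth_inverse_\<zeta>x])
    (use assms in auto)

lemma smooth_slice_deriv:
  assumes "smooth_on UNIV \<phi>"
  shows "smooth_on noncritical ((slice_deriv ^^ k) (\<lambda>p. \<phi> (fst p)))"
proof (induction k)
  case 0
  have "smooth_on UNIV (\<lambda>p::real \<times> real. \<phi> (fst p))"
    by (rule smooth_on_compose[OF _ _ _ smooth_on_linear[OF bounded_linear_fst] assms]) auto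
  then show ?case using smooth_on_subset by auto
next
  case (Suc k)
  show ?case
    unfolding funpow.simps o_apply slice_deriv_def[abs_def]
    by (intro smooth_on_frechet smooth_on_mult open_noncritical smooth_inverse_\<zeta>x Suc[unfolded slice_deriv_def[abs_def]])
qed

lemma slice_deriv_eq_twisted_deriv:
  assumes "smooth_on UNIV \<phi>" and nc: "\<And>x. x \<in> {-r<..<r} \<Longrightarrow> (x, t) \<in> noncritical" and "x \<in> {-r<..<r}"
  shows "(slice_deriv ^^ k) (\<lambda>p. \<phi> (fst p)) (x, t)
    = (twisted_deriv (\<lambda>x. inverse (\<zeta>x (x, t))) ^^ k) \<phi> x"
  using assms(3)
proof (induction k arbitrary: x)
  case (Suc k)
  let ?g = "(slice_deriv ^^ k) (\<lambda>p. \<phi> (fst p))" and ?m = "\<lambda>x. inverse (\<zeta>x (x, t))"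
  have sm: "smooth_on noncritical (\<lambda>p. inverse (\<zeta>x p) * ?g p)"
    by (intro smooth_on_mult open_noncritical smooth_inverse_\<zeta>x smooth_slice_deriv assms(1))
  have "((\<lambda>p. inverse (\<zeta>x p) * ?g p) has_derivative
      frechet_derivative (\<lambda>p. inverse (\<zeta>x p) * ?g p) (at (x, t))) (at (x, t) within UNIV \<times> UNIV)"
    using smooth_on_has_derivative[OF sm nc[OF Suc.prems]] by simp
  from has_derivative_within_Times_partials(1)[OF this]
  have "((\<lambda>x. ?m x * ?g (x, t)) has_vector_derivative slice_deriv ?g (x, t)) (at x)"
    by (simp add: slice_deriv_def)
  then have "((\<lambda>x. ?m x * (twisted_deriv ?m ^^ k) \<phi> x) has_vector_derivative slice_deriv ?g (x, t)) (at x)"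
    by (rule has_vector_derivative_transform_within_open[of _ _ _ "{-r<..<r}"])
      (use Suc in auto)
  from frechet_derivative_at[OF this[unfolded has_vector_derivative_def], symmetric]
  show ?case by (simp add: twisted_deriv_def[of ?m "(twisted_deriv ?m ^^ k) \<phi>"])
qed simp

lemma integral_primitive_twisted_deriv:
  assumes ug: "is_primitive u g" and g: "continuous_on strip g" and t: "t \<in> {0<..T}"
    and nc: "\<And>x. x \<in> {-r<..<r} \<Longrightarrow> (x, t) \<in> noncritical"
    and \<psi>: "test_function {-r<..<r} \<psi>"
  shows "integral {-r..r} (\<lambda>x. u (x, t) * twisted_deriv (\<lambda>x. inverse (\<zeta>x (x, t))) \<psi> x)
    = - integral {-r..r} (\<lambda>x. g (x, t) * \<psi> x)"
proof -
  let ?m = "\<lambda>x. inverse (\<zeta>x (x, t))"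
  have tm: "test_function {-r<..<r} (\<lambda>x. ?m x * \<psi> x)"
    by (rule test_function_mult_smooth[OF \<psi>]) (use nc smooth_row_inverse_\<zeta>x in auto)
  have "integral {-r..r} (\<lambda>x. u (x, t) * deriv1 (\<lambda>x. ?m x * \<psi> x) x)
      = - integral {-r..r} (\<lambda>x. (g (x, t) * \<zeta>x (x, t)) * (?m x * \<psi> x))"
  proof (rule integral_test_by_parts[OF tm])
    fix x assume x: "x \<in> {-r<..<r}"
    then have "at x within {-r..r} = at x" by (intro at_within_interior) auto
    then show "((\<lambda>x. u (x, t)) has_vector_derivative g (x, t) * \<zeta>x (x, t)) (at x)"
      using is_primitive_partials(1)[OF ug _ t, of x] x by simp
  next
    have "continuous_on strip (\<lambda>p. g p * \<zeta>x p)"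
      by (auto intro!: continuous_intros g continuous_partials strip_D')
    then show "continuous_on {-r<..<r} (\<lambda>x. g (x, t) * \<zeta>x (x, t))"
      by (rule continuous_on_compose2) (use t in \<open>auto intro!: continuous_intros\<close>)
  qed (use r in auto)
  also have "integral {-r..r} (\<lambda>x. (g (x, t) * \<zeta>x (x, t)) * (?m x * \<psi> x))
      = integral {-r..r} (\<lambda>x. g (x, t) * \<psi> x)"
  proof (rule integral_cong)
    fix x assume "x \<in> {-r..r}"
    show "(g (x, t) * \<zeta>x (x, t)) * (?m x * \<psi> x) = g (x, t) * \<psi> x"
    proof (cases "x \<in> {-r<..<r}")
      case True
      then show ?thesis using nc by (simp add: noncritical_def)
    next
      case False
      then have "\<psi> x = 0" using \<psi> unfolding test_function_def by blast
      then show ?thesis by simp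
    qed
  qed
  finally show ?thesis by (simp add: twisted_deriv_def)
qed

text \<open>For \<open>t > 0\<close> the \<open>k\<close> integrations are moved onto the test
  function by parts. Then \<open>w\<close> and the iterated derivative are continuous up to
  \<open>t = 0\<close>, the limit passes under the integral, and uniqueness of limits identifies
  \<open>l\<close>.\<close>

lemma trace_of_iterated_primitive:
  assumes nz: "\<And>p. p \<in> {-r..r} \<times> {0..T} \<Longrightarrow> \<zeta>x p \<noteq> 0"
    and G: "\<And>j. is_primitive (G (Suc j)) (G j)" and F: "continuous_on strip (G 0)"
    and w: "continuous_on ({-r..r} \<times> {0..T}) w" "\<And>p. p \<in> strip \<Longrightarrow> w p = G k p"
    and \<phi>: "test_function {-r<..<r} \<phi>"
    and lim: "((\<lambda>t. integral {-r..r} (\<lambda>x. G 0 (x, t) * \<phi> x)) \<longlongrightarrow> l) (at_right 0)"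
  shows "l = (-1) ^ k *
    integral {-r..r} (\<lambda>x. w (x, 0) * (twisted_deriv (\<lambda>x. inverse (\<zeta>x (x, 0))) ^^ k) \<phi> x)"
proof -
  let ?T = "\<lambda>t. twisted_deriv (\<lambda>x. inverse (\<zeta>x (x, t)))"
  let ?V = "(slice_deriv ^^ k) (\<lambda>p. \<phi> (fst p))"
  have nc: "p \<in> noncritical" if "p \<in> {-r..r} \<times> {0..T}" for p
    using nz[OF that] strip_D[OF that] by (simp add: noncritical_def)
  have sm: "smooth_on UNIV \<phi>" using test_function_smooth[OF \<phi>] .
  have cG: "continuous_on strip (G j)" for j
    by (cases j) (use F G is_primitive_continuous in auto)
  have it: "integral {-r..r} (\<lambda>x. G 0 (x, t) * \<phi> x) = (-1) ^ j * integral {-r..r} (\<lambda>x. G j (x, t) * (?T t ^^ j) \<phi> x)"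
    if t: "t \<in> {0<..T}" for t j
  proof (induction j)
    case (Suc j)
    have "test_function {-r<..<r} ((?T t ^^ j) \<phi>)"
      by (rule test_function_twisted_deriv[OF smooth_row_inverse_\<zeta>x \<phi>]) (use nc t in auto)
    from integral_primitive_twisted_deriv[OF G cG t _ this, of j]
    have "integral {-r..r} (\<lambda>x. G (Suc j) (x, t) * (?T t ^^ Suc j) \<phi> x)
        = - integral {-r..r} (\<lambda>x. G j (x, t) * (?T t ^^ j) \<phi> x)"
      using nc t by auto
    then show ?case using Suc by simp
  qed simp
  have eqV: "integral {-r..r} (\<lambda>x. w (x, t) * (?T t ^^ k) \<phi> x) = integral {-r..r} (\<lambda>x. w (x, t) * ?V (x, t))"
    if "t \<in> {0..T}" for t
    by (rule integral_spike[of "{-r, r}"])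
      (use slice_deriv_eq_twisted_deriv[OF sm, of t] nc that in auto)
  have "continuous_on {0..T} (\<lambda>t. integral (cbox (-r) r) (\<lambda>x. w (x, t) * ?V (x, t)))"
  proof (rule integral_continuous_on_param)
    have "continuous_on ({-r..r} \<times> {0..T}) ?V"
      by (rule continuous_on_subset[OF smooth_on_continuous_on[OF smooth_slice_deriv[OF sm]]]) (use nc in auto)
    then have "continuous_on ({-r..r} \<times> {0..T}) (\<lambda>p. w p * ?V p)"
      by (intro continuous_intros w(1))
    then show "continuous_on ({0..T} \<times> cbox (-r) r) (\<lambda>(t, x). w (x, t) * ?V (x, t))"
      unfolding case_prod_unfold
      by (rule continuous_on_compose2) (auto intro!: continuous_intros)
  qed
  then have cV: "continuous_on {0..T} (\<lambda>t. integral {-r..r} (\<lambda>x. w (x, t) * ?V (x, t)))"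
    by simp
  then have "((\<lambda>t. (-1) ^ k * integral {-r..r} (\<lambda>x. w (x, t) * ?V (x, t)))
      \<longlongrightarrow> (-1) ^ k * integral {-r..r} (\<lambda>x. w (x, 0) * ?V (x, 0))) (at_right 0)"
    using T by (intro tendsto_intros) (auto simp: continuous_on_def at_within_Icc_at_right dest!: bspec[of _ _ 0])
  moreover have "\<forall>\<^sub>F t in at_right 0. (-1) ^ k * integral {-r..r} (\<lambda>x. w (x, t) * ?V (x, t))
      = integral {-r..r} (\<lambda>x. G 0 (x, t) * \<phi> x)"
  proof -
    have "(-1) ^ k * integral {-r..r} (\<lambda>x. w (x, t) * ?V (x, t)) = integral {-r..r} (\<lambda>x. G 0 (x, t) * \<phi> x)"
      if t: "0 < t" "t < T" for t
    proof -
      have "integral {-r..r} (\<lambda>x. w (x, t) * (?T t ^^ k) \<phi> x) = integral {-r..r} (\<lambda>x. G k (x, t) * (?T t ^^ k) \<phi> x)"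
        by (rule integral_cong) (use w(2) t in auto)
      then show ?thesis using it[of t k] eqV[of t] t by simp
    qed
    then show ?thesis using T by (auto simp: eventually_at_right)
  qed
  ultimately have "((\<lambda>t. integral {-r..r} (\<lambda>x. G 0 (x, t) * \<phi> x))
      \<longlongrightarrow> (-1) ^ k * integral {-r..r} (\<lambda>x. w (x, 0) * ?V (x, 0))) (at_right 0)"
    by (rule Lim_transform_eventually)
  then have "l = (-1) ^ k * integral {-r..r} (\<lambda>x. w (x, 0) * ?V (x, 0))"
    using lim tendsto_unique trivial_limit_at_right_real by blast
  then show ?thesis using eqV[of 0] T by simp
qed

text \<open>Integrating \<open>h\<close> along \<zeta> \<open>k\<close> times gives a function
  \<open>b k\<close> with the same \<open>k\<close>-th weak derivative as \<open>w\<close>. The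
  difference is a polynomial in \<zeta> of degree below \<open>k\<close>, which leaves the leading
  coefficient alone, and \<open>b k\<close> has the expansion wherever the first integral is
  differentiable with the expected derivative.\<close>

lemma trace_peano_expansion:
  assumes nz: "\<And>p. p \<in> {-r..r} \<times> {0..T} \<Longrightarrow> \<zeta>x p \<noteq> 0"
    and w: "continuous_on {-r..r} w"
    and h: "h absolutely_integrable_on {-r..r}" and k: "1 \<le> k"
    and tr: "\<And>\<phi>. test_function {-r<..<r} \<phi> \<Longrightarrow> integral {-r..r} (\<lambda>x. h x * \<phi> x)
      = (-1) ^ k * integral {-r..r} (\<lambda>x. w x * (twisted_deriv (\<lambda>x. inverse (\<zeta>x (x, 0))) ^^ k) \<phi> x)"
  obtains N where "negligible N"
    "\<And>x0. x0 \<in> {-r<..<r} \<Longrightarrow> x0 \<notin> N \<Longrightarrow> peano_expansion w (\<lambda>x. \<zeta> (x, 0)) k x0 (h x0)"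
proof -
  let ?I = "{-r<..<r}"
  let ?m = "\<lambda>x. inverse (\<zeta>x (x, 0))" and ?z = "\<lambda>x. \<zeta> (x, 0)" and ?z' = "\<lambda>x. \<zeta>x (x, 0)"
  let ?T = "twisted_deriv ?m"
  have sm: "smooth_on ?I ?m"
    by (rule smooth_row_inverse_\<zeta>x) (use nz strip_D T in \<open>auto simp: noncritical_def\<close>)
  have cz': "continuous_on {-r..r} ?z'"
    by (rule continuous_on_compose2[OF continuous_partials(2)[OF D(2)]])
      (use T in \<open>auto intro!: continuous_intros\<close>)
  have zd: "(?z has_vector_derivative ?z' x) (at x)" if "x \<in> ?I" for x
    using \<zeta>_partials(1)[of x 0 UNIV UNIV] strip_D[of "(x, 0)"] that T by auto
  define b where "b = rec_nat h (\<lambda>j u x. integral {-r..x} (\<lambda>s. u s * ?z' s))"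
  have b: "b 0 = h" "b (Suc j) = (\<lambda>x. integral {-r..x} (\<lambda>s. b j s * ?z' s))" for j
    by (simp_all add: b_def)
  have hz: "(\<lambda>s. h s * ?z' s) absolutely_integrable_on {-r..r}"
  proof -
    have "(\<lambda>s. ?z' s * h s) absolutely_integrable_on {-r..r}"
      by (rule absolutely_integrable_bounded_measurable_product
          [OF bounded_bilinear_mult[THEN bilinear_conv_bounded_bilinear[THEN iffD2]] _ _ _ h])
        (auto intro!: compact_imp_bounded compact_continuous_image cz' continuous_imp_measurable_on_sets_lebesgue)
    then show ?thesis by (simp add: mult.commute)
  qed
  have hzi: "(\<lambda>s. h s * ?z' s) integrable_on {-r..r}"
    using hz by (simp add: absolutely_integrable_on_def)
  have cb: "continuous_on {-r..r} (b (Suc j))" for j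
  proof (induction j)
    case 0
    show ?case unfolding b(2)[of 0] b(1) by (rule indefinite_integral_continuous_1[OF hzi])
  next
    case (Suc j)
    show ?case unfolding b(2)[of "Suc j"]
      by (rule indefinite_integral_continuous_1)
        (intro integrable_continuous_interval continuous_intros Suc cz')
  qed
  have db: "(b (Suc j) has_vector_derivative b j x * ?z' x) (at x)" if "1 \<le> j" "x \<in> ?I" for j x
  proof -
    obtain i where i: "j = Suc i" using \<open>1 \<le> j\<close> by (cases j) auto
    have "continuous_on {-r..r} (\<lambda>s. b j s * ?z' s)"
      unfolding i by (intro continuous_intros cb cz')
    from integral_has_vector_derivative[OF this, of x]
    have "(b (Suc j) has_vector_derivative b j x * ?z' x) (at x within {-r..r})"
      using that(2) unfolding b(2) by auto
    moreover have "at x within {-r..r} = at x" using that(2) by (intro at_within_interior) auto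
    ultimately show ?thesis by simp
  qed
  \<comment> \<open>The first step is separate: \<open>h\<close> is only integrable, so parts
    require the absolutely integrable version. From \<open>b 1\<close> on the functions are
    continuous and the next one is differentiable.\<close>
  have b1: "integral {-r..r} (\<lambda>x. b 1 x * ?T \<psi> x) = - integral {-r..r} (\<lambda>x. h x * \<psi> x)"
    if \<psi>: "test_function ?I \<psi>" for \<psi>
  proof -
    have tm: "test_function ?I (\<lambda>x. ?m x * \<psi> x)"
      by (rule test_function_mult_smooth[OF \<psi> _ sm]) auto
    note smm = test_function_smooth[OF tm]
    have "integral {-r..r} (\<lambda>x. integral {-r..x} (\<lambda>s. h s * ?z' s) * deriv1 (\<lambda>x. ?m x * \<psi> x) x)
        = integral {-r..r} (\<lambda>s. h s * ?z' s) * (?m r * \<psi> r) - integral {-r..r} (\<lambda>x. (h x * ?z' x) * (?m x * \<psi> x))"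
      by (rule integral_by_parts_absolutely_integrable(1)[OF hz])
        (use r smooth_on_has_vector_derivative[OF smm] smooth_on_continuous_on[OF smooth_on_frechet[OF smm]] in auto)
    moreover have "\<psi> r = 0" using \<psi> unfolding test_function_def by force
    moreover have "integral {-r..r} (\<lambda>x. (h x * ?z' x) * (?m x * \<psi> x)) = integral {-r..r} (\<lambda>x. h x * \<psi> x)"
      by (rule integral_cong) (use nz T in auto)
    ultimately show ?thesis by (simp add: b twisted_deriv_def)
  qed
  have tT: "test_function ?I ((?T ^^ j) \<phi>)" if "test_function ?I \<phi>" for \<phi> j
    by (rule test_function_twisted_deriv[OF sm that])
  have bj: "integral {-r..r} (\<lambda>x. h x * \<phi> x) = (-1) ^ j * integral {-r..r} (\<lambda>x. b j x * (?T ^^ j) \<phi> x)"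
    if \<phi>: "test_function ?I \<phi>" and "1 \<le> j" for \<phi> j
    using \<open>1 \<le> j\<close>
  proof (induction j rule: dec_induct)
    case base
    then show ?case using b1[OF \<phi>] by simp
  next
    case (step j)
    let ?\<psi> = "(?T ^^ j) \<phi>"
    have tm: "test_function ?I (\<lambda>x. ?m x * ?\<psi> x)"
      by (rule test_function_mult_smooth[OF tT[OF \<phi>] _ sm]) auto
    obtain i where i: "j = Suc i" using step by (cases j) auto
    have "integral {-r..r} (\<lambda>x. b (Suc j) x * deriv1 (\<lambda>x. ?m x * ?\<psi> x) x)
        = - integral {-r..r} (\<lambda>x. (b j x * ?z' x) * (?m x * ?\<psi> x))"
    proof (rule integral_test_by_parts[OF tm _ db])
      have "continuous_on {-r..r} (\<lambda>x. b j x * ?z' x)" unfolding i by (intro continuous_intros cb cz')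
      then show "continuous_on ?I (\<lambda>x. b j x * ?z' x)" by (rule continuous_on_subset) auto
    qed (use r step in auto)
    also have "integral {-r..r} (\<lambda>x. (b j x * ?z' x) * (?m x * ?\<psi> x)) = integral {-r..r} (\<lambda>x. b j x * ?\<psi> x)"
      by (rule integral_cong) (use nz T in auto)
    finally have "integral {-r..r} (\<lambda>x. b (Suc j) x * ?T ?\<psi> x) = - integral {-r..r} (\<lambda>x. b j x * ?\<psi> x)"
      by (simp only: twisted_deriv_def[of _ ?\<psi>])
    then show ?case using step.IH by (simp only: funpow.simps o_apply) simp
  qed
  obtain i where i: "k = Suc i" using k by (cases k) auto
  have cbk: "continuous_on {-r..r} (b k)" unfolding i by (rule cb)
  have sub: "?I \<subseteq> {-r..r}" by auto
  have "\<exists>c. \<forall>x\<in>?I. w x - b k x = (\<Sum>j<k. c j * ?z x ^ j)"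
  proof (rule iterated_du_Bois_Reymond[OF _ sm])
    show "continuous_on ?I (\<lambda>x. w x - b k x)"
      using w cbk by (intro continuous_intros continuous_on_subset[OF _ sub])
    show "(?z has_vector_derivative inverse (?m x)) (at x)" if "x \<in> ?I" for x using zd[OF that] by simp
    show "?m x \<noteq> 0" if "x \<in> ?I" for x using nz[of "(x, 0)"] that T by simp
    fix \<phi> assume \<phi>: "test_function ?I \<phi>"
    have int: "(\<lambda>x. v x * (?T ^^ k) \<phi> x) integrable_on {-r..r}" if "continuous_on {-r..r} v" for v
      by (intro integrable_continuous_interval continuous_intros that
          continuous_on_subset[OF smooth_on_continuous_on[OF test_function_smooth[OF tT[OF \<phi>]]]]) auto
    have "(-1) ^ k * integral {-r..r} (\<lambda>x. w x * (?T ^^ k) \<phi> x)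
        = (-1) ^ k * integral {-r..r} (\<lambda>x. b k x * (?T ^^ k) \<phi> x)"
      using tr[OF \<phi>] bj[OF \<phi> k] by simp
    then have "integral {-r..r} (\<lambda>x. w x * (?T ^^ k) \<phi> x) = integral {-r..r} (\<lambda>x. b k x * (?T ^^ k) \<phi> x)"
      by simp
    then show "integral {-r..r} (\<lambda>x. (w x - b k x) * (?T ^^ k) \<phi> x) = 0"
      unfolding left_diff_distrib by (subst integral_diff[OF int[OF w] int[OF cbk]]) simp
  qed (use r in auto)
  then obtain c where c: "\<And>x. x \<in> ?I \<Longrightarrow> w x - b k x = (\<Sum>j<k. c j * ?z x ^ j)" by blast
  define p where "p = (\<Sum>j<k. monom (c j) j)"
  have dp: "degree p \<le> k" unfolding p_def
    by (intro degree_sum_le) (auto intro: order_trans[OF degree_monom_le])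
  have p0: "coeff p k = 0" by (simp add: p_def coeff_sum)
  have pw: "poly p z = (\<Sum>j<k. c j * z ^ j)" for z by (simp add: p_def poly_sum poly_monom)
  obtain N where N: "negligible N"
    "\<And>x. x \<in> ?I \<Longrightarrow> x \<notin> N \<Longrightarrow> ((\<lambda>x. integral {-r..x} (\<lambda>s. h s * ?z' s)) has_vector_derivative h x * ?z' x) (at x)"
    using indefinite_integral_has_vector_derivative_ae[OF hzi] by blast
  have "peano_expansion w ?z k x0 (h x0)" if x0: "x0 \<in> ?I" "x0 \<notin> N" for x0
  proof (rule peano_expansion_add_poly[OF _ _ p0 dp])
    show "peano_expansion (b k) ?z k x0 (h x0)"
    proof (rule peano_expansion_chain[where g = b and w' = ?z', OF x0(1) zd _ _ db _ k])
      show "continuous_on ?I ?z'" using cz' by (rule continuous_on_subset) auto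
      show "?z' x0 \<noteq> 0" using nz[of "(x0, 0)"] x0 T by simp
      show "(b 1 has_vector_derivative h x0 * ?z' x0) (at x0)" using N(2)[OF x0] by (simp add: b)
    qed
    have "\<forall>\<^sub>F x in nhds x0. x \<in> ?I" using x0 by (intro eventually_nhds_in_open) auto
    then show "\<forall>\<^sub>F x in nhds x0. w x = b k x + poly p (?z x)"
      by eventually_elim (use c pw in \<open>simp add: algebra_simps\<close>)
  qed
  then show ?thesis using that N(1) by blast
qed

end

section \<open>Continuity of the iterated primitives up to the boundary\<close>

context boundary_strip
begin

lemma iterated_primitives:
  assumes F: "continuous_on strip F"
    and loc: "\<And>p. p \<in> strip \<Longrightarrow> \<exists>e>0. \<exists>H. \<forall>q\<in>ball p e. (H has_derivative (\<lambda>v. F q * d\<zeta> q v)) (at q)"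
  shows "continuous_on strip ((primitive ^^ j) F)"
    and "is_primitive ((primitive ^^ Suc j) F) ((primitive ^^ j) F)"
proof (induction j)
  case 0
  show "continuous_on strip ((primitive ^^ 0) F)" "is_primitive ((primitive ^^ Suc 0) F) ((primitive ^^ 0) F)"
    using F is_primitive_primitive_local[OF F loc] by simp_all
next
  case (Suc j)
  show "continuous_on strip ((primitive ^^ Suc j) F)" by (rule is_primitive_continuous[OF Suc(2)])
  show "is_primitive ((primitive ^^ Suc (Suc j)) F) ((primitive ^^ Suc j) F)"
    unfolding funpow.simps(2)[of "Suc j"] o_apply by (rule is_primitive_primitive[OF Suc(2,1)])
qed

text \<open>The exponents in the bounds for \<open>G 1\<close>, \<open>G 2\<close>, ... are
  \<open>n + 1/2\<close>, \<open>n - 1/2\<close>, ..., \<open>1/2\<close>, 0; half-integers never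
  hit the logarithmic exponent 1. So \<open>G (n + 2)\<close> is bounded and the next primitive
  extends, whence the bound on \<open>k\<close>.\<close>

lemma iterated_primitives_extend:
  assumes F: "continuous_on strip (G 0)" and G: "\<And>j. is_primitive (G (Suc j)) (G j)"
    and C: "C \<ge> 0" "\<And>t. t \<in> {0<..T} \<Longrightarrow>
      integral {-r..r} (\<lambda>x. norm (G 0 (x, t))) \<le> C * t powr (- (real n + 1/2))"
    and k: "k \<ge> n + 3"
  obtains w where "continuous_on ({-r..r} \<times> {0..T}) w" "\<And>p. p \<in> strip \<Longrightarrow> w p = G k p"
proof -
  define \<beta> where "\<beta> i = (if i \<le> n then real (n - i) + 1/2 else 0)" for i
  have \<beta>: "max 0 (\<beta> i - 1) = \<beta> (Suc i)" for i
  proof -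
    consider "i < n" | "i = n" | "i > n" by linarith
    then show ?thesis
    proof cases
      case 1
      then have "n - i = Suc (n - Suc i)" by simp
      then show ?thesis using 1 by (simp add: \<beta>_def del: diff_Suc_Suc)
    qed (auto simp: \<beta>_def)
  qed
  have \<beta>1: "\<beta> i \<noteq> 1" for i
  proof
    assume "\<beta> i = 1"
    moreover from this have "i \<le> n" by (auto simp: \<beta>_def split: if_splits)
    ultimately have "real (n - i) + 1/2 = 1" by (simp only: \<beta>_def if_True)
    then have "2 * real (n - i) = 1" by linarith
    then have "real (2 * (n - i)) = real 1" by (simp only: of_nat_mult of_nat_numeral of_nat_1)
    then have "2 * (n - i) = 1" by (simp only: of_nat_eq_iff)
    then show False by presburger
  qed
  have bound: "\<exists>C'\<ge>0. \<forall>x\<in>{-r..r}. \<forall>t\<in>{0<..T}. norm (G (Suc i) (x, t)) \<le> C' * t powr (- \<beta> i)" for i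
  proof (induction i)
    case 0
    show ?case
      by (rule primitive_growth_base[OF G F _ C(1)]) (use C(2) in \<open>auto simp: \<beta>_def\<close>)
  next
    case (Suc i)
    then obtain C' where "C' \<ge> 0" "\<forall>x\<in>{-r..r}. \<forall>t\<in>{0<..T}. norm (G (Suc i) (x, t)) \<le> C' * t powr (- \<beta> i)"
      by blast
    then show ?case
      using primitive_growth_step[OF G \<beta>1 \<open>C' \<ge> 0\<close>, of "Suc i"] \<beta> by simp
  qed
  obtain i where i: "k = Suc (Suc i)" "i > n"
    using k by (intro that[of "k - 2"]) auto
  obtain C' where "\<forall>x\<in>{-r..r}. \<forall>t\<in>{0<..T}. norm (G (Suc i) (x, t)) \<le> C' * t powr (- \<beta> i)"
    using bound by blast
  then have "norm (G (Suc i) p) \<le> C'" if "p \<in> strip" for p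
    using that i by (cases p) (auto simp: \<beta>_def)
  from primitive_extends[OF G[of "Suc i"] this] show ?thesis using that i by metis
qed

end

section \<open>Approximation by entire functions of the first integral\<close>

text \<open>The constant 3/8 is chosen so that \<open>(5/8)^2 - (3/8)^2 = 1/4\<close>. In this
  sector around the real axis the kernel \<open>exp (- n \<Delta>^2)\<close> is dominated by a real
  Gaussian.\<close>

lemma Re_square_ge:
  assumes "cmod (\<Delta> - of_real d) \<le> 3 / 8 * \<bar>d\<bar>"
  shows "Re (\<Delta>\<^sup>2) \<ge> d\<^sup>2 / 4"
proof -
  have "\<bar>Re \<Delta> - d\<bar> \<le> 3 / 8 * \<bar>d\<bar>" "\<bar>Im \<Delta>\<bar> \<le> 3 / 8 * \<bar>d\<bar>"
    using abs_Re_le_cmod[of "\<Delta> - of_real d"] abs_Im_le_cmod[of "\<Delta> - of_real d"] assms by auto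
  then have re: "5 / 8 * \<bar>d\<bar> \<le> \<bar>Re \<Delta>\<bar>" and im: "\<bar>Im \<Delta>\<bar> \<le> 3 / 8 * \<bar>d\<bar>" by linarith+
  have "(5 / 8 * \<bar>d\<bar>)\<^sup>2 \<le> \<bar>Re \<Delta>\<bar>\<^sup>2" "\<bar>Im \<Delta>\<bar>\<^sup>2 \<le> (3 / 8 * \<bar>d\<bar>)\<^sup>2"
    by (intro power_mono re im; simp)+
  then have "25 / 64 * d\<^sup>2 \<le> (Re \<Delta>)\<^sup>2" "(Im \<Delta>)\<^sup>2 \<le> 9 / 64 * d\<^sup>2"
    by (simp_all add: power2_eq_square)
  then show ?thesis by (simp add: Re_power2)
qed

definition gauss_mass :: "nat \<Rightarrow> real" where
  "gauss_mass n = integral {-1..1} (\<lambda>x. exp (- real n * x\<^sup>2))"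

text \<open>Crude, as the mass is of order \<open>n powr (-1/2)\<close>, but any polynomial lower
  bound suffices against exponentially small errors.\<close>

lemma gauss_mass_ge:
  assumes "n \<ge> 1"
  shows "gauss_mass n \<ge> exp (-1) / real n"
proof -
  have i: "(\<lambda>x. exp (- real n * x\<^sup>2)) integrable_on {a..b}" for a b
    by (intro integrable_continuous_interval continuous_intros)
  have "exp (-1) / real n = integral {0..1 / real n} (\<lambda>x. exp (-1))" using assms by simp
  also have "\<dots> \<le> integral {0..1 / real n} (\<lambda>x. exp (- real n * x\<^sup>2))"
  proof (rule integral_le)
    fix x assume x: "x \<in> {0..1 / real n}"
    then have "real n * x\<^sup>2 \<le> real n * (1 / real n)\<^sup>2" by (intro mult_left_mono power_mono) auto
    also have "\<dots> \<le> 1" using assms by (simp add: power2_eq_square)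
    finally show "exp (-1) \<le> exp (- real n * x\<^sup>2)" by simp
  qed (use i in auto)
  also have "\<dots> \<le> gauss_mass n"
    unfolding gauss_mass_def
    by (rule integral_subset_le) (use assms i in \<open>auto intro: order_trans[of _ 0]\<close>)
  finally show ?thesis .
qed

lemma gauss_mass_pos: "n \<ge> 1 \<Longrightarrow> gauss_mass n > 0"
  using gauss_mass_ge[of n] by (smt (verit) divide_pos_pos exp_gt_zero of_nat_0_less_iff zero_less_one_class.zero_le_one le_eq_less_or_eq less_le_trans zero_less_one)

text \<open>The substitution \<open>x = 2 v + x0\<close> turns the Gaussian with the exponent
  divided by 4 into the one that defines \<open>gauss_mass\<close>, at the price of the factor
  2.\<close>

lemma gauss_integral_le:
  assumes "x0 - 2 \<le> a" "b \<le> x0 + 2"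
  shows "integral {a..b} (\<lambda>x. exp (- real n * (x - x0)\<^sup>2 / 4)) \<le> 2 * gauss_mass n"
proof -
  let ?f = "\<lambda>v::real. exp (- real n * v\<^sup>2)"
  have "(?f has_integral gauss_mass n) (cbox (-1) 1)"
    unfolding gauss_mass_def cbox_interval
    by (intro integrable_integral integrable_continuous_interval continuous_intros)
  from has_integral_affinity[OF this, of "1/2" "- x0 / 2"]
  have "((\<lambda>x. ?f ((1/2) *\<^sub>R x + - x0 / 2)) has_integral 2 * gauss_mass n)
      ((\<lambda>x. 2 * x + x0) ` cbox (-1) 1)"
    by (simp add: algebra_simps)
  moreover have "(\<lambda>x. 2 * x + x0) ` cbox (-1) 1 = {x0 - 2..x0 + 2}"
    using image_affinity_atLeastAtMost[of 2 x0 "-1" 1] by simp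
  moreover have "?f ((1/2) *\<^sub>R x + - x0 / 2) = exp (- real n * (x - x0)\<^sup>2 / 4)" for x
  proof -
    have "((1/2) *\<^sub>R x + - x0 / 2)\<^sup>2 = (x - x0)\<^sup>2 / 4" by (simp add: power2_eq_square field_simps)
    then show ?thesis by (simp only: times_divide_eq_right)
  qed
  ultimately have hi: "((\<lambda>x. exp (- real n * (x - x0)\<^sup>2 / 4)) has_integral 2 * gauss_mass n) {x0 - 2..x0 + 2}"
    by (simp only:)
  have "integral {a..b} (\<lambda>x. exp (- real n * (x - x0)\<^sup>2 / 4))
      \<le> integral {x0 - 2..x0 + 2} (\<lambda>x. exp (- real n * (x - x0)\<^sup>2 / 4))"
    by (rule integral_subset_le)
      (use assms hi in \<open>auto intro!: integrable_continuous_interval continuous_intros\<close>)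
  then show ?thesis using hi by (simp add: integral_unique)
qed

text \<open>Move the end point of the path to \<open>1\<close> within the sector where the kernel decays.\<close>

lemma gauss_primitive_endpoint:
  assumes H: "\<And>w::complex. (H has_field_derivative exp (- of_nat n * w\<^sup>2)) (at w)"
    and d: "0 < \<delta>" "\<delta> \<le> d" "\<delta> \<le> 1" "d \<le> 2" and \<Delta>: "cmod (\<Delta> - of_real d) \<le> 3 / 8 * d"
  shows "cmod (H \<Delta> - H 1) \<le> 4 * exp (- real n * (\<delta>\<^sup>2 / 4))"
proof -
  have "cmod (H \<Delta> - H 1) \<le> exp (- real n * (\<delta>\<^sup>2 / 4)) * cmod (\<Delta> - 1)"
  proof (rule field_differentiable_bound[of "closed_segment \<Delta> 1" H "\<lambda>w. exp (- of_nat n * w\<^sup>2)"])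
    fix w assume "w \<in> closed_segment \<Delta> 1"
    then obtain l where l: "0 \<le> l" "l \<le> 1" "w = (1 - l) *\<^sub>R \<Delta> + l *\<^sub>R 1"
      by (auto simp: closed_segment_def)
    \<comment> \<open>The real point belonging to \<open>w\<close>. Moving towards 1 shrinks the
      deviation by the factor \<open>1 - l\<close>, so the whole segment stays in the sector of
      \<open>Re_square_ge\<close> with real part of size at least \<delta> for
      \<open>D\<close>.\<close>
    define D where "D = (1 - l) * d + l"
    have D: "\<delta> \<le> D" "(1 - l) * d \<le> D"
    proof -
      have "(1 - l) * \<delta> + l * \<delta> \<le> (1 - l) * d + l * 1" using l d by (intro add_mono mult_left_mono) auto
      then show "\<delta> \<le> D" by (simp add: D_def algebra_simps)
    qed (use l in \<open>simp add: D_def\<close>)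
    have "w - of_real D = (1 - l) *\<^sub>R (\<Delta> - of_real d)"
      by (simp add: l D_def scaleR_conv_of_real algebra_simps)
    then have "cmod (w - of_real D) = (1 - l) * cmod (\<Delta> - of_real d)" using l by simp
    also have "\<dots> \<le> (1 - l) * (3 / 8 * d)" using l \<Delta> by (intro mult_left_mono) auto
    also have "\<dots> = 3 / 8 * ((1 - l) * d)" by simp
    also have "\<dots> \<le> 3 / 8 * \<bar>D\<bar>" using D(2) by linarith
    finally have "Re (w\<^sup>2) \<ge> D\<^sup>2 / 4" by (rule Re_square_ge)
    moreover have "D\<^sup>2 \<ge> \<delta>\<^sup>2" using D d by (intro power_mono) auto
    ultimately have "real n * (\<delta>\<^sup>2 / 4) \<le> real n * Re (w\<^sup>2)" by (intro mult_left_mono) auto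
    then show "cmod (exp (- of_nat n * w\<^sup>2)) \<le> exp (- real n * (\<delta>\<^sup>2 / 4))"
      by simp
    show "(H has_field_derivative exp (- of_nat n * w\<^sup>2)) (at w within closed_segment \<Delta> 1)"
      by (rule has_field_derivative_at_within[OF H])
  qed auto
  also have "\<dots> \<le> exp (- real n * (\<delta>\<^sup>2 / 4)) * 4"
  proof (rule mult_left_mono)
    have "cmod \<Delta> \<le> cmod (of_real d) + cmod (\<Delta> - of_real d)" by (rule norm_triangle_sub)
    also have "\<dots> \<le> 3" using \<Delta> d by simp
    finally show "cmod (\<Delta> - 1) \<le> 4" using norm_triangle_ineq4[of \<Delta> 1] by simp
  qed simp
  finally show ?thesis by simp
qed

text \<open>The kernel is entire and even, so the odd part of any primitive is again a primitive.
  Oddness lets the left end of a slice be treated as a right end.\<close>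

lemma gauss_primitive:
  obtains H :: "complex \<Rightarrow> complex" where "\<And>w. (H has_field_derivative exp (- of_nat n * w\<^sup>2)) (at w)"
    "H 1 - H (-1) = of_real (gauss_mass n)" "\<And>w. H (- w) = - H w"
proof -
  have "(\<lambda>w. exp (- of_nat n * w\<^sup>2)) holomorphic_on UNIV" by (intro holomorphic_intros)
  then obtain H0 :: "complex \<Rightarrow> complex" where H0: "\<And>w. (H0 has_field_derivative exp (- of_nat n * w\<^sup>2)) (at w)"
    using holomorphic_convex_primitive'[of UNIV "\<lambda>w. exp (- of_nat n * w\<^sup>2)"] by auto
  define H where "H w = (H0 w - H0 (- w)) / 2" for w
  have H: "(H has_field_derivative exp (- of_nat n * w\<^sup>2)) (at w)" for w
  proof -
    have "((\<lambda>w. H0 (- w)) has_field_derivative exp (- of_nat n * (- w)\<^sup>2) * (-1)) (at w)"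
      by (rule DERIV_chain2[OF H0]) (auto intro!: derivative_eq_intros)
    then have "((\<lambda>w. (H0 w - H0 (- w)) / 2) has_field_derivative
        (exp (- of_nat n * w\<^sup>2) - exp (- of_nat n * (- w)\<^sup>2) * (-1)) / 2) (at w)"
      by (intro DERIV_cdivide DERIV_diff H0)
    then show ?thesis by (simp add: H_def[abs_def])
  qed
  have 1: "((\<lambda>x. exp (- of_nat n * (of_real x)\<^sup>2)) has_integral H (of_real 1) - H (of_real (-1))) {-1..1}"
  proof (rule fundamental_theorem_of_calculus)
    fix x :: real
    show "((\<lambda>x. H (of_real x)) has_vector_derivative exp (- of_nat n * (of_real x)\<^sup>2)) (at x within {-1..1})"
      by (rule has_vector_derivative_real_field[OF H])
  qed simp
  have 2: "((\<lambda>x. complex_of_real (exp (- real n * x\<^sup>2))) has_integral of_real (gauss_mass n)) {-1..1}"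
    unfolding gauss_mass_def
    by (intro has_integral_of_real integrable_integral integrable_continuous_interval continuous_intros)
  have "(\<lambda>x. complex_of_real (exp (- real n * x\<^sup>2))) = (\<lambda>x. exp (- of_nat n * (of_real x)\<^sup>2))"
    by (simp add: exp_of_real[symmetric])
  from has_integral_unique[OF 1 2[unfolded this]]
  have "H 1 - H (-1) = of_real (gauss_mass n)" by simp
  moreover have "H (- w) = - H w" for w by (simp add: H_def minus_divide_left)
  ultimately show ?thesis using that H by blast
qed

context boundary_strip
begin

text \<open>By the product rule the differential of \<open>u \<phi>(\<zeta>)\<close> is again a
  multiple of \<open>d\<zeta>\<close>, so factors that depend holomorphically on \<zeta> preserve
  closedness. This is what permits moving the slice of integration.\<close>

lemma is_primitive_mult_entire:
  assumes ug: "is_primitive u g" and cg: "continuous_on strip g"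
    and \<phi>: "\<And>y. (\<phi> has_field_derivative \<phi>' y) (at y)" "continuous_on UNIV \<phi>'"
  shows "is_primitive (primitive (\<lambda>p. u p * \<phi> (\<zeta> p))) (\<lambda>p. u p * \<phi> (\<zeta> p))"
proof (rule is_primitive_primitive)
  have c\<zeta>: "continuous_on strip \<zeta>" using strip_D' by (intro continuous_partials) auto
  have c\<phi>: "continuous_on UNIV \<phi>"
    using \<phi>(1) by (meson DERIV_isCont continuous_at_imp_continuous_on)
  show "continuous_on strip (\<lambda>p. u p * \<phi>' (\<zeta> p) + g p * \<phi> (\<zeta> p))"
    by (intro continuous_intros cg is_primitive_continuous[OF ug]
        continuous_on_compose2[OF \<phi>(2) c\<zeta>] continuous_on_compose2[OF c\<phi> c\<zeta>]) auto
  show "is_primitive (\<lambda>p. u p * \<phi> (\<zeta> p)) (\<lambda>p. u p * \<phi>' (\<zeta> p) + g p * \<phi> (\<zeta> p))"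
    unfolding is_primitive_def
  proof
    fix p assume p: "p \<in> strip"
    have "((\<lambda>p. \<phi> (\<zeta> p)) has_derivative (\<lambda>v. \<phi>' (\<zeta> p) * d\<zeta> p v)) (at p within strip)"
      using has_derivative_compose[OF \<zeta>_has_derivative[OF strip_D'[OF p]]
          \<phi>(1)[of "\<zeta> p", unfolded has_field_derivative_def]] .
    from has_derivative_mult[OF _ this, of u "\<lambda>v. g p * d\<zeta> p v"] ug p
    have "((\<lambda>p. u p * \<phi> (\<zeta> p)) has_derivative
        (\<lambda>v. u p * (\<phi>' (\<zeta> p) * d\<zeta> p v) + g p * d\<zeta> p v * \<phi> (\<zeta> p))) (at p within strip)"
      unfolding is_primitive_def by blast
    then show "((\<lambda>p. u p * \<phi> (\<zeta> p)) has_derivative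
        (\<lambda>v. (u p * \<phi>' (\<zeta> p) + g p * \<phi> (\<zeta> p)) * d\<zeta> p v)) (at p within strip)"
      by (rule back_subst[of "\<lambda>D. ((\<lambda>p. u p * \<phi> (\<zeta> p)) has_derivative D) (at p within strip)"])
        (simp add: algebra_simps)
  qed
qed

text \<open>After division by \<open>\<zeta>x (0, 0)\<close> each slice is a small perturbation of a
  real segment. The tolerance 1/4 leaves 1/8 of the admissible 3/8 for a shift in
  \<open>t\<close>.\<close>

lemma near_identity_slices:
  assumes "\<zeta>x (0, 0) \<noteq> 0"
  obtains a s where "0 < a" "a \<le> r" "a \<le> 1" "0 < s" "s \<le> T"
    "\<And>x t. x \<in> {-a..a} \<Longrightarrow> t \<in> {0..s} \<Longrightarrow> cmod (\<zeta>x (x, t) / \<zeta>x (0, 0) - 1) \<le> 1 / 4"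
    "\<And>x y t. x \<in> {-a..a} \<Longrightarrow> y \<in> {-a..a} \<Longrightarrow> t \<in> {0..s} \<Longrightarrow>
      cmod (\<zeta> (x, t) / \<zeta>x (0, 0) - \<zeta> (y, t) / \<zeta>x (0, 0) - of_real (x - y)) \<le> 1 / 4 * \<bar>x - y\<bar>"
proof -
  define c where "c = \<zeta>x (0, 0)"
  have c: "c \<noteq> 0" using assms by (simp add: c_def)
  have "continuous_on ({-r..r} \<times> {0..T}) (\<lambda>p. \<zeta>x p / c)"
    by (intro continuous_intros continuous_partials D) (use c in auto)
  then have "\<forall>e>0. \<exists>d>0. \<forall>p\<in>{-r..r} \<times> {0..T}. dist p (0, 0) < d \<longrightarrow> dist (\<zeta>x p / c) (\<zeta>x (0, 0) / c) < e"
    unfolding continuous_on_iff using r T by auto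
  moreover have "(1 / 4 :: real) > 0" by simp
  ultimately obtain d where d: "d > 0" "\<And>p. p \<in> {-r..r} \<times> {0..T} \<Longrightarrow> dist p (0, 0) < d \<Longrightarrow>
      dist (\<zeta>x p / c) (\<zeta>x (0, 0) / c) < 1 / 4"
    by meson
  define a where "a = min r (min 1 (d / 3))"
  define s where "s = min T (d / 3)"
  have as: "0 < a" "a \<le> r" "a \<le> 1" "0 < s" "s \<le> T" "a \<le> d / 3" "s \<le> d / 3"
    using r T d by (auto simp: a_def s_def)
  have near: "cmod (\<zeta>x (x, t) / c - 1) \<le> 1 / 4" if xt: "x \<in> {-a..a}" "t \<in> {0..s}" for x t
  proof -
    have "dist (x, t) (0, 0) \<le> \<bar>x\<bar> + \<bar>t\<bar>"
      using sqrt_sum_squares_le_sum_abs[of x t] by (simp add: dist_prod_def dist_real_def)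
    also have "\<dots> \<le> a + s" using xt by (intro add_mono) auto
    also have "\<dots> < d" using as d by linarith
    finally have "dist (\<zeta>x (x, t) / c) (\<zeta>x (0, 0) / c) < 1 / 4"
      by (intro d(2)) (use xt as in auto)
    then show ?thesis using c by (simp add: c_def dist_norm)
  qed
  have "cmod (\<zeta> (x, t) / c - \<zeta> (y, t) / c - of_real (x - y)) \<le> 1 / 4 * \<bar>x - y\<bar>"
    if xyt: "x \<in> {-a..a}" "y \<in> {-a..a}" "t \<in> {0..s}" for x y t
  proof -
    have "cmod ((\<zeta> (x, t) / c - of_real x) - (\<zeta> (y, t) / c - of_real y)) \<le> 1 / 4 * norm (x - y)"
    proof (rule differentiable_bound[of "{-a..a}" "\<lambda>x. \<zeta> (x, t) / c - of_real x"
          "\<lambda>x h. h *\<^sub>R (\<zeta>x (x, t) / c - 1)", OF _ _ _ xyt(1,2)])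
      fix x assume x: "x \<in> {-a..a}"
      have xD: "(x, t) \<in> D" using x xyt as strip_D by auto
      have "((\<lambda>x. \<zeta> (x, t) / c - of_real x) has_vector_derivative \<zeta>x (x, t) / c - 1) (at x within {-a..a})"
        by (intro has_vector_derivative_diff has_vector_derivative_divide \<zeta>_partials(1)[OF xD x UNIV_I]
            has_vector_derivative_of_real[of "\<lambda>x. x" 1, simplified] has_vector_derivative_id)
      then show "((\<lambda>x. \<zeta> (x, t) / c - of_real x) has_derivative (\<lambda>h. h *\<^sub>R (\<zeta>x (x, t) / c - 1))) (at x within {-a..a})"
        by (simp add: has_vector_derivative_def)
      have "norm (h *\<^sub>R (\<zeta>x (x, t) / c - 1)) \<le> 1 / 4 * norm h" for h :: real
        unfolding norm_scaleR real_norm_def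
        by (subst mult.commute) (intro mult_right_mono near[OF x xyt(3)] abs_ge_zero)
      then show "onorm (\<lambda>h. h *\<^sub>R (\<zeta>x (x, t) / c - 1)) \<le> 1 / 4" by (rule onorm_le)
    qed simp
    then show ?thesis by (simp add: algebra_simps)
  qed
  then show ?thesis using that[of a s] as near by (simp add: c_def)
qed

text \<open>
  The Baouendi-Treves argument: convolve on a slice with the Gaussian kernel \<open>exp (-n (z - \<zeta>)\<^sup>2)\<close>.
  Since \<open>w\<close> times the kernel has a primitive, moving the slice to \<open>t = 0\<close> costs only
  contributions from the vertical sides, which are exponentially small.
\<close>

lemma entire_approximation:
  assumes ug: "is_primitive u g" and cg: "continuous_on strip g"
    and cw: "continuous_on ({-r..r} \<times> {0..T}) w" and wu: "\<And>p. p \<in> strip \<Longrightarrow> w p = u p"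
    and nz: "\<zeta>x (0, 0) \<noteq> 0"
  obtains \<rho> \<tau> E where "0 < \<rho>" "\<rho> \<le> r" "0 < \<tau>" "\<tau> \<le> T"
    "\<And>n. E n holomorphic_on UNIV"
    "uniform_limit ({-\<rho>..\<rho>} \<times> {0..\<tau>}) (\<lambda>n p. E n (\<zeta> p)) w sequentially"
proof -
  define c where "c = \<zeta>x (0, 0)"
  have c: "c \<noteq> 0" using nz by (simp add: c_def)
  define z where "z p = \<zeta> p / c" for p
  obtain a s0 where a: "0 < a" "a \<le> r" "a \<le> 1" and s0: "0 < s0" "s0 \<le> T"
    and zx: "\<And>x t. x \<in> {-a..a} \<Longrightarrow> t \<in> {0..s0} \<Longrightarrow> cmod (\<zeta>x (x, t) / c - 1) \<le> 1 / 4"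
    and zdiff: "\<And>x y t. x \<in> {-a..a} \<Longrightarrow> y \<in> {-a..a} \<Longrightarrow> t \<in> {0..s0} \<Longrightarrow>
      cmod (z (x, t) - z (y, t) - of_real (x - y)) \<le> 1 / 4 * \<bar>x - y\<bar>"
    using near_identity_slices[OF nz] unfolding c_def z_def by blast
  obtain K where K: "K > 0" "\<And>p. p \<in> {-r..r} \<times> {0..T} \<Longrightarrow> norm (\<zeta>x p) \<le> K"
    "\<And>p. p \<in> {-r..r} \<times> {0..T} \<Longrightarrow> norm (\<zeta>t p) \<le> K"
    by (rule bounded_partials) blast
  have "bounded (w ` ({-r..r} \<times> {0..T}))"
    by (intro compact_imp_bounded compact_continuous_image cw compact_Times) auto
  then obtain M0 where M0: "\<And>p. p \<in> {-r..r} \<times> {0..T} \<Longrightarrow> norm (w p) \<le> M0"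
    unfolding bounded_iff by blast
  define M where "M = max 1 M0"
  have M: "M > 0" "\<And>p. p \<in> {-r..r} \<times> {0..T} \<Longrightarrow> norm (w p) \<le> M"
    using M0 by (auto simp: M_def intro: max.coboundedI2)
  define L where "L = K / cmod c"
  have L: "L > 0" using K c by (simp add: L_def)
  \<comment> \<open>With this height a vertical move changes \<open>z\<close> by at most
    \<open>a / 16\<close>, which is 1/8 of the distance \<open>a / 2\<close> that base points keep
    from the sides.\<close>
  define \<tau> where "\<tau> = min s0 (a / (16 * L))"
  have \<tau>: "0 < \<tau>" "\<tau> \<le> s0" "\<tau> \<le> T" "L * \<tau> \<le> a / 16" "\<tau> \<le> 1"
  proof -
    have "L * \<tau> \<le> L * (a / (16 * L))" using L by (intro mult_left_mono) (auto simp: \<tau>_def)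
    then show "L * \<tau> \<le> a / 16" using L by simp
  qed (use s0 a L T in \<open>auto simp: \<tau>_def\<close>)
  \<comment> \<open>Base points keep the distance \<open>a / 2\<close> from the sides
    \<open>-a\<close> and \<open>a\<close>; \<kappa> is the resulting exponential rate
    there.\<close>
  define \<rho> where "\<rho> = a / 2"
  define \<kappa> where "\<kappa> = (a / 2)\<^sup>2 / 4"
  have \<kappa>: "\<kappa> > 0" using a by (simp add: \<kappa>_def)

  \<comment> \<open>Decay of the kernel on the vertical sides\<close>
  have zt: "cmod (z (x, t) - z (x, s)) \<le> a / 16" if "x \<in> {-r..r}" "t \<in> {0..\<tau>}" "s \<in> {0..\<tau>}" for x t s
  proof -
    have "cmod (\<zeta> (x, t) - \<zeta> (x, s)) \<le> K * norm (t - s)"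
    proof (rule differentiable_bound[of "{0..\<tau>}" "\<lambda>t. \<zeta> (x, t)" "\<lambda>t h. h *\<^sub>R \<zeta>t (x, t)", OF _ _ _ that(2,3)])
      fix t assume t: "t \<in> {0..\<tau>}"
      have "(x, t) \<in> D" using that(1) t \<tau> strip_D by auto
      from \<zeta>_partials(2)[OF this UNIV_I t]
      show "((\<lambda>t. \<zeta> (x, t)) has_derivative (\<lambda>h. h *\<^sub>R \<zeta>t (x, t))) (at t within {0..\<tau>})"
        by (simp add: has_vector_derivative_def)
      have "norm (\<zeta>t (x, t)) \<le> K" using that(1) t \<tau> by (intro K) auto
      then have "norm (h *\<^sub>R \<zeta>t (x, t)) \<le> K * norm h" for h :: real
        unfolding norm_scaleR real_norm_def by (subst mult.commute) (rule mult_right_mono, auto)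
      then show "onorm (\<lambda>h. h *\<^sub>R \<zeta>t (x, t)) \<le> K" by (rule onorm_le)
    qed simp
    also have "\<dots> \<le> K * \<tau>" using that K by (intro mult_left_mono) auto
    finally have "cmod (\<zeta> (x, t) - \<zeta> (x, s)) / cmod c \<le> K * \<tau> / cmod c" by (intro divide_right_mono) auto
    also have "\<dots> = L * \<tau>" by (simp add: L_def)
    finally have "cmod (\<zeta> (x, t) - \<zeta> (x, s)) / cmod c \<le> a / 16" using \<tau>(4) by linarith
    moreover have "z (x, t) - z (x, s) = (\<zeta> (x, t) - \<zeta> (x, s)) / c" by (simp add: z_def diff_divide_distrib)
    ultimately show ?thesis by (simp only: norm_divide)
  qed
  define h where "h n Z p = exp (- of_nat n * (Z - z p)\<^sup>2)" for n :: nat and Z p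
  have norm_h: "cmod (h n Z p) \<le> exp (- real n * (d\<^sup>2 / 4))"
    if "cmod (Z - z p - of_real d) \<le> 3 / 8 * \<bar>d\<bar>" for n Z p d
  proof -
    have "real n * (d\<^sup>2 / 4) \<le> real n * Re ((Z - z p)\<^sup>2)"
      using Re_square_ge[OF that] by (intro mult_left_mono) auto
    then show ?thesis by (simp add: h_def)
  qed
  have side: "cmod (z (x0, t) - z (e, s) - of_real (x0 - e)) \<le> 3 / 8 * \<bar>x0 - e\<bar>" "a / 2 \<le> \<bar>x0 - e\<bar>"
    if "x0 \<in> {-\<rho>..\<rho>}" "t \<in> {0..\<tau>}" "s \<in> {0..\<tau>}" "e \<in> {-a, a}" for x0 t s e
  proof -
    show d: "a / 2 \<le> \<bar>x0 - e\<bar>" using that a by (auto simp: \<rho>_def abs_if)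
    have eq: "z (x0, t) - z (e, s) - of_real (x0 - e)
        = (z (x0, t) - z (x0, s)) + (z (x0, s) - z (e, s) - of_real (x0 - e))"
      by (simp add: algebra_simps)
    have "cmod (z (x0, t) - z (e, s) - of_real (x0 - e))
        \<le> cmod (z (x0, t) - z (x0, s)) + cmod (z (x0, s) - z (e, s) - of_real (x0 - e))"
      by (subst eq) (rule norm_triangle_ineq)
    also have "\<dots> \<le> a / 16 + 1 / 4 * \<bar>x0 - e\<bar>"
      by (intro add_mono zt zdiff) (use that a \<tau> in \<open>auto simp: \<rho>_def\<close>)
    also have "\<dots> \<le> 3 / 8 * \<bar>x0 - e\<bar>"
    proof -
      have "a / 16 + 1 / 4 * y \<le> 3 / 8 * y" if "a / 2 \<le> y" for y using that by argo
      from this[OF d] show ?thesis .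
    qed
    finally show "cmod (z (x0, t) - z (e, s) - of_real (x0 - e)) \<le> 3 / 8 * \<bar>x0 - e\<bar>" .
  qed
  have h_side: "cmod (h n (z (x0, t)) (e, s)) \<le> exp (- real n * \<kappa>)"
    if "x0 \<in> {-\<rho>..\<rho>}" "t \<in> {0..\<tau>}" "s \<in> {0..\<tau>}" "e \<in> {-a, a}" for n x0 t s e
  proof -
    note sd = side[OF that]
    have "(a / 2)\<^sup>2 \<le> \<bar>x0 - e\<bar>\<^sup>2" using sd(2) a by (intro power_mono) auto
    then have "real n * \<kappa> \<le> real n * ((x0 - e)\<^sup>2 / 4)"
      by (intro mult_left_mono) (auto simp: \<kappa>_def)
    then have "exp (- real n * ((x0 - e)\<^sup>2 / 4)) \<le> exp (- real n * \<kappa>)" by simp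
    then show ?thesis using norm_h[OF sd(1), of n] by linarith
  qed

  \<comment> \<open>The convolution on a slice and its dependence on the slice\<close>
  have cz: "continuous_on ({-r..r} \<times> {0..T}) z"
    unfolding z_def[abs_def] by (intro continuous_intros continuous_partials D) (use c in auto)
  have ch: "continuous_on ({-r..r} \<times> {0..T}) (h n Z)" for n Z
    unfolding h_def[abs_def] by (intro continuous_intros cz)
  \<comment> \<open>The Gaussian convolution of \<open>w\<close> on the slice at height
    \<open>s\<close>, evaluated at the complex point \<open>Z\<close> and not yet normalised;
    \<open>\<zeta>x / c\<close> is the complex line element.\<close>
  define I where "I n Z s = integral {-a..a} (\<lambda>x. h n Z (x, s) * w (x, s) * (\<zeta>x (x, s) / c))" for n Z s
  have cint: "continuous_on ({-r..r} \<times> {0..T}) (\<lambda>p. h n Z p * w p * (\<zeta>x p / c))" for n Z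
    by (intro continuous_intros ch cw continuous_partials D) (use c in auto)
  have row: "continuous_on {-a..a} (\<lambda>x. k (x, s))"
    if "continuous_on ({-r..r} \<times> {0..T}) k" "s \<in> {0..T}" for k :: "real \<times> real \<Rightarrow> complex" and s
    by (rule continuous_on_compose2[OF that(1)]) (use that a in \<open>auto intro!: continuous_intros\<close>)
  define B where "B = 2 * M * K / cmod c"
  have B: "B \<ge> 0" using M K by (simp add: B_def)
  \<comment> \<open>The closed form \<open>u \<phi>(\<zeta>) d\<zeta>\<close> has the primitive
    \<open>U\<close>, so \<open>c\<close> times the difference of the two slice integrals is a
    difference of vertical increments of \<open>U\<close>. These run along the sides, where the
    kernel is at most \<open>exp (- n \<kappa>)\<close>.\<close>
  have moveI: "cmod (I n (z (x0, t)) t - I n (z (x0, t)) s) \<le> B * exp (- real n * \<kappa>)"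
    if x0: "x0 \<in> {-\<rho>..\<rho>}" and t: "t \<in> {0..\<tau>}" and s: "0 < s" "s \<le> t" for n x0 t s
  proof -
    define Z where "Z = z (x0, t)"
    define \<phi> where "\<phi> y = exp (- of_nat n * (Z - y / c)\<^sup>2)" for y
    have h\<phi>: "h n Z p = \<phi> (\<zeta> p)" for p by (simp add: h_def \<phi>_def z_def)
    define U where "U = primitive (\<lambda>p. u p * \<phi> (\<zeta> p))"
    have U: "is_primitive U (\<lambda>p. u p * \<phi> (\<zeta> p))"
      unfolding U_def
    proof (rule is_primitive_mult_entire[OF ug cg])
      show "(\<phi> has_field_derivative (\<phi> y * (of_nat n * 2 * (Z - y / c) / c))) (at y)" for y
        unfolding \<phi>_def[abs_def] using c by (auto intro!: derivative_eq_intros)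
      show "continuous_on UNIV (\<lambda>y. \<phi> y * (of_nat n * 2 * (Z - y / c) / c))"
        unfolding \<phi>_def by (intro continuous_intros) (use c in auto)
    qed
    have hor: "U (a, t') - U (-a, t') = c * I n Z t'" if t': "t' \<in> {0<..\<tau>}" for t'
    proof -
      have "((\<lambda>x. u (x, t') * \<phi> (\<zeta> (x, t')) * \<zeta>x (x, t')) has_integral U (a, t') - U (-a, t')) {-a..a}"
        by (rule fundamental_theorem_of_calculus,
            use a in simp, rule has_vector_derivative_within_subset[OF is_primitive_partials(1)[OF U]])
          (use t' a \<tau> in auto)
      then have "U (a, t') - U (-a, t') = integral {-a..a} (\<lambda>x. u (x, t') * \<phi> (\<zeta> (x, t')) * \<zeta>x (x, t'))"
        by (simp add: integral_unique)
      also have "\<dots> = integral {-a..a} (\<lambda>x. c * (h n Z (x, t') * w (x, t') * (\<zeta>x (x, t') / c)))"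
        by (rule integral_cong) (use wu t' a \<tau> c in \<open>simp add: h\<phi>\<close>)
      also have "\<dots> = c * I n Z t'" unfolding I_def by (rule integral_mult_right)
      finally show ?thesis .
    qed
    have ver: "cmod (U (e, t) - U (e, s)) \<le> M * K * exp (- real n * \<kappa>)" if e: "e \<in> {-a, a}" for e
    proof -
      have "cmod (U (e, t) - U (e, s)) \<le> (M * K * exp (- real n * \<kappa>)) * norm (t - s)"
      proof (rule differentiable_bound[of "{s..t}" "\<lambda>t. U (e, t)" "\<lambda>t h. h *\<^sub>R (u (e, t) * \<phi> (\<zeta> (e, t)) * \<zeta>t (e, t))"])
        fix y assume y: "y \<in> {s..t}"
        have er: "e \<in> {-r..r}" using e a by auto
        have y': "y \<in> {0<..T}" "y \<in> {0..\<tau>}" using y s t \<tau> by auto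
        from is_primitive_partials(2)[OF U er y'(1)]
        show "((\<lambda>t. U (e, t)) has_derivative (\<lambda>h. h *\<^sub>R (u (e, y) * \<phi> (\<zeta> (e, y)) * \<zeta>t (e, y)))) (at y within {s..t})"
          unfolding has_vector_derivative_def[symmetric]
          by (rule has_vector_derivative_within_subset) (use s t \<tau> in auto)
        have "cmod (u (e, y)) * cmod (\<phi> (\<zeta> (e, y))) * cmod (\<zeta>t (e, y)) \<le> M * exp (- real n * \<kappa>) * K"
        proof (intro mult_mono)
          show "cmod (u (e, y)) \<le> M" using M(2)[of "(e, y)"] wu[of "(e, y)"] er y' by auto
          show "cmod (\<phi> (\<zeta> (e, y))) \<le> exp (- real n * \<kappa>)"
            using h_side[OF x0 t y'(2) e, of n] by (simp add: h\<phi>[symmetric] Z_def)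
          show "cmod (\<zeta>t (e, y)) \<le> K" using er y' by (intro K) auto
        qed (use M in auto)
        then have "norm (u (e, y) * \<phi> (\<zeta> (e, y)) * \<zeta>t (e, y)) \<le> M * K * exp (- real n * \<kappa>)"
          by (simp add: norm_mult mult_ac)
        then have "norm (k *\<^sub>R (u (e, y) * \<phi> (\<zeta> (e, y)) * \<zeta>t (e, y))) \<le> M * K * exp (- real n * \<kappa>) * norm k" for k :: real
          unfolding norm_scaleR real_norm_def by (subst mult.commute) (rule mult_right_mono, auto)
        then show "onorm (\<lambda>k. k *\<^sub>R (u (e, y) * \<phi> (\<zeta> (e, y)) * \<zeta>t (e, y))) \<le> M * K * exp (- real n * \<kappa>)"
          by (rule onorm_le)
      qed (use s in auto)
      also have "\<dots> \<le> (M * K * exp (- real n * \<kappa>)) * 1"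
        using s t \<tau> M K by (intro mult_left_mono) auto
      finally show ?thesis by simp
    qed
    have "c * (I n Z t - I n Z s) = (U (a, t) - U (a, s)) - (U (-a, t) - U (-a, s))"
      using hor[of t] hor[of s] s t by (simp add: algebra_simps)
    then have "cmod (c * (I n Z t - I n Z s)) \<le> cmod (U (a, t) - U (a, s)) + cmod (U (-a, t) - U (-a, s))"
      by (simp only: norm_triangle_ineq4)
    also have "\<dots> \<le> M * K * exp (- real n * \<kappa>) + M * K * exp (- real n * \<kappa>)"
      by (intro add_mono ver) auto
    finally have "cmod (c * (I n Z t - I n Z s)) \<le> 2 * M * K * exp (- real n * \<kappa>)" by (simp add: mult_ac)
    then have "cmod (I n Z t - I n Z s) * cmod c \<le> 2 * M * K * exp (- real n * \<kappa>)"
      by (simp only: norm_mult mult.commute[of "cmod c"])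
    then have "cmod (I n Z t - I n Z s) \<le> 2 * M * K * exp (- real n * \<kappa>) / cmod c"
      using c by (simp add: pos_le_divide_eq)
    then show ?thesis by (simp add: B_def Z_def)
  qed
  \<comment> \<open>The primitive exists only for \<open>s > 0\<close>; the slice at height 0 is
    reached by continuity of \<open>w\<close> on the closed strip.\<close>
  have move0: "cmod (I n (z (x0, t)) t - I n (z (x0, t)) 0) \<le> B * exp (- real n * \<kappa>)"
    if x0: "x0 \<in> {-\<rho>..\<rho>}" and t: "t \<in> {0..\<tau>}" for n x0 t
  proof (cases "t = 0")
    case False
    let ?Z = "z (x0, t)"
    have "continuous_on {0..T} (\<lambda>s. integral (cbox (-a) a) (\<lambda>x. h n ?Z (x, s) * w (x, s) * (\<zeta>x (x, s) / c)))"
    proof (rule integral_continuous_on_param)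
      show "continuous_on ({0..T} \<times> cbox (-a) a) (\<lambda>(s, x). h n ?Z (x, s) * w (x, s) * (\<zeta>x (x, s) / c))"
        unfolding case_prod_unfold
        by (rule continuous_on_compose2[OF cint]) (use a in \<open>auto intro!: continuous_intros\<close>)
    qed
    then have "continuous_on {0..T} (I n ?Z)" by (simp add: I_def[abs_def])
    then have "(I n ?Z \<longlongrightarrow> I n ?Z 0) (at_right 0)"
      using T by (auto simp: continuous_on_def at_within_Icc_at_right dest!: bspec[of _ _ 0])
    then have "((\<lambda>s. cmod (I n ?Z t - I n ?Z s)) \<longlongrightarrow> cmod (I n ?Z t - I n ?Z 0)) (at_right 0)"
      by (intro tendsto_intros)
    moreover have "\<forall>\<^sub>F s in at_right 0. cmod (I n ?Z t - I n ?Z s) \<le> B * exp (- real n * \<kappa>)"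
      unfolding eventually_at_right_field
      by (rule exI[of _ t]) (use False t moveI[OF x0 t] in auto)
    ultimately show ?thesis by (intro tendsto_upperbound) auto
  qed (use B in simp)

  \<comment> \<open>The approximate identity\<close>
  define J where "J n x0 t = integral {-a..a} (\<lambda>x. h n (z (x0, t)) (x, t) * (\<zeta>x (x, t) / c))" for n x0 t
  \<comment> \<open>The kernel integrates over the slice to nearly its mass on a real segment: both
    are increments of the same entire \<open>H\<close>, and corresponding end points lie in the same
    sector of decay.\<close>
  have Jest: "cmod (J n x0 t - of_real (gauss_mass n)) \<le> 8 * exp (- real n * \<kappa>)"
    if x0: "x0 \<in> {-\<rho>..\<rho>}" and t: "t \<in> {0..\<tau>}" for n x0 t
  proof -
    obtain H :: "complex \<Rightarrow> complex" where H: "\<And>w. (H has_field_derivative exp (- of_nat n * w\<^sup>2)) (at w)"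
      "H 1 - H (-1) = of_real (gauss_mass n)" "\<And>w. H (- w) = - H w"
      by (rule gauss_primitive[of n]) blast
    define \<Delta> where "\<Delta> x = z (x, t) - z (x0, t)" for x
    have "((\<lambda>x. h n (z (x0, t)) (x, t) * (\<zeta>x (x, t) / c)) has_integral H (\<Delta> a) - H (\<Delta> (-a))) {-a..a}"
    proof (rule fundamental_theorem_of_calculus)
      fix x assume x: "x \<in> {-a..a}"
      have xD: "(x, t) \<in> D" using x t a \<tau> strip_D by auto
      have "(\<Delta> has_vector_derivative \<zeta>x (x, t) / c - 0) (at x within {-a..a})"
        unfolding \<Delta>_def[abs_def] z_def
        by (intro has_vector_derivative_diff has_vector_derivative_divide \<zeta>_partials(1)[OF xD x UNIV_I]
            has_vector_derivative_const)
      from field_vector_diff_chain_within[OF this has_field_derivative_at_within[OF H(1)]]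
      show "((\<lambda>x. H (\<Delta> x)) has_vector_derivative h n (z (x0, t)) (x, t) * (\<zeta>x (x, t) / c)) (at x within {-a..a})"
        by (simp add: o_def h_def \<Delta>_def power2_commute mult.commute)
    qed (use a in simp)
    then have J: "J n x0 t = H (\<Delta> a) - H (\<Delta> (-a))" unfolding J_def by (rule integral_unique)
    have "cmod (H (\<Delta> a) - H 1) \<le> 4 * exp (- real n * ((a / 2)\<^sup>2 / 4))"
    proof (rule gauss_primitive_endpoint[OF H(1), where d = "a - x0"])
      have "cmod (- (z (x0, t) - z (a, t) - of_real (x0 - a))) \<le> 3 / 8 * \<bar>x0 - a\<bar>"
        unfolding norm_minus_cancel by (rule side(1)[OF x0 t t]) simp
      then show "cmod (\<Delta> a - of_real (a - x0)) \<le> 3 / 8 * (a - x0)"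
        using x0 a by (simp add: \<Delta>_def \<rho>_def algebra_simps)
    qed (use x0 a in \<open>auto simp: \<rho>_def\<close>)
    moreover have "cmod (H (- \<Delta> (-a)) - H 1) \<le> 4 * exp (- real n * ((a / 2)\<^sup>2 / 4))"
    proof (rule gauss_primitive_endpoint[OF H(1), where d = "x0 + a"])
      show "cmod (- \<Delta> (-a) - of_real (x0 + a)) \<le> 3 / 8 * (x0 + a)"
        using side(1)[OF x0 t t, of "-a"] x0 a by (simp add: \<Delta>_def \<rho>_def)
    qed (use x0 a in \<open>auto simp: \<rho>_def\<close>)
    moreover have "J n x0 t - of_real (gauss_mass n) = (H (\<Delta> a) - H 1) + (H (- \<Delta> (-a)) - H 1)"
      using H(2) H(3)[of "\<Delta> (-a)"] H(3)[of 1] by (simp add: J algebra_simps)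
    ultimately show ?thesis
      using norm_triangle_ineq[of "H (\<Delta> a) - H 1" "H (- \<Delta> (-a)) - H 1"] by (simp add: \<kappa>_def)
  qed
  \<comment> \<open>Within distance \<eta> uniform continuity of \<open>w\<close> is used, beyond it
    the decay of the kernel; the factor \<open>5 / 4\<close> bounds the line element.\<close>
  have IJ: "cmod (I n (z (x0, t)) t - w (x0, t) * J n x0 t)
      \<le> 5 / 2 * \<epsilon> * gauss_mass n + 5 * M * exp (- real n * (\<eta>\<^sup>2 / 4))"
    if x0: "x0 \<in> {-\<rho>..\<rho>}" and t: "t \<in> {0..\<tau>}" and "\<epsilon> > 0" "\<eta> > 0"
      and uc: "\<And>p q. p \<in> {-r..r} \<times> {0..T} \<Longrightarrow> q \<in> {-r..r} \<times> {0..T} \<Longrightarrow> dist q p < \<eta> \<Longrightarrow> dist (w q) (w p) < \<epsilon>"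
    for n x0 t \<epsilon> \<eta>
  proof -
    have tT: "t \<in> {0..T}" using t \<tau> by auto
    have x0r: "x0 \<in> {-r..r}" "x0 \<in> {-a..a}" using x0 a by (auto simp: \<rho>_def)
    let ?k = "\<lambda>x. h n (z (x0, t)) (x, t) * w (x, t) * (\<zeta>x (x, t) / c)"
    let ?j = "\<lambda>x. h n (z (x0, t)) (x, t) * (\<zeta>x (x, t) / c)"
    have i1: "?k integrable_on {-a..a}"
      by (rule integrable_continuous_interval[OF row[OF cint tT]])
    have "continuous_on ({-r..r} \<times> {0..T}) (\<lambda>p. h n (z (x0, t)) p * (\<zeta>x p / c))"
      by (intro continuous_intros ch continuous_partials D) (use c in auto)
    from integrable_continuous_interval[OF row[OF this tT]]
    have i2: "?j integrable_on {-a..a}" .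
    have eq: "I n (z (x0, t)) t - w (x0, t) * J n x0 t = integral {-a..a} (\<lambda>x. ?k x - w (x0, t) * ?j x)"
      by (simp only: I_def J_def integral_diff[OF i1 integrable_on_mult_right[OF i2]] integral_mult_right)
    have "cmod (I n (z (x0, t)) t - w (x0, t) * J n x0 t) \<le> integral {-a..a} (\<lambda>x. 5 / 4 * \<epsilon> * exp (- real n * (x - x0)\<^sup>2 / 4)
        + 5 / 2 * M * exp (- real n * (\<eta>\<^sup>2 / 4)))"
      unfolding eq
    proof (rule integral_norm_bound_integral)
      show "(\<lambda>x. ?k x - w (x0, t) * ?j x) integrable_on {-a..a}"
        by (intro integrable_diff integrable_on_mult_right i1 i2)
      show "(\<lambda>x. 5 / 4 * \<epsilon> * exp (- real n * (x - x0)\<^sup>2 / 4)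
          + 5 / 2 * M * exp (- real n * (\<eta>\<^sup>2 / 4))) integrable_on {-a..a}"
        by (intro integrable_continuous_interval continuous_intros) auto
      fix x assume x: "x \<in> {-a..a}"
      have xr: "x \<in> {-r..r}" using x a by auto
      have "cmod (z (x0, t) - z (x, t) - of_real (x0 - x)) \<le> 1 / 4 * \<bar>x0 - x\<bar>"
        by (rule zdiff) (use x x0r t \<tau> in auto)
      then have "cmod (z (x0, t) - z (x, t) - of_real (x0 - x)) \<le> 3 / 8 * \<bar>x0 - x\<bar>"
        by (rule order_trans) (intro mult_right_mono, auto)
      from norm_h[OF this, of n]
      have nh: "cmod (h n (z (x0, t)) (x, t)) \<le> exp (- real n * (x - x0)\<^sup>2 / 4)"
        by (simp add: power2_commute)
      have nx: "cmod (\<zeta>x (x, t) / c) \<le> 5 / 4"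
      proof -
        have "cmod (\<zeta>x (x, t) / c) \<le> cmod 1 + cmod (\<zeta>x (x, t) / c - 1)" by (rule norm_triangle_sub)
        then show ?thesis using zx[OF x, of t] t \<tau> by auto
      qed
      have "cmod (h n (z (x0, t)) (x, t)) * cmod (w (x, t) - w (x0, t))
          \<le> \<epsilon> * exp (- real n * (x - x0)\<^sup>2 / 4) + 2 * M * exp (- real n * (\<eta>\<^sup>2 / 4))"
      proof (cases "\<bar>x - x0\<bar> < \<eta>")
        case True
        have "cmod (w (x, t) - w (x0, t)) < \<epsilon>"
          using uc[of "(x0, t)" "(x, t)"] True xr x0r tT by (simp add: dist_prod_def dist_norm)
        then have "cmod (h n (z (x0, t)) (x, t)) * cmod (w (x, t) - w (x0, t))
            \<le> exp (- real n * (x - x0)\<^sup>2 / 4) * \<epsilon>"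
          by (intro mult_mono nh) auto
        then show ?thesis using M(1) by (simp add: mult.commute add_increasing2)
      next
        case False
        have "\<eta>\<^sup>2 \<le> \<bar>x - x0\<bar>\<^sup>2" using False \<open>\<eta> > 0\<close> by (intro power_mono) auto
        then have "real n * (\<eta>\<^sup>2 / 4) \<le> real n * ((x - x0)\<^sup>2 / 4)" by (intro mult_left_mono) auto
        then have "exp (- real n * (x - x0)\<^sup>2 / 4) \<le> exp (- real n * (\<eta>\<^sup>2 / 4))" by simp
        then have "cmod (h n (z (x0, t)) (x, t)) \<le> exp (- real n * (\<eta>\<^sup>2 / 4))" using nh by linarith
        moreover have "cmod (w (x, t) - w (x0, t)) \<le> M + M"
          by (rule order_trans[OF norm_triangle_ineq4 add_mono]) (use M(2) xr x0r tT in auto)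
        ultimately have "cmod (h n (z (x0, t)) (x, t)) * cmod (w (x, t) - w (x0, t))
            \<le> exp (- real n * (\<eta>\<^sup>2 / 4)) * (M + M)"
          by (intro mult_mono) auto
        also have "\<dots> = 2 * M * exp (- real n * (\<eta>\<^sup>2 / 4))" by simp
        finally show ?thesis using \<open>\<epsilon> > 0\<close> by (simp add: add_increasing)
      qed
      from mult_mono[OF this nx _ norm_ge_zero]
      have "cmod (h n (z (x0, t)) (x, t)) * cmod (w (x, t) - w (x0, t)) * cmod (\<zeta>x (x, t) / c)
          \<le> (\<epsilon> * exp (- real n * (x - x0)\<^sup>2 / 4) + 2 * M * exp (- real n * (\<eta>\<^sup>2 / 4))) * (5 / 4)"
        using \<open>\<epsilon> > 0\<close> M(1) by (simp add: add_nonneg_nonneg)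
      moreover have "?k x - w (x0, t) * ?j x = h n (z (x0, t)) (x, t) * (w (x, t) - w (x0, t)) * (\<zeta>x (x, t) / c)"
        by (simp add: algebra_simps)
      ultimately have "cmod (?k x - w (x0, t) * ?j x)
          \<le> (\<epsilon> * exp (- real n * (x - x0)\<^sup>2 / 4) + 2 * M * exp (- real n * (\<eta>\<^sup>2 / 4))) * (5 / 4)"
        by (simp only: norm_mult)
      also have "\<dots> = 5 / 4 * \<epsilon> * exp (- real n * (x - x0)\<^sup>2 / 4) + 5 / 2 * M * exp (- real n * (\<eta>\<^sup>2 / 4))"
        by (simp add: algebra_simps)
      finally show "cmod (?k x - w (x0, t) * ?j x)
          \<le> 5 / 4 * \<epsilon> * exp (- real n * (x - x0)\<^sup>2 / 4) + 5 / 2 * M * exp (- real n * (\<eta>\<^sup>2 / 4))" .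
    qed
    also have "\<dots> = 5 / 4 * \<epsilon> * integral {-a..a} (\<lambda>x. exp (- real n * (x - x0)\<^sup>2 / 4))
        + 2 * a * (5 / 2 * M * exp (- real n * (\<eta>\<^sup>2 / 4)))"
      by (subst integral_add) (use a in \<open>auto intro!: integrable_continuous_interval continuous_intros\<close>)
    also have "\<dots> \<le> 5 / 4 * \<epsilon> * (2 * gauss_mass n) + 2 * (5 / 2 * M * exp (- real n * (\<eta>\<^sup>2 / 4)))"
    proof (intro add_mono mult_left_mono mult_right_mono gauss_integral_le)
      show "2 * a \<le> 2" using a by simp
    qed (use \<open>\<epsilon> > 0\<close> M a x0 in \<open>auto simp: \<rho>_def\<close>)
    finally show ?thesis by simp
  qed
  \<comment> \<open>The variable enters only through the kernel, which is entire in it, and the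
    slice is fixed at \<open>t = 0\<close>; hence \<open>E n\<close> is entire.\<close>
  define E where "E n y = I n (y / c) 0 / of_real (gauss_mass n)" for n y
  have E: "E n holomorphic_on UNIV" for n
  proof -
    have "(\<lambda>y. integral (cbox (-a) a) (\<lambda>x. h n (y / c) (x, 0) * w (x, 0) * (\<zeta>x (x, 0) / c))) holomorphic_on UNIV"
    proof (rule leibniz_rule_holomorphic)
      let ?d = "\<lambda>y x. h n (y / c) (x, 0) * (- of_nat n * (2 * (y / c - z (x, 0)) * (1 / c)))
          * w (x, 0) * (\<zeta>x (x, 0) / c)"
      show "((\<lambda>y. h n (y / c) (x, 0) * w (x, 0) * (\<zeta>x (x, 0) / c)) has_field_derivative ?d y x) (at y within UNIV)" for y x
        unfolding h_def using c by (auto intro!: derivative_eq_intros)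
      show "(\<lambda>x. h n (y / c) (x, 0) * w (x, 0) * (\<zeta>x (x, 0) / c)) integrable_on cbox (-a) a" for y
        using integrable_continuous_interval[OF row[OF cint]] T by simp
      have cc: "continuous_on (UNIV \<times> cbox (-a) a) (\<lambda>q::complex \<times> real. k (snd q, 0))"
        if "continuous_on ({-r..r} \<times> {0..T}) k" for k :: "real \<times> real \<Rightarrow> complex"
        by (rule continuous_on_compose2[OF that]) (use a T in \<open>auto intro!: continuous_intros\<close>)
      show "continuous_on (UNIV \<times> cbox (-a) a) (\<lambda>(y, x). ?d y x)"
        unfolding case_prod_unfold h_def
        by (intro continuous_intros cc cz cw continuous_partials D) (use c in auto)
    qed auto
    then have "(\<lambda>y. I n (y / c) 0) holomorphic_on UNIV" by (simp add: I_def)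
    then show ?thesis
      unfolding E_def[abs_def]
      by (cases "gauss_mass n = 0") (auto intro!: holomorphic_intros)
  qed
  have "uniform_limit ({-\<rho>..\<rho>} \<times> {0..\<tau>}) (\<lambda>n p. E n (\<zeta> p)) w sequentially"
    unfolding uniform_limit_iff
  proof (intro allI impI)
    fix e :: real assume "e > 0"
    \<comment> \<open>Then the main term \<open>5 / 2 * \<epsilon>\<close> equals
      \<open>e / 2\<close>. The other half is for the exponentially small terms, which are divided
      by a mass of at least \<open>exp (-1) / n\<close>.\<close>
    define \<epsilon> where "\<epsilon> = e / 5"
    have \<epsilon>: "\<epsilon> > 0" using \<open>e > 0\<close> by (simp add: \<epsilon>_def)
    have "uniformly_continuous_on ({-r..r} \<times> {0..T}) w"
      by (intro compact_uniformly_continuous cw compact_Times) auto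
    then obtain \<eta> where \<eta>: "\<eta> > 0" "\<And>p q. p \<in> {-r..r} \<times> {0..T} \<Longrightarrow> q \<in> {-r..r} \<times> {0..T} \<Longrightarrow> dist q p < \<eta> \<Longrightarrow> dist (w q) (w p) < \<epsilon>"
      unfolding uniformly_continuous_on_def using \<epsilon> by metis
    define \<theta> where "\<theta> = min \<kappa> (\<eta>\<^sup>2 / 4)"
    have \<theta>: "\<theta> > 0" using \<kappa> \<eta> by (simp add: \<theta>_def)
    define A where "A = B + 8 * M + 5 * M"
    have A: "A > 0" using B M by (simp add: A_def add_nonneg_pos)
    have "(\<lambda>n. A * (exp 1 * (real n * exp (- real n * \<theta>)))) \<longlonglongrightarrow> 0"
      using \<theta> by real_asymp
    then have ev: "\<forall>\<^sub>F n in sequentially. A * (exp 1 * (real n * exp (- real n * \<theta>))) < e / 2"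
      by (rule order_tendstoD) (use \<open>e > 0\<close> in simp)
    show "\<forall>\<^sub>F n in sequentially. \<forall>p\<in>{-\<rho>..\<rho>} \<times> {0..\<tau>}. dist (E n (\<zeta> p)) (w p) < e"
      using ev eventually_ge_at_top[of 1]
    proof eventually_elim
      case (elim n)
      show ?case
      proof
        fix p assume "p \<in> {-\<rho>..\<rho>} \<times> {0..\<tau>}"
        then obtain x0 t where p: "p = (x0, t)" and x0: "x0 \<in> {-\<rho>..\<rho>}" and t: "t \<in> {0..\<tau>}" by auto
        let ?g = "gauss_mass n" and ?I = "\<lambda>s. I n (z (x0, t)) s"
        have g: "?g \<ge> exp (-1) / real n" "?g > 0" using gauss_mass_ge gauss_mass_pos elim(2) by auto
        have pr: "p \<in> {-r..r} \<times> {0..T}" using p x0 t a \<tau> by (auto simp: \<rho>_def)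
        have eq: "?I 0 - w p * of_real ?g = (?I 0 - ?I t) + (?I t - w p * J n x0 t) + w p * (J n x0 t - of_real ?g)"
          by (simp add: algebra_simps)
        have "cmod (?I 0 - w p * of_real ?g) \<le> B * exp (- real n * \<kappa>) + (5 / 2 * \<epsilon> * ?g + 5 * M * exp (- real n * (\<eta>\<^sup>2 / 4)))
            + M * (8 * exp (- real n * \<kappa>))"
          unfolding eq
        proof (intro norm_triangle_mono)
          show "cmod (?I 0 - ?I t) \<le> B * exp (- real n * \<kappa>)"
            using move0[OF x0 t] by (simp add: norm_minus_commute)
          show "cmod (?I t - w p * J n x0 t) \<le> 5 / 2 * \<epsilon> * ?g + 5 * M * exp (- real n * (\<eta>\<^sup>2 / 4))"
            unfolding p by (rule IJ[OF x0 t \<epsilon> \<eta>])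
          show "cmod (w p * (J n x0 t - of_real ?g)) \<le> M * (8 * exp (- real n * \<kappa>))"
            unfolding norm_mult using M(1) by (intro mult_mono M(2)[OF pr] Jest[OF x0 t]) auto
        qed
        also have "\<dots> \<le> B * exp (- real n * \<theta>) + (5 / 2 * \<epsilon> * ?g + 5 * M * exp (- real n * \<theta>))
            + M * (8 * exp (- real n * \<theta>))"
        proof -
          have "exp (- real n * \<kappa>) \<le> exp (- real n * \<theta>)" "exp (- real n * (\<eta>\<^sup>2 / 4)) \<le> exp (- real n * \<theta>)"
          proof -
            have "real n * \<theta> \<le> real n * \<kappa>" "real n * \<theta> \<le> real n * (\<eta>\<^sup>2 / 4)"
              unfolding \<theta>_def by (intro mult_left_mono min.cobounded1 min.cobounded2 of_nat_0_le_iff)+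
            then show "exp (- real n * \<kappa>) \<le> exp (- real n * \<theta>)" "exp (- real n * (\<eta>\<^sup>2 / 4)) \<le> exp (- real n * \<theta>)"
              by simp_all
          qed
          then show ?thesis using B M(1) \<epsilon> g(2) by (intro add_mono mult_left_mono) auto
        qed
        also have "\<dots> = 5 / 2 * \<epsilon> * ?g + A * exp (- real n * \<theta>)" by (simp add: A_def algebra_simps)
        finally have "cmod (?I 0 - w p * of_real ?g) / ?g \<le> (5 / 2 * \<epsilon> * ?g + A * exp (- real n * \<theta>)) / ?g"
          using g by (intro divide_right_mono) auto
        also have "\<dots> = e / 2 + A * exp (- real n * \<theta>) / ?g"
          using g by (simp add: add_divide_distrib \<epsilon>_def)
        also have "A * exp (- real n * \<theta>) / ?g \<le> A * exp (- real n * \<theta>) / (exp (-1) / real n)"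
          using g A elim(2) by (intro divide_left_mono) auto
        also have "A * exp (- real n * \<theta>) / (exp (-1) / real n) = A * (exp 1 * (real n * exp (- real n * \<theta>)))"
          by (simp add: exp_minus field_simps)
        finally have "cmod (?I 0 - w p * of_real ?g) / ?g < e" using elim(1) by simp
        moreover have "E n (\<zeta> p) - w p = (?I 0 - w p * of_real ?g) / of_real ?g"
          using g by (simp add: E_def z_def p diff_divide_distrib)
        ultimately show "dist (E n (\<zeta> p)) (w p) < e"
          using g by (simp add: dist_norm norm_divide)
      qed
    qed
  qed
  moreover have "0 < \<rho>" "\<rho> \<le> r" using a by (auto simp: \<rho>_def)
  ultimately show ?thesis using that[of \<rho> \<tau> E] \<tau> E by blast
qed

end

section \<open>A Fatou theorem above a Lipschitz graph\<close>

lemma higher_deriv_poly_shift: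
  fixes q :: "complex poly"
  assumes "degree q \<le> k"
  shows "(deriv ^^ k) (\<lambda>z. poly q (z - z0)) z = fact k * coeff q k"
proof -
  have D: "(deriv ^^ i) (\<lambda>z. poly q (z - z0)) = (\<lambda>z. poly ((pderiv ^^ i) q) (z - z0))" for i
  proof (induction i)
    case (Suc i)
    have "((\<lambda>z. poly p (z - z0)) has_field_derivative poly (pderiv p) (z - z0)) (at z)" for p :: "complex poly" and z
      by (auto intro!: derivative_eq_intros poly_DERIV[THEN DERIV_chain2])
    then show ?case by (auto simp: Suc intro!: DERIV_imp_deriv)
  qed simp
  have "degree ((pderiv ^^ k) q) = 0" using assms by (simp add: degree_higher_pderiv)
  then obtain a where a: "(pderiv ^^ k) q = [:a:]" by (rule degree_eq_zeroE)
  have "a = coeff ((pderiv ^^ k) q) 0" by (simp add: a)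
  also have "\<dots> = fact k * coeff q k" by (simp add: coeff_higher_pderiv pochhammer_fact)
  finally show ?thesis by (simp add: D a)
qed

text \<open>
  With \<open>z\<^sup>* = z\<^sub>0 - i s\<close>, the maximum modulus principle for \<open>(F - q) s / (z - z\<^sup>*)\<^bsup>k+1\<^esup>\<close> bounds
  \<open>F - q\<close> by \<open>\<epsilon> s\<^sup>k\<close> on a disc around \<open>z\<^sub>0 + i s\<close> of radius comparable to \<open>s\<close>: the extra factor
  \<open>s / (z - z\<^sup>*)\<close> makes the part of the boundary away from \<open>z\<^sub>0\<close> negligible. Cauchy's inequality
  then bounds the \<open>k\<close>-th derivative.
\<close>

lemma higher_deriv_above_graph:
  fixes b0 :: "real \<Rightarrow> real" and F :: "complex \<Rightarrow> complex" and q :: "complex poly" and x0 d c \<Lambda> \<epsilon> :: real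
  assumes z0: "z0 = Complex x0 (b0 x0)" and d: "d > 0" and c: "c > 0" and \<Lambda>: "\<Lambda> \<ge> 0"
    and lip: "\<And>x y. \<bar>b0 x - b0 y\<bar> \<le> \<Lambda> * \<bar>x - y\<bar>"
    and V: "V = {z. \<bar>Re z - x0\<bar> < d \<and> b0 (Re z) < Im z \<and> Im z < b0 (Re z) + c}"
    and W: "W = {z. \<bar>Re z - x0\<bar> \<le> d \<and> b0 (Re z) \<le> Im z \<and> Im z \<le> b0 (Re z) + c}"
    and cF: "continuous_on W F" and hF: "F holomorphic_on V"
    and k: "k \<ge> 1" and q: "degree q \<le> k"
    and bot: "\<And>e. e > 0 \<Longrightarrow> \<forall>\<^sub>F x in nhds x0.
      cmod (F (Complex x (b0 x)) - poly q (Complex x (b0 x) - z0)) \<le> e * cmod (Complex x (b0 x) - z0) ^ k"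
    and "\<epsilon> > 0"
  shows "\<exists>\<eta>>0. \<forall>s. 0 < s \<longrightarrow> s < \<eta> \<longrightarrow>
    cmod ((deriv ^^ k) F (Complex x0 (b0 x0 + s)) - fact k * coeff q k) \<le> \<epsilon>"
proof -
  define \<Lambda>1 where "\<Lambda>1 = 1 + \<Lambda>"
  have \<Lambda>1: "\<Lambda>1 \<ge> 1" using \<Lambda> by (simp add: \<Lambda>1_def)
  have cb: "continuous_on UNIV b0"
    unfolding continuous_on_iff
  proof (intro ballI allI impI)
    fix x and e :: real assume e: "e > 0"
    show "\<exists>\<delta>>0. \<forall>x'\<in>UNIV. dist x' x < \<delta> \<longrightarrow> dist (b0 x') (b0 x) < e"
    proof (intro exI[of _ "e / \<Lambda>1"] conjI ballI impI)
      fix x' assume x': "dist x' x < e / \<Lambda>1"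
      have "dist (b0 x') (b0 x) \<le> \<Lambda> * \<bar>x' - x\<bar>"
        unfolding dist_real_def by (rule lip)
      also have "\<dots> \<le> \<Lambda>1 * \<bar>x' - x\<bar>" by (intro mult_right_mono) (auto simp: \<Lambda>1_def)
      also have "\<dots> < e" using x' \<Lambda>1 by (simp add: dist_real_def field_simps)
      finally show "dist (b0 x') (b0 x) < e" .
    qed (use e \<Lambda>1 in simp)
  qed
  have cbR: "continuous_on UNIV (\<lambda>z. b0 (Re z))"
    by (rule continuous_on_compose2[OF cb]) (auto intro!: continuous_intros)
  have clW: "closed W"
    unfolding W by (intro closed_Collect_conj closed_Collect_le continuous_intros cbR)
  have opV: "open V"
    unfolding V by (intro open_Collect_conj open_Collect_less continuous_intros cbR)
  have VW: "V \<subseteq> W" by (auto simp: V W)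
  have bW: "bounded W"
  proof -
    have "cmod z \<le> (\<bar>x0\<bar> + d) + (\<bar>b0 x0\<bar> + \<Lambda> * d + c)" if "z \<in> W" for z
    proof -
      have 1: "\<bar>Re z - x0\<bar> \<le> d" "b0 (Re z) \<le> Im z" "Im z \<le> b0 (Re z) + c" using that by (auto simp: W)
      have "\<bar>b0 (Re z) - b0 x0\<bar> \<le> \<Lambda> * d"
        by (rule order_trans[OF lip mult_left_mono[OF 1(1) \<Lambda>]])
      then show ?thesis using cmod_le[of z] 1 by (simp only: abs_le_iff) linarith
    qed
    then show ?thesis unfolding bounded_iff by blast
  qed
  have compW: "compact W" using clW bW by (simp add: compact_eq_bounded_closed)
  define U where "U z = F z - poly q (z - z0)" for z
  have cU: "continuous_on W U" unfolding U_def[abs_def] by (intro continuous_intros cF)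
  have hU: "U holomorphic_on V" unfolding U_def[abs_def] by (intro holomorphic_intros hF)
  obtain M0 where "\<forall>y\<in>U ` W. cmod y \<le> M0"
    using compact_imp_bounded[OF compact_continuous_image[OF cU compW]] unfolding bounded_iff by blast
  define M where "M = max 1 M0"
  have M: "M \<ge> 1" "cmod (U z) \<le> M" if "z \<in> W" for z
    using \<open>\<forall>y\<in>U ` W. cmod y \<le> M0\<close> that by (auto simp: M_def intro: max.coboundedI2)
  have M1: "M \<ge> 1" by (simp add: M_def)
  \<comment> \<open>The factor that Cauchy's inequality on radius
    \<open>s / (2 * \<Lambda>1)\<close> attaches to \<open>\<epsilon>1\<close> when the function is
    at most \<open>\<epsilon>1 * \<Lambda>1 * 3 ^ Suc k * s ^ k\<close>.\<close>
  define C where "C = fact k * \<Lambda>1 * 3 ^ Suc k * (2 * \<Lambda>1) ^ k"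
  have C: "C > 0" using \<Lambda>1 by (simp add: C_def)
  define \<epsilon>1 where "\<epsilon>1 = \<epsilon> / C"
  have \<epsilon>1: "\<epsilon>1 > 0" using C \<open>\<epsilon> > 0\<close> by (simp add: \<epsilon>1_def)
  have "\<epsilon>1 / \<Lambda>1 ^ k > 0" using \<epsilon>1 \<Lambda>1 by simp
  from bot[OF this] obtain \<delta>0 where \<delta>0: "\<delta>0 > 0"
    "\<And>x. \<bar>x - x0\<bar> < \<delta>0 \<Longrightarrow> cmod (U (Complex x (b0 x))) \<le> \<epsilon>1 / \<Lambda>1 ^ k * cmod (Complex x (b0 x) - z0) ^ k"
    unfolding eventually_nhds_metric dist_real_def U_def by blast
  have near: "cmod (U (Complex x (b0 x))) \<le> \<epsilon>1 * \<bar>x - x0\<bar> ^ k" if "\<bar>x - x0\<bar> < \<delta>0" for x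
  proof -
    have "cmod (Complex x (b0 x) - z0) \<le> \<bar>x - x0\<bar> + \<bar>b0 x - b0 x0\<bar>"
      using cmod_le[of "Complex x (b0 x) - z0"] by (simp add: z0)
    also have "\<dots> \<le> \<Lambda>1 * \<bar>x - x0\<bar>" using lip[of x x0] by (simp add: \<Lambda>1_def distrib_right)
    finally have "cmod (Complex x (b0 x) - z0) ^ k \<le> (\<Lambda>1 * \<bar>x - x0\<bar>) ^ k" by (intro power_mono) auto
    then have "\<epsilon>1 / \<Lambda>1 ^ k * cmod (Complex x (b0 x) - z0) ^ k \<le> \<epsilon>1 / \<Lambda>1 ^ k * (\<Lambda>1 * \<bar>x - x0\<bar>) ^ k"
      using \<epsilon>1 \<Lambda>1 by (intro mult_left_mono) auto
    also have "\<dots> = \<epsilon>1 * \<bar>x - x0\<bar> ^ k" using \<Lambda>1 by (simp add: power_mult_distrib)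
    finally show ?thesis using \<delta>0(2)[OF that] by linarith
  qed
  \<comment> \<open>A lower bound, independent of \<open>s\<close>, for the distance from
    \<open>zs\<close> to all boundary points of \<open>V\<close> outside the part of the graph where
    the expansion is effective.\<close>
  define m where "m = min (min \<delta>0 d) (c / \<Lambda>1)"
  have m: "m > 0" "m \<le> \<delta>0" "m \<le> d" "\<Lambda>1 * m \<le> c"
  proof -
    have "\<Lambda>1 * m \<le> \<Lambda>1 * (c / \<Lambda>1)" using \<Lambda>1 by (intro mult_left_mono) (auto simp: m_def)
    then show "\<Lambda>1 * m \<le> c" using \<Lambda>1 by simp
  qed (use \<delta>0 d c \<Lambda>1 in \<open>auto simp: m_def\<close>)
  \<comment> \<open>The last entry gives \<open>M * s \<le> \<epsilon>1 * m ^ Suc k\<close>: on the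
    far part of the boundary the factor \<open>s\<close> beats the uniform bound
    \<open>M\<close>.\<close>
  define \<eta> where "\<eta> = min (min d (c / 2)) (\<epsilon>1 * m ^ Suc k / M)"
  have \<eta>: "\<eta> > 0" using d c \<epsilon>1 m M1 by (auto simp: \<eta>_def)
  have "cmod ((deriv ^^ k) F (Complex x0 (b0 x0 + s)) - fact k * coeff q k) \<le> \<epsilon>"
    if s: "0 < s" "s < \<eta>" for s
  proof -
    have s': "s < d" "s < c / 2" "M * s \<le> \<epsilon>1 * m ^ Suc k"
    proof -
      have "s \<le> \<epsilon>1 * m ^ Suc k / M" using s by (simp add: \<eta>_def)
      then show "M * s \<le> \<epsilon>1 * m ^ Suc k" using M1 by (simp add: pos_le_divide_eq mult.commute)
    qed (use s in \<open>auto simp: \<eta>_def\<close>)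
    define zs where "zs = Complex x0 (b0 x0 - s)"
    define z1 where "z1 = Complex x0 (b0 x0 + s)"
    have dist1: "\<bar>Re w - x0\<bar> \<le> cmod (w - zs)" for w
      using abs_Re_le_cmod[of "w - zs"] by (simp add: zs_def)
    \<comment> \<open>A point at height \<open>v\<close> above the graph has distance at least
      \<open>(s + v) / \<Lambda>1\<close> from \<open>zs\<close>, because \<open>zs\<close> lies
      \<open>s\<close> below a point of a Lipschitz graph.\<close>
    have dist2: "s + (Im w - b0 (Re w)) \<le> \<Lambda>1 * cmod (w - zs)" for w
    proof -
      have "s + (Im w - b0 (Re w)) = (Im w - (b0 x0 - s)) + (b0 x0 - b0 (Re w))" by simp
      also have "\<dots> \<le> cmod (w - zs) + \<Lambda> * \<bar>Re w - x0\<bar>"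
        using abs_Im_le_cmod[of "w - zs"] lip[of x0 "Re w"] by (simp add: zs_def abs_minus_commute)
      also have "\<dots> \<le> cmod (w - zs) + \<Lambda> * cmod (w - zs)"
        using dist1 \<Lambda> by (intro add_left_mono mult_left_mono)
      finally show ?thesis by (simp add: \<Lambda>1_def distrib_right)
    qed
    have nzs: "w \<noteq> zs" if "w \<in> W" for w
      using dist2[of w] that s by (auto simp: W)
    define Q where "Q w = U w * of_real s / (w - zs) ^ Suc k" for w
    have bound: "cmod (Q w) \<le> \<epsilon>1 * \<Lambda>1" if w: "w \<in> V" for w
    proof (rule maximum_modulus_frontier[of Q V])
      show "Q holomorphic_on interior V"
        unfolding interior_open[OF opV] Q_def[abs_def]
        by (intro holomorphic_intros hU) (use nzs VW in auto)
      have cl: "closure V \<subseteq> W" using VW clW by (simp add: closure_minimal)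
      show "continuous_on (closure V) Q"
        unfolding Q_def[abs_def]
        by (intro continuous_intros continuous_on_subset[OF cU cl]) (use nzs cl in auto)
      show "bounded V" using bW VW bounded_subset by blast
      fix w assume "w \<in> frontier V"
      then have wW: "w \<in> W" and wV: "w \<notin> V" using cl opV by (auto simp: frontier_def interior_open)
      have pos: "cmod (w - zs) ^ Suc k > 0" using nzs[OF wW] by simp
      have far: "cmod (U w) * s \<le> \<epsilon>1 * \<Lambda>1 * cmod (w - zs) ^ Suc k" if "m \<le> cmod (w - zs)"
      proof -
        have "cmod (U w) * s \<le> M * s" using M(2)[OF wW] s by (intro mult_right_mono) auto
        also have "\<dots> \<le> \<epsilon>1 * m ^ Suc k" by (rule s')
        also have "\<dots> \<le> \<epsilon>1 * cmod (w - zs) ^ Suc k" using that m \<epsilon>1 by (intro mult_left_mono power_mono) auto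
        also have "\<dots> \<le> \<epsilon>1 * \<Lambda>1 * cmod (w - zs) ^ Suc k"
          using \<epsilon>1 \<Lambda>1 by (intro mult_right_mono) auto
        finally show ?thesis .
      qed
      have "cmod (U w) * s \<le> \<epsilon>1 * \<Lambda>1 * cmod (w - zs) ^ Suc k"
      proof (cases "Im w = b0 (Re w) \<and> \<bar>Re w - x0\<bar> < \<delta>0")
        case True
        then have "w = Complex (Re w) (b0 (Re w))" by (simp add: complex_eq_iff)
        then have "cmod (U w) \<le> \<epsilon>1 * \<bar>Re w - x0\<bar> ^ k" using near[of "Re w"] True by metis
        also have "\<dots> \<le> \<epsilon>1 * cmod (w - zs) ^ k" using \<epsilon>1 dist1 by (intro mult_left_mono power_mono) auto
        \<comment> \<open>On the graph the factor \<open>s\<close> is traded for one more power of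
          the distance to \<open>zs\<close>, by \<open>dist2\<close> at height 0.\<close>
        finally have "cmod (U w) * s \<le> (\<epsilon>1 * cmod (w - zs) ^ k) * (\<Lambda>1 * cmod (w - zs))"
          using dist2[of w] True s \<epsilon>1 by (intro mult_mono) auto
        then show ?thesis by (simp add: mult_ac)
      next
        case False
        from wW wV consider "\<bar>Re w - x0\<bar> = d" | "Im w = b0 (Re w)" | "Im w = b0 (Re w) + c"
          unfolding V W by (auto simp: less_le)
        then have "m \<le> cmod (w - zs)"
        proof cases
          case 1
          then show ?thesis using dist1[of w] m by linarith
        next
          case 2
          then show ?thesis using False dist1[of w] m by linarith
        next
          case 3
          then have "\<Lambda>1 * m \<le> \<Lambda>1 * cmod (w - zs)" using dist2[of w] m s by linarith
          then show ?thesis using \<Lambda>1 by simp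
        qed
        then show ?thesis by (rule far)
      qed
      then show "cmod (Q w) \<le> \<epsilon>1 * \<Lambda>1"
        using pos s by (simp add: Q_def norm_mult norm_divide norm_power pos_divide_le_eq del: power_Suc)
    qed (rule w)
    \<comment> \<open>Within radius \<open>\<kappa> * s\<close> of \<open>z1\<close> the height
      above the graph differs from \<open>s\<close> by at most
      \<open>\<Lambda>1 * \<kappa> * s = s / 2\<close>, so the disc stays in
      \<open>V\<close>.\<close>
    define \<kappa> where "\<kappa> = 1 / (2 * \<Lambda>1)"
    have \<kappa>: "\<kappa> > 0" "\<kappa> \<le> 1" "\<Lambda>1 * \<kappa> = 1 / 2" using \<Lambda>1 by (auto simp: \<kappa>_def field_simps)
    have disc: "w \<in> V \<and> cmod (w - zs) \<le> 3 * s" if w: "cmod (w - z1) \<le> \<kappa> * s" for w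
    proof -
      have re: "\<bar>Re w - x0\<bar> \<le> \<kappa> * s" and im: "\<bar>Im w - (b0 x0 + s)\<bar> \<le> \<kappa> * s"
        using abs_Re_le_cmod[of "w - z1"] abs_Im_le_cmod[of "w - z1"] w by (auto simp: z1_def)
      have ks: "\<kappa> * s \<le> 1 * s" using \<kappa> s by (intro mult_right_mono) auto
      have "\<bar>b0 (Re w) - b0 x0\<bar> \<le> \<Lambda> * (\<kappa> * s)"
        by (rule order_trans[OF lip mult_left_mono[OF re \<Lambda>]])
      then have "\<bar>(Im w - b0 (Re w)) - s\<bar> \<le> \<kappa> * s + \<Lambda> * (\<kappa> * s)" using im by linarith
      also have "\<dots> = (\<Lambda>1 * \<kappa>) * s" by (simp add: \<Lambda>1_def algebra_simps)
      finally have "\<bar>(Im w - b0 (Re w)) - s\<bar> \<le> s / 2" using \<kappa> by simp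
      then have "w \<in> V" unfolding V mem_Collect_eq using re ks s s' by (intro conjI) linarith+
      moreover have "cmod (w - zs) \<le> cmod (w - z1) + cmod (z1 - zs)"
        using norm_triangle_ineq[of "w - z1" "z1 - zs"] by simp
      moreover have "cmod (z1 - zs) = 2 * s" using s by (simp add: z1_def zs_def cmod_def real_sqrt_mult)
      ultimately show ?thesis using w ks by linarith
    qed
    have Ub: "cmod (U w) \<le> \<epsilon>1 * \<Lambda>1 * 3 ^ Suc k * s ^ k" if w: "cmod (w - z1) \<le> \<kappa> * s" for w
    proof -
      note dw = disc[OF w]
      have "w \<noteq> zs" using nzs dw VW by blast
      then have pos: "cmod (w - zs) ^ Suc k > 0" by simp
      have "cmod (U w) * s / cmod (w - zs) ^ Suc k \<le> \<epsilon>1 * \<Lambda>1"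
        using bound dw s by (simp add: Q_def norm_mult norm_divide norm_power del: power_Suc)
      then have "cmod (U w) * s \<le> \<epsilon>1 * \<Lambda>1 * cmod (w - zs) ^ Suc k"
        using pos by (simp add: pos_divide_le_eq del: power_Suc)
      also have "\<dots> \<le> \<epsilon>1 * \<Lambda>1 * (3 * s) ^ Suc k"
        using dw \<epsilon>1 \<Lambda>1 by (intro mult_left_mono power_mono) auto
      also have "\<dots> = (\<epsilon>1 * \<Lambda>1 * 3 ^ Suc k * s ^ k) * s" by (simp add: power_mult_distrib mult_ac)
      finally show ?thesis using s by simp
    qed
    have "cmod ((deriv ^^ k) U z1) \<le> fact k * (\<epsilon>1 * \<Lambda>1 * 3 ^ Suc k * s ^ k) / (\<kappa> * s) ^ k"
    proof (rule Cauchy_inequality)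
      have "cball z1 (\<kappa> * s) \<subseteq> V" using disc by (auto simp: dist_norm norm_minus_commute)
      then show "U holomorphic_on ball z1 (\<kappa> * s)" "continuous_on (cball z1 (\<kappa> * s)) U"
        using hU holomorphic_on_subset holomorphic_on_imp_continuous_on ball_subset_cball by (meson order_trans)+
      show "0 < \<kappa> * s" using \<kappa> s by simp
      show "cmod (U x) \<le> \<epsilon>1 * \<Lambda>1 * 3 ^ Suc k * s ^ k" if "cmod (z1 - x) = \<kappa> * s" for x
        using that by (intro Ub) (simp add: norm_minus_commute)
    qed
    also have "\<dots> = \<epsilon>"
    proof -
      have ks: "(\<kappa> * s) ^ k = s ^ k / (2 * \<Lambda>1) ^ k" by (simp add: \<kappa>_def power_divide power_mult_distrib)
      have alg: "A * (\<epsilon>1 * B * E * y) / (y / P) = \<epsilon>1 * (A * B * E * P)" if "y \<noteq> 0" "P \<noteq> 0" for A B E y P :: real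
        using that by simp
      then have "fact k * (\<epsilon>1 * \<Lambda>1 * 3 ^ Suc k * s ^ k) / (\<kappa> * s) ^ k = \<epsilon>1 * C"
        unfolding ks C_def using s \<Lambda>1 by (intro alg) auto
      then show ?thesis using C by (simp add: \<epsilon>1_def)
    qed
    finally have "cmod ((deriv ^^ k) U z1) \<le> \<epsilon>" .
    moreover have "z1 \<in> V" using disc[of z1] \<kappa> s by simp
    then have "(deriv ^^ k) U z1 = (deriv ^^ k) F z1 - (deriv ^^ k) (\<lambda>z. poly q (z - z0)) z1"
      unfolding U_def[abs_def]
      by (intro higher_deriv_diff[OF hF _ opV]) (auto intro!: holomorphic_intros)
    ultimately show ?thesis
      using higher_deriv_poly_shift[OF q, of z0] by (simp add: z1_def)
  qed
  then show ?thesis using \<eta> by blast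
qed

text \<open>An isolated point is the only point of \<open>S\<close> in some member of a countable
  base, and distinct points need distinct members.\<close>

lemma countable_isolated_points:
  fixes S :: "'a::second_countable_topology set"
  shows "countable {x. x isolated_in S}"
proof -
  obtain B :: "'a set set" where B: "countable B" "\<And>X. open X \<Longrightarrow> \<exists>U. U \<subseteq> B \<and> X = \<Union> U"
    by (rule univ_second_countable) blast
  have "\<exists>b\<in>B. b \<inter> S = {x}" if x: "x isolated_in S" for x
  proof -
    obtain X where X: "open X" "X \<inter> S = {x}" using x by (auto simp: isolated_in_def)
    then obtain U where "U \<subseteq> B" "X = \<Union> U" using B(2)[OF X(1)] by auto
    with X have "x \<in> \<Union> U" by auto
    then obtain b where b: "b \<in> U" "x \<in> b" by auto
    have "b \<inter> S = {x}" using X b \<open>X = \<Union> U\<close> by (auto dest: equalityD1)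
    then show ?thesis using b \<open>U \<subseteq> B\<close> by auto
  qed
  then obtain c where c: "\<And>x. x isolated_in S \<Longrightarrow> c x \<in> B \<and> c x \<inter> S = {x}" by metis
  have "inj_on c {x. x isolated_in S}"
  proof (rule inj_onI)
    fix x y assume xy: "x \<in> {x. x isolated_in S}" "y \<in> {x. x isolated_in S}" and eq: "c x = c y"
    have "c x \<inter> S = {x}" "c y \<inter> S = {y}" using c xy by auto
    then have "{x} = {y}" unfolding eq by (rule trans[OF sym])
    then show "x = y" by (rule singleton_inject)
  qed
  moreover have "countable (c ` {x. x isolated_in S})"
    by (rule countable_subset[OF _ B(1)]) (use c in auto)
  ultimately show ?thesis by (simp add: countable_image_inj_eq)
qed

lemma isCont_eventually_in_open:
  assumes "isCont f x" "open S" "f x \<in> S"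
  shows "\<forall>\<^sub>F y in nhds x. f y \<in> S"
proof -
  have "(f \<longlongrightarrow> f x) (nhds x)"
    using assms(1) unfolding isCont_def by (rule tendsto_at_iff_tendsto_nhds[THEN iffD1])
  then show ?thesis using assms(2,3) by (rule topological_tendstoD)
qed

lemma peano_expansion_cnj:
  assumes "peano_expansion g w k x0 c"
  shows "peano_expansion (\<lambda>x. cnj (g x)) (\<lambda>x. cnj (w x)) k x0 (cnj c)"
proof -
  obtain q where q: "degree q \<le> k" "coeff q k = c / fact k"
    and e: "\<And>e. e > 0 \<Longrightarrow> \<forall>\<^sub>F x in nhds x0. norm (g x - poly q (w x - w x0)) \<le> e * norm (w x - w x0) ^ k"
    using assms unfolding peano_expansion_def by blast
  have eq: "cnj (g x) - poly (map_poly cnj q) (cnj (w x) - cnj (w x0)) = cnj (g x - poly q (w x - w x0))" for x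
    by simp
  have eq': "norm (cnj (w x) - cnj (w x0)) = norm (w x - w x0)" for x
    by (simp only: complex_cnj_diff[symmetric] complex_mod_cnj)
  show ?thesis
    unfolding peano_expansion_def
  proof (intro exI[of _ "map_poly cnj q"] conjI allI impI)
    show "degree (map_poly cnj q) \<le> k" using q(1) by (rule order_trans[OF map_poly_degree_leq])
    show "coeff (map_poly cnj q) k = cnj c / fact k" using q(2) by (simp add: coeff_map_poly)
  qed (use e in \<open>simp only: eq eq' complex_mod_cnj\<close>)
qed

section \<open>Convergence along fibres\<close>

text \<open>
  The coordinates are \<open>(X, t)\<close> with \<open>X = Re \<zeta>\<close>, and \<open>\<phi> = Im \<zeta>\<close>; \<open>E\<close> is the sequence of entire
  functions with \<open>E\<^sub>n(\<zeta>) \<rightarrow> w\<close>.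
\<close>

locale fibred_strip =
  fixes a b T \<Lambda> :: real and \<phi> \<phi>x :: "real \<times> real \<Rightarrow> real"
    and G :: "nat \<Rightarrow> real \<times> real \<Rightarrow> complex" and w :: "real \<times> real \<Rightarrow> complex"
    and E :: "nat \<Rightarrow> complex \<Rightarrow> complex" and k :: nat
  assumes ab: "a < b" and T: "0 < T" and \<Lambda>: "0 \<le> \<Lambda>" and k: "1 \<le> k"
    and c\<phi>: "continuous_on ({a..b} \<times> {0..T}) \<phi>"
    and lip: "\<And>x y. x \<in> {a..b} \<Longrightarrow> y \<in> {a..b} \<Longrightarrow> \<bar>\<phi> (x, 0) - \<phi> (y, 0)\<bar> \<le> \<Lambda> * \<bar>x - y\<bar>"
    and c\<phi>x: "\<And>t. t \<in> {0<..<T} \<Longrightarrow> continuous_on {a<..<b} (\<lambda>x. \<phi>x (x, t))"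
    and \<phi>x: "\<And>x t. x \<in> {a<..<b} \<Longrightarrow> t \<in> {0<..<T} \<Longrightarrow>
      ((\<lambda>x. \<phi> (x, t)) has_real_derivative \<phi>x (x, t)) (at x)"
    and Gx: "\<And>j x t. x \<in> {a<..<b} \<Longrightarrow> t \<in> {0<..<T} \<Longrightarrow>
      ((\<lambda>x. G (Suc j) (x, t)) has_vector_derivative G j (x, t) * Complex 1 (\<phi>x (x, t))) (at x)"
    and cG: "\<And>x. x \<in> {a<..<b} \<Longrightarrow> continuous_on {0<..<T} (\<lambda>t. G 0 (x, t))"
    and wG: "\<And>p. p \<in> {a..b} \<times> {0<..<T} \<Longrightarrow> w p = G k p"
    and E: "\<And>n. E n holomorphic_on UNIV"
    and lim: "uniform_limit ({a..b} \<times> {0..T}) (\<lambda>n p. E n (Complex (fst p) (\<phi> p))) w sequentially"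
begin

text \<open>Conjugation reflects the values of \<zeta> in the real axis and keeps their real part;
  \<open>cnj (E n (cnj z))\<close> is again entire. Points below the graph become points above
  it.\<close>

lemma conjugate_fibred_strip:
  "fibred_strip a b T \<Lambda> (\<lambda>p. - \<phi> p) (\<lambda>p. - \<phi>x p) (\<lambda>j p. cnj (G j p)) (\<lambda>p. cnj (w p))
     (\<lambda>n z. cnj (E n (cnj z))) k"
proof
  show "\<bar>- \<phi> (x, 0) - - \<phi> (y, 0)\<bar> \<le> \<Lambda> * \<bar>x - y\<bar>" if "x \<in> {a..b}" "y \<in> {a..b}" for x y
    using lip[OF that] by linarith
  show "((\<lambda>x. cnj (G (Suc j) (x, t))) has_vector_derivative
      cnj (G j (x, t)) * Complex 1 (- \<phi>x (x, t))) (at x)"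
    if "x \<in> {a<..<b}" "t \<in> {0<..<T}" for j x t
    using has_vector_derivative_cnj[OF Gx[OF that, of j]] by (simp add: complex_cnj)
  show "(\<lambda>z. cnj (E n (cnj z))) holomorphic_on UNIV" for n
    using holomorphic_on_compose_cnj_cnj[OF holomorphic_on_subset[OF E subset_UNIV] open_UNIV]
    by (simp add: comp_def)
  have "cnj (Complex x (- y)) = Complex x y" for x y by (simp add: complex_eq_iff)
  then show "uniform_limit ({a..b} \<times> {0..T}) (\<lambda>n p. cnj (E n (cnj (Complex (fst p) (- \<phi> p)))))
      (\<lambda>p. cnj (w p)) sequentially"
    using lim by (simp add: uniform_limit_iff dist_norm flip: complex_cnj_diff)
qed (use ab T \<Lambda> k c\<phi> c\<phi>x \<phi>x cG wG in \<open>auto intro!: continuous_intros derivative_intros\<close>)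

text \<open>The limit is taken in the height \<phi>(x0, t) and not in \<open>t\<close>: all
  \<open>t\<close> of the same height give the same point of the plane, at which a holomorphic
  function has just one \<open>k\<close>-th derivative.\<close>

lemma above_fibre_limit:
  assumes x0: "x0 \<in> {a<..<b}" and "\<epsilon> > 0"
    and pe: "peano_expansion (\<lambda>x. w (x, 0)) (\<lambda>x. Complex x (\<phi> (x, 0))) k x0 h"
  shows "\<exists>\<eta>>0. \<forall>t\<in>{0<..<T}. \<phi> (x0, 0) < \<phi> (x0, t) \<longrightarrow> \<phi> (x0, t) < \<phi> (x0, 0) + \<eta> \<longrightarrow>
    cmod (G 0 (x0, t) - h) \<le> \<epsilon>"
proof (cases "\<exists>t1\<in>{0<..<T}. \<phi> (x0, 0) < \<phi> (x0, t1)")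
  case True
  then obtain t1 where t1: "t1 \<in> {0<..<T}" "\<phi> (x0, 0) < \<phi> (x0, t1)" by blast
  define \<zeta> where "\<zeta> p = Complex (fst p) (\<phi> p)" for p
  \<comment> \<open>Clamping to \<open>{a..b}\<close> extends the Lipschitz graph to the whole
    line.\<close>
  define b0 where "b0 x = \<phi> (max a (min b x), 0)" for x
  have b0: "b0 x = \<phi> (x, 0)" if "x \<in> {a..b}" for x using that by (auto simp: b0_def)
  have lip0: "\<bar>b0 x - b0 y\<bar> \<le> \<Lambda> * \<bar>x - y\<bar>" for x y
  proof -
    have "\<bar>b0 x - b0 y\<bar> \<le> \<Lambda> * \<bar>max a (min b x) - max a (min b y)\<bar>"
      unfolding b0_def using ab by (intro lip) auto
    also have "\<dots> \<le> \<Lambda> * \<bar>x - y\<bar>" using \<Lambda> by (intro mult_left_mono) auto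
    finally show ?thesis .
  qed
  \<comment> \<open>Half of the gap at \<open>x0\<close>, so that by continuity the same
    \<open>t1\<close> exceeds height \<open>c\<close> over all \<open>x\<close> near
    \<open>x0\<close>; the intermediate value theorem in \<open>t\<close> then fills
    \<open>W\<close>.\<close>
  define c where "c = (\<phi> (x0, t1) - \<phi> (x0, 0)) / 2"
  have c: "c > 0" using t1 by (simp add: c_def)
  have row: "continuous_on {a..b} (\<lambda>x. \<phi> (x, t))" if "t \<in> {0..T}" for t
    by (rule continuous_on_compose2[OF c\<phi>]) (use that in \<open>auto intro!: continuous_intros\<close>)
  have "isCont (\<lambda>x. \<phi> (x, t1) - \<phi> (x, 0)) x0"
    by (rule continuous_on_interior[of "{a..b}"]) (use row t1 T x0 in \<open>auto intro!: continuous_intros\<close>)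
  then have "\<forall>\<^sub>F x in nhds x0. \<phi> (x, t1) - \<phi> (x, 0) \<in> {c<..}"
    by (rule isCont_eventually_in_open[where f = "\<lambda>x. \<phi> (x, t1) - \<phi> (x, 0)"]) (use c in \<open>auto simp: c_def\<close>)
  then obtain d1 where d1: "d1 > 0" "\<And>x. \<bar>x - x0\<bar> < d1 \<Longrightarrow> c < \<phi> (x, t1) - \<phi> (x, 0)"
    unfolding eventually_nhds_metric dist_real_def greaterThan_iff by blast
  define d where "d = min (d1 / 2) (min ((x0 - a) / 2) ((b - x0) / 2))"
  have d: "d > 0" "d < d1" "d < x0 - a" "d < b - x0" using d1(1) x0 by (auto simp: d_def min_def)
  define V where "V = {z. \<bar>Re z - x0\<bar> < d \<and> b0 (Re z) < Im z \<and> Im z < b0 (Re z) + c}"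
  define W where "W = {z. \<bar>Re z - x0\<bar> \<le> d \<and> b0 (Re z) \<le> Im z \<and> Im z \<le> b0 (Re z) + c}"
  have Wab: "x \<in> {a<..<b}" if "\<bar>x - x0\<bar> \<le> d" for x using that d by auto
  have cover: "\<exists>p\<in>{a..b} \<times> {0..T}. \<zeta> p = z" if z: "z \<in> W" for z
  proof -
    define x where "x = Re z"
    have x: "\<bar>x - x0\<bar> \<le> d" "b0 x \<le> Im z" "Im z \<le> b0 x + c" using z by (auto simp: W_def x_def)
    have xab: "x \<in> {a..b}" using Wab[OF x(1)] by auto
    have "\<exists>t\<ge>0. t \<le> t1 \<and> \<phi> (x, t) = Im z"
    proof (rule IVT')
      show "\<phi> (x, 0) \<le> Im z" "Im z \<le> \<phi> (x, t1)" "0 \<le> t1"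
        using x b0[OF xab] d1(2)[of x] d t1 by auto
      show "continuous_on {0..t1} (\<lambda>t. \<phi> (x, t))"
        by (rule continuous_on_compose2[OF c\<phi>]) (use xab t1 in \<open>auto intro!: continuous_intros\<close>)
    qed
    then obtain t where "0 \<le> t" "t \<le> t1" "\<phi> (x, t) = Im z" by blast
    then show ?thesis using xab t1 by (intro bexI[of _ "(x, t)"]) (auto simp: \<zeta>_def x_def)
  qed
  \<comment> \<open>A pointwise limit in the plane. As every point of \<open>W\<close> is a value of
    \<zeta>, uniform convergence in the coordinates becomes uniform convergence on
    \<open>W\<close>.\<close>
  define F where "F z = Lim sequentially (\<lambda>n. E n z)" for z
  have Fw: "F (\<zeta> p) = w p" if "p \<in> {a..b} \<times> {0..T}" for p
    unfolding F_def \<zeta>_def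
    by (intro tendsto_Lim tendsto_uniform_limitI[OF lim that]) simp
  have unif: "uniform_limit W E F sequentially"
    unfolding uniform_limit_iff
  proof (intro allI impI)
    fix e :: real assume "e > 0"
    with lim have "\<forall>\<^sub>F n in sequentially. \<forall>p\<in>{a..b} \<times> {0..T}. dist (E n (\<zeta> p)) (w p) < e"
      unfolding uniform_limit_iff \<zeta>_def by blast
    then show "\<forall>\<^sub>F n in sequentially. \<forall>z\<in>W. dist (E n z) (F z) < e"
    proof eventually_elim
      case (elim n)
      show ?case
      proof
        fix z assume "z \<in> W"
        then obtain p where "p \<in> {a..b} \<times> {0..T}" "\<zeta> p = z" using cover by blast
        then show "dist (E n z) (F z) < e" using elim Fw by auto
      qed
    qed
  qed
  have cF: "continuous_on W F"
    by (rule uniform_limit_theorem[OF _ unif])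
      (auto intro!: always_eventually holomorphic_on_imp_continuous_on holomorphic_on_subset[OF E])
  have cb0: "continuous_on UNIV b0"
  proof -
    have "continuous_on UNIV (\<lambda>x. \<phi> (max a (min b x), 0))"
      by (rule continuous_on_compose2[OF c\<phi>]) (use ab T in \<open>auto intro!: continuous_intros\<close>)
    then show ?thesis by (simp add: b0_def[abs_def])
  qed
  have opV: "open V"
    unfolding V_def
    by (intro open_Collect_conj open_Collect_less continuous_intros continuous_on_compose2[OF cb0]) auto
  have VW: "V \<subseteq> W" by (auto simp: V_def W_def)
  have hF: "F holomorphic_on V"
  proof (rule holomorphic_uniform_sequence[OF opV])
    show "E n holomorphic_on V" for n by (rule holomorphic_on_subset[OF E]) simp
    fix z assume "z \<in> V"
    then obtain e where e: "e > 0" "cball z e \<subseteq> V" using opV open_contains_cball by blast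
    then show "\<exists>e>0. cball z e \<subseteq> V \<and> uniform_limit (cball z e) E F sequentially"
      using uniform_limit_on_subset[OF unif] VW by blast
  qed
  \<comment> \<open>A horizontal line is mapped by \<zeta> to a curve of velocity
    \<open>Complex 1 (\<phi>x (x, t))\<close>, which never vanishes, so the complex derivative can
    be read off from the one in \<open>x\<close>.\<close>
  have deriv: "(deriv ^^ i) F (\<zeta> (x, t)) = G (k - i) (x, t)"
    if "i \<le> k" "\<bar>x - x0\<bar> < d" "t \<in> {0<..<T}" "\<zeta> (x, t) \<in> V" for i x t
    using that
  proof (induction i arbitrary: x)
    case 0
    then have "(x, t) \<in> {a..b} \<times> {0..T}" "(x, t) \<in> {a..b} \<times> {0<..<T}" using Wab[of x] by auto
    then show ?case using Fw[of "(x, t)"] wG[of "(x, t)"] by simp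
  next
    case (Suc i)
    have x: "x \<in> {a<..<b}" using Wab[of x] Suc.prems by auto
    have "((\<lambda>x. \<zeta> (x, t)) has_vector_derivative Complex 1 (\<phi>x (x, t))) (at x)"
      using \<phi>x[OF x Suc.prems(3)] unfolding \<zeta>_def
      by (simp add: has_vector_derivative_complex_iff has_real_derivative_iff_has_vector_derivative)
    note dz = this
    have "((deriv ^^ i) F has_field_derivative (deriv ^^ Suc i) F (\<zeta> (x, t))) (at (\<zeta> (x, t)))"
      using holomorphic_higher_deriv[OF hF opV, of i] Suc.prems(4) opV
      by (simp add: holomorphic_derivI)
    from field_vector_diff_chain_at[OF dz this]
    have 1: "((\<lambda>x. (deriv ^^ i) F (\<zeta> (x, t))) has_vector_derivative
        Complex 1 (\<phi>x (x, t)) * (deriv ^^ Suc i) F (\<zeta> (x, t))) (at x)"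
      by (simp add: comp_def)
    have "isCont (\<lambda>x. \<zeta> (x, t)) x" using dz by (rule has_vector_derivative_continuous)
    then have "\<forall>\<^sub>F y in nhds x. \<zeta> (y, t) \<in> V"
      by (rule isCont_eventually_in_open[where f = "\<lambda>x. \<zeta> (x, t)", OF _ opV Suc.prems(4)])
    moreover have "\<forall>\<^sub>F y in nhds x. y \<in> {x0 - d<..<x0 + d}"
      by (intro eventually_nhds_in_open) (use Suc.prems in auto)
    ultimately have ev: "\<forall>\<^sub>F y in nhds x. G (k - i) (y, t) = (deriv ^^ i) F (\<zeta> (y, t))"
    proof eventually_elim
      case (elim y)
      then show ?case using Suc.IH[of y] Suc.prems by (simp add: abs_diff_less_iff)
    qed
    have ki: "k - i = Suc (k - Suc i)" using Suc.prems(1) by simp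
    have "((\<lambda>x. G (k - i) (x, t)) has_vector_derivative
        G (k - Suc i) (x, t) * Complex 1 (\<phi>x (x, t))) (at x)"
      using Gx[OF x Suc.prems(3), of "k - Suc i"] ki by simp
    moreover have "((\<lambda>x. G (k - i) (x, t)) has_vector_derivative
        Complex 1 (\<phi>x (x, t)) * (deriv ^^ Suc i) F (\<zeta> (x, t))) (at x)"
      unfolding has_vector_derivative_def
      by (rule has_derivative_transform_eventually[OF 1[unfolded has_vector_derivative_def]])
        (use ev in \<open>auto simp: eventually_nhds_conv_at elim: eventually_mono\<close>)
    ultimately have "G (k - Suc i) (x, t) * Complex 1 (\<phi>x (x, t))
        = Complex 1 (\<phi>x (x, t)) * (deriv ^^ Suc i) F (\<zeta> (x, t))"
      by (rule vector_derivative_unique_at)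
    moreover have "Complex 1 (\<phi>x (x, t)) \<noteq> 0" by (simp add: complex_eq_iff)
    ultimately show ?case by (simp add: mult.commute)
  qed
  obtain q where q: "degree q \<le> k" "coeff q k = h / fact k"
    and pq: "\<And>e. e > 0 \<Longrightarrow> \<forall>\<^sub>F x in nhds x0. norm (w (x, 0) - poly q (\<zeta> (x, 0) - \<zeta> (x0, 0)))
      \<le> e * norm (\<zeta> (x, 0) - \<zeta> (x0, 0)) ^ k"
    using pe unfolding peano_expansion_def \<zeta>_def by auto
  have \<zeta>0: "\<zeta> (x, 0) = Complex x (b0 x)" if "x \<in> {a..b}" for x using b0[OF that] by (simp add: \<zeta>_def)
  have "\<exists>\<eta>>0. \<forall>s. 0 < s \<longrightarrow> s < \<eta> \<longrightarrow>
      cmod ((deriv ^^ k) F (Complex x0 (b0 x0 + s)) - fact k * coeff q k) \<le> \<epsilon>"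
  proof (rule higher_deriv_above_graph[OF refl d(1) c \<Lambda> lip0 V_def W_def cF hF k q(1) _ \<open>\<epsilon> > 0\<close>])
    fix e :: real assume "e > 0"
    have "\<forall>\<^sub>F x in nhds x0. x \<in> {a<..<b}" by (intro eventually_nhds_in_open) (use x0 in auto)
    with pq[OF \<open>e > 0\<close>] show "\<forall>\<^sub>F x in nhds x0. cmod (F (Complex x (b0 x))
        - poly q (Complex x (b0 x) - Complex x0 (b0 x0))) \<le> e * cmod (Complex x (b0 x) - Complex x0 (b0 x0)) ^ k"
    proof eventually_elim
      case (elim x)
      have "F (\<zeta> (x, 0)) = w (x, 0)" using elim T by (intro Fw) auto
      then show ?case using elim \<zeta>0[of x] \<zeta>0[of x0] x0 by simp
    qed
  qed
  then obtain \<eta> where \<eta>: "\<eta> > 0" "\<And>s. 0 < s \<Longrightarrow> s < \<eta> \<Longrightarrow>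
      cmod ((deriv ^^ k) F (Complex x0 (b0 x0 + s)) - h) \<le> \<epsilon>"
    using q by auto
  show ?thesis
  proof (intro exI[of _ "min \<eta> c"] conjI ballI impI)
    fix t assume t: "t \<in> {0<..<T}" "\<phi> (x0, 0) < \<phi> (x0, t)" "\<phi> (x0, t) < \<phi> (x0, 0) + min \<eta> c"
    have b00: "b0 x0 = \<phi> (x0, 0)" using x0 by (intro b0) auto
    have "\<zeta> (x0, t) \<in> V" using t d by (auto simp: V_def \<zeta>_def b00)
    from deriv[OF order_refl _ t(1) this] d
    have "G 0 (x0, t) = (deriv ^^ k) F (\<zeta> (x0, t))" by simp
    also have "\<zeta> (x0, t) = Complex x0 (b0 x0 + (\<phi> (x0, t) - \<phi> (x0, 0)))" by (simp add: \<zeta>_def b00)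
    finally show "cmod (G 0 (x0, t) - h) \<le> \<epsilon>" using \<eta>(2)[of "\<phi> (x0, t) - \<phi> (x0, 0)"] t by simp
  qed (use \<eta> c in auto)
\<comment> \<open>Here no point of the fibre lies above its foot, and the claim is vacuous.\<close>
qed (intro exI[of _ 1], auto)

lemma below_fibre_limit:
  assumes x0: "x0 \<in> {a<..<b}" and "\<epsilon> > 0"
    and pe: "peano_expansion (\<lambda>x. w (x, 0)) (\<lambda>x. Complex x (\<phi> (x, 0))) k x0 h"
  shows "\<exists>\<eta>>0. \<forall>t\<in>{0<..<T}. \<phi> (x0, t) < \<phi> (x0, 0) \<longrightarrow> \<phi> (x0, 0) - \<eta> < \<phi> (x0, t) \<longrightarrow>
    cmod (G 0 (x0, t) - h) \<le> \<epsilon>"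
proof -
  interpret C: fibred_strip a b T \<Lambda> "\<lambda>p. - \<phi> p" "\<lambda>p. - \<phi>x p" "\<lambda>j p. cnj (G j p)" "\<lambda>p. cnj (w p)"
     "\<lambda>n z. cnj (E n (cnj z))" k
    by (rule conjugate_fibred_strip)
  have "peano_expansion (\<lambda>x. cnj (w (x, 0))) (\<lambda>x. Complex x (- \<phi> (x, 0))) k x0 (cnj h)"
    using peano_expansion_cnj[OF pe] by (simp add: complex_cnj)
  from C.above_fibre_limit[OF x0 \<open>\<epsilon> > 0\<close> this]
  obtain \<eta> where \<eta>: "\<eta> > 0" "\<And>t. t \<in> {0<..<T} \<Longrightarrow> - \<phi> (x0, 0) < - \<phi> (x0, t) \<Longrightarrow>
      - \<phi> (x0, t) < - \<phi> (x0, 0) + \<eta> \<Longrightarrow> cmod (cnj (G 0 (x0, t)) - cnj h) \<le> \<epsilon>"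
    by blast
  show ?thesis
  proof (intro exI[of _ \<eta>] conjI ballI impI \<eta>(1))
    fix t assume "t \<in> {0<..<T}" "\<phi> (x0, t) < \<phi> (x0, 0)" "\<phi> (x0, 0) - \<eta> < \<phi> (x0, t)"
    then have "cmod (cnj (G 0 (x0, t)) - cnj h) \<le> \<epsilon>" by (intro \<eta>(2)) auto
    then show "cmod (G 0 (x0, t) - h) \<le> \<epsilon>"
      by (simp only: complex_cnj_diff[symmetric] complex_mod_cnj)
  qed
qed

text \<open>At the points of the accumulating sequence both slices have the same \<zeta>, so
  \<open>w\<close> agrees there, being a limit of functions of \<zeta>. The slice at height
  \<open>t\<close> carries a classical chain, whose expansion has the leading coefficient given by
  \<open>G 0 (x0, t)\<close>; the slice at 0 has \<open>h\<close>.\<close>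

lemma coincident_fibre:
  assumes x0: "x0 \<in> {a<..<b}" and t: "t \<in> {0<..<T}"
    and pe: "peano_expansion (\<lambda>x. w (x, 0)) (\<lambda>x. Complex x (\<phi> (x, 0))) k x0 h"
    and eq: "\<phi> (x0, t) = \<phi> (x0, 0)" and lp: "x0 islimpt {x \<in> {a<..<b}. \<phi> (x, t) = \<phi> (x, 0)}"
  shows "G 0 (x0, t) = h"
proof -
  obtain x where x: "\<And>n. x n \<in> {a<..<b}" "\<And>n. \<phi> (x n, t) = \<phi> (x n, 0)" "\<And>n. x n \<noteq> x0" "x \<longlonglongrightarrow> x0"
    using lp unfolding islimpt_sequential by auto
  have \<zeta>x: "((\<lambda>x. Complex x (\<phi> (x, t))) has_vector_derivative Complex 1 (\<phi>x (x, t))) (at x)"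
    if "x \<in> {a<..<b}" for x
    using \<phi>x[OF that t]
    by (simp add: has_vector_derivative_complex_iff has_real_derivative_iff_has_vector_derivative)
  have "peano_expansion (\<lambda>x. G k (x, t)) (\<lambda>x. Complex x (\<phi> (x, t))) k x0 (G 0 (x0, t))"
  proof (rule peano_expansion_chain[where g = "\<lambda>j x. G j (x, t)", OF x0 \<zeta>x _ _ _ _ k])
    show "continuous_on {a<..<b} (\<lambda>x. Complex 1 (\<phi>x (x, t)))"
      by (intro continuous_intros c\<phi>x[OF t])
    show "Complex 1 (\<phi>x (x0, t)) \<noteq> 0" by (simp add: complex_eq_iff)
    show "((\<lambda>x. G (Suc j) (x, t)) has_vector_derivative G j (x, t) * Complex 1 (\<phi>x (x, t))) (at x)"
      if "x \<in> {a<..<b}" for j x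
      by (rule Gx[OF that t])
    show "((\<lambda>x. G 1 (x, t)) has_vector_derivative G 0 (x0, t) * Complex 1 (\<phi>x (x0, t))) (at x0)"
      using Gx[OF x0 t, of 0] by simp
  qed
  then show ?thesis
  proof (rule peano_expansion_coincide[OF _ pe x(4)])
    show "Complex (x n) (\<phi> (x n, t)) \<noteq> Complex x0 (\<phi> (x0, t))" for n using x(3)[of n] by simp
    show "isCont (\<lambda>x. Complex x (\<phi> (x, t))) x0"
      using \<zeta>x[OF x0] by (rule has_vector_derivative_continuous)
    show "G k (x n, t) = w (x n, 0)" for n
    proof -
      have xn: "(x n, t) \<in> {a..b} \<times> {0..T}" "(x n, 0) \<in> {a..b} \<times> {0..T}" "(x n, t) \<in> {a..b} \<times> {0<..<T}"
        using x(1)[of n] t by auto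
      have "(\<lambda>m. E m (Complex (x n) (\<phi> (x n, t)))) \<longlonglongrightarrow> w (x n, t)"
        "(\<lambda>m. E m (Complex (x n) (\<phi> (x n, 0)))) \<longlonglongrightarrow> w (x n, 0)"
        using tendsto_uniform_limitI[OF lim xn(1)] tendsto_uniform_limitI[OF lim xn(2)] by simp_all
      then have "w (x n, t) = w (x n, 0)" unfolding x(2) by (rule LIMSEQ_unique)
      then show ?thesis using wG[OF xn(3)] by simp
    qed
  qed (use x eq in auto)
qed

text \<open>
  Rational heights suffice by continuity, and for a fixed height \<open>t\<close> the points over which the fibre
  meets \<open>\<phi> (x, t) = \<phi> (x, 0)\<close> only in isolation form a countable set.
\<close>

theorem fibre_limit:
  assumes N: "negligible N"
    and pe: "\<And>x. x \<in> {a<..<b} - N \<Longrightarrow> peano_expansion (\<lambda>x. w (x, 0)) (\<lambda>x. Complex x (\<phi> (x, 0))) k x (h x)"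
  obtains N' where "negligible N'"
    "\<And>x. x \<in> {a<..<b} - N' \<Longrightarrow> ((\<lambda>t. G 0 (x, t)) \<longlongrightarrow> h x) (at_right 0)"
proof
  define S where "S t = {x \<in> {a<..<b}. \<phi> (x, t) = \<phi> (x, 0)}" for t
  \<comment> \<open>One countable set for each rational height; a union over all real heights need
    not be null.\<close>
  define N' where "N' = N \<union> (\<Union>t\<in>\<rat>. {x. x isolated_in S t})"
  show "negligible N'"
    unfolding N'_def
    by (intro negligible_Un N null_sets_completionI[THEN negligible_iff_null_sets[THEN iffD2]]
        countable_imp_null_set_lborel countable_UN countable_rat countable_isolated_points)
  fix x0 assume "x0 \<in> {a<..<b} - N'"
  then have x0: "x0 \<in> {a<..<b}" "x0 \<notin> N" and iso: "\<And>t. t \<in> \<rat> \<Longrightarrow> \<not> x0 isolated_in S t"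
    by (auto simp: N'_def)
  have pe0: "peano_expansion (\<lambda>x. w (x, 0)) (\<lambda>x. Complex x (\<phi> (x, 0))) k x0 (h x0)"
    using pe x0 by blast
  have c\<phi>0: "continuous_on {0..T} (\<lambda>t. \<phi> (x0, t))"
    by (rule continuous_on_compose2[OF c\<phi>]) (use x0 in \<open>auto intro!: continuous_intros\<close>)
  show "((\<lambda>t. G 0 (x0, t)) \<longlongrightarrow> h x0) (at_right 0)"
  proof (rule tendstoI)
    fix e :: real assume "e > 0"
    then have e2: "e / 2 > 0" by simp
    obtain \<eta>1 where \<eta>1: "\<eta>1 > 0" "\<And>t. t \<in> {0<..<T} \<Longrightarrow> \<phi> (x0, 0) < \<phi> (x0, t) \<Longrightarrow>
        \<phi> (x0, t) < \<phi> (x0, 0) + \<eta>1 \<Longrightarrow> cmod (G 0 (x0, t) - h x0) \<le> e / 2"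
      using above_fibre_limit[OF x0(1) e2 pe0] by blast
    obtain \<eta>2 where \<eta>2: "\<eta>2 > 0" "\<And>t. t \<in> {0<..<T} \<Longrightarrow> \<phi> (x0, t) < \<phi> (x0, 0) \<Longrightarrow>
        \<phi> (x0, 0) - \<eta>2 < \<phi> (x0, t) \<Longrightarrow> cmod (G 0 (x0, t) - h x0) \<le> e / 2"
      using below_fibre_limit[OF x0(1) e2 pe0] by blast
    have "min \<eta>1 \<eta>2 > 0" using \<eta>1 \<eta>2 by simp
    with c\<phi>0 T obtain \<tau> where \<tau>: "\<tau> > 0"
      "\<And>t. t \<in> {0..T} \<Longrightarrow> dist t 0 < \<tau> \<Longrightarrow> dist (\<phi> (x0, t)) (\<phi> (x0, 0)) < min \<eta>1 \<eta>2"
      unfolding continuous_on_iff by (metis atLeastAtMost_iff less_eq_real_def)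
    define s where "s = min T \<tau>"
    have rat: "cmod (G 0 (x0, t) - h x0) \<le> e / 2" if t: "t \<in> \<rat>" "t \<in> {0<..<s}" for t
    proof -
      have tT: "t \<in> {0<..<T}" using t by (auto simp: s_def)
      have near: "\<bar>\<phi> (x0, t) - \<phi> (x0, 0)\<bar> < min \<eta>1 \<eta>2"
        using \<tau>(2)[of t] t by (simp add: s_def dist_real_def)
      consider "\<phi> (x0, 0) < \<phi> (x0, t)" | "\<phi> (x0, t) < \<phi> (x0, 0)" | "\<phi> (x0, t) = \<phi> (x0, 0)" by linarith
      then show ?thesis
      proof cases
        case 1
        then show ?thesis using near by (intro \<eta>1(2)[OF tT]) auto
      next
        case 2
        then show ?thesis using near by (intro \<eta>2(2)[OF tT]) auto
      next
        case 3
        then have "x0 islimpt S t"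
          using iso[OF t(1)] x0 unfolding isolated_in_islimpt_iff by (simp add: S_def)
        then have "G 0 (x0, t) = h x0" unfolding S_def by (rule coincident_fibre[OF x0(1) tT pe0 3])
        then show ?thesis using e2 by simp
      qed
    qed
    \<comment> \<open>A strict excess over \<open>e / 2\<close> would persist on an open set of
      heights, which contains a rational one.\<close>
    have all: "cmod (G 0 (x0, t) - h x0) \<le> e / 2" if t: "t \<in> {0<..<s}" for t
    proof (rule ccontr)
      assume "\<not> ?thesis"
      then have gt: "e / 2 < cmod (G 0 (x0, t) - h x0)" by simp
      have "continuous_on {0<..<s} (\<lambda>t. cmod (G 0 (x0, t) - h x0))"
        by (intro continuous_intros continuous_on_subset[OF cG[OF x0(1)]]) (auto simp: s_def)
      then have "open ({0<..<s} \<inter> (\<lambda>t. cmod (G 0 (x0, t) - h x0)) -` {e / 2<..})"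
        by (rule continuous_open_preimage) auto
      moreover have "t \<in> {0<..<s} \<inter> (\<lambda>t. cmod (G 0 (x0, t) - h x0)) -` {e / 2<..}" using t gt by simp
      ultimately obtain d where d: "d > 0"
        "\<And>y. dist y t < d \<Longrightarrow> y \<in> {0<..<s} \<inter> (\<lambda>t. cmod (G 0 (x0, t) - h x0)) -` {e / 2<..}"
        unfolding open_dist by blast
      obtain q where q: "q \<in> \<rat>" "t < q" "q < t + d" using Rats_dense_in_real[of t "t + d"] d(1) by auto
      have "q \<in> {0<..<s} \<inter> (\<lambda>t. cmod (G 0 (x0, t) - h x0)) -` {e / 2<..}"
        by (rule d(2)) (use q in \<open>auto simp: dist_real_def\<close>)
      then show False using rat[OF q(1)] by auto
    qed
    have "s > 0" using T \<tau> by (simp add: s_def)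
    then show "\<forall>\<^sub>F t in at_right 0. dist (G 0 (x0, t)) (h x0) < e"
      unfolding eventually_at_right_field
      by (intro exI[of _ s] conjI allI impI) (use all e2 in \<open>fastforce simp: dist_norm\<close>)+
  qed
qed

end

text \<open>Since the error is measured through \<open>w\<close>, a continuous change of parameter
  is harmless; this passes from \<open>x\<close> to \<open>X = Re \<zeta>\<close> on the slice
  \<open>t = 0\<close>.\<close>

lemma peano_expansion_compose:
  assumes pe: "peano_expansion g w k (u y0) c" and u: "isCont u y0"
  shows "peano_expansion (\<lambda>y. g (u y)) (\<lambda>y. w (u y)) k y0 c"
proof -
  have *: "\<forall>\<^sub>F y in nhds y0. P (u y)" if ev: "\<forall>\<^sub>F x in nhds (u y0). P x" for P
  proof -
    obtain S where S: "open S" "u y0 \<in> S" "\<And>x. x \<in> S \<Longrightarrow> P x"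
      using ev unfolding eventually_nhds by blast
    from isCont_eventually_in_open[OF u S(1,2)] show ?thesis by eventually_elim (rule S(3))
  qed
  obtain q where q: "degree q \<le> k" "coeff q k = c / fact k"
    and e: "\<And>e. e > 0 \<Longrightarrow> \<forall>\<^sub>F x in nhds (u y0). norm (g x - poly q (w x - w (u y0))) \<le> e * norm (w x - w (u y0)) ^ k"
    using pe unfolding peano_expansion_def by blast
  show ?thesis
    unfolding peano_expansion_def using q *[OF e] by blast
qed

lemma peano_expansion_cong:
  assumes pe: "peano_expansion g w k x0 c" and ev: "\<forall>\<^sub>F x in nhds x0. g x = g' x \<and> w x = w' x"
  shows "peano_expansion g' w' k x0 c"
proof -
  have "w x0 = w' x0" using eventually_nhds_x_imp_x[OF ev] by simp
  obtain q where q: "degree q \<le> k" "coeff q k = c / fact k"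
    and e: "\<And>e. e > 0 \<Longrightarrow> \<forall>\<^sub>F x in nhds x0. norm (g x - poly q (w x - w x0)) \<le> e * norm (w x - w x0) ^ k"
    using pe unfolding peano_expansion_def by blast
  have "\<forall>\<^sub>F x in nhds x0. norm (g' x - poly q (w' x - w' x0)) \<le> e * norm (w' x - w' x0) ^ k"
    if "e > 0" for e
    using ev e[OF that] by eventually_elim (simp add: \<open>w x0 = w' x0\<close>)
  then show ?thesis unfolding peano_expansion_def using q by blast
qed

section \<open>The coordinates given by the real part of \<zeta> and \<open>t\<close>\<close>

context boundary_strip
begin

lemma Re_\<zeta>_partial:
  assumes "p \<in> {-r..r} \<times> {0..T}"
  shows "((\<lambda>x. Re (\<zeta> (x, snd p))) has_real_derivative Re (\<zeta>x p)) (at (fst p) within A)"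
    and "((\<lambda>x. Im (\<zeta> (x, snd p))) has_real_derivative Im (\<zeta>x p)) (at (fst p) within A)"
proof -
  have "((\<lambda>x. \<zeta> (x, snd p)) has_vector_derivative \<zeta>x p) (at (fst p))"
    using \<zeta>_partials(1)[of "fst p" "snd p" UNIV UNIV] strip_D[OF assms] by simp
  note this[THEN has_vector_derivative_at_within, of A]
  then show "((\<lambda>x. Re (\<zeta> (x, snd p))) has_real_derivative Re (\<zeta>x p)) (at (fst p) within A)"
    "((\<lambda>x. Im (\<zeta> (x, snd p))) has_real_derivative Im (\<zeta>x p)) (at (fst p) within A)"
    by (simp_all add: has_vector_derivative_complex_iff has_real_derivative_iff_has_vector_derivative)
qed

text \<open>On each slice \<open>Re \<zeta>\<close> is strictly monotone, so
  \<open>(x, t) \<mapsto> (Re \<zeta>, t)\<close> is injective on a compact box and its inverse is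
  continuous by compactness; it remains to find a rectangle in the image.\<close>

lemma fibre_coordinates:
  assumes nz: "\<And>p. p \<in> {-r..r} \<times> {0..T} \<Longrightarrow> 0 < Re (\<zeta>x (0, 0)) * Re (\<zeta>x p)"
    and \<rho>: "0 < \<rho>" "\<rho> \<le> r" and \<tau>: "0 < \<tau>" "\<tau> \<le> T"
  obtains \<xi> a b s where "0 < s" "s \<le> \<tau>" "a < Re (\<zeta> (0, 0))" "Re (\<zeta> (0, 0)) < b"
    "continuous_on ({a..b} \<times> {0..s}) \<xi>"
    "\<And>p. p \<in> {a..b} \<times> {0..s} \<Longrightarrow> \<xi> p \<in> {-\<rho><..<\<rho>}"
    "\<And>p. p \<in> {a..b} \<times> {0..s} \<Longrightarrow> Re (\<zeta> (\<xi> p, snd p)) = fst p"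
    "\<And>x t. x \<in> {-\<rho>..\<rho>} \<Longrightarrow> t \<in> {0..s} \<Longrightarrow> \<xi> (Re (\<zeta> (x, t)), t) = x"
proof -
  \<comment> \<open>Multiplication by \<sigma> makes \<open>Re \<zeta>\<close> increasing in
    \<open>x\<close>, whatever the sign of its derivative.\<close>
  define \<sigma> where "\<sigma> = Re (\<zeta>x (0, 0))"
  have \<sigma>: "\<sigma> \<noteq> 0" using nz[of "(0, 0)"] r T by (auto simp: \<sigma>_def)
  define u where "u x t = \<sigma> * Re (\<zeta> (x, t))" for x t
  have c\<zeta>: "continuous_on ({-r..r} \<times> {0..T}) \<zeta>" by (rule continuous_partials) (rule D)
  have mono: "u x t < u y t" if "x \<in> {-\<rho>..\<rho>}" "y \<in> {-\<rho>..\<rho>}" "x < y" "t \<in> {0..\<tau>}" for x y t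
    unfolding u_def
  proof (rule DERIV_pos_imp_increasing[OF \<open>x < y\<close>])
    fix z assume "x \<le> z" "z \<le> y"
    then have z: "(z, t) \<in> {-r..r} \<times> {0..T}" using that \<rho> \<tau> by auto
    show "\<exists>d. ((\<lambda>x. \<sigma> * Re (\<zeta> (x, t))) has_real_derivative d) (at z) \<and> 0 < d"
      using DERIV_cmult[OF Re_\<zeta>_partial(1)[OF z, of UNIV], where c = \<sigma>] nz[OF z] by (auto simp: \<sigma>_def)
  qed
  have inj: "x = y" if "x \<in> {-\<rho>..\<rho>}" "y \<in> {-\<rho>..\<rho>}" "u x t = u y t" "t \<in> {0..\<tau>}" for x y t
    using mono[of x y t] mono[of y x t] that by (cases x y rule: linorder_cases) auto
  define X0 where "X0 = Re (\<zeta> (0, 0))"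
  have "u (-\<rho>) 0 < \<sigma> * X0" "\<sigma> * X0 < u \<rho> 0"
    using mono[of "-\<rho>" 0 0] mono[of 0 \<rho> 0] \<rho> \<tau> by (auto simp: u_def X0_def)
  \<comment> \<open>A margin that is spent twice: on the half width
    \<open>d = m / |\<sigma>|\<close> of the base interval and on the drift of the end values for
    \<open>t \<le> s\<close>.\<close>
  then obtain m where m: "m > 0" "u (-\<rho>) 0 + m \<le> \<sigma> * X0 - m" "\<sigma> * X0 + m \<le> u \<rho> 0 - m"
  proof -
    let ?m = "min (\<sigma> * X0 - u (-\<rho>) 0) (u \<rho> 0 - \<sigma> * X0) / 2"
    have "?m > 0" "2 * ?m \<le> \<sigma> * X0 - u (-\<rho>) 0" "2 * ?m \<le> u \<rho> 0 - \<sigma> * X0"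
      using \<open>u (-\<rho>) 0 < \<sigma> * X0\<close> \<open>\<sigma> * X0 < u \<rho> 0\<close> by (auto simp: min_def)
    then show thesis by (intro that[of ?m]) linarith+
  qed
  have cu: "continuous_on {0..\<tau>} (\<lambda>t. u x t)" "continuous_on {-\<rho>..\<rho>} (\<lambda>x. u x t)"
    if "x \<in> {-\<rho>..\<rho>}" "t \<in> {0..\<tau>}" for x t
    unfolding u_def
    by (intro continuous_intros continuous_on_compose2[OF c\<zeta>]; use that \<rho> \<tau> in auto)+
  have near: "\<exists>s>0. \<forall>t\<in>{0..\<tau>}. t < s \<longrightarrow> \<bar>u x t - u x 0\<bar> < m" if "x \<in> {-\<rho>..\<rho>}" for x
  proof -
    have 0: "0 \<in> {0..\<tau>}" using \<tau> by simp
    have "\<exists>s>0. \<forall>t\<in>{0..\<tau>}. dist t 0 < s \<longrightarrow> dist (u x t) (u x 0) < m"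
      using cu(1)[OF that 0] 0 m(1) unfolding continuous_on_iff by blast
    then show ?thesis by (auto simp: dist_real_def)
  qed
  obtain s1 where s1: "s1 > 0" "\<And>t. t \<in> {0..\<tau>} \<Longrightarrow> t < s1 \<Longrightarrow> \<bar>u (-\<rho>) t - u (-\<rho>) 0\<bar> < m"
    using near[of "-\<rho>"] \<rho> by auto
  obtain s2 where s2: "s2 > 0" "\<And>t. t \<in> {0..\<tau>} \<Longrightarrow> t < s2 \<Longrightarrow> \<bar>u \<rho> t - u \<rho> 0\<bar> < m"
    using near[of \<rho>] \<rho> by auto
  define s where "s = min \<tau> (min (s1 / 2) (s2 / 2))"
  have s: "0 < s" "s \<le> \<tau>" "s < s1" "s < s2" using \<tau> s1(1) s2(1) by (auto simp: s_def)
  define d where "d = m / \<bar>\<sigma>\<bar>"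
  have d: "d > 0" using m \<sigma> by (simp add: d_def)
  define K where "K = {-\<rho>..\<rho>} \<times> {0..s}"
  define \<Theta> where "\<Theta> p = (Re (\<zeta> p), snd p)" for p
  have inj\<Theta>: "inj_on \<Theta> K"
  proof (rule inj_onI)
    fix p q assume p: "p \<in> K" and q: "q \<in> K" and "\<Theta> p = \<Theta> q"
    then have "Re (\<zeta> p) = Re (\<zeta> q)" "snd p = snd q" by (auto simp: \<Theta>_def)
    then have "u (fst p) (snd p) = u (fst q) (snd p)" by (cases p; cases q) (simp add: u_def)
    moreover have "fst p \<in> {-\<rho>..\<rho>}" "fst q \<in> {-\<rho>..\<rho>}" "snd p \<in> {0..\<tau>}"
      using p q s by (auto simp: K_def)
    ultimately have "fst p = fst q" using inj[of "fst p" "fst q" "snd p"] by simp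
    then show "p = q" using \<open>snd p = snd q\<close> by (simp add: prod_eq_iff)
  qed
  have cont: "continuous_on (\<Theta> ` K) (inv_into K \<Theta>)"
  proof (rule continuous_on_inv)
    show "continuous_on K \<Theta>"
      unfolding \<Theta>_def[abs_def]
      by (intro continuous_intros continuous_on_subset[OF c\<zeta>]) (use s \<tau> \<rho> in \<open>auto simp: K_def\<close>)
    show "compact K" by (simp add: K_def compact_Times)
    show "\<forall>p\<in>K. inv_into K \<Theta> (\<Theta> p) = p" using inj\<Theta> by simp
  qed
  have surj: "\<exists>x\<in>{-\<rho><..<\<rho>}. \<Theta> (x, t) = (X, t)" if X: "X \<in> {X0 - d..X0 + d}" and t: "t \<in> {0..s}" for X t
  proof -
    have "\<bar>\<sigma> * X - \<sigma> * X0\<bar> = \<bar>\<sigma>\<bar> * \<bar>X - X0\<bar>" by (simp add: abs_mult[symmetric] right_diff_distrib)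
    also have "\<dots> \<le> \<bar>\<sigma>\<bar> * d" using X by (intro mult_left_mono) auto
    also have "\<dots> = m" using \<sigma> by (simp add: d_def)
    finally have "\<bar>\<sigma> * X - \<sigma> * X0\<bar> \<le> m" .
    moreover have "\<bar>u (-\<rho>) t - u (-\<rho>) 0\<bar> < m" "\<bar>u \<rho> t - u \<rho> 0\<bar> < m" using s1(2) s2(2) s t by auto
    ultimately have lt: "u (-\<rho>) t < \<sigma> * X" "\<sigma> * X < u \<rho> t" using m(2,3) by linarith+
    have "\<exists>x\<ge>-\<rho>. x \<le> \<rho> \<and> u x t = \<sigma> * X"
      by (rule IVT') (use lt cu(2)[of 0 t] s t \<rho> in auto)
    then obtain x where x: "-\<rho> \<le> x" "x \<le> \<rho>" "u x t = \<sigma> * X" by blast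
    then have "x \<noteq> -\<rho>" "x \<noteq> \<rho>" using lt by auto
    then show ?thesis using x \<sigma> by (intro bexI[of _ x]) (auto simp: \<Theta>_def u_def)
  qed
  have inv: "inv_into K \<Theta> p = (x, snd p)" if "\<Theta> (x, snd p) = p" "x \<in> {-\<rho>..\<rho>}" "snd p \<in> {0..s}" for p x
    using inv_into_f_f[OF inj\<Theta>, of "(x, snd p)"] that by (simp add: K_def)
  show thesis
  proof (rule that[of s "X0 - d" "X0 + d" "\<lambda>p. fst (inv_into K \<Theta> p)"])
    show "continuous_on ({X0 - d..X0 + d} \<times> {0..s}) (\<lambda>p. fst (inv_into K \<Theta> p))"
    proof (intro continuous_intros continuous_on_subset[OF cont] subsetI)
      fix p assume "p \<in> {X0 - d..X0 + d} \<times> {0..s}"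
      then obtain X t where p: "p = (X, t)" "X \<in> {X0 - d..X0 + d}" "t \<in> {0..s}" by auto
      then obtain x where "x \<in> {-\<rho><..<\<rho>}" "\<Theta> (x, t) = (X, t)" using surj by blast
      then show "p \<in> \<Theta> ` K" using p by (intro image_eqI[of _ _ "(x, t)"]) (auto simp: K_def)
    qed
    fix p assume "p \<in> {X0 - d..X0 + d} \<times> {0..s}"
    then obtain X t where p: "p = (X, t)" "X \<in> {X0 - d..X0 + d}" "t \<in> {0..s}" by auto
    then obtain x where x: "x \<in> {-\<rho><..<\<rho>}" "\<Theta> (x, t) = (X, t)" using surj by blast
    then have eq: "inv_into K \<Theta> p = (x, t)" using inv[of x p] p by simp
    show "fst (inv_into K \<Theta> p) \<in> {-\<rho><..<\<rho>}" using x eq by simp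
    show "Re (\<zeta> (fst (inv_into K \<Theta> p), snd p)) = fst p" using x eq p by (simp add: \<Theta>_def)
  next
    fix x t assume "x \<in> {-\<rho>..\<rho>}" "t \<in> {0..s}"
    then show "fst (inv_into K \<Theta> (Re (\<zeta> (x, t)), t)) = x"
      using inv[of x "(Re (\<zeta> (x, t)), t)"] by (simp add: \<Theta>_def)
  qed (use s d in \<open>auto simp: X0_def\<close>)
qed

theorem strip_fibre_limit:
  assumes nz: "\<And>p. p \<in> {-r..r} \<times> {0..T} \<Longrightarrow> 0 < Re (\<zeta>x (0, 0)) * Re (\<zeta>x p)"
    and F: "continuous_on strip F"
    and loc: "\<And>p. p \<in> strip \<Longrightarrow> \<exists>e>0. \<exists>H. \<forall>q\<in>ball p e. (H has_derivative (\<lambda>v. F q * d\<zeta> q v)) (at q)"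
    and growth: "C \<ge> 0" "\<And>t. t \<in> {0<..T} \<Longrightarrow>
      integral {-r..r} (\<lambda>x. norm (F (x, t))) \<le> C * t powr (- (real n + 1/2))"
    and h: "h absolutely_integrable_on {-r..r}"
    and tr: "\<And>\<phi>. test_function {-r<..<r} \<phi> \<Longrightarrow>
      ((\<lambda>t. integral {-r..r} (\<lambda>x. F (x, t) * \<phi> x)) \<longlongrightarrow> integral {-r..r} (\<lambda>x. h x * \<phi> x)) (at_right 0)"
  obtains \<rho> N where "0 < \<rho>" "negligible N"
    "\<And>x0. x0 \<in> {-\<rho><..<\<rho>} - N \<Longrightarrow>
      (F \<longlongrightarrow> h x0) (at (x0, 0) within {p. 0 < snd p \<and> Re (\<zeta> p) = Re (\<zeta> (x0, 0))})"
proof -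

  \<comment> \<open>Primitives, trace expansion and approximation in the strip\<close>
  have nz': "\<zeta>x p \<noteq> 0" if "p \<in> {-r..r} \<times> {0..T}" for p using nz[OF that] by auto
  define G where "G j = (primitive ^^ j) F" for j
  have G0: "G 0 = F" by (simp add: G_def)
  have G: "is_primitive (G (Suc j)) (G j)" for j
    unfolding G_def by (rule iterated_primitives(2)[OF F loc])
  have cG: "continuous_on strip (G j)" for j
    unfolding G_def by (rule iterated_primitives(1)[OF F loc])
  \<comment> \<open>The number of integrations required by
    \<open>iterated_primitives_extend\<close>; \<open>G (n + 2)\<close> is the function of which
    \<open>G k\<close> is a primitive.\<close>
  define k where "k = Suc (n + 2)"
  obtain w where w: "continuous_on ({-r..r} \<times> {0..T}) w" "\<And>p. p \<in> strip \<Longrightarrow> w p = G k p"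
    by (rule iterated_primitives_extend[of G C n k]) (use F G growth in \<open>auto simp: G0 k_def\<close>)
  obtain N0 where N0: "negligible N0"
    "\<And>x0. x0 \<in> {-r<..<r} \<Longrightarrow> x0 \<notin> N0 \<Longrightarrow> peano_expansion (\<lambda>x. w (x, 0)) (\<lambda>x. \<zeta> (x, 0)) k x0 (h x0)"
  proof (rule trace_peano_expansion[OF nz' _ h, of "\<lambda>x. w (x, 0)" k])
    show "continuous_on {-r..r} (\<lambda>x. w (x, 0))"
      by (rule continuous_on_compose2[OF w(1)]) (use T in \<open>auto intro!: continuous_intros\<close>)
    show "1 \<le> k" by (simp add: k_def)
    show "integral {-r..r} (\<lambda>x. h x * \<phi> x) =
        (-1) ^ k * integral {-r..r} (\<lambda>x. w (x, 0) * (twisted_deriv (\<lambda>x. inverse (\<zeta>x (x, 0))) ^^ k) \<phi> x)"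
      if "test_function {-r<..<r} \<phi>" for \<phi>
      by (rule trace_of_iterated_primitive[OF nz' G _ w that]) (use F tr[OF that] in \<open>auto simp: G0\<close>)
    fix N assume "negligible N"
      "\<And>x0. x0 \<in> {-r<..<r} \<Longrightarrow> x0 \<notin> N \<Longrightarrow> peano_expansion (\<lambda>x. w (x, 0)) (\<lambda>x. \<zeta> (x, 0)) k x0 (h x0)"
    then show thesis by (rule that)
  qed
  have "\<zeta>x (0, 0) \<noteq> 0" using nz'[of "(0, 0)"] r T by auto
  obtain \<rho> \<tau> E where \<rho>: "0 < \<rho>" "\<rho> \<le> r" and \<tau>: "0 < \<tau>" "\<tau> \<le> T"
    and E: "\<And>n. E n holomorphic_on UNIV"
    and lim: "uniform_limit ({-\<rho>..\<rho>} \<times> {0..\<tau>}) (\<lambda>n p. E n (\<zeta> p)) w sequentially"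
  proof (rule entire_approximation[of "G k" "G (n + 2)" w])
    show "is_primitive (G k) (G (n + 2))" unfolding k_def by (rule G)
    show "continuous_on strip (G (n + 2))" by (rule cG)
    show "continuous_on ({-r..r} \<times> {0..T}) w" "\<And>p. p \<in> strip \<Longrightarrow> w p = G k p" by (fact w)+
    show "\<zeta>x (0, 0) \<noteq> 0" by fact
    fix \<rho> \<tau> E assume "0 < \<rho>" "\<rho> \<le> r" "0 < \<tau>" "\<tau> \<le> T" "\<And>n. E n holomorphic_on UNIV"
      "uniform_limit ({-\<rho>..\<rho>} \<times> {0..\<tau>}) (\<lambda>n p. E n (\<zeta> p)) w sequentially"
    then show thesis by (rule that)
  qed
  obtain \<xi> a b s where s: "0 < s" "s \<le> \<tau>" and ab: "a < Re (\<zeta> (0, 0))" "Re (\<zeta> (0, 0)) < b"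
    and c\<xi>: "continuous_on ({a..b} \<times> {0..s}) \<xi>"
    and \<xi>: "\<And>p. p \<in> {a..b} \<times> {0..s} \<Longrightarrow> \<xi> p \<in> {-\<rho><..<\<rho>}"
    and Re\<xi>: "\<And>p. p \<in> {a..b} \<times> {0..s} \<Longrightarrow> Re (\<zeta> (\<xi> p, snd p)) = fst p"
    and \<xi>Re: "\<And>x t. x \<in> {-\<rho>..\<rho>} \<Longrightarrow> t \<in> {0..s} \<Longrightarrow> \<xi> (Re (\<zeta> (x, t)), t) = x"
  proof (rule fibre_coordinates[OF nz \<rho> \<tau>])
    fix \<xi> a b s
    assume "0 < s" "s \<le> \<tau>" "a < Re (\<zeta> (0, 0))" "Re (\<zeta> (0, 0)) < b"
      "continuous_on ({a..b} \<times> {0..s}) \<xi>"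
      "\<And>p. p \<in> {a..b} \<times> {0..s} \<Longrightarrow> \<xi> p \<in> {-\<rho><..<\<rho>}"
      "\<And>p. p \<in> {a..b} \<times> {0..s} \<Longrightarrow> Re (\<zeta> (\<xi> p, snd p)) = fst p"
      "\<And>x t. x \<in> {-\<rho>..\<rho>} \<Longrightarrow> t \<in> {0..s} \<Longrightarrow> \<xi> (Re (\<zeta> (x, t)), t) = x"
    then show thesis by (rule that)
  qed
  define g where "g p = (\<xi> p, snd p)" for p
  have g_box: "g p \<in> {-\<rho>..\<rho>} \<times> {0..\<tau>}" "g p \<in> {-r..r} \<times> {0..T}" if "p \<in> {a..b} \<times> {0..s}" for p
    using \<xi>[OF that] that s \<tau> \<rho> by (auto simp: g_def)
  have g_strip: "g p \<in> strip" if "p \<in> {a..b} \<times> {0<..<s}" for p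
  proof -
    have "p \<in> {a..b} \<times> {0..s}" using that by auto
    then show ?thesis using g_box(2)[of p] that by (auto simp: g_def)
  qed
  have cg: "continuous_on ({a..b} \<times> {0..s}) g"
    unfolding g_def[abs_def] by (intro continuous_intros c\<xi>)
  have \<zeta>g: "\<zeta> (g p) = Complex (fst p) (Im (\<zeta> (g p)))" if "p \<in> {a..b} \<times> {0..s}" for p
    using Re\<xi>[OF that] by (simp add: g_def complex_eq_iff)
  have c\<xi>t: "continuous_on {a..b} (\<lambda>X. \<xi> (X, t))" if "t \<in> {0..s}" for t
    by (rule continuous_on_compose2[OF c\<xi>]) (use that in \<open>auto intro!: continuous_intros\<close>)
  have isCont\<xi>: "isCont (\<lambda>X. \<xi> (X, t)) X" if "X \<in> {a<..<b}" "t \<in> {0..s}" for X t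
    by (rule continuous_on_interior[OF c\<xi>t[OF that(2)]]) (use that in auto)
  have Re_nz: "Re (\<zeta>x (g p)) \<noteq> 0" if "p \<in> {a..b} \<times> {0..s}" for p
    using nz[OF g_box(2)[OF that]] by auto
  have d\<xi>: "((\<lambda>X. \<xi> (X, t)) has_real_derivative inverse (Re (\<zeta>x (g (X, t))))) (at X)"
    if X: "X \<in> {a<..<b}" and t: "t \<in> {0..s}" for X t
  proof (rule DERIV_inverse_function[where f = "\<lambda>x. Re (\<zeta> (x, t))" and a = a and b = b])
    have p: "(X, t) \<in> {a..b} \<times> {0..s}" using X t by auto
    show "((\<lambda>x. Re (\<zeta> (x, t))) has_real_derivative Re (\<zeta>x (g (X, t)))) (at (\<xi> (X, t)))"
      using Re_\<zeta>_partial(1)[OF g_box(2)[OF p], of UNIV] by (simp add: g_def)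
    show "Re (\<zeta>x (g (X, t))) \<noteq> 0" by (rule Re_nz[OF p])
    show "Re (\<zeta> (\<xi> (Y, t), t)) = Y" if "a < Y" "Y < b" for Y
      using Re\<xi>[of "(Y, t)"] that t by simp
  qed (use X isCont\<xi>[OF X t] in auto)
  define \<phi> where "\<phi> p = Im (\<zeta> (g p))" for p
  define \<phi>x where "\<phi>x p = Im (\<zeta>x (g p)) / Re (\<zeta>x (g p))" for p
  \<comment> \<open>Per unit of \<open>X\<close> the function \<zeta> moves by
    \<open>\<zeta>x / Re \<zeta>x = 1 + i \<phi>x\<close>; in this way the chains of primitives in
    \<open>x\<close> become chains in \<open>X\<close>.\<close>
  have \<zeta>x_eq: "inverse (Re (\<zeta>x (g p))) *\<^sub>R \<zeta>x (g p) = Complex 1 (\<phi>x p)" if "p \<in> {a..b} \<times> {0..s}" for p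
    using Re_nz[OF that] by (simp add: complex_eq_iff \<phi>x_def field_simps)
  obtain K where K: "K > 0" "\<And>p. p \<in> {-r..r} \<times> {0..T} \<Longrightarrow> norm (\<zeta>x p) \<le> K"
    by (rule bounded_partials) blast
  have box0: "(0, 0) \<in> {-r..r} \<times> {0..T}" using r T by simp
  have cpt: "compact ((\<lambda>p. \<bar>Re (\<zeta>x p)\<bar>) ` ({-r..r} \<times> {0..T}))"
    by (intro compact_continuous_image continuous_intros continuous_partials D compact_Times) auto
  then obtain m where m: "m \<in> (\<lambda>p. \<bar>Re (\<zeta>x p)\<bar>) ` ({-r..r} \<times> {0..T})"
    "\<And>p. p \<in> {-r..r} \<times> {0..T} \<Longrightarrow> m \<le> \<bar>Re (\<zeta>x p)\<bar>"
    using compact_attains_inf[OF cpt] box0 by blast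
  have m0: "m > 0" using m(1) nz by fastforce
  \<comment> \<open>The Lipschitz constant \<open>K / m\<close> is an upper bound for the size of
    \<open>\<zeta>x\<close> divided by a lower bound for that of its real part.\<close>
  interpret fib: fibred_strip a b s "K / m" \<phi> \<phi>x "\<lambda>j p. G j (g p)" "\<lambda>p. w (g p)" E k
  proof
    show "a < b" using ab by simp
    show "0 < s" by (rule s)
    show "0 \<le> K / m" using K m0 by simp
    show "1 \<le> k" by (simp add: k_def)
    have c\<zeta>g: "continuous_on ({a..b} \<times> {0..s}) (\<lambda>p. f (g p))" if "continuous_on ({-r..r} \<times> {0..T}) f" for f :: "real \<times> real \<Rightarrow> complex"
      by (rule continuous_on_compose2[OF that cg]) (use g_box in blast)
    show "continuous_on ({a..b} \<times> {0..s}) \<phi>"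
      unfolding \<phi>_def[abs_def] by (intro continuous_intros c\<zeta>g continuous_partials D)
    have c\<phi>x: "continuous_on ({a..b} \<times> {0..s}) \<phi>x"
      unfolding \<phi>x_def[abs_def] using Re_nz by (intro continuous_intros c\<zeta>g continuous_partials D) blast
    show "continuous_on {a<..<b} (\<lambda>x. \<phi>x (x, t))" if "t \<in> {0<..<s}" for t
      by (rule continuous_on_compose2[OF c\<phi>x]) (use that in \<open>auto intro!: continuous_intros\<close>)
    show "\<bar>\<phi> (X, 0) - \<phi> (Y, 0)\<bar> \<le> K / m * \<bar>X - Y\<bar>" if X: "X \<in> {a..b}" and Y: "Y \<in> {a..b}" for X Y
    proof -
      have pX: "(X, 0) \<in> {a..b} \<times> {0..s}" and pY: "(Y, 0) \<in> {a..b} \<times> {0..s}" using X Y s by auto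
      define x where "x = \<xi> (X, 0)"
      define y where "y = \<xi> (Y, 0)"
      have xy: "x \<in> {-r..r}" "y \<in> {-r..r}" using g_box(2)[OF pX] g_box(2)[OF pY] by (auto simp: x_def y_def g_def)
      have d: "((\<lambda>x. Re (\<zeta> (x, 0))) has_real_derivative Re (\<zeta>x (z, 0))) (at z within {-r..r})"
        "((\<lambda>x. Im (\<zeta> (x, 0))) has_real_derivative Im (\<zeta>x (z, 0))) (at z within {-r..r})"
        "(z, 0) \<in> {-r..r} \<times> {0..T}" if "z \<in> {-r..r}" for z
        using Re_\<zeta>_partial[of "(z, 0)" "{-r..r}"] that T by auto
      have "\<bar>Im (\<zeta> (x, 0)) - Im (\<zeta> (y, 0))\<bar> \<le> K * \<bar>x - y\<bar>"
        unfolding real_norm_def[symmetric]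
      proof (rule field_differentiable_bound[where S = "{-r..r}" and f = "\<lambda>x. Im (\<zeta> (x, 0))", OF _ d(2) _ xy])
        show "norm (Im (\<zeta>x (z, 0))) \<le> K" if "z \<in> {-r..r}" for z
          using abs_Im_le_cmod K(2)[OF d(3)[OF that]] order_trans by (simp only: real_norm_def) blast
      qed auto
      moreover have "m * \<bar>x - y\<bar> \<le> \<bar>Re (\<zeta> (x, 0)) - Re (\<zeta> (y, 0))\<bar>"
      proof -
        have *: "m * \<bar>x - y\<bar> \<le> \<bar>Re (\<zeta> (x, 0)) - Re (\<zeta> (y, 0))\<bar>"
          if "x < y" "x \<in> {-r..r}" "y \<in> {-r..r}" for x y
        proof -
          have "\<exists>z. x < z \<and> z < y \<and> Re (\<zeta> (y, 0)) - Re (\<zeta> (x, 0)) = (y - x) * Re (\<zeta>x (z, 0))"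
            by (rule MVT2[OF \<open>x < y\<close>]) (use that Re_\<zeta>_partial(1)[of "(_, 0)" UNIV] T in auto)
          then obtain z where z: "x < z" "z < y"
            "Re (\<zeta> (y, 0)) - Re (\<zeta> (x, 0)) = (y - x) * Re (\<zeta>x (z, 0))" by blast
          have "m * \<bar>y - x\<bar> \<le> \<bar>Re (\<zeta>x (z, 0))\<bar> * \<bar>y - x\<bar>"
            using z that T by (intro mult_right_mono m(2)) auto
          also have "\<dots> = \<bar>Re (\<zeta> (y, 0)) - Re (\<zeta> (x, 0))\<bar>" by (simp add: z(3) abs_mult)
          finally show ?thesis by (simp add: abs_minus_commute)
        qed
        show ?thesis using *[of x y] *[of y x] xy
          by (cases x y rule: linorder_cases) (auto simp: abs_minus_commute)
      qed
      moreover have "Re (\<zeta> (x, 0)) = X" "Re (\<zeta> (y, 0)) = Y"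
        using Re\<xi>[OF pX] Re\<xi>[OF pY] by (simp_all add: x_def y_def)
      ultimately have 1: "\<bar>Im (\<zeta> (x, 0)) - Im (\<zeta> (y, 0))\<bar> \<le> K * \<bar>x - y\<bar>" and 2: "m * \<bar>x - y\<bar> \<le> \<bar>X - Y\<bar>"
        by simp_all
      have "K * \<bar>x - y\<bar> \<le> K * (\<bar>X - Y\<bar> / m)"
        using 2 m0 K by (intro mult_left_mono) (auto simp: pos_le_divide_eq mult.commute)
      then show ?thesis using 1 by (simp add: \<phi>_def g_def x_def y_def)
    qed
    fix X t assume X: "X \<in> {a<..<b}" and t: "t \<in> {0<..<s}"
    have p: "(X, t) \<in> {a..b} \<times> {0..s}" using X t by auto
    have t': "t \<in> {0..s}" using t by auto
    have chain: "((\<lambda>X. f (g (X, t))) has_vector_derivative c * Complex 1 (\<phi>x (X, t))) (at X)"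
      if "((\<lambda>x. f (x, t)) has_vector_derivative c * \<zeta>x (g (X, t))) (at (\<xi> (X, t)))" for f :: "real \<times> real \<Rightarrow> complex" and c
    proof -
      have "((\<lambda>X. \<xi> (X, t)) has_vector_derivative inverse (Re (\<zeta>x (g (X, t))))) (at X)"
        using d\<xi>[OF X t'] by (simp add: has_real_derivative_iff_has_vector_derivative)
      from vector_diff_chain_at[OF this that]
      have "((\<lambda>X. f (g (X, t))) has_vector_derivative inverse (Re (\<zeta>x (g (X, t)))) *\<^sub>R (c * \<zeta>x (g (X, t)))) (at X)"
        by (simp add: comp_def g_def)
      then show ?thesis unfolding \<zeta>x_eq[OF p, symmetric] by (simp only: mult_scaleR_right)
    qed
    show "((\<lambda>x. \<phi> (x, t)) has_real_derivative \<phi>x (X, t)) (at X)"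
    proof -
      have "((\<lambda>x. \<zeta> (x, t)) has_vector_derivative 1 * \<zeta>x (g (X, t))) (at (\<xi> (X, t)))"
        using \<zeta>_partials(1)[of "\<xi> (X, t)" t UNIV UNIV] strip_D[OF g_box(2)[OF p]] by (simp add: g_def)
      from chain[OF this] show ?thesis
        by (simp add: \<phi>_def has_vector_derivative_complex_iff has_real_derivative_iff_has_vector_derivative)
    qed
    show "((\<lambda>x. G (Suc j) (g (x, t))) has_vector_derivative G j (g (X, t)) * Complex 1 (\<phi>x (X, t))) (at X)" for j
    proof (rule chain)
      have tT: "t \<in> {0<..T}" using t s \<tau> by auto
      have \<xi>r: "\<xi> (X, t) \<in> {-r<..<r}" using \<xi>[OF p] \<rho> by auto
      then have "((\<lambda>x. G (Suc j) (x, t)) has_vector_derivative G j (\<xi> (X, t), t) * \<zeta>x (\<xi> (X, t), t)) (at (\<xi> (X, t)) within {-r..r})"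
        by (intro is_primitive_partials(1)[OF G _ tT]) auto
      moreover have "at (\<xi> (X, t)) within {-r..r} = at (\<xi> (X, t))"
        using \<xi>r by (intro at_within_interior) auto
      ultimately show "((\<lambda>x. G (Suc j) (x, t)) has_vector_derivative G j (g (X, t)) * \<zeta>x (g (X, t))) (at (\<xi> (X, t)))"
        by (simp add: g_def)
    qed
  next
    fix X assume X: "X \<in> {a<..<b}"
    have "continuous_on {0<..<s} (\<lambda>t. g (X, t))"
      by (rule continuous_on_compose2[OF cg]) (use X in \<open>auto intro!: continuous_intros\<close>)
    then show "continuous_on {0<..<s} (\<lambda>t. G 0 (g (X, t)))"
      by (rule continuous_on_compose2[OF cG], use X in \<open>intro image_subsetI g_strip\<close>) auto
  next
    show "w (g p) = G k (g p)" if "p \<in> {a..b} \<times> {0<..<s}" for p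
      by (rule w(2)[OF g_strip[OF that]])
    show "E n holomorphic_on UNIV" for n by (rule E)
    show "uniform_limit ({a..b} \<times> {0..s}) (\<lambda>n p. E n (Complex (fst p) (\<phi> p))) (\<lambda>p. w (g p)) sequentially"
      unfolding uniform_limit_iff
    proof (intro allI impI)
      fix e :: real assume "e > 0"
      with lim have "\<forall>\<^sub>F n in sequentially. \<forall>p\<in>{-\<rho>..\<rho>} \<times> {0..\<tau>}. dist (E n (\<zeta> p)) (w p) < e"
        unfolding uniform_limit_iff by blast
      then show "\<forall>\<^sub>F n in sequentially. \<forall>p\<in>{a..b} \<times> {0..s}. dist (E n (Complex (fst p) (\<phi> p))) (w (g p)) < e"
      proof eventually_elim
        case (elim n)
        show ?case
        proof
          fix p assume p: "p \<in> {a..b} \<times> {0..s}"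
          then show "dist (E n (Complex (fst p) (\<phi> p))) (w (g p)) < e"
            using bspec[OF elim g_box(1)[OF p]] by (simp only: \<phi>_def \<zeta>g[OF p, symmetric])
        qed
      qed
    qed
  qed
  \<comment> \<open>Null sets are carried between \<open>x\<close> and \<open>X\<close> by
    differentiable maps: the exceptional set of the trace to the fibre side (\<open>N1\<close>), and
    in the end that of the fibres back (\<open>N\<close>).\<close>
  have neg_image: "negligible (f ` S)"
    if "negligible S" "\<And>x. x \<in> S \<Longrightarrow> (f has_real_derivative f' x) (at x)" for f f' :: "real \<Rightarrow> real" and S
  proof (rule negligible_differentiable_image_negligible[OF _ that(1)])
    show "f differentiable_on S"
      unfolding differentiable_on_def
      using that(2) by (meson differentiableI differentiable_at_withinI has_field_derivative_imp_has_derivative)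
  qed simp
  define N1 where "N1 = (\<lambda>x. Re (\<zeta> (x, 0))) ` (N0 \<inter> {-r..r})"
  have "negligible N1"
    unfolding N1_def
  proof (rule neg_image)
    show "negligible (N0 \<inter> {-r..r})" using N0(1) by (rule negligible_subset) auto
    show "((\<lambda>x. Re (\<zeta> (x, 0))) has_real_derivative Re (\<zeta>x (x, 0))) (at x)" if "x \<in> N0 \<inter> {-r..r}" for x
      using Re_\<zeta>_partial(1)[of "(x, 0)" UNIV] that T by auto
  qed
  then obtain N2 where N2: "negligible N2"
    "\<And>X. X \<in> {a<..<b} - N2 \<Longrightarrow> ((\<lambda>t. G 0 (g (X, t))) \<longlongrightarrow> h (\<xi> (X, 0))) (at_right 0)"
  proof (rule fib.fibre_limit[where h = "\<lambda>X. h (\<xi> (X, 0))"])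
    fix X assume X: "X \<in> {a<..<b} - N1"
    have p: "(X, 0) \<in> {a..b} \<times> {0..s}" using X s by auto
    have \<xi>r: "\<xi> (X, 0) \<in> {-r<..<r}" using \<xi>[OF p] \<rho> by auto
    have "\<xi> (X, 0) \<notin> N0"
    proof
      assume "\<xi> (X, 0) \<in> N0"
      then have "X \<in> N1" unfolding N1_def
        using Re\<xi>[OF p] \<xi>r by (intro image_eqI[of _ _ "\<xi> (X, 0)"]) auto
      then show False using X by simp
    qed
    from N0(2)[OF \<xi>r this]
    have "peano_expansion (\<lambda>x. w (\<xi> (x, 0), 0)) (\<lambda>x. \<zeta> (\<xi> (x, 0), 0)) k X (h (\<xi> (X, 0)))"
      by (rule peano_expansion_compose[where u = "\<lambda>X. \<xi> (X, 0)"]) (use isCont\<xi>[of X 0] X s in auto)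
    then show "peano_expansion (\<lambda>x. w (g (x, 0))) (\<lambda>x. Complex x (\<phi> (x, 0))) k X (h (\<xi> (X, 0)))"
    proof (rule peano_expansion_cong)
      have "\<forall>\<^sub>F Y in nhds X. Y \<in> {a<..<b}" by (intro eventually_nhds_in_open) (use X in auto)
      then show "\<forall>\<^sub>F Y in nhds X. w (\<xi> (Y, 0), 0) = w (g (Y, 0)) \<and> \<zeta> (\<xi> (Y, 0), 0) = Complex Y (\<phi> (Y, 0))"
      proof eventually_elim
        case (elim Y)
        then show ?case using \<zeta>g[of "(Y, 0)"] s by (simp add: \<phi>_def g_def)
      qed
    qed
  next
    fix N assume "negligible N"
      "\<And>X. X \<in> {a<..<b} - N \<Longrightarrow> ((\<lambda>t. G 0 (g (X, t))) \<longlongrightarrow> h (\<xi> (X, 0))) (at_right 0)"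
    then show thesis by (rule that)
  qed

  \<comment> \<open>Return to the original coordinates\<close>
  define N where "N = (\<lambda>X. \<xi> (X, 0)) ` (N2 \<inter> {a<..<b})"
  have N: "negligible N"
    unfolding N_def
  proof (rule neg_image)
    show "negligible (N2 \<inter> {a<..<b})" using N2(1) by (rule negligible_subset) auto
    show "((\<lambda>X. \<xi> (X, 0)) has_real_derivative inverse (Re (\<zeta>x (g (X, 0))))) (at X)" if "X \<in> N2 \<inter> {a<..<b}" for X
      using that s by (intro d\<xi>) auto
  qed
  have "isCont (\<lambda>x. Re (\<zeta> (x, 0))) 0"
    using Re_\<zeta>_partial(1)[of "(0, 0)" UNIV] box0 by (auto intro: DERIV_isCont)
  then have "\<forall>\<^sub>F x in nhds 0. Re (\<zeta> (x, 0)) \<in> {a<..<b}"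
    by (rule isCont_eventually_in_open[where f = "\<lambda>x. Re (\<zeta> (x, 0))"]) (use ab in auto)
  then obtain d where d: "d > 0" "\<And>x. \<bar>x\<bar> < d \<Longrightarrow> Re (\<zeta> (x, 0)) \<in> {a<..<b}"
    unfolding eventually_nhds_metric dist_real_def by auto
  show thesis
  proof (rule that[of "min d \<rho>" N])
    show "0 < min d \<rho>" using d \<rho> by simp
    show "negligible N" by (rule N)
    fix x0 assume "x0 \<in> {- min d \<rho><..<min d \<rho>} - N"
    then have x0: "\<bar>x0\<bar> < d" "x0 \<in> {-\<rho><..<\<rho>}" "x0 \<notin> N" by auto
    define X where "X = Re (\<zeta> (x0, 0))"
    have X: "X \<in> {a<..<b}" unfolding X_def by (rule d(2)[OF x0(1)])
    have \<xi>X: "\<xi> (X, 0) = x0" unfolding X_def using x0 s by (intro \<xi>Re) auto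
    have "X \<notin> N2"
    proof
      assume "X \<in> N2"
      then have "x0 \<in> N" unfolding N_def using X \<xi>X by (intro image_eqI[of _ _ X]) auto
      then show False using x0 by simp
    qed
    then have "((\<lambda>t. F (g (X, t))) \<longlongrightarrow> h x0) (at_right 0)"
      using N2(2)[of X] X unfolding G0 \<xi>X by blast
    show "(F \<longlongrightarrow> h x0) (at (x0, 0) within {p. 0 < snd p \<and> Re (\<zeta> p) = Re (\<zeta> (x0, 0))})"
    proof (rule tendstoI)
      fix e :: real assume "e > 0"
      then have "\<forall>\<^sub>F t in at_right 0. dist (F (g (X, t))) (h x0) < e"
        using \<open>((\<lambda>t. F (g (X, t))) \<longlongrightarrow> h x0) (at_right 0)\<close> by (rule tendstoD[rotated])
      then obtain \<eta> where \<eta>: "\<eta> > 0" "\<And>t. 0 < t \<Longrightarrow> t < \<eta> \<Longrightarrow> dist (F (g (X, t))) (h x0) < e"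
        unfolding eventually_at_right_field by blast
      \<comment> \<open>Within this distance a point of the fibre has its first coordinate in
        \<open>{-\<rho>..\<rho>}\<close> and \<open>t < s\<close>, so it is \<open>g (X, t)\<close>:
        approach within the curve is approach in \<open>t\<close>.\<close>
      define \<delta> where "\<delta> = min (min \<eta> s) (min (\<rho> - x0) (\<rho> + x0))"
      have \<delta>: "\<delta> > 0" "\<delta> \<le> \<eta>" "\<delta> \<le> s" "\<delta> \<le> \<rho> - x0" "\<delta> \<le> \<rho> + x0"
        using \<eta>(1) s x0 by (auto simp: \<delta>_def)
      show "\<forall>\<^sub>F p in at (x0, 0) within {p. 0 < snd p \<and> Re (\<zeta> p) = Re (\<zeta> (x0, 0))}. dist (F p) (h x0) < e"
        unfolding eventually_at
      proof (intro exI[of _ \<delta>] conjI ballI impI \<delta>(1))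
        fix p assume p: "p \<in> {p. 0 < snd p \<and> Re (\<zeta> p) = Re (\<zeta> (x0, 0))}" "p \<noteq> (x0, 0) \<and> dist p (x0, 0) < \<delta>"
        have "\<bar>fst p - x0\<bar> < \<delta>" "\<bar>snd p\<bar> < \<delta>"
          using dist_fst_le[of p "(x0, 0)"] dist_snd_le[of p "(x0, 0)"] p by (auto simp: dist_real_def)
        then have "fst p \<in> {-\<rho>..\<rho>}" "snd p \<in> {0..s}" "0 < snd p" "snd p < \<eta>" using \<delta> p by auto
        moreover from this have "\<xi> (X, snd p) = fst p"
          using \<xi>Re[of "fst p" "snd p"] p by (simp add: X_def)
        then have "g (X, snd p) = p" by (simp add: g_def prod_eq_iff)
        ultimately show "dist (F p) (h x0) < e" using \<eta>(2)[of "snd p"] by simp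
      qed
    qed
  qed
qed

end

section \<open>Boundary charts\<close>

text \<open>By the mean value theorem a nowhere vanishing derivative makes \<open>u\<close>
  injective, and the inverse \<open>v\<close> is differentiable; the set is then contained in a
  differentiable image of a null set.\<close>

lemma negligible_differentiable_vimage:
  fixes u :: "real \<Rightarrow> real"
  assumes M: "negligible M" and u: "\<And>s. s \<in> {a<..<b} \<Longrightarrow> (u has_real_derivative u' s) (at s)"
    and nz: "\<And>s. s \<in> {a<..<b} \<Longrightarrow> u' s \<noteq> 0"
  shows "negligible {s \<in> {a<..<b}. u s \<in> M}"
proof -
  have less: "u s \<noteq> u t" if "s \<in> {a<..<b}" "t \<in> {a<..<b}" "s < t" for s t
  proof
    assume "u s = u t"
    have "\<exists>z. s < z \<and> z < t \<and> u t - u s = (t - s) * u' z"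
      by (rule MVT2[OF \<open>s < t\<close>]) (use that u in auto)
    then obtain z where "s < z" "z < t" "u t - u s = (t - s) * u' z" by blast
    then show False using \<open>u s = u t\<close> nz[of z] that by auto
  qed
  have inj: "inj_on u {a<..<b}"
    unfolding inj_on_def using less by (metis linorder_neqE_linordered_idom)
  have cu: "continuous_on {a<..<b} u"
    using u by (meson DERIV_isCont continuous_at_imp_continuous_on)
  define v where "v = inv_into {a<..<b} u"
  have v: "v (u s) = s" if "s \<in> {a<..<b}" for s unfolding v_def by (rule inv_into_f_f[OF inj that])
  have dv: "(v has_real_derivative inverse (u' s)) (at (u s))" if "s \<in> {a<..<b}" for s
    by (rule has_field_derivative_inverse_strong[OF u[OF that] nz[OF that] _ that cu v]) auto
  have "negligible (v ` (M \<inter> u ` {a<..<b}))"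
  proof (rule negligible_differentiable_image_negligible)
    show "negligible (M \<inter> u ` {a<..<b})" using M by (rule negligible_subset) auto
    show "v differentiable_on (M \<inter> u ` {a<..<b})"
      unfolding differentiable_on_def
    proof
      fix y assume "y \<in> M \<inter> u ` {a<..<b}"
      then obtain s where "s \<in> {a<..<b}" "y = u s" by auto
      with dv[of s] show "v differentiable (at y within M \<inter> u ` {a<..<b})"
        by (meson differentiableI differentiable_at_withinI has_field_derivative_imp_has_derivative)
    qed
  qed simp
  moreover have "{s \<in> {a<..<b}. u s \<in> M} \<subseteq> v ` (M \<inter> u ` {a<..<b})"
  proof
    fix s assume "s \<in> {s \<in> {a<..<b}. u s \<in> M}"
    then show "s \<in> v ` (M \<inter> u ` {a<..<b})" using v[of s] by (intro image_eqI[of _ _ "u s"]) auto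
  qed
  ultimately show ?thesis by (rule negligible_subset)
qed

lemma arc_integral_ge:
  assumes "regular_arc_in C a b \<gamma>"
  shows "(\<integral>\<^sup>+ s\<in>{a<..<b}. g (\<gamma> s) * ennreal (norm (vector_derivative \<gamma> (at s))) \<partial>lebesgue) \<le> arc_integral C g"
proof -
  have "disjoint_arcs_in C {(a, b, \<gamma>)}"
    using assms by (auto simp: disjoint_arcs_in_def disjoint_family_on_def)
  then have "(\<Sum>(a, b, \<gamma>)\<in>{(a, b, \<gamma>)}. \<integral>\<^sup>+ s\<in>{a<..<b}. g (\<gamma> s) * ennreal (norm (vector_derivative \<gamma> (at s))) \<partial>lebesgue)
      \<le> arc_integral C g"
    unfolding arc_integral_def by (intro SUP_upper) simp
  then show ?thesis by simp
qed

text \<open>A single arc is one admissible system, and the lower bound \<mu> for its speed compares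
  arc length with the parameter.\<close>

lemma arc_integral_ge_subinterval:
  assumes arc: "regular_arc_in C a b \<gamma>" and cd: "{c..d} \<subseteq> {a<..<b}"
    and \<mu>: "\<And>s. s \<in> {c..d} \<Longrightarrow> \<mu> \<le> norm (vector_derivative \<gamma> (at s))"
    and g: "(\<lambda>s. g (\<gamma> s)) \<in> borel_measurable (lebesgue_on {c..d})"
  shows "ennreal \<mu> * (\<integral>\<^sup>+ s. ennreal (norm (g (\<gamma> s))) \<partial>lebesgue_on {c..d}) \<le> arc_integral C (\<lambda>q. ennreal (norm (g q)))"
proof -
  have "ennreal \<mu> * (\<integral>\<^sup>+ s. ennreal (norm (g (\<gamma> s))) \<partial>lebesgue_on {c..d})
      = (\<integral>\<^sup>+ s. ennreal \<mu> * ennreal (norm (g (\<gamma> s))) \<partial>lebesgue_on {c..d})"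
    by (rule nn_integral_cmult[symmetric]) (use g in measurable)
  also have "\<dots> = (\<integral>\<^sup>+ s. ennreal \<mu> * ennreal (norm (g (\<gamma> s))) * indicator {c..d} s \<partial>lebesgue)"
    by (rule nn_integral_restrict_space) simp
  also have "\<dots> \<le> (\<integral>\<^sup>+ s\<in>{a<..<b}. ennreal (norm (g (\<gamma> s))) * ennreal (norm (vector_derivative \<gamma> (at s))) \<partial>lebesgue)"
  proof (rule nn_integral_mono)
    fix s :: real
    show "ennreal \<mu> * ennreal (norm (g (\<gamma> s))) * indicator {c..d} s
        \<le> ennreal (norm (g (\<gamma> s))) * ennreal (norm (vector_derivative \<gamma> (at s))) * indicator {a<..<b} s"
    proof (cases "s \<in> {c..d}")
      case True
      then have "ennreal \<mu> \<le> ennreal (norm (vector_derivative \<gamma> (at s)))" by (intro ennreal_leI \<mu>)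
      then have "ennreal (norm (g (\<gamma> s))) * ennreal \<mu> \<le> ennreal (norm (g (\<gamma> s))) * ennreal (norm (vector_derivative \<gamma> (at s)))"
        by (rule mult_left_mono) simp
      then show ?thesis using True cd by (auto simp: mult.commute)
    qed simp
  qed
  also have "\<dots> \<le> arc_integral C (\<lambda>q. ennreal (norm (g q)))"
    by (rule arc_integral_ge[OF arc])
  finally show ?thesis .
qed

text \<open>Hypotheses stated for arcs reach the coordinates through the horizontal lines of the
  chart, which are regular because the differential of \<Phi> is injective.\<close>

lemma boundary_chart_row:
  assumes chart: "boundary_chart \<Omega> \<Sigma> \<rho> U p \<delta> \<Phi>" and d: "0 < d" "d \<le> \<delta>" and t: "t \<in> {-\<delta><..<\<delta>}"
  shows "regular_arc (-d) d (\<lambda>x. \<Phi> (x, t))"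
    and "\<And>x. x \<in> {-\<delta><..<\<delta>} \<Longrightarrow> vector_derivative (\<lambda>x. \<Phi> (x, t)) (at x) = frechet_derivative \<Phi> (at (x, t)) (1, 0)"
    and "\<And>x. x \<in> {-\<delta><..<\<delta>} \<Longrightarrow> frechet_derivative \<Phi> (at (x, t)) (1, 0) \<noteq> 0"
proof -
  let ?Q = "{-\<delta><..<\<delta>} \<times> {-\<delta><..<\<delta>}"
  have sm: "smooth_on ?Q \<Phi>" and inj: "inj_on \<Phi> ?Q"
    and bij: "\<And>z. z \<in> ?Q \<Longrightarrow> bij (frechet_derivative \<Phi> (at z))"
    using chart by (auto simp: boundary_chart_def)
  have row: "((\<lambda>x. \<Phi> (x, t)) has_vector_derivative frechet_derivative \<Phi> (at (x, t)) (1, 0)) (at x)"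
    and nz: "frechet_derivative \<Phi> (at (x, t)) (1, 0) \<noteq> 0" if "x \<in> {-\<delta><..<\<delta>}" for x
  proof -
    have xt: "(x, t) \<in> ?Q" using that t by simp
    note D = smooth_on_has_derivative[OF sm xt]
    have 1: "((\<lambda>x. (x, t)) has_derivative (\<lambda>h. (h, 0))) (at x)" by (auto intro!: derivative_eq_intros)
    have "frechet_derivative \<Phi> (at (x, t)) (h, 0) = h *\<^sub>R frechet_derivative \<Phi> (at (x, t)) (1, 0)" for h
      using linear_cmul[OF has_derivative_linear[OF D], of h "(1, 0)"] by simp
    then have eq: "(\<lambda>h. frechet_derivative \<Phi> (at (x, t)) (h, 0)) = (\<lambda>h. h *\<^sub>R frechet_derivative \<Phi> (at (x, t)) (1, 0))"
      by (rule ext)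
    show "((\<lambda>x. \<Phi> (x, t)) has_vector_derivative frechet_derivative \<Phi> (at (x, t)) (1, 0)) (at x)"
      using has_derivative_compose[OF 1 D] unfolding has_vector_derivative_def eq .
    show "frechet_derivative \<Phi> (at (x, t)) (1, 0) \<noteq> 0"
    proof
      assume "frechet_derivative \<Phi> (at (x, t)) (1, 0) = 0"
      then have "frechet_derivative \<Phi> (at (x, t)) (1, 0) = frechet_derivative \<Phi> (at (x, t)) 0"
        by (simp add: linear_0[OF has_derivative_linear[OF D]])
      then have "(1, 0) = (0 :: real \<times> real)" by (rule injD[OF bij_is_inj[OF bij[OF xt]]])
      then show False by (simp add: zero_prod_def)
    qed
  qed
  show vd: "vector_derivative (\<lambda>x. \<Phi> (x, t)) (at x) = frechet_derivative \<Phi> (at (x, t)) (1, 0)"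
    if "x \<in> {-\<delta><..<\<delta>}" for x
    by (rule vector_derivative_at[OF row[OF that]])
  show "frechet_derivative \<Phi> (at (x, t)) (1, 0) \<noteq> 0" if "x \<in> {-\<delta><..<\<delta>}" for x
    by (rule nz[OF that])
  show "regular_arc (-d) d (\<lambda>x. \<Phi> (x, t))"
    unfolding regular_arc_def
  proof (intro conjI ballI)
    show "smooth_on {-d<..<d} (\<lambda>x. \<Phi> (x, t))"
      by (rule smooth_on_compose[OF _ _ _ smooth_on_subset[OF smooth_on_row subset_UNIV] sm])
        (use d t in \<open>auto intro!: open_Times\<close>)
    show "inj_on (\<lambda>x. \<Phi> (x, t)) {-d<..<d}"
    proof (rule inj_onI)
      fix x y assume xy: "x \<in> {-d<..<d}" "y \<in> {-d<..<d}" and eq: "\<Phi> (x, t) = \<Phi> (y, t)"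
      have "(x, t) = (y, t)" by (rule inj_onD[OF inj eq]) (use xy d t in auto)
      then show "x = y" by simp
    qed
    show "vector_derivative (\<lambda>x. \<Phi> (x, t)) (at x) \<noteq> 0" if "x \<in> {-d<..<d}" for x
      using vd[of x] nz[of x] that d by simp
  qed (use d in simp)
qed

lemma lebesgue_integral_eq_integral_interval:
  fixes u :: "real \<Rightarrow> complex"
  assumes "u absolutely_integrable_on {a..b}" "\<And>x. x \<notin> {a..b} \<Longrightarrow> u x = 0"
  shows "(LINT x|lebesgue. u x) = integral {a..b} u"
proof -
  have "(LINT x:{a..b}|lebesgue. u x) = integral {a..b} u"
    using assms(1) by (rule set_lebesgue_integral_eq_integral(2))
  moreover have "(\<lambda>x. indicator {a..b} x *\<^sub>R u x) = u"
    using assms(2) by (auto simp: fun_eq_iff indicator_def)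
  ultimately show ?thesis by (simp add: set_lebesgue_integral_def)
qed

lemma nn_integral_norm_continuous:
  fixes u :: "real \<Rightarrow> complex"
  assumes "continuous_on {a..b} u"
  shows "(\<integral>\<^sup>+ x. ennreal (norm (u x)) \<partial>lebesgue_on {a..b}) = ennreal (integral {a..b} (\<lambda>x. norm (u x)))"
proof -
  have "integrable (lebesgue_on {a..b}) (\<lambda>x. norm (u x))"
    by (rule continuous_imp_integrable_real) (intro continuous_intros assms)
  then show ?thesis
    by (simp add: nn_integral_eq_integral lebesgue_integral_eq_integral)
qed

text \<open>The exceptional set is recorded by values of \<open>Re Z\<close> and not by points of
  the chart: in this form it can be pulled back along any arc in \<Sigma>.\<close>

theorem local_boundary_values:
  fixes \<Omega> \<Sigma> U V :: "plane set" and N :: int and c \<delta> :: real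
  assumes op: "open \<Omega>" "open U" and L: "locally_integrable_vf L U"
    and sol: "continuous_solution L (\<Omega> \<inter> U) f"
    and growth: "\<forall>\<^sub>F t in at_right 0.
      arc_integral {q \<in> \<Omega> \<inter> U. \<rho> q = t} (\<lambda>q. ennreal (norm (f q))) \<le> ennreal (c * t powi (-N))"
    and bf: "arc_L1 \<Sigma> bf" and V: "open V" "V \<subseteq> U" and Z: "first_integral L V Z"
    and nz: "nonzero_differential_along \<Sigma> (\<lambda>q. Re (Z q))"
    and chart: "boundary_chart \<Omega> \<Sigma> \<rho> U p \<delta> \<Phi>" and p: "p \<in> V"
    and trace: "\<And>\<phi>. test_function {-\<delta><..<\<delta>} \<phi> \<Longrightarrow>
      ((\<lambda>t. LINT x|lebesgue. f (\<Phi> (x, t)) * \<phi> x) \<longlongrightarrow>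
        (LINT x|lebesgue. bf (\<Phi> (x, 0)) * \<phi> x)) (at_right 0)"
  obtains W M where "open W" "p \<in> W" "negligible M"
    "\<And>q. q \<in> \<Sigma> \<inter> W \<Longrightarrow> Re (Z q) \<notin> M \<Longrightarrow> (f \<longlongrightarrow> bf q) (at q within level_curve_plus \<Omega> V Z q)"
proof -

  \<comment> \<open>Choice of the strip inside the chart\<close>
  define Q where "Q = {-\<delta><..<\<delta>} \<times> {-\<delta><..<\<delta>}"
  have \<delta>: "\<delta> > 0" and \<Phi>0: "\<Phi> (0, 0) = p" and sm: "smooth_on Q \<Phi>" and inj: "inj_on \<Phi> Q"
    and \<Phi>: "\<And>z. z \<in> Q \<Longrightarrow> \<Phi> z \<in> U \<and> \<rho> (\<Phi> z) = snd z \<and> (\<Phi> z \<in> \<Sigma> \<longleftrightarrow> snd z = 0) \<and> (\<Phi> z \<in> \<Omega> \<longleftrightarrow> snd z > 0)"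
    using chart unfolding boundary_chart_def Q_def by auto
  have oQ: "open Q" unfolding Q_def by (intro open_Times) auto
  have Q0: "(0, 0) \<in> Q" using \<delta> by (simp add: Q_def)
  have c\<Phi>: "continuous_on Q \<Phi>" by (rule smooth_on_continuous_on[OF sm])
  define D where "D = Q \<inter> \<Phi> -` V"
  have oD: "open D" unfolding D_def by (rule continuous_open_preimage[OF c\<Phi> oQ V(1)])
  have D0: "(0, 0) \<in> D" using Q0 \<Phi>0 p by (simp add: D_def)
  have DQ: "D \<subseteq> Q" and \<Phi>V: "\<Phi> ` D \<subseteq> V" by (auto simp: D_def)
  have smD: "smooth_on D \<Phi>" by (rule smooth_on_subset[OF sm DQ])
  have smZ: "smooth_on V Z" using Z by (simp add: first_integral_def)
  define \<zeta> where "\<zeta> z = Z (\<Phi> z)" for z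
  have sm\<zeta>: "smooth_on D \<zeta>"
    unfolding \<zeta>_def[abs_def] by (rule smooth_on_compose[OF oD V(1) \<Phi>V smD smZ])
  have d\<zeta>: "frechet_derivative \<zeta> (at z) = (\<lambda>v. frechet_derivative Z (at (\<Phi> z)) (frechet_derivative \<Phi> (at z) v))"
    if "z \<in> D" for z
    unfolding \<zeta>_def[abs_def]
    by (rule frechet_derivative_at[OF has_derivative_compose[OF smooth_on_has_derivative[OF smD that]
          smooth_on_has_derivative[OF smZ]], symmetric]) (use that \<Phi>V in blast)
  define \<zeta>x where "\<zeta>x z = frechet_derivative \<zeta> (at z) (1, 0)" for z
  define \<Phi>x where "\<Phi>x z = frechet_derivative \<Phi> (at z) (1, 0)" for z
  obtain d where d: "d > 0" "d \<le> \<delta>" "{-d<..<d} \<times> {-d<..<d} \<subseteq> D"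
  proof -
    obtain e where e: "e > 0" "ball (0, 0) e \<subseteq> D" using oD D0 open_contains_ball by blast
    have "{-(min (e / 2) \<delta>)<..<min (e / 2) \<delta>} \<times> {-(min (e / 2) \<delta>)<..<min (e / 2) \<delta>} \<subseteq> ball (0, 0) e"
    proof
      fix z assume "z \<in> {-(min (e / 2) \<delta>)<..<min (e / 2) \<delta>} \<times> {-(min (e / 2) \<delta>)<..<min (e / 2) \<delta>}"
      then obtain x t where z: "z = (x, t)" "\<bar>x\<bar> < e / 2" "\<bar>t\<bar> < e / 2" by (cases z) auto
      have "dist (0, 0) z \<le> \<bar>x\<bar> + \<bar>t\<bar>"
        using sqrt_sum_squares_le_sum_abs[of x t] z by (simp add: dist_prod_def dist_real_def)
      then show "z \<in> ball (0, 0) e" using z by simp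
    qed
    then show thesis using e \<delta> by (intro that[of "min (e / 2) \<delta>"]) auto
  qed
  have rows: "regular_arc (-d) d (\<lambda>x. \<Phi> (x, t))"
    "\<And>x. x \<in> {-\<delta><..<\<delta>} \<Longrightarrow> vector_derivative (\<lambda>x. \<Phi> (x, t)) (at x) = \<Phi>x (x, t)"
    "\<And>x. x \<in> {-\<delta><..<\<delta>} \<Longrightarrow> \<Phi>x (x, t) \<noteq> 0" if "t \<in> {-\<delta><..<\<delta>}" for t
    unfolding \<Phi>x_def using boundary_chart_row[OF chart d(1,2) that] by auto
  have row\<Sigma>: "regular_arc_in \<Sigma> (-d) d (\<lambda>x. \<Phi> (x, 0))"
    unfolding regular_arc_in_def using rows(1)[of 0] d \<Phi> DQ \<delta> by (auto simp: Q_def)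
  have row\<rho>: "regular_arc_in {q \<in> \<Omega> \<inter> U. \<rho> q = t} (-d) d (\<lambda>x. \<Phi> (x, t))" if "t \<in> {0<..<d}" for t
    unfolding regular_arc_in_def using rows(1)[of t] d \<Phi> that by (auto simp: Q_def)
  \<comment> \<open>The row \<open>t = 0\<close> is an arc in \<Sigma>, so the nonzero differential
    of \<open>Re Z\<close> along \<Sigma> applies to it.\<close>
  have "Re (\<zeta>x (0, 0)) \<noteq> 0"
  proof -
    have "vector_derivative (\<lambda>x. Re (Z (\<Phi> (x, 0)))) (at 0) \<noteq> 0"
      using nz row\<Sigma> d unfolding nonzero_differential_along_def by auto
    moreover have "((\<lambda>x. \<zeta> (x, 0)) has_vector_derivative \<zeta>x (0, 0)) (at 0)"
      using has_derivative_within_Times_partials(1)[of \<zeta> _ 0 0 UNIV UNIV]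
        smooth_on_has_derivative[OF sm\<zeta> D0] by (simp add: \<zeta>x_def)
    then have "((\<lambda>x. Re (\<zeta> (x, 0))) has_vector_derivative Re (\<zeta>x (0, 0))) (at 0)"
      by (simp add: has_vector_derivative_complex_iff has_real_derivative_iff_has_vector_derivative)
    ultimately show ?thesis by (auto simp: \<zeta>_def dest: vector_derivative_at)
  qed
  have c\<zeta>x: "continuous_on D \<zeta>x"
    unfolding \<zeta>x_def[abs_def] by (intro smooth_on_continuous_on smooth_on_frechet sm\<zeta>)
  have "open (D \<inter> (\<lambda>z. Re (\<zeta>x (0, 0)) * Re (\<zeta>x z)) -` {0<..})"
    by (intro continuous_open_preimage oD continuous_intros c\<zeta>x)
  moreover have "(0, 0) \<in> D \<inter> (\<lambda>z. Re (\<zeta>x (0, 0)) * Re (\<zeta>x z)) -` {0<..}"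
    using D0 \<open>Re (\<zeta>x (0, 0)) \<noteq> 0\<close> by (auto simp: zero_less_mult_iff)
  ultimately obtain e where e: "e > 0" "ball (0, 0) e \<subseteq> D \<inter> (\<lambda>z. Re (\<zeta>x (0, 0)) * Re (\<zeta>x z)) -` {0<..}"
    using open_contains_ball by blast
  obtain t0 where t0: "t0 > 0" "\<And>t. 0 < t \<Longrightarrow> t < t0 \<Longrightarrow>
      arc_integral {q \<in> \<Omega> \<inter> U. \<rho> q = t} (\<lambda>q. ennreal (norm (f q))) \<le> ennreal (c * t powi (-N))"
    using growth unfolding eventually_at_right_field by blast
  \<comment> \<open>The strip has to lie where \<open>Re \<zeta>x\<close> keeps its sign, inside the
    rows over \<open>{-d<..<d}\<close>, below the height from which the growth bound holds, and to
    have height at most 1.\<close>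
  define r where "r = min (min (e / 3) (d / 2)) (min (t0 / 2) 1)"
  have r: "0 < r" "r \<le> e / 3" "r < d" "r < t0" "r \<le> 1" using e(1) d(1) t0(1) by (auto simp: r_def)
  have box: "z \<in> D" "0 < Re (\<zeta>x (0, 0)) * Re (\<zeta>x z)" if zr: "z \<in> {-r..r} \<times> {0..r}" for z
  proof -
    obtain x t where z: "z = (x, t)" "\<bar>x\<bar> \<le> r" "\<bar>t\<bar> \<le> r" using zr by (cases z) auto
    have "dist (0, 0) z \<le> \<bar>x\<bar> + \<bar>t\<bar>"
      using sqrt_sum_squares_le_sum_abs[of x t] z by (simp add: dist_prod_def dist_real_def)
    also have "\<dots> < e" using z r e(1) by linarith
    finally have "z \<in> ball (0, 0) e" by simp
    then have "z \<in> D \<inter> (\<lambda>z. Re (\<zeta>x (0, 0)) * Re (\<zeta>x z)) -` {0<..}" using e(2) by blast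
    then show "z \<in> D" "0 < Re (\<zeta>x (0, 0)) * Re (\<zeta>x z)" by auto
  qed
  interpret B: boundary_strip \<zeta> r r D
    using r oD box sm\<zeta> by unfold_locales auto
  have r\<delta>: "{-r..r} \<times> {0..r} \<subseteq> Q" using box(1) DQ by blast
  \<comment> \<open>The minimal speed of the rows, uniform in \<open>t\<close>: it turns arc length
    integrals on the level curves of \<rho> into integrals in \<open>x\<close>.\<close>
  obtain \<mu> where \<mu>: "\<mu> > 0" "\<And>z. z \<in> {-r..r} \<times> {0..r} \<Longrightarrow> \<mu> \<le> norm (\<Phi>x z)"
  proof -
    have "continuous_on ({-r..r} \<times> {0..r}) \<Phi>x"
      unfolding \<Phi>x_def[abs_def]
      by (rule continuous_on_subset[OF smooth_on_continuous_on[OF smooth_on_frechet[OF sm]] r\<delta>])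
    then have "compact ((\<lambda>z. norm (\<Phi>x z)) ` ({-r..r} \<times> {0..r}))"
      by (intro compact_continuous_image continuous_intros compact_Times) auto
    moreover have "(0, 0) \<in> {-r..r} \<times> {0..r}" using r by simp
    ultimately obtain m where m: "m \<in> (\<lambda>z. norm (\<Phi>x z)) ` ({-r..r} \<times> {0..r})"
      "\<And>z. z \<in> {-r..r} \<times> {0..r} \<Longrightarrow> m \<le> norm (\<Phi>x z)"
      using compact_attains_inf[of "(\<lambda>z. norm (\<Phi>x z)) ` ({-r..r} \<times> {0..r})"] by blast
    have "\<Phi>x z \<noteq> 0" if "z \<in> {-r..r} \<times> {0..r}" for z
      using rows(3)[of "snd z" "fst z"] that r\<delta> by (auto simp: Q_def)
    then have "m > 0" using m(1) by auto
    then show thesis using m(2) by (rule that)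
  qed

  \<comment> \<open>The solution, its growth and its trace in the chart\<close>
  have cf: "continuous_on (\<Omega> \<inter> U) f" using sol by (simp add: continuous_solution_def)
  define F where "F z = f (\<Phi> z)" for z
  have strip\<Omega>: "z \<in> Q" "\<Phi> z \<in> \<Omega> \<inter> U" "\<Phi> z \<in> V" "z \<in> D" if "z \<in> {-r..r} \<times> {0<..r}" for z
  proof -
    have "z \<in> {-r..r} \<times> {0..r}" "snd z > 0" using that by auto
    then show "z \<in> Q" "\<Phi> z \<in> \<Omega> \<inter> U" "\<Phi> z \<in> V" "z \<in> D"
      using box(1)[of z] DQ \<Phi>V \<Phi>[of z] by auto
  qed
  have cF: "continuous_on ({-r..r} \<times> {0<..r}) F"
    unfolding F_def[abs_def]
    by (rule continuous_on_compose2[OF cf continuous_on_subset[OF c\<Phi>]]) (use strip\<Omega> in blast)+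
  have cFrow: "continuous_on {-r..r} (\<lambda>x. F (x, t))" if "t \<in> {0<..r}" for t
    by (rule continuous_on_compose2[OF cF]) (use that in \<open>auto intro!: continuous_intros\<close>)
  \<comment> \<open>A primitive of \<open>f dZ\<close> near \<open>\<Phi> z\<close>, composed with
    \<Phi>, is one of \<open>F d\<zeta>\<close>; this replaces a change of variables in the
    distributional equation.\<close>
  have loc: "\<exists>e>0. \<exists>H. \<forall>q\<in>ball z e. (H has_derivative (\<lambda>v. F q * frechet_derivative \<zeta> (at q) v)) (at q)"
    if z: "z \<in> {-r..r} \<times> {0<..r}" for z
  proof -
    have "\<exists>e>0. \<exists>H. \<forall>q\<in>ball (\<Phi> z) e. (H has_derivative (\<lambda>v. f q * frechet_derivative Z (at q) v)) (at q)"
    proof (rule continuous_solution_local_primitive[OF sol _ V(1) _ _ Z])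
      show "open (\<Omega> \<inter> U)" using op by blast
      show "smooth_on V L" using L V(2) smooth_on_subset unfolding locally_integrable_vf_def by blast
      show "L q \<noteq> 0" if "q \<in> V" for q using L V(2) that unfolding locally_integrable_vf_def by blast
      show "\<Phi> z \<in> \<Omega> \<inter> U \<inter> V" using strip\<Omega>[OF z] by blast
    qed
    then obtain e H where e: "e > 0"
      "\<And>q. q \<in> ball (\<Phi> z) e \<Longrightarrow> (H has_derivative (\<lambda>v. f q * frechet_derivative Z (at q) v)) (at q)" by blast
    have "open (D \<inter> \<Phi> -` ball (\<Phi> z) e)"
      by (rule continuous_open_preimage[OF continuous_on_subset[OF c\<Phi> DQ] oD]) auto
    moreover have "z \<in> D \<inter> \<Phi> -` ball (\<Phi> z) e" using strip\<Omega>[OF z] e(1) by simp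
    ultimately obtain e' where e': "e' > 0" "ball z e' \<subseteq> D \<inter> \<Phi> -` ball (\<Phi> z) e"
      using open_contains_ball by blast
    have "((\<lambda>y. H (\<Phi> y)) has_derivative (\<lambda>v. F q * frechet_derivative \<zeta> (at q) v)) (at q)"
      if "q \<in> ball z e'" for q
    proof -
      have q: "q \<in> D" "\<Phi> q \<in> ball (\<Phi> z) e" using that e' by auto
      show ?thesis
        unfolding F_def d\<zeta>[OF q(1)]
        by (rule has_derivative_compose[OF smooth_on_has_derivative[OF smD q(1)] e(2)[OF q(2)]])
    qed
    then show ?thesis using e'(1) by blast
  qed
  \<comment> \<open>For \<open>t \<le> 1\<close> the power \<open>t powi (- N)\<close> is at most
    \<open>t powr (- (n + 1/2))\<close>, the half-integral form required for the primitives,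
    whatever the sign of \<open>N\<close>. The maximum with 0 covers a negative
    \<open>c\<close>.\<close>
  define n where "n = nat \<bar>N\<bar>"
  define C where "C = max c 0 / \<mu>"
  have C: "C \<ge> 0" using \<mu> by (simp add: C_def)
  have gr: "integral {-r..r} (\<lambda>x. norm (F (x, t))) \<le> C * t powr (- (real n + 1/2))" if t: "t \<in> {0<..r}" for t
  proof -
    let ?I = "integral {-r..r} (\<lambda>x. norm (F (x, t)))"
    have td: "t \<in> {0<..<d}" "t \<in> {-\<delta><..<\<delta>}" using t r d by auto
    have "ennreal \<mu> * (\<integral>\<^sup>+ x. ennreal (norm (f (\<Phi> (x, t)))) \<partial>lebesgue_on {-r..r})
        \<le> arc_integral {q \<in> \<Omega> \<inter> U. \<rho> q = t} (\<lambda>q. ennreal (norm (f q)))"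
    proof (rule arc_integral_ge_subinterval[OF row\<rho>[OF td(1)]])
      show "{-r..r} \<subseteq> {-d<..<d}" using r by auto
      show "\<mu> \<le> norm (vector_derivative (\<lambda>x. \<Phi> (x, t)) (at x))" if "x \<in> {-r..r}" for x
        using \<mu>(2)[of "(x, t)"] rows(2)[OF td(2), of x] that t r d by auto
      show "(\<lambda>x. f (\<Phi> (x, t))) \<in> borel_measurable (lebesgue_on {-r..r})"
        using cFrow[OF t] by (intro continuous_imp_measurable_on_sets_lebesgue) (auto simp: F_def)
    qed
    also have "\<dots> \<le> ennreal (c * t powi (-N))" by (rule t0(2)) (use t r in auto)
    also have "\<dots> \<le> ennreal (max c 0 * t powi (-N))"
      using t by (intro ennreal_leI mult_right_mono) auto
    also have "(\<integral>\<^sup>+ x. ennreal (norm (f (\<Phi> (x, t)))) \<partial>lebesgue_on {-r..r}) = ennreal ?I"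
      using nn_integral_norm_continuous[OF cFrow[OF t]] by (simp add: F_def)
    finally have "ennreal (\<mu> * ?I) \<le> ennreal (max c 0 * t powi (-N))"
      using \<mu>(1) by (simp add: ennreal_mult' )
    then have "\<mu> * ?I \<le> max c 0 * t powi (-N)" using t by (subst (asm) ennreal_le_iff) auto
    also have "t powi (-N) = t powr (of_int (-N))" using t by (intro powr_real_of_int'[symmetric]) auto
    also have "\<dots> \<le> t powr (- (real n + 1/2))" using t r by (intro powr_mono') (auto simp: n_def)
    finally have "\<mu> * ?I \<le> max c 0 * t powr (- (real n + 1/2))" by (simp add: mult_left_mono)
    then show ?thesis using \<mu>(1) by (simp add: C_def field_simps)
  qed
  define h where "h x = bf (\<Phi> (x, 0))" for x
  have hm: "h \<in> borel_measurable (lebesgue_on {-r..r})"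
  proof -
    have "h \<in> borel_measurable (lebesgue_on {-d<..<d})"
      using bf row\<Sigma> unfolding arc_L1_def h_def[abs_def] by blast
    then show ?thesis by (rule measurable_restrict_mono) (use r in auto)
  qed
  have h: "h absolutely_integrable_on {-r..r}"
  proof -
    have "ennreal \<mu> * (\<integral>\<^sup>+ x. ennreal (norm (bf (\<Phi> (x, 0)))) \<partial>lebesgue_on {-r..r})
        \<le> arc_integral \<Sigma> (\<lambda>q. ennreal (norm (bf q)))"
    proof (rule arc_integral_ge_subinterval[OF row\<Sigma>])
      show "{-r..r} \<subseteq> {-d<..<d}" using r by auto
      show "\<mu> \<le> norm (vector_derivative (\<lambda>x. \<Phi> (x, 0)) (at x))" if "x \<in> {-r..r}" for x
        using \<mu>(2)[of "(x, 0)"] rows(2)[of 0 x] that r d by auto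
      show "(\<lambda>x. bf (\<Phi> (x, 0))) \<in> borel_measurable (lebesgue_on {-r..r})"
        using hm by (simp add: h_def[abs_def])
    qed
    also have "\<dots> < \<infinity>" using bf by (simp add: arc_L1_def)
    finally have "(\<integral>\<^sup>+ x. ennreal (norm (h x)) \<partial>lebesgue_on {-r..r}) < \<infinity>"
      using \<mu>(1) by (auto simp: h_def ennreal_mult_less_top)
    then have "integrable (lebesgue_on {-r..r}) h" using hm by (intro integrableI_bounded)
    then show ?thesis by (simp add: set_integrable_def integrable_restrict_space)
  qed
  have tr: "((\<lambda>t. integral {-r..r} (\<lambda>x. F (x, t) * \<phi> x)) \<longlongrightarrow> integral {-r..r} (\<lambda>x. h x * \<phi> x)) (at_right 0)"
    if \<phi>: "test_function {-r<..<r} \<phi>" for \<phi>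
  proof -
    have c\<phi>: "continuous_on {-r..r} \<phi>"
      using smooth_on_continuous_on[OF test_function_smooth[OF \<phi>]] continuous_on_subset by blast
    have \<phi>0: "\<phi> x = 0" if "x \<notin> {-r..r}" for x
    proof -
      have "\<exists>K. K \<subseteq> {-r<..<r} \<and> (\<forall>x. x \<notin> K \<longrightarrow> \<phi> x = 0)" using \<phi> unfolding test_function_def by blast
      then show ?thesis using that by (meson greaterThanLessThan_subseteq_atLeastAtMost_iff order_refl subsetD)
    qed
    have "test_function {-\<delta><..<\<delta>} \<phi>" by (rule test_function_mono[OF \<phi>]) (use r d in auto)
    from trace[OF this]
    have "((\<lambda>t. LINT x|lebesgue. F (x, t) * \<phi> x) \<longlongrightarrow> (LINT x|lebesgue. h x * \<phi> x)) (at_right 0)"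
      by (simp add: F_def h_def)
    moreover have "(LINT x|lebesgue. h x * \<phi> x) = integral {-r..r} (\<lambda>x. h x * \<phi> x)"
    proof (rule lebesgue_integral_eq_integral_interval)
      have "(\<lambda>x. \<phi> x * h x) absolutely_integrable_on {-r..r}"
        by (rule absolutely_integrable_bounded_measurable_product
            [OF bounded_bilinear_mult[THEN bilinear_conv_bounded_bilinear[THEN iffD2]] _ _ _ h])
          (auto intro!: compact_imp_bounded compact_continuous_image c\<phi> continuous_imp_measurable_on_sets_lebesgue)
      then show "(\<lambda>x. h x * \<phi> x) absolutely_integrable_on {-r..r}" by (simp add: mult.commute)
    qed (use \<phi>0 in simp)
    moreover have "\<forall>\<^sub>F t in at_right 0. (LINT x|lebesgue. F (x, t) * \<phi> x) = integral {-r..r} (\<lambda>x. F (x, t) * \<phi> x)"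
      unfolding eventually_at_right_field
    proof (intro exI[of _ r] conjI allI impI r(1))
      fix t assume t: "0 < t" "t < r"
      show "(LINT x|lebesgue. F (x, t) * \<phi> x) = integral {-r..r} (\<lambda>x. F (x, t) * \<phi> x)"
        by (intro lebesgue_integral_eq_integral_interval absolutely_integrable_continuous_real
            continuous_intros cFrow c\<phi>) (use t \<phi>0 in auto)
    qed
    ultimately show ?thesis by (simp add: tendsto_cong)
  qed
  obtain \<rho>1 M0 where \<rho>1: "0 < \<rho>1" "negligible M0" "\<And>x0. x0 \<in> {-\<rho>1<..<\<rho>1} - M0 \<Longrightarrow>
      (F \<longlongrightarrow> h x0) (at (x0, 0) within {z. 0 < snd z \<and> Re (\<zeta> z) = Re (\<zeta> (x0, 0))})"
  proof (rule B.strip_fibre_limit[OF _ cF loc C gr h tr])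
    show "0 < Re (frechet_derivative \<zeta> (at (0, 0)) (1, 0)) * Re (frechet_derivative \<zeta> (at z) (1, 0))"
      if "z \<in> {-r..r} \<times> {0..r}" for z
      using box(2)[OF that] by (simp add: \<zeta>x_def)
    fix \<rho>1 M0
    assume "0 < \<rho>1" "negligible M0" "\<And>x0. x0 \<in> {-\<rho>1<..<\<rho>1} - M0 \<Longrightarrow>
      (F \<longlongrightarrow> h x0) (at (x0, 0) within {z. 0 < snd z \<and> Re (\<zeta> z) = Re (\<zeta> (x0, 0))})"
    then show thesis by (rule that)
  qed

  \<comment> \<open>Return to the plane\<close>
  define \<rho>2 where "\<rho>2 = min \<rho>1 d"
  have "\<rho>2 \<le> \<rho>1" by (simp add: \<rho>2_def)
  define S where "S = {-\<rho>2<..<\<rho>2} \<times> {-d<..<d}"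
  have SD: "S \<subseteq> D" by (rule order_trans[OF _ d(3)]) (auto simp: S_def \<rho>2_def min_def split: if_splits)
  have oS: "open S" unfolding S_def by (intro open_Times) auto
  \<comment> \<open>Invariance of domain translates small neighbourhoods in the chart into
    neighbourhoods of the boundary point in the plane.\<close>
  have open_image: "open (\<Phi> ` A)" if "open A" "A \<subseteq> D" for A
    by (rule invariance_of_domain[OF continuous_on_subset[OF c\<Phi>] that(1) inj_on_subset[OF inj]])
      (use that DQ in auto)
  define M where "M = (\<lambda>x. Re (\<zeta> (x, 0))) ` (M0 \<inter> {-\<rho>2<..<\<rho>2})"
  have M: "negligible M"
    unfolding M_def
  proof (rule negligible_differentiable_image_negligible)
    show "negligible (M0 \<inter> {-\<rho>2<..<\<rho>2})" using \<rho>1(2) by (rule negligible_subset) auto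
    show "(\<lambda>x. Re (\<zeta> (x, 0))) differentiable_on (M0 \<inter> {-\<rho>2<..<\<rho>2})"
      unfolding differentiable_on_def
    proof
      fix x assume "x \<in> M0 \<inter> {-\<rho>2<..<\<rho>2}"
      then have "(x, 0) \<in> D" using SD d(1) by (auto simp: S_def)
      then have "((\<lambda>x. \<zeta> (x, 0)) has_vector_derivative \<zeta>x (x, 0)) (at x)"
        using has_derivative_within_Times_partials(1)[of \<zeta> _ x 0 UNIV UNIV]
          smooth_on_has_derivative[OF sm\<zeta>] by (simp add: \<zeta>x_def)
      then have "((\<lambda>x. Re (\<zeta> (x, 0))) has_real_derivative Re (\<zeta>x (x, 0))) (at x)"
        by (simp add: has_vector_derivative_complex_iff)
      then show "(\<lambda>x. Re (\<zeta> (x, 0))) differentiable (at x within M0 \<inter> {-\<rho>2<..<\<rho>2})"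
        by (meson differentiableI differentiable_at_withinI has_field_derivative_imp_has_derivative)
    qed
  qed simp
  show thesis
  proof (rule that[of "\<Phi> ` S" M])
    show "open (\<Phi> ` S)" by (rule open_image[OF oS SD])
    show "p \<in> \<Phi> ` S" using \<Phi>0 \<rho>1(1) d(1) by (intro image_eqI[of _ _ "(0, 0)"]) (auto simp: S_def \<rho>2_def)
    show "negligible M" by (rule M)
    fix q assume q: "q \<in> \<Sigma> \<inter> \<Phi> ` S" and qM: "Re (Z q) \<notin> M"
    then obtain x0 t where xt: "(x0, t) \<in> S" "q = \<Phi> (x0, t)" by auto
    then have "t = 0" using \<Phi>[of "(x0, t)"] q SD DQ by auto
    then have x0: "x0 \<in> {-\<rho>2<..<\<rho>2}" "q = \<Phi> (x0, 0)" "(x0, 0) \<in> D" using xt SD by (auto simp: S_def)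
    have "x0 \<notin> M0" using qM x0 by (auto simp: M_def \<zeta>_def)
    then have lim: "(F \<longlongrightarrow> bf q) (at (x0, 0) within {z. 0 < snd z \<and> Re (\<zeta> z) = Re (\<zeta> (x0, 0))})"
      using \<rho>1(3)[of x0] x0 \<open>\<rho>2 \<le> \<rho>1\<close> by (simp add: h_def)
    show "(f \<longlongrightarrow> bf q) (at q within level_curve_plus \<Omega> V Z q)"
    proof (rule tendstoI)
      fix e :: real assume "e > 0"
      from tendstoD[OF lim this] obtain \<eta> where \<eta>: "\<eta> > 0"
        "\<And>z. 0 < snd z \<Longrightarrow> Re (\<zeta> z) = Re (\<zeta> (x0, 0)) \<Longrightarrow> z \<noteq> (x0, 0) \<Longrightarrow> dist z (x0, 0) < \<eta> \<Longrightarrow> dist (F z) (bf q) < e"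
        unfolding eventually_at by blast
      have "open (\<Phi> ` (ball (x0, 0) \<eta> \<inter> D))" by (rule open_image) (use oD in auto)
      moreover have "q \<in> \<Phi> ` (ball (x0, 0) \<eta> \<inter> D)" using x0 \<eta>(1) by (intro image_eqI[of _ _ "(x0, 0)"]) auto
      ultimately have "\<forall>\<^sub>F y in at q within level_curve_plus \<Omega> V Z q. y \<in> \<Phi> ` (ball (x0, 0) \<eta> \<inter> D)"
        unfolding eventually_at_topological by blast
      moreover have "\<forall>\<^sub>F y in at q within level_curve_plus \<Omega> V Z q. y \<in> level_curve_plus \<Omega> V Z q"
        by (simp add: eventually_at_filter)
      ultimately show "\<forall>\<^sub>F y in at q within level_curve_plus \<Omega> V Z q. dist (f y) (bf q) < e"
      proof eventually_elim
        case (elim y)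
        then obtain z where z: "z \<in> D" "dist z (x0, 0) < \<eta>" "y = \<Phi> z" by (auto simp: dist_commute)
        have "y \<in> \<Omega>" "Re (Z y) = Re (Z q)" using elim(2) by (auto simp: level_curve_plus_def)
        then have "0 < snd z" "Re (\<zeta> z) = Re (\<zeta> (x0, 0))"
          using \<Phi>[of z] z DQ x0 by (auto simp: \<zeta>_def)
        moreover from this have "z \<noteq> (x0, 0)" by auto
        ultimately have "dist (F z) (bf q) < e" using z by (intro \<eta>(2))
        then show ?case by (simp add: F_def z)
      qed
    qed
  qed
qed

text \<open>Along an arc \<gamma> the function \<open>u = Re Z \<circ> \<gamma>\<close> has a
  nonvanishing derivative, so near each parameter a null set of bad values of \<open>Re Z\<close>
  yields a null set of bad parameters.\<close>

theorem theorem2p1: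
  fixes \<Omega> \<Sigma> U V :: "plane set"
    and L :: cvfield
    and \<rho> :: "plane \<Rightarrow> real"
    and f bf Z :: "plane \<Rightarrow> complex"
    and N :: int
  assumes "smooth_domain \<Omega>"
    and "boundary_piece \<Omega> \<Sigma>"
    and "open U" and "\<Sigma> \<subseteq> U"
    and "locally_integrable_vf L U"
    and "defining_function \<Omega> \<rho>"
    and "noncharacteristic L \<rho> \<Sigma>"
    and "continuous_solution L (\<Omega> \<inter> U) f"
    and "\<exists>c. \<forall>\<^sub>F t in at_right 0.
           arc_integral {q \<in> \<Omega> \<inter> U. \<rho> q = t} (\<lambda>q. ennreal (norm (f q))) \<le> ennreal (c * t powi (-N))"
    and "is_trace \<Omega> \<Sigma> \<rho> U f bf"
    and "arc_L1 \<Sigma> bf"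
    and "open V" and "\<Sigma> \<subseteq> V" and "V \<subseteq> U"
    and "first_integral L V Z"
    and "nonzero_differential_along \<Sigma> (\<lambda>q. Re (Z q))"
  shows "arc_AE \<Sigma> (\<lambda>p. (f \<longlongrightarrow> bf p) (at p within level_curve_plus \<Omega> V Z p))"
  unfolding arc_AE_def
proof (intro allI impI)
  fix a b :: real and \<gamma> :: "real \<Rightarrow> plane"
  assume arc: "regular_arc_in \<Sigma> a b \<gamma>"
  let ?P = "\<lambda>p. (f \<longlongrightarrow> bf p) (at p within level_curve_plus \<Omega> V Z p)"
  define S where "S = {s \<in> {a<..<b}. \<not> ?P (\<gamma> s)}"
  have sm: "smooth_on {a<..<b} \<gamma>" and \<gamma>\<Sigma>: "\<And>s. s \<in> {a<..<b} \<Longrightarrow> \<gamma> s \<in> \<Sigma>"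
    using arc by (auto simp: regular_arc_in_def regular_arc_def)
  have smZ: "smooth_on V Z" using assms(15) by (simp add: first_integral_def)
  have \<gamma>V: "\<gamma> ` {a<..<b} \<subseteq> V" using \<gamma>\<Sigma> assms(13) by blast
  define u where "u s = Re (Z (\<gamma> s))" for s
  have smu: "smooth_on {a<..<b} u"
    unfolding u_def[abs_def]
    by (intro smooth_on_linear_compose[OF bounded_linear_Re] smooth_on_compose[OF _ assms(12) \<gamma>V sm smZ]) auto
  have u: "(u has_real_derivative vector_derivative u (at s)) (at s)" if "s \<in> {a<..<b}" for s
    using smooth_on_has_vector_derivative[OF smu that] vector_derivative_at
    by (fastforce simp: has_real_derivative_iff_has_vector_derivative)
  have u': "vector_derivative u (at s) \<noteq> 0" if "s \<in> {a<..<b}" for s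
    using assms(16) arc that unfolding nonzero_differential_along_def u_def[abs_def] by blast
  obtain c where c: "\<forall>\<^sub>F t in at_right 0.
      arc_integral {q \<in> \<Omega> \<inter> U. \<rho> q = t} (\<lambda>q. ennreal (norm (f q))) \<le> ennreal (c * t powi (-N))"
    using assms(9) by blast
  \<comment> \<open>Being negligible is a local property, so one chart around each bad parameter
    suffices; passing to countably many of them is done by
    \<open>locally_negligible_alt\<close>.\<close>
  have "\<exists>A. openin (top_of_set S) A \<and> s \<in> A \<and> negligible A" if s: "s \<in> S" for s
  proof -
    have sab: "s \<in> {a<..<b}" using s by (simp add: S_def)
    obtain \<delta> \<Phi> where chart: "boundary_chart \<Omega> \<Sigma> \<rho> U (\<gamma> s) \<delta> \<Phi>"
      and tr: "\<And>\<phi>. test_function {-\<delta><..<\<delta>} \<phi> \<Longrightarrow> ((\<lambda>t. LINT x|lebesgue. f (\<Phi> (x, t)) * \<phi> x) \<longlongrightarrow>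
            (LINT x|lebesgue. bf (\<Phi> (x, 0)) * \<phi> x)) (at_right 0)"
      using assms(10) \<gamma>\<Sigma>[OF sab] unfolding is_trace_def by blast
    have "open \<Omega>" using assms(1) by (simp add: smooth_domain_def)
    moreover have "\<gamma> s \<in> V" using \<gamma>V sab by blast
    ultimately obtain W M where W: "open W" "\<gamma> s \<in> W" and M: "negligible M"
      "\<And>q. q \<in> \<Sigma> \<inter> W \<Longrightarrow> Re (Z q) \<notin> M \<Longrightarrow> ?P q"
    proof (rule local_boundary_values[OF _ assms(3,5,8) c assms(11,12,14,15,16) chart _ tr])
      fix W M assume "open W" "\<gamma> s \<in> W" "negligible M" "\<And>q. q \<in> \<Sigma> \<inter> W \<Longrightarrow> Re (Z q) \<notin> M \<Longrightarrow> ?P q"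
      then show thesis by (rule that)
    qed
    define A where "A = S \<inter> ({a<..<b} \<inter> \<gamma> -` W)"
    have "open ({a<..<b} \<inter> \<gamma> -` W)"
      by (rule continuous_open_preimage[OF smooth_on_continuous_on[OF sm] _ W(1)]) simp
    then have "openin (top_of_set S) A" unfolding A_def by (rule openin_open_Int)
    moreover have "s \<in> A" using s sab W(2) by (simp add: A_def)
    moreover have "A \<subseteq> {s \<in> {a<..<b}. u s \<in> M}"
    proof
      fix s' assume "s' \<in> A"
      then have s': "s' \<in> {a<..<b}" "\<gamma> s' \<in> W" "\<not> ?P (\<gamma> s')" by (auto simp: A_def S_def)
      then have "u s' \<in> M" using M(2)[of "\<gamma> s'"] \<gamma>\<Sigma> unfolding u_def by blast
      then show "s' \<in> {s \<in> {a<..<b}. u s \<in> M}" using s'(1) by simp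
    qed
    moreover have "negligible {s \<in> {a<..<b}. u s \<in> M}"
      by (rule negligible_differentiable_vimage[OF M(1) u u'])
    then have "negligible A" by (rule negligible_subset) fact
    ultimately show ?thesis by blast
  qed
  then have "negligible S" by (subst locally_negligible_alt) blast
  then have "S \<in> null_sets lebesgue" by (simp add: negligible_iff_null_sets)
  then show "AE s in lebesgue. s \<in> {a<..<b} \<longrightarrow> ?P (\<gamma> s)"
    by (rule AE_I') (auto simp: S_def)
qed

end
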